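(* Let $d\ge 1$, $T>0$, let $\mathfrak f\in C_c^\infty(\mathbb{R}^d\times\mathbb{R};\mathbb{R}^d)$ and $u_0\in C_c^\infty(\mathbb{R}^d)$. Then the Cauchy problem $$u_t+\operatorname{div}_{\mathbf x}\big(\mathfrak f(\mathbf x,u)\big)=\Delta u+\partial_t\Delta u \quad\text{in } (0,T)\times\mathbb{R}^d,\qquad u|_{t=0}=u_0,$$ has a weak solution $u\in L^2((0,T)\times\mathbb{R}^d)$, this weak solution is unique among weak solutions in $L^2((0,T)\times\mathbb{R}^d)$, and it belongs to $C^\infty((0,T)\times\mathbb{R}^d)$.
   Context: Here $\operatorname{div}_{\mathbf x}(\mathfrak f(\mathbf x,u))$ denotes $\sum_{j=1}^d\partial_{x_j}[f_j(\mathbf x,u(t,\mathbf x))]$. Weak solution: for a given vector field $F\in L^2((0,T)\times\mathbb{R}^d;\mathbb{R}^d)$ and $u_0\in L^2(\mathbb{R}^d)$, a function $u\in L^2((0,T)\times\mathbb{R}^d)$ is a weak solution of $u_t+\operatorname{div}F=\Delta u+\partial_t\Delta u$, $u|_{t=0}=u_0$, if for every $\varphi\in C_c^\infty([0,T)\times\mathbb{R}^d)$ $$\int_0^T\!\!\int_{\mathbb{R}^d}\big(u\,\partial_t\varphi+F\cdot\nabla\varphi+u\,\Delta\varphi-u\,\partial_t\Delta\varphi\big)\,d\mathbf x\,dt+\int_{\mathbb{R}^d}u_0\big(\varphi(0,\cdot)-\Delta\varphi(0,\cdot)\big)\,d\mathbf x=0 .$$ For the nonlinear problem, $F(t,\mathbf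 x)=\mathfrak f(\mathbf x,u(t,\mathbf x))$. *)

theory Defs
  imports "HOL-Analysis.Analysis"
begin

definition pdiff :: "'a::euclidean_space \<Rightarrow> ('a \<Rightarrow> real) \<Rightarrow> 'a \<Rightarrow> real" where
  "pdiff e g x = deriv (\<lambda>s. g (x + s *\<^sub>R e)) 0"

fun ipdiff :: "'a::euclidean_space list \<Rightarrow> ('a \<Rightarrow> real) \<Rightarrow> 'a \<Rightarrow> real" where
  "ipdiff [] g = g"
| "ipdiff (e # es) g = pdiff e (ipdiff es g)"

definition Cinf_on :: "'a::euclidean_space set \<Rightarrow> ('a \<Rightarrow> real) \<Rightarrow> bool" where
  "Cinf_on S g \<longleftrightarrow> open S \<and>
     (\<forall>es. set es \<subseteq> Basis \<longrightarrow>
        continuous_on S (ipdiff es g) \<and>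
        (\<forall>e\<in>Basis. \<forall>x\<in>S. (\<lambda>s. ipdiff es g (x + s *\<^sub>R e)) differentiable (at 0)))"

definition compact_support :: "('a::topological_space \<Rightarrow> 'b::zero) \<Rightarrow> bool" where
  "compact_support g \<longleftrightarrow> compact (closure {z. g z \<noteq> 0})"

definition L2_on :: "'a::euclidean_space set \<Rightarrow> ('a \<Rightarrow> real) \<Rightarrow> bool" where
  "L2_on S g \<longleftrightarrow> set_borel_measurable lebesgue S g \<and> set_integrable lebesgue S (\<lambda>z. (g z)\<^sup>2)"

definition Omega :: "real \<Rightarrow> ((real \<times> (real^'n))) set" where
  "Omega T = {0<..<T} \<times> UNIV"

definition et :: "(real \<times> (real^'n))" where "et = (1, 0)"
definition ex :: "'n::finite \<Rightarrow> (real \<times> (real^'n))" where "ex j = (0, axis j 1)"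

definition lap :: "((real \<times> (real^'n::finite)) \<Rightarrow> real) \<Rightarrow> (real \<times> (real^'n)) \<Rightarrow> real" where
  "lap g z = (\<Sum>j\<in>UNIV. ipdiff [ex j, ex j] g z)"

text \<open>Test functions in C_c^infinity([0,T) x R^d): smooth on R x R^d, compact support
  contained in (-inf,T) x R^d.\<close>
definition test_fun :: "real \<Rightarrow> ((real \<times> (real^'n::finite)) \<Rightarrow> real) \<Rightarrow> bool" where
  "test_fun T \<phi> \<longleftrightarrow> Cinf_on UNIV \<phi> \<and> compact_support \<phi> \<and>
     closure {z. \<phi> z \<noteq> 0} \<subseteq> {..<T} \<times> UNIV"

text \<open>Weak solution of u_t + div F = Lap u + d_t Lap u, u(0) = u0.\<close>
definition weak_sol_lin ::
  "real \<Rightarrow> ((real \<times> (real^'n::finite)) \<Rightarrow> real^'n) \<Rightarrow> (real^'n \<Rightarrow> real) \<Rightarrow> ((real \<times> (real^'n)) \<Rightarrow> real) \<Rightarrow> bool" where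
  "weak_sol_lin T F u0 u \<longleftrightarrow>
     L2_on (Omega T) u \<and> (\<forall>j. L2_on (Omega T) (\<lambda>z. F z $ j)) \<and> L2_on UNIV u0 \<and>
     (\<forall>\<phi>. test_fun T \<phi> \<longrightarrow>
        (LINT z:Omega T|lebesgue.
            u z * pdiff et \<phi> z
          + (\<Sum>j\<in>UNIV. F z $ j * pdiff (ex j) \<phi> z)
          + u z * lap \<phi> z
          - u z * pdiff et (lap \<phi>) z)
        + (LINT x|lebesgue. u0 x * (\<phi> (0, x) - lap \<phi> (0, x))) = 0)"

definition weak_sol ::
  "real \<Rightarrow> (real^'n::finite \<Rightarrow> real \<Rightarrow> real^'n) \<Rightarrow> (real^'n \<Rightarrow> real) \<Rightarrow> ((real \<times> (real^'n)) \<Rightarrow> real) \<Rightarrow> bool" where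
  "weak_sol T f u0 u \<longleftrightarrow> weak_sol_lin T (\<lambda>z. f (snd z) (u z)) u0 u"

end

theory Submission
  imports Defs "HOL-Probability.Sinc_Integral"
begin

text \<open>
  Inverting \<open>1 - \<Delta>\<close> turns the equation into an ordinary differential equation with bounded operators,
  \<open>u\<^sub>t = - u + B u - \<Sum>\<^sub>j \<partial>\<^sub>j B (f\<^sub>j(x, u))\<close> with \<open>B = (1 - \<Delta>)\<^sup>-\<^sup>1\<close>. The operators \<open>B\<close> and \<open>\<partial>\<^sub>j B\<close> are averages
  of translates against finite signed measures. Hence they preserve \<open>C\<^sup>k\<close> bounds and weighted bounds \<open>|u| \<le> C \<rho>\<close>
  with an integrable weight \<open>\<rho>\<close>, and Picard iteration gives a global solution. No smoothing is needed for
  regularity: each spatial derivative solves a linear equation of the same type, and the equation itself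
  yields the time derivatives.

  For uniqueness, the difference \<open>w\<close> of two weak solutions is tested with \<open>A(t) \<chi>(\<epsilon>x) B g(x)\<close>, where \<open>g\<close> is a bump
  and \<open>-A'\<close> is a bump on positive times. Letting \<open>\<epsilon> \<rightarrow> 0\<close> and letting the bumps tend to indicators of boxes,
  Lebesgue differentiation gives \<open>|w| \<le> \<integral>\<^sub>0\<^sup>t P|w| ds\<close> almost everywhere with a positive averaging operator \<open>P\<close>.
  The integral of \<open>e\<^bsup>-\<lambda>t\<^esup> \<rho> |w|\<close> is then at most half of itself for large \<open>\<lambda>\<close>.
\<close>

section \<open>Parametric integrals and weighted function classes\<close>

text \<open>\<open>B\<close> spreads supports, so the compact support of \<open>u0\<close> is lost
  at once, yet membership in L2, the duality computations and test functions without compact support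
  all need decay. The weight \<open>rho\<close> therefore decays only polynomially: a translation
  costs a polynomial factor, \<open>moment\<close>, and the Gaussian kernels have all such moments.
  Existence is run with the weight \<open>rho\<close>, regularity with the weight 1.

  Differentiability of a solution in x is not known in advance, and the equation does not smooth.
  Picard iterates are differentiable by construction, so convergence of their derivatives is shown
  instead.

  For uniqueness, the difference \<open>w\<close> is merely L2, without any time regularity, so
  \<open>1 - \<Delta>\<close> cannot be inverted on \<open>w\<close>. It is inverted on the test
  function instead, where \<open>(1 - \<Delta>) B g = g\<close> isolates \<open>w\<close> against a
  bump. What remains is estimated with positive kernels in \<open>ennreal\<close>, where Tonelli
  needs no prior integrability. The argument closes in a weighted L1 norm, which is finite because
  \<open>|w| rho\<close> is bounded by \<open>w^2 + rho^2\<close>.\<close>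

lemma continuous_param_integral:
  fixes g :: "'a::metric_space \<Rightarrow> 'm \<Rightarrow> real"
  assumes majorant_measurable: "\<And>x. g x \<in> borel_measurable M"
    and cont: "\<And>m. continuous_on UNIV (\<lambda>x. g x m)"
    and dom: "\<And>x. \<exists>U W. open U \<and> x \<in> U \<and> integrable M W \<and> (\<forall>y\<in>U. \<forall>m. \<bar>g y m\<bar> \<le> W m)"
  shows "continuous_on UNIV (\<lambda>x. \<integral>m. g x m \<partial>M)"
  unfolding continuous_on_sequentially
proof (intro allI ballI impI, elim conjE)
  fix X and a :: 'a assume X: "X \<longlonglongrightarrow> a"
  obtain U W where U: "open U" "a \<in> U" "integrable M W" "\<forall>y\<in>U. \<forall>m. \<bar>g y m\<bar> \<le> W m"
    using dom[of a] by blast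
  obtain N where N: "\<And>n. n \<ge> N \<Longrightarrow> X n \<in> U"
    using topological_tendstoD[OF X U(1,2)] by (auto simp: eventually_sequentially)
  have "(\<lambda>n. \<integral>m. g (X (n + N)) m \<partial>M) \<longlonglongrightarrow> (\<integral>m. g a m \<partial>M)"
  proof (rule integral_dominated_convergence[where w=W])
    show "AE m in M. (\<lambda>i. g (X (i + N)) m) \<longlonglongrightarrow> g a m"
    proof (rule AE_I2)
      fix m
      have "isCont (\<lambda>x. g x m) a" using cont[of m] by (simp add: continuous_on_eq_continuous_at)
      then show "(\<lambda>i. g (X (i + N)) m) \<longlonglongrightarrow> g a m"
        using isCont_tendsto_compose LIMSEQ_ignore_initial_segment[OF X] by fastforce
    qed
  qed (use majorant_measurable U N in auto)
  then show "((\<lambda>x. \<integral>m. g x m \<partial>M) \<circ> X) \<longlonglongrightarrow> (\<integral>m. g a m \<partial>M)"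
    unfolding comp_def by (rule LIMSEQ_offset)
qed

text \<open>By the mean value theorem \<open>W\<close> dominates the difference quotients, so
  dominated convergence applies along every sequence tending to 0. Measurability of
  \<open>g' 0\<close> follows because it is a limit of these quotients.\<close>

lemma DERIV_param_integral:
  fixes g :: "real \<Rightarrow> 'm \<Rightarrow> real"
  assumes int: "\<And>s. integrable M (g s)"
    and der: "\<And>s m. ((\<lambda>s. g s m) has_real_derivative g' s m) (at s)"
    and W: "integrable M W" "\<And>s m. \<bar>s\<bar> < 1 \<Longrightarrow> \<bar>g' s m\<bar> \<le> W m"
  shows "((\<lambda>s. \<integral>m. g s m \<partial>M) has_real_derivative (\<integral>m. g' 0 m \<partial>M)) (at 0)"
  unfolding DERIV_def tendsto_at_iff_sequentially
proof (intro allI impI)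
  fix X :: "nat \<Rightarrow> real" assume X0: "\<forall>i. X i \<in> UNIV - {0}" and X: "X \<longlonglongrightarrow> 0"
  obtain N where N: "\<And>n. n \<ge> N \<Longrightarrow> \<bar>X n\<bar> < 1"
    using LIMSEQ_D[OF X, of 1] by auto
  have lim: "(\<lambda>i. (g (X (i + N)) m - g 0 m) / X (i + N)) \<longlonglongrightarrow> g' 0 m" for m
  proof -
    have "((\<lambda>h. (g (0 + h) m - g 0 m) / h) \<longlongrightarrow> g' 0 m) (at 0)"
      using der[of m 0] by (simp add: DERIV_def)
    then have "((\<lambda>h. (g (0 + h) m - g 0 m) / h) \<circ> (\<lambda>i. X (i + N))) \<longlonglongrightarrow> g' 0 m"
      unfolding tendsto_at_iff_sequentially
      by (rule allE[of _ "\<lambda>i. X (i + N)"]) (use X0 LIMSEQ_ignore_initial_segment[OF X, of N] in simp)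
    then show ?thesis by (simp add: comp_def)
  qed
  have "(\<lambda>i. \<integral>m. (g (X (i + N)) m - g 0 m) / X (i + N) \<partial>M) \<longlonglongrightarrow> (\<integral>m. g' 0 m \<partial>M)"
  proof (rule integral_dominated_convergence[where w=W])
    show "g' 0 \<in> borel_measurable M"
      by (rule borel_measurable_LIMSEQ_real[OF lim]) (use int in auto)
    show "AE m in M. norm ((g (X (i + N)) m - g 0 m) / X (i + N)) \<le> W m" for i
    proof (rule AE_I2)
      fix m
      have "\<bar>g (X (i + N)) m - g 0 m\<bar> \<le> W m * \<bar>X (i + N) - 0\<bar>"
        using field_differentiable_bound[of "{-1<..<1}" "\<lambda>s. g s m" "\<lambda>s. g' s m" "W m" "X (i+N)" 0]
          der W(2) N[of "i+N"] by (auto simp: has_field_derivative_at_within abs_less_iff)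
      then show "norm ((g (X (i + N)) m - g 0 m) / X (i + N)) \<le> W m"
        using X0 by (auto simp: field_simps)
    qed
  qed (use lim int W in auto)
  also have "(\<lambda>i. \<integral>m. (g (X (i + N)) m - g 0 m) / X (i + N) \<partial>M) =
      (\<lambda>i. ((\<integral>m. g (0 + X (i + N)) m \<partial>M) - (\<integral>m. g 0 m \<partial>M)) / X (i + N))"
    using int by simp
  finally show "((\<lambda>h. ((\<integral>m. g (0 + h) m \<partial>M) - (\<integral>m. g 0 m \<partial>M)) / h) \<circ> X) \<longlonglongrightarrow> (\<integral>m. g' 0 m \<partial>M)"
    unfolding comp_def by (rule LIMSEQ_offset)
qed

text \<open>Relational companion of \<open>pdiff\<close>: \<open>deriv\<close> returns a value even
  where no derivative exists, so existence has to be carried together with the value.\<close>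

definition has_pdiff :: "'a::euclidean_space \<Rightarrow> ('a \<Rightarrow> real) \<Rightarrow> ('a \<Rightarrow> real) \<Rightarrow> bool" where
  "has_pdiff e g g' \<longleftrightarrow> (\<forall>z. ((\<lambda>s. g (z + s *\<^sub>R e)) has_real_derivative g' z) (at 0))"

lemma has_pdiff_at:
  assumes "has_pdiff e g g'"
  shows "((\<lambda>s. g (z + s *\<^sub>R e)) has_real_derivative g' (z + s0 *\<^sub>R e)) (at s0)"
proof -
  have "((\<lambda>s. g ((z + s0 *\<^sub>R e) + s *\<^sub>R e)) has_real_derivative g' (z + s0 *\<^sub>R e)) (at 0)"
    using assms by (simp add: has_pdiff_def)
  then have "((\<lambda>s. g (z + (s + s0) *\<^sub>R e)) has_real_derivative g' (z + s0 *\<^sub>R e)) (at 0)"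
    by (simp add: algebra_simps)
  then show ?thesis
    using DERIV_shift[of "\<lambda>s. g (z + s *\<^sub>R e)" _ 0 s0] by simp
qed

lemma has_pdiff_pdiff: "has_pdiff e g g' \<Longrightarrow> pdiff e g = g'"
  by (auto simp: has_pdiff_def pdiff_def fun_eq_iff intro: DERIV_imp_deriv)

lemma Cinf_on_pdiff:
  assumes "Cinf_on UNIV g" "e \<in> Basis"
  shows "has_pdiff e g (pdiff e g)" "Cinf_on UNIV (pdiff e g)"
proof -
  have "(\<lambda>s. g (x + s *\<^sub>R e)) differentiable (at 0)" for x
    using assms unfolding Cinf_on_def by (metis UNIV_I empty_set empty_subsetI ipdiff.simps(1))
  then show "has_pdiff e g (pdiff e g)"
    by (simp add: has_pdiff_def pdiff_def DERIV_deriv_iff_real_differentiable)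
  have *: "ipdiff es (pdiff e g) = ipdiff (es @ [e]) g" for es
    by (induction es) auto
  show "Cinf_on UNIV (pdiff e g)"
    using assms unfolding Cinf_on_def * by auto
qed

lemma Cinf_on_continuous: "Cinf_on S g \<Longrightarrow> continuous_on S g"
  unfolding Cinf_on_def by (metis empty_set empty_subsetI ipdiff.simps(1))

text \<open>\<open>W\<close> is a decay profile in space only. The constant may depend on the time
  window, since solutions may grow in time; windows are symmetric because time derivatives at 0 are
  two-sided.\<close>

definition C0 :: "(real^'n \<Rightarrow> real) \<Rightarrow> (real \<times> (real^'n) \<Rightarrow> real) \<Rightarrow> bool" where
  "C0 W g \<longleftrightarrow> continuous_on UNIV g \<and> (\<forall>\<tau>. \<exists>C\<ge>0. \<forall>t x. \<bar>t\<bar> \<le> \<tau> \<longrightarrow> \<bar>g (t, x)\<bar> \<le> C * W x)"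

text \<open>The directions range over all of \<open>Basis\<close>, so time derivatives are included.
  The derivative is an existential witness, which lets each closure property be proved by induction
  on the order.\<close>

fun CB :: "(real^'n \<Rightarrow> real) \<Rightarrow> nat \<Rightarrow> (real \<times> (real^'n) \<Rightarrow> real) \<Rightarrow> bool" where
  "CB W 0 g \<longleftrightarrow> C0 W g"
| "CB W (Suc k) g \<longleftrightarrow> C0 W g \<and> (\<forall>e\<in>Basis. \<exists>g'. has_pdiff e g g' \<and> CB W k g')"

lemma CB_C0: "CB W k g \<Longrightarrow> C0 W g"
  by (cases k) auto

lemma C0_continuous: "C0 W g \<Longrightarrow> continuous_on UNIV g"
  by (simp add: C0_def)

lemma C0_bound:
  assumes "C0 W g"
  obtains C where "C \<ge> 0" "\<And>t x. \<bar>t\<bar> \<le> \<tau> \<Longrightarrow> \<bar>g (t, x)\<bar> \<le> C * W x"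
  using assms unfolding C0_def by blast

lemma CB_Suc_imp: "CB W (Suc k) g \<Longrightarrow> CB W k g"
proof (induction k arbitrary: g)
  case (Suc k)
  then show ?case by (metis CB.simps(2))
qed simp

lemma CB_pdiff: "CB W (Suc k) g \<Longrightarrow> e \<in> Basis \<Longrightarrow> has_pdiff e g (pdiff e g) \<and> CB W k (pdiff e g)"
  using has_pdiff_pdiff by fastforce

lemma CB_Cinf:
  assumes "\<And>k. CB W k g"
  shows "Cinf_on UNIV g"
proof -
  have *: "set es \<subseteq> Basis \<Longrightarrow> CB W k (ipdiff es g)" for es k
  proof (induction es arbitrary: k)
    case (Cons e es)
    then show ?case using CB_pdiff[of W k "ipdiff es g" e] Cons.IH[of "Suc k"] by auto
  qed (use assms in auto)
  show ?thesis
    unfolding Cinf_on_def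
  proof (intro conjI allI impI ballI)
    fix es :: "(real \<times> (real^'a)) list" and e x :: "real \<times> (real^'a)"
    assume es: "set es \<subseteq> Basis"
    show "continuous_on UNIV (ipdiff es g)" using *[OF es, of 0] by (simp add: C0_def)
    assume "e \<in> Basis"
    then have "has_pdiff e (ipdiff es g) (pdiff e (ipdiff es g))" using CB_pdiff[of W 0 "ipdiff es g" e] *[OF es, of "Suc 0"] by simp
    then show "(\<lambda>s. ipdiff es g (x + s *\<^sub>R e)) differentiable (at 0)"
      unfolding has_pdiff_def real_differentiable_def by blast
  qed auto
qed

section \<open>Algebra of the weighted classes\<close>

lemma C0_add: assumes "C0 W f" "C0 W g" shows "C0 W (\<lambda>z. f z + g z)"
  unfolding C0_def
proof (intro conjI allI)
  fix \<tau>
  obtain C D where "C \<ge> 0" "D \<ge> 0"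
    and *: "\<And>t x. \<bar>t\<bar> \<le> \<tau> \<Longrightarrow> \<bar>f (t, x)\<bar> \<le> C * W x" "\<And>t x. \<bar>t\<bar> \<le> \<tau> \<Longrightarrow> \<bar>g (t, x)\<bar> \<le> D * W x"
    using C0_bound[OF assms(1), of \<tau>] C0_bound[OF assms(2), of \<tau>] by metis
  have "\<bar>t\<bar> \<le> \<tau> \<Longrightarrow> \<bar>f (t, x) + g (t, x)\<bar> \<le> (C + D) * W x" for t x
    using *(1)[of t x] *(2)[of t x] by (simp add: algebra_simps)
  then show "\<exists>C\<ge>0. \<forall>t x. \<bar>t\<bar> \<le> \<tau> \<longrightarrow> \<bar>f (t, x) + g (t, x)\<bar> \<le> C * W x"
    using \<open>C \<ge> 0\<close> \<open>D \<ge> 0\<close> by (intro exI[of _ "C + D"]) auto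
qed (use assms in \<open>auto simp: C0_def intro!: continuous_intros\<close>)

lemma C0_mult: assumes "C0 (\<lambda>_. 1) f" "C0 W g" shows "C0 W (\<lambda>z. f z * g z)"
  unfolding C0_def
proof (intro conjI allI)
  fix \<tau>
  obtain C D where "C \<ge> 0" "D \<ge> 0"
    and *: "\<And>t x. \<bar>t\<bar> \<le> \<tau> \<Longrightarrow> \<bar>f (t, x)\<bar> \<le> C * 1" "\<And>t x. \<bar>t\<bar> \<le> \<tau> \<Longrightarrow> \<bar>g (t, x)\<bar> \<le> D * W x"
    using C0_bound[OF assms(1), of \<tau>] C0_bound[OF assms(2), of \<tau>] by metis
  have "\<bar>t\<bar> \<le> \<tau> \<Longrightarrow> \<bar>f (t, x) * g (t, x)\<bar> \<le> (C * D) * W x" for t x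
    using mult_mono[OF *(1)[of t x] *(2)[of t x]] \<open>C \<ge> 0\<close> by (simp add: abs_mult algebra_simps)
  then show "\<exists>C\<ge>0. \<forall>t x. \<bar>t\<bar> \<le> \<tau> \<longrightarrow> \<bar>f (t, x) * g (t, x)\<bar> \<le> C * W x"
    using \<open>C \<ge> 0\<close> \<open>D \<ge> 0\<close> by (intro exI[of _ "C * D"]) auto
qed (use assms in \<open>auto simp: C0_def intro!: continuous_intros\<close>)

lemma C0_const: "C0 (\<lambda>_. 1) (\<lambda>_. c)"
  unfolding C0_def by (auto intro!: exI[of _ "\<bar>c\<bar>"])

lemma C0_zero: "(\<And>x. 0 \<le> W x) \<Longrightarrow> C0 W (\<lambda>_. 0)"
  unfolding C0_def by auto

lemma C0_weight: assumes "C0 W g" "\<And>x. W x \<le> 1" shows "C0 (\<lambda>_. 1) g"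
  unfolding C0_def
proof (intro conjI allI)
  fix \<tau>
  obtain C where C: "C \<ge> 0" "\<And>t x. \<bar>t\<bar> \<le> \<tau> \<Longrightarrow> \<bar>g (t, x)\<bar> \<le> C * W x"
    using C0_bound[OF assms(1)] by metis
  have "C * W x \<le> C * 1" for x using mult_left_mono[OF assms(2) C(1)] .
  then show "\<exists>C\<ge>0. \<forall>t x. \<bar>t\<bar> \<le> \<tau> \<longrightarrow> \<bar>g (t, x)\<bar> \<le> C * 1"
    using C by (meson order_trans)
qed (use assms in \<open>auto simp: C0_def\<close>)

lemma C0_cmult: "C0 W g \<Longrightarrow> C0 W (\<lambda>z. c * g z)"
  using C0_mult[OF C0_const] .

lemma C0_minus: "C0 W g \<Longrightarrow> C0 W (\<lambda>z. - g z)"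
  using C0_cmult[of W g "-1"] by simp

lemma C0_diff: "C0 W f \<Longrightarrow> C0 W g \<Longrightarrow> C0 W (\<lambda>z. f z - g z)"
  using C0_add[OF _ C0_minus, of W f g] by simp

lemma C0_sum:
  assumes "\<And>x. 0 \<le> W x" "finite I" "\<And>i. i \<in> I \<Longrightarrow> C0 W (g i)" shows "C0 W (\<lambda>z. \<Sum>i\<in>I. g i z)"
  using assms(2,3) by (induction I rule: finite_induct) (auto intro: C0_add C0_zero assms(1))

lemma has_pdiff_add: "has_pdiff e f f' \<Longrightarrow> has_pdiff e g g' \<Longrightarrow> has_pdiff e (\<lambda>z. f z + g z) (\<lambda>z. f' z + g' z)"
  by (auto simp: has_pdiff_def intro!: derivative_intros)

lemma has_pdiff_mult: "has_pdiff e f f' \<Longrightarrow> has_pdiff e g g' \<Longrightarrow> has_pdiff e (\<lambda>z. f z * g z) (\<lambda>z. f z * g' z + f' z * g z)"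
  unfolding has_pdiff_def using DERIV_mult' by fastforce

lemma has_pdiff_const: "has_pdiff e (\<lambda>_. c) (\<lambda>_. 0)"
  by (auto simp: has_pdiff_def)

lemma has_pdiff_cmult: "has_pdiff e g g' \<Longrightarrow> has_pdiff e (\<lambda>z. c * g z) (\<lambda>z. c * g' z)"
  using has_pdiff_mult[OF has_pdiff_const] by fastforce

lemma has_pdiff_sum: "finite I \<Longrightarrow> (\<And>i. i \<in> I \<Longrightarrow> has_pdiff e (g i) (g' i)) \<Longrightarrow> has_pdiff e (\<lambda>z. \<Sum>i\<in>I. g i z) (\<lambda>z. \<Sum>i\<in>I. g' i z)"
  by (induction I rule: finite_induct) (auto intro: has_pdiff_const has_pdiff_add)

lemma CB_zero: "(\<And>x. 0 \<le> W x) \<Longrightarrow> CB W k (\<lambda>_. 0)"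
  by (induction k) (auto intro: C0_zero has_pdiff_const)

lemma CB_const: "CB (\<lambda>_. 1) k (\<lambda>_. c)"
  by (induction k arbitrary: c) (auto intro: C0_const has_pdiff_const)

lemma CB_add: "CB W k f \<Longrightarrow> CB W k g \<Longrightarrow> CB W k (\<lambda>z. f z + g z)"
proof (induction k arbitrary: f g)
  case (Suc k)
  then show ?case by (auto intro!: C0_add) (metis has_pdiff_add)
qed (auto intro: C0_add)

lemma CB_mult: "CB (\<lambda>_. 1) k f \<Longrightarrow> CB W k g \<Longrightarrow> CB W k (\<lambda>z. f z * g z)"
proof (induction k arbitrary: f g)
  case (Suc k)
  have "CB W (Suc k) (\<lambda>z. f z * g z) \<longleftrightarrow> C0 W (\<lambda>z. f z * g z) \<and>
      (\<forall>e\<in>Basis. \<exists>g'. has_pdiff e (\<lambda>z. f z * g z) g' \<and> CB W k g')"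
    by simp
  also have "\<dots>"
  proof (intro conjI ballI)
    show "C0 W (\<lambda>z. f z * g z)" using Suc.prems by (auto intro: C0_mult)
    fix e :: "real \<times> (real^'a)" assume "e \<in> Basis"
    then obtain f' g' where "has_pdiff e f f'" "CB (\<lambda>_. 1) k f'" "has_pdiff e g g'" "CB W k g'"
      using Suc.prems by fastforce
    then show "\<exists>g'. has_pdiff e (\<lambda>z. f z * g z) g' \<and> CB W k g'"
      by (intro exI[of _ "\<lambda>z. f z * g' z + f' z * g z"] conjI has_pdiff_mult CB_add Suc.IH)
        (use Suc.prems CB_Suc_imp in blast)+
  qed
  finally show ?case by blast
qed (auto intro: C0_mult)

lemma CB_cmult: "CB W k g \<Longrightarrow> CB W k (\<lambda>z. c * g z)"
  using CB_mult[OF CB_const] .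

lemma CB_minus: "CB W k g \<Longrightarrow> CB W k (\<lambda>z. - g z)"
  using CB_cmult[of W k g "-1"] by simp

lemma CB_sum:
  assumes "\<And>x. 0 \<le> W x" "finite I" "\<And>i. i \<in> I \<Longrightarrow> CB W k (g i)" shows "CB W k (\<lambda>z. \<Sum>i\<in>I. g i z)"
  using assms(2,3) by (induction I rule: finite_induct) (auto intro: CB_add CB_zero assms(1))

lemma CB_weight: "CB W k g \<Longrightarrow> (\<And>x. W x \<le> 1) \<Longrightarrow> CB (\<lambda>_. 1) k g"
proof (induction k arbitrary: g)
  case (Suc k)
  then show ?case by (auto intro: C0_weight) (metis)
qed (auto intro: C0_weight)

text \<open>\<open>Jop\<close> is \<open>\<integral>\<^sub>0\<^sup>t\<close>, written over the fixed interval \<open>[0, 1]\<close> so that negative times need no oriented integral.\<close>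

definition Jop :: "(real \<times> (real^'n) \<Rightarrow> real) \<Rightarrow> real \<times> (real^'n) \<Rightarrow> real" where
  "Jop g z = fst z * (\<integral>\<theta>. g (\<theta> * fst z, snd z) * indicator {0..1} \<theta> \<partial>lborel)"

lemma Jop_integrable:
  fixes g :: "real \<times> (real^'n) \<Rightarrow> real"
  assumes "continuous_on UNIV g"
  shows "integrable lborel (\<lambda>\<theta>. g (\<theta> * t, x) * indicator {0..1::real} \<theta>)"
proof -
  have "continuous_on UNIV (\<lambda>\<theta>. g (\<theta> * t, x))"
    by (intro continuous_on_compose2[OF assms] continuous_intros) auto
  then have "integrable lborel (\<lambda>\<theta>. indicator {0..1} \<theta> *\<^sub>R g (\<theta> * t, x))"
    using borel_integrable_compact[of "{0..1::real}" "\<lambda>\<theta>. g (\<theta> * t, x)"] continuous_on_subset by blast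
  then show ?thesis by (simp add: mult.commute)
qed

lemma Jop_diff:
  assumes "continuous_on UNIV g" "continuous_on UNIV h"
  shows "Jop (\<lambda>z. g z - h z) z = Jop g z - Jop h z"
  using Jop_integrable[OF assms(1), of "fst z" "snd z"] Jop_integrable[OF assms(2), of "fst z" "snd z"]
  by (simp add: Jop_def left_diff_distrib right_diff_distrib)

text \<open>Integration raises the power of \<open>|t|\<close> by one and divides by
  \<open>n + 1\<close>. Iterated, this produces the factorials that make the Picard series converge
  on every time interval.\<close>

lemma Jop_bound:
  assumes cont: "continuous_on UNIV g" and le: "\<And>s. \<bar>s\<bar> \<le> \<bar>t\<bar> \<Longrightarrow> \<bar>g (s, x)\<bar> \<le> K * \<bar>s\<bar> ^ n"
  shows "\<bar>Jop g (t, x)\<bar> \<le> K * \<bar>t\<bar> ^ Suc n / Suc n"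
proof -
  have int: "integrable lborel (\<lambda>\<theta>::real. K * \<bar>t\<bar>^n * (\<theta>^n * indicator {0..1} \<theta>))"
  proof -
    have "integrable lborel (\<lambda>\<theta>::real. indicator {0..1} \<theta> *\<^sub>R (\<theta>^n))"
      by (intro borel_integrable_compact continuous_intros) auto
    then have "integrable lborel (\<lambda>\<theta>::real. \<theta>^n * indicator {0..1} \<theta>)" by (simp add: mult.commute)
    then show ?thesis by (rule integrable_mult_right)
  qed
  have "\<bar>\<integral>\<theta>. g (\<theta> * t, x) * indicator {0..1} \<theta> \<partial>lborel\<bar> \<le> (\<integral>\<theta>. K * \<bar>t\<bar>^n * (\<theta>^n * indicator {0..1} \<theta>) \<partial>lborel)"
  proof (rule order_trans[OF integral_abs_bound integral_mono])
    show "integrable lborel (\<lambda>\<theta>. \<bar>g (\<theta> * t, x) * indicator {0..1} \<theta>\<bar>)"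
      using Jop_integrable[OF cont] by (rule integrable_abs)
    fix \<theta> :: real
    show "\<bar>g (\<theta> * t, x) * indicator {0..1} \<theta>\<bar> \<le> K * \<bar>t\<bar>^n * (\<theta>^n * indicator {0..1} \<theta>)"
    proof (cases "\<theta> \<in> {0..1}")
      case True
      have "\<bar>\<theta> * t\<bar> \<le> \<bar>t\<bar>" using True by (auto simp: abs_mult mult_left_le_one_le)
      from le[OF this] True show ?thesis by (simp add: abs_mult power_mult_distrib mult_ac)
    qed simp
  qed (rule int)
  also have "\<dots> = K * \<bar>t\<bar>^n / Suc n"
    using integral_power[of 0 1 n] by simp
  finally have "\<bar>t\<bar> * \<bar>\<integral>\<theta>. g (\<theta> * t, x) * indicator {0..1} \<theta> \<partial>lborel\<bar> \<le> \<bar>t\<bar> * (K * \<bar>t\<bar>^n / Suc n)"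
    by (rule mult_left_mono) simp
  then show ?thesis by (simp add: Jop_def abs_mult algebra_simps)
qed

lemma Jop_continuous:
  assumes cont: "continuous_on UNIV g"
  shows "continuous_on UNIV (Jop g)"
proof -
  have "continuous_on UNIV (\<lambda>z. \<integral>\<theta>. g (\<theta> * fst z, snd z) * indicator {0..1} \<theta> \<partial>lborel)"
  proof (rule continuous_param_integral)
    show "(\<lambda>\<theta>. g (\<theta> * fst z, snd z) * indicator {0..1} \<theta>) \<in> borel_measurable lborel" for z
      using Jop_integrable[OF cont, of "fst z" "snd z"] by simp
    show "continuous_on UNIV (\<lambda>z. g (m * fst z, snd z) * indicator {0..1} m)" for m
      by (intro continuous_on_mult continuous_on_compose2[OF cont] continuous_intros) auto
    fix z :: "real \<times> (real^'a)"
    have "continuous_on ({0..1::real} \<times> cball z 1) (\<lambda>p. g (fst p * fst (snd p), snd (snd p)))"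
      by (intro continuous_on_compose2[OF cont] continuous_intros) auto
    then have "bounded ((\<lambda>p. g (fst p * fst (snd p), snd (snd p))) ` ({0..1::real} \<times> cball z 1))"
      by (rule compact_imp_bounded[OF compact_continuous_image]) (intro compact_Times; simp)
    then obtain B where B: "\<And>p. p \<in> {0..1::real} \<times> cball z 1 \<Longrightarrow> norm (g (fst p * fst (snd p), snd (snd p))) \<le> B"
      unfolding bounded_iff by blast
    have "\<bar>g (\<theta> * fst y, snd y)\<bar> \<le> B" if "y \<in> ball z 1" "\<theta> \<in> {0..1}" for y \<theta>
      using B[of "(\<theta>, y)"] that by auto
    then show "\<exists>U W. open U \<and> z \<in> U \<and> integrable lborel W \<and>
        (\<forall>y\<in>U. \<forall>m. \<bar>g (m * fst y, snd y) * indicator {0..1} m\<bar> \<le> W m)"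
      by (intro exI[of _ "ball z 1"] exI[of _ "\<lambda>m. B * indicator {0..1::real} m"])
         (auto simp: abs_mult split: split_indicator intro!: integrable_mult_right integrable_real_indicator)
  qed
  then show ?thesis
    unfolding Jop_def[abs_def] by (intro continuous_intros)
qed

lemma C0_Jop:
  assumes "C0 W g"
  shows "C0 W (Jop g)"
  unfolding C0_def
proof (intro conjI allI)
  note cont = C0_continuous[OF assms]
  show "continuous_on UNIV (Jop g)" by (rule Jop_continuous[OF cont])
  fix \<tau>
  obtain C where C: "C \<ge> 0" "\<And>t x. \<bar>t\<bar> \<le> \<tau> \<Longrightarrow> \<bar>g (t, x)\<bar> \<le> C * W x"
    using C0_bound[OF assms] by metis
  have "\<bar>Jop g (t, x)\<bar> \<le> (C * \<bar>\<tau>\<bar>) * W x" if "\<bar>t\<bar> \<le> \<tau>" for t x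
  proof -
    have "\<bar>Jop g (t, x)\<bar> \<le> (C * W x) * \<bar>t\<bar>"
      using Jop_bound[OF cont, of t x "C * W x" 0] C(2) that by fastforce
    also have "\<dots> \<le> (C * W x) * \<bar>\<tau>\<bar>"
      using that C(2)[OF that, of x] by (intro mult_left_mono) auto
    finally show ?thesis by (simp add: mult_ac)
  qed
  then show "\<exists>C\<ge>0. \<forall>t x. \<bar>t\<bar> \<le> \<tau> \<longrightarrow> \<bar>Jop g (t, x)\<bar> \<le> C * W x"
    using C(1) by (intro exI[of _ "C * \<bar>\<tau>\<bar>"]) auto
qed

text \<open>The substitution \<open>y = \<theta> u\<close> is made by recognising
  \<open>\<theta> \<mapsto> F (\<theta> * u)\<close> as a primitive of the integrand, with
  \<open>F\<close> a primitive of \<open>g\<close> in time. This treats both signs of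
  \<open>u\<close> at once.\<close>

lemma Jop_time_derivative:
  assumes cont: "continuous_on UNIV g"
  shows "has_pdiff (1, 0) (Jop g) g"
  unfolding has_pdiff_def
proof
  fix z :: "real \<times> (real^'a)"
  obtain t x where z: "z = (t, x)" by fastforce
  define F where "F u = (LBINT y=0..u. g (y, x))" for u :: real
  have c: "continuous_on A (\<lambda>y. g (y, x))" for A
    by (intro continuous_on_compose2[OF cont] continuous_intros) auto
  have F: "(F has_real_derivative g (u, x)) (at u)" for u
  proof -
    \<comment> \<open>The interval contains 0 and has \<open>u\<close> in its interior, so the
      derivative relative to the interval becomes a full one.\<close>
    have "((\<lambda>u. LBINT y=0..u. g (y, x)) has_vector_derivative g (u, x)) (at u within {-\<bar>u\<bar>-1..\<bar>u\<bar>+1})"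
      using interval_integral_FTC2[OF _ _ c, of "-\<bar>u\<bar>-1" 0 "\<bar>u\<bar>+1" u] by (simp add: zero_ereal_def)
    then have "(F has_vector_derivative g (u, x)) (at u)"
      using at_within_Icc_at[of "-\<bar>u\<bar>-1" u "\<bar>u\<bar>+1"] by (simp add: F_def[abs_def])
    then show ?thesis by (simp add: has_real_derivative_iff_has_vector_derivative)
  qed
  have J: "Jop g (u, x) = F u - F 0" for u
  proof -
    have "(\<integral>\<theta>. (g (\<theta> * u, x) * u) * indicator {0..1} \<theta> \<partial>lborel) = F (1 * u) - F (0 * u)"
    proof (rule integral_FTC_Icc_real)
      fix \<theta>
      show "((\<lambda>a. F (a * u)) has_real_derivative g (\<theta> * u, x) * u) (at \<theta>)"
        by (rule DERIV_chain2[OF F]) (auto intro!: derivative_eq_intros)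
      have "continuous_on UNIV (\<lambda>\<theta>. g (\<theta> * u, x) * u)"
        by (intro continuous_intros continuous_on_compose2[OF cont]) auto
      then show "isCont (\<lambda>\<theta>. g (\<theta> * u, x) * u) \<theta>"
        by (simp add: continuous_on_eq_continuous_at)
    qed simp
    also have "(\<integral>\<theta>. (g (\<theta> * u, x) * u) * indicator {0..1} \<theta> \<partial>lborel) =
      (\<integral>\<theta>. u * (g (\<theta> * u, x) * indicator {0..1} \<theta>) \<partial>lborel)" by (simp add: mult_ac)
    finally show ?thesis by (simp add: Jop_def)
  qed
  have "((\<lambda>s. F (s + t) - F 0) has_real_derivative g (t, x)) (at 0)"
    using DERIV_shift[of F "g (t, x)" 0 t] F[of t] by (auto intro!: derivative_eq_intros)
  then show "((\<lambda>s. Jop g (z + s *\<^sub>R (1, 0))) has_real_derivative g z) (at 0)"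
    by (simp add: z J add.commute)
qed

lemma has_pdiff_Jop_space:
  assumes g: "C0 (\<lambda>_. 1) g" and g': "C0 (\<lambda>_. 1) g'" and has_pdiff: "has_pdiff (0, b) g g'"
  shows "has_pdiff (0, b) (Jop g) (Jop g')"
  unfolding has_pdiff_def
proof
  fix z :: "real \<times> (real^'a)"
  obtain t x where z: "z = (t, x)" by fastforce
  obtain C where C: "C \<ge> 0" "\<And>s x. \<bar>s\<bar> \<le> \<bar>t\<bar> \<Longrightarrow> \<bar>g' (s, x)\<bar> \<le> C * 1"
    using C0_bound[OF g'] by metis
  have "((\<lambda>s. \<integral>\<theta>. g (\<theta> * t, x + s *\<^sub>R b) * indicator {0..1} \<theta> \<partial>lborel) has_real_derivative
      (\<integral>\<theta>. g' (\<theta> * t, x + 0 *\<^sub>R b) * indicator {0..1} \<theta> \<partial>lborel)) (at 0)"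
  proof (rule DERIV_param_integral[where W="\<lambda>\<theta>. C * indicator {0..1} \<theta>"
      and g'="\<lambda>s \<theta>. g' (\<theta> * t, x + s *\<^sub>R b) * indicator {0..1} \<theta>"])
    show "integrable lborel (\<lambda>\<theta>. g (\<theta> * t, x + s *\<^sub>R b) * indicator {0..1} \<theta>)" for s
      by (rule Jop_integrable[OF C0_continuous[OF g]])
    fix s \<theta> :: real
    have "((\<lambda>s. g ((\<theta> * t, x) + s *\<^sub>R (0, b))) has_real_derivative g' ((\<theta> * t, x) + s *\<^sub>R (0, b))) (at s)"
      by (rule has_pdiff_at[OF has_pdiff])
    then show "((\<lambda>s. g (\<theta> * t, x + s *\<^sub>R b) * indicator {0..1} \<theta>) has_real_derivative
        g' (\<theta> * t, x + s *\<^sub>R b) * indicator {0..1} \<theta>) (at s)"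
      by (auto intro!: derivative_eq_intros)
    have "\<theta> \<in> {0..1} \<Longrightarrow> \<bar>\<theta> * t\<bar> \<le> \<bar>t\<bar>" by (auto simp: abs_mult mult_left_le_one_le)
    then show "\<bar>g' (\<theta> * t, x + s *\<^sub>R b) * indicator {0..1} \<theta>\<bar> \<le> C * indicator {0..1} \<theta>"
      using C(2)[of "\<theta> * t" "x + s *\<^sub>R b"] by (auto simp: indicator_def)
  qed simp
  then show "((\<lambda>s. Jop g (z + s *\<^sub>R (0, b))) has_real_derivative Jop g' z) (at 0)"
    by (auto simp: z Jop_def intro!: derivative_eq_intros)
qed

section \<open>The Bessel potential as a Gaussian average\<close>

definition q :: "real \<Rightarrow> real" where "q s = 1 / (1 + s\<^sup>2)"

lemma q_pos: "0 < q s" and q_le: "q s \<le> 1"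
  by (auto simp: q_def add_pos_nonneg)

lemma continuous_q [continuous_intros]: "continuous_on A f \<Longrightarrow> continuous_on A (\<lambda>x. q (f x))"
  unfolding q_def by (intro continuous_intros) (auto simp: add_nonneg_eq_0_iff)

lemma q_measurable [measurable]: "q \<in> borel_measurable borel"
  by (intro borel_measurable_continuous_onI continuous_intros)

lemma integrable_q: "integrable lborel q"
proof -
  have "einterval (-\<infinity>) \<infinity> = UNIV" by (auto simp: einterval_def)
  then show ?thesis
    using integrable_inverse_1_plus_square by (simp add: set_integrable_def q_def[abs_def] inverse_eq_divide)
qed

lemma integrable_prod_q: "integrable lborel (\<lambda>z::'a::euclidean_space. \<Prod>b\<in>Basis. q (z \<bullet> b))"
proof (rule integrableI_nonneg)
  show "(\<lambda>z::'a. \<Prod>b\<in>Basis. q (z \<bullet> b)) \<in> borel_measurable lborel" by measurable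
  show "AE z::'a in lborel. 0 \<le> (\<Prod>b\<in>Basis. q (z \<bullet> b))"
    by (intro AE_I2 prod_nonneg) (simp add: q_pos less_imp_le)
  have "(\<integral>\<^sup>+ z. ennreal (\<Prod>b\<in>Basis. q ((z::'a) \<bullet> b)) \<partial>lborel) = (\<integral>\<^sup>+ z. (\<Prod>b\<in>Basis. ennreal (q ((z::'a) \<bullet> b))) \<partial>lborel)"
    by (simp add: prod_ennreal q_pos less_imp_le)
  also have "\<dots> = (\<Prod>b\<in>(Basis::'a set). \<integral>\<^sup>+ s. ennreal (q s) \<partial>lborel)"
    by (rule nn_integral_lborel_prod) auto
  also have "\<dots> < \<infinity>"
    using nn_integral_eq_integral[OF integrable_q] by (simp add: ennreal_power q_pos less_imp_le)
  finally show "(\<integral>\<^sup>+ z. ennreal (\<Prod>b\<in>Basis. q ((z::'a) \<bullet> b)) \<partial>lborel) < \<infinity>" .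
qed

text \<open>Being a product, \<open>rho\<close> reduces integrability, the behaviour under
  translation and the comparison with the Gaussian to statements about one real variable.\<close>

definition rho :: "real^'n \<Rightarrow> real" where "rho x = (\<Prod>j\<in>UNIV. q (x $ j))"

lemma prod_Basis_vec: "(\<Prod>b\<in>(Basis::(real^'n) set). F ((x::real^'n) \<bullet> b)) = (\<Prod>j\<in>UNIV. F (x $ j))"
proof -
  have B: "(Basis::(real^'n) set) = (\<lambda>j. axis j 1) ` UNIV" by (auto simp: Basis_vec_def)
  have "inj (\<lambda>j. axis j 1 :: real^'n)" by (auto simp: inj_on_def axis_eq_axis)
  then show ?thesis unfolding B by (simp add: prod.reindex inner_axis)
qed

lemma rho_pos: "0 < rho x" and rho_le: "rho x \<le> 1"
  by (auto simp: rho_def q_pos q_le less_imp_le intro!: prod_pos prod_le_1)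

lemma continuous_rho [continuous_intros]: "continuous_on A f \<Longrightarrow> continuous_on A (\<lambda>x. rho (f x))"
  unfolding rho_def by (intro continuous_intros)

lemma rho_measurable [measurable]: "rho \<in> borel_measurable borel"
  by (intro borel_measurable_continuous_onI continuous_intros)

lemma integrable_rho: "integrable lborel (rho :: real^'n \<Rightarrow> real)"
  using integrable_prod_q[where 'a="real^'n"] by (simp add: prod_Basis_vec rho_def[abs_def])

text \<open>This profile is the dominating function twice: in the kernel variables
  \<open>(r, y)\<close> and on \<open>Omega T\<close>.\<close>

lemma integrable_q_rho: "integrable lborel (\<lambda>z::real \<times> (real^'n). q (fst z) * rho (snd z))"
proof -
  have "(\<Prod>b\<in>Basis. q (z \<bullet> b)) = q (fst z) * rho (snd z)" for z :: "real \<times> (real^'n)"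
  proof -
    have "(\<Prod>b\<in>Basis. q (z \<bullet> b)) = (\<Prod>b\<in>(\<lambda>u. (u, 0)) ` Basis. q (z \<bullet> b)) * (\<Prod>b\<in>(\<lambda>u. (0, u)) ` Basis. q (z \<bullet> b))"
      unfolding Basis_prod_def by (rule prod.union_disjoint) auto
    also have "\<dots> = q (fst z) * rho (snd z)"
      by (simp add: prod.reindex inj_on_def inner_prod_def prod_Basis_vec rho_def)
    finally show ?thesis .
  qed
  then show ?thesis using integrable_prod_q[where 'a="real \<times> (real^'n)"] by simp
qed

text \<open>From \<open>exp a \<ge> (1 + a / n) ^ n\<close> with \<open>a = s^2 / 2\<close> and
  \<open>n = m + 1\<close>: the Gaussian beats one power of \<open>1 + s^2\<close> more than
  required, and this extra power supplies \<open>q\<close>.\<close>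

lemma power_exp_le_q:
  obtains C where "C \<ge> 0" "\<And>s. (1 + s\<^sup>2) ^ m * exp (- s\<^sup>2 / 2) \<le> C * q s"
proof
  let ?n = "Suc m"
  show "(2 * real ?n) ^ ?n \<ge> 0" by simp
  fix s :: real
  have "((1 + s\<^sup>2) / (2 * real ?n)) ^ ?n \<le> (1 + (s\<^sup>2 / 2) / real ?n) ^ ?n"
    by (intro power_mono) (auto simp: divide_simps)
  also have "\<dots> \<le> exp (s\<^sup>2 / 2)"
    by (rule exp_ge_one_plus_x_over_n_power_n) (auto intro: order_trans[of _ 0])
  finally have "(1 + s\<^sup>2) ^ ?n \<le> (2 * real ?n) ^ ?n * exp (s\<^sup>2 / 2)"
    by (simp only: power_divide) (simp add: divide_simps mult.commute)
  then have "(1 + s\<^sup>2) ^ ?n * exp (- s\<^sup>2 / 2) \<le> (2 * real ?n) ^ ?n"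
    by (simp add: exp_minus divide_simps)
  moreover have "0 < 1 + s\<^sup>2" by (simp add: add_pos_nonneg)
  ultimately show "(1 + s\<^sup>2) ^ m * exp (- s\<^sup>2 / 2) \<le> (2 * real ?n) ^ ?n * q s"
    unfolding q_def by (simp add: pos_le_divide_eq mult_ac)
qed

section \<open>The Gaussian density and the moments of the kernels\<close>

definition gauss :: "real^'n \<Rightarrow> real" where "gauss y = exp (- (norm y)\<^sup>2 / 2)"

lemma gauss_prod: "gauss y = (\<Prod>j\<in>UNIV. exp (- (y $ j)\<^sup>2 / 2))"
proof -
  have "(norm y)\<^sup>2 = (\<Sum>j\<in>UNIV. (y $ j)\<^sup>2)"
    by (simp add: norm_vec_def L2_set_def sum_nonneg)
  then show ?thesis
    by (simp add: gauss_def exp_sum[symmetric] sum_divide_distrib sum_negf)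
qed

lemma gauss_pos: "0 < gauss y" by (simp add: gauss_def)

lemma continuous_gauss [continuous_intros]: "continuous_on A f \<Longrightarrow> continuous_on A (\<lambda>x. gauss (f x))"
  unfolding gauss_def by (intro continuous_intros) auto

lemma gauss_measurable [measurable]: "gauss \<in> borel_measurable borel"
  by (intro borel_measurable_continuous_onI continuous_intros)

lemma gauss_power_le_rho:
  obtains C where "C \<ge> 0" "\<And>y::real^'n. (\<Prod>j\<in>UNIV. (1 + (y $ j)\<^sup>2) ^ m) * gauss y \<le> C * rho y"
proof -
  obtain C where C: "C \<ge> 0" "\<And>s. (1 + s\<^sup>2) ^ m * exp (- s\<^sup>2 / 2) \<le> C * q s" using power_exp_le_q by blast
  have "(\<Prod>j\<in>UNIV. (1 + (y $ j)\<^sup>2) ^ m) * gauss y \<le> C ^ CARD('n) * rho y" for y :: "real^'n"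
  proof -
    have "(\<Prod>j\<in>UNIV. (1 + (y $ j)\<^sup>2) ^ m) * gauss y = (\<Prod>j\<in>UNIV. (1 + (y $ j)\<^sup>2) ^ m * exp (- (y $ j)\<^sup>2 / 2))"
      by (simp add: gauss_prod prod.distrib)
    also have "\<dots> \<le> (\<Prod>j\<in>(UNIV::'n set). C * q (y $ j))"
      by (intro prod_mono conjI C) (simp add: zero_le_mult_iff)
    also have "\<dots> = C ^ CARD('n) * rho y" by (simp add: prod.distrib rho_def)
    finally show ?thesis .
  qed
  then show ?thesis using that C(1) by (meson zero_le_power)
qed

lemma integrable_gauss: "integrable lborel (gauss :: real^'n \<Rightarrow> real)"
proof -
  obtain C where C: "C \<ge> 0" "\<And>y::real^'n. (\<Prod>j\<in>UNIV. (1 + (y $ j)\<^sup>2) ^ 0) * gauss y \<le> C * rho y"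
    using gauss_power_le_rho by blast
  show ?thesis
    by (rule Bochner_Integration.integrable_bound[OF integrable_mult_right[OF integrable_rho, of C]])
       (use C(2) in \<open>auto simp: gauss_pos less_imp_le intro!: AE_I2 order_trans[OF _ abs_ge_self]\<close>)
qed

definition cG :: "'n::finite itself \<Rightarrow> real" where "cG _ = (\<integral>y. gauss (y::real^'n) \<partial>lborel)"

lemma cG_pos: "0 < cG TYPE('n::finite)"
proof -
  have "cG TYPE('n) \<ge> 0" by (simp add: cG_def gauss_pos less_imp_le)
  moreover have "cG TYPE('n) \<noteq> 0"
  proof
    assume "cG TYPE('n) = 0"
    then have "AE y::real^'n in lborel. gauss y = 0"
      using integral_nonneg_eq_0_iff_AE[OF integrable_gauss[where 'n='n]] by (simp add: cG_def gauss_pos less_imp_le)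
    then have "AE y::real^'n in lborel. False"
      by eventually_elim (use gauss_pos less_irrefl in metis)
    then show False
      by (simp add: AE_iff_measurable[OF _ refl])
  qed
  ultimately show ?thesis by simp
qed

text \<open>The substitution \<open>s = r\<^sup>2 / 2\<close> in the heat kernel representation
  \<open>(1 - \<Delta>)\<^sup>-\<^sup>1 = \<integral>\<^sub>0\<^sup>\<infinity> e\<^sup>-\<^sup>s e\<^bsup>s\<Delta>\<^esup> ds\<close> gives
  \<open>((1 - \<Delta>)\<^sup>-\<^sup>1 g)(x) = \<integral> ker None (r, y) g(x + r y) d(r, y)\<close>; the kernels \<open>ker (Some j)\<close> represent
  \<open>\<partial>\<^sub>j (1 - \<Delta>)\<^sup>-\<^sup>1\<close>. In this form no kernel has a singularity.\<close>

definition gk :: "real \<times> (real^'n) \<Rightarrow> real" where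
  "gk z = (if 0 \<le> fst z then exp (- (fst z)\<^sup>2 / 2) * gauss (snd z) / cG TYPE('n) else 0)"

definition ker :: "'n option \<Rightarrow> real \<times> (real^'n) \<Rightarrow> real" where
  "ker i z = (case i of None \<Rightarrow> fst z | Some j \<Rightarrow> snd z $ j) * gk z"

text \<open>The largest factor by which \<open>rho\<close> can grow under a translation by
  \<open>r y\<close>, one factor per coordinate.\<close>

definition moment :: "real \<times> (real^'n) \<Rightarrow> real" where
  "moment z = (\<Prod>j\<in>UNIV. 2 * (1 + (fst z * snd z $ j)\<^sup>2))"

lemma gk_measurable [measurable]: "(gk :: real \<times> (real^'n) \<Rightarrow> real) \<in> borel_measurable borel"
proof -
  have "gk = (\<lambda>z::real \<times> (real^'n). indicator {z. 0 \<le> fst z} z * (exp (- (fst z)\<^sup>2 / 2) * gauss (snd z) / cG TYPE('n)))"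
    by (auto simp: gk_def fun_eq_iff)
  also have "\<dots> \<in> borel_measurable borel"
    by (intro borel_measurable_times borel_measurable_indicator borel_measurable_continuous_onI borel_closed
        closed_Collect_le continuous_intros) (use cG_pos[where 'n='n] in auto)
  finally show ?thesis .
qed

lemma ker_measurable [measurable]: "ker i \<in> borel_measurable borel"
proof (cases i)
  case None
  have "(\<lambda>z::real \<times> (real^'a). fst z * gk z) \<in> borel_measurable borel"
    by (intro borel_measurable_times gk_measurable borel_measurable_continuous_onI continuous_intros)
  then show ?thesis by (simp add: None ker_def[abs_def])
next
  case (Some j)
  have "(\<lambda>z::real \<times> (real^'a). snd z $ j * gk z) \<in> borel_measurable borel"
    by (intro borel_measurable_times gk_measurable borel_measurable_continuous_onI continuous_intros)
  then show ?thesis by (simp add: Some ker_def[abs_def])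
qed

lemma continuous_moment [continuous_intros]: "continuous_on A moment"
  unfolding moment_def by (intro continuous_intros)

lemma moment_measurable [measurable]: "moment \<in> borel_measurable borel"
  by (intro borel_measurable_continuous_onI continuous_intros)

lemma moment_ge_1: "1 \<le> moment z"
  unfolding moment_def by (rule prod_ge_1) (simp add: algebra_simps)

lemma gk_nonneg: "0 \<le> gk z"
  using cG_pos by (auto simp: gk_def gauss_pos less_imp_le intro!: divide_nonneg_pos mult_nonneg_nonneg)

lemma abs_le_1_sq: "\<bar>a::real\<bar> \<le> 1 + a\<^sup>2"
  using zero_le_power2[of "\<bar>a\<bar> - 1"] by (simp add: power2_eq_square algebra_simps split: abs_split)

text \<open>One estimate for three prefactors: 1 for the density itself, \<open>r\<close> for
  \<open>B\<close>, and \<open>y_j\<close> for its derivatives.\<close>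

lemma integrable_gk_bound:
  fixes p :: "real \<times> (real^'n) \<Rightarrow> real"
  assumes [measurable]: "p \<in> borel_measurable borel"
    and p: "\<And>z. \<bar>p z\<bar> \<le> (1 + (fst z)\<^sup>2) * (\<Prod>j\<in>UNIV. 1 + (snd z $ j)\<^sup>2)"
  shows "integrable lborel (\<lambda>z. \<bar>p z * gk z\<bar> * moment z)"
proof -
  let ?n = "CARD('n)"
  \<comment> \<open>The exponent of \<open>1 + r^2\<close> is the dimension, contributed by
    \<open>moment\<close>, plus one from \<open>p\<close>. The exponent 2 below counts one factor
    \<open>1 + y_j^2\<close> from each of them.\<close>
  obtain C where C: "C \<ge> 0" "\<And>s. (1 + s\<^sup>2) ^ Suc ?n * exp (- s\<^sup>2 / 2) \<le> C * q s" using power_exp_le_q by blast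
  obtain D where D: "D \<ge> 0" "\<And>y::real^'n. (\<Prod>j\<in>UNIV. (1 + (y $ j)\<^sup>2) ^ 2) * gauss y \<le> D * rho y"
    using gauss_power_le_rho by blast
  let ?c = "cG TYPE('n)"
  have c: "?c > 0" by (rule cG_pos)
  have le: "\<bar>p z * gk z\<bar> * moment z \<le> (2 ^ ?n * C * D / ?c) * (q (fst z) * rho (snd z))" for z
  proof -
    let ?r = "1 + (fst z)\<^sup>2" and ?P = "\<Prod>j\<in>UNIV. 1 + (snd z $ j)\<^sup>2"
    have P0: "0 \<le> ?P" by (intro prod_nonneg) auto
    \<comment> \<open>The bound \<open>1 + (r y_j)^2 \<le> (1 + r^2) (1 + y_j^2)\<close> separates
      the variables.\<close>
    have m: "moment z \<le> 2 ^ ?n * ?r ^ ?n * ?P"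
    proof -
      have "moment z \<le> (\<Prod>j\<in>(UNIV::'n set). 2 * (?r * (1 + (snd z $ j)\<^sup>2)))"
        unfolding moment_def by (intro prod_mono) (auto simp: power_mult_distrib algebra_simps)
      also have "\<dots> = 2 ^ ?n * ?r ^ ?n * ?P" by (simp add: prod.distrib)
      finally show ?thesis .
    qed
    have g: "gk z \<le> exp (- (fst z)\<^sup>2 / 2) * gauss (snd z) / ?c"
      using c by (auto simp: gk_def gauss_pos less_imp_le intro!: divide_nonneg_pos mult_nonneg_nonneg)
    have "\<bar>p z * gk z\<bar> * moment z = \<bar>p z\<bar> * gk z * moment z" by (simp add: abs_mult gk_nonneg)
    also have "\<dots> \<le> (?r * ?P) * (exp (- (fst z)\<^sup>2 / 2) * gauss (snd z) / ?c) * (2 ^ ?n * ?r ^ ?n * ?P)"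
      using P0 moment_ge_1[of z] gk_nonneg[of z] c
      by (intro mult_mono p m g mult_nonneg_nonneg) (auto simp: gauss_pos less_imp_le)
    also have "\<dots> = (2 ^ ?n / ?c) * ((?r ^ Suc ?n * exp (- (fst z)\<^sup>2 / 2)) * (?P ^ 2 * gauss (snd z)))"
      by (simp add: power2_eq_square mult_ac)
    also have "\<dots> \<le> (2 ^ ?n / ?c) * ((C * q (fst z)) * (D * rho (snd z)))"
    proof (rule mult_left_mono[OF mult_mono[OF C(2)]])
      show "?P ^ 2 * gauss (snd z) \<le> D * rho (snd z)"
        using D(2)[of "snd z"] by (simp add: prod_power_distrib)
      show "0 \<le> C * q (fst z)" using C(1) by (simp add: q_pos less_imp_le)
      show "0 \<le> ?P ^ 2 * gauss (snd z)" using P0 by (simp add: gauss_pos less_imp_le)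
    qed (use c in simp)
    finally show ?thesis by (simp add: mult_ac)
  qed
  show ?thesis
  proof (rule Bochner_Integration.integrable_bound[OF integrable_mult_right[OF integrable_q_rho, of "2 ^ ?n * C * D / ?c"]])
    show "(\<lambda>z. \<bar>p z * gk z\<bar> * moment z) \<in> borel_measurable lborel" by measurable
    show "AE z in lborel. norm (\<bar>p z * gk z\<bar> * moment z) \<le> norm ((2 ^ ?n * C * D / ?c) * (q (fst z) * rho (snd z)))"
    proof (rule AE_I2)
      fix z :: "real \<times> (real^'n)"
      have "norm (\<bar>p z * gk z\<bar> * moment z) = \<bar>p z * gk z\<bar> * moment z"
        using moment_ge_1[of z] by (simp add: abs_mult)
      then show "norm (\<bar>p z * gk z\<bar> * moment z) \<le> norm ((2 ^ ?n * C * D / ?c) * (q (fst z) * rho (snd z)))"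
        using le[of z] by (metis abs_ge_self order_trans real_norm_def)
    qed
  qed
qed

lemma le_prod_1_sq: "1 \<le> (\<Prod>j\<in>UNIV. 1 + (y $ j)\<^sup>2)" and abs_le_prod_1_sq: "\<bar>y $ i\<bar> \<le> (\<Prod>j\<in>UNIV. 1 + ((y::real^'n) $ j)\<^sup>2)"
proof -
  show "1 \<le> (\<Prod>j\<in>UNIV. 1 + (y $ j)\<^sup>2)" by (rule prod_ge_1) auto
  have "(\<Prod>j\<in>UNIV. 1 + (y $ j)\<^sup>2) = (1 + (y $ i)\<^sup>2) * (\<Prod>j\<in>UNIV - {i}. 1 + (y $ j)\<^sup>2)"
    by (simp add: prod.remove)
  moreover have "1 \<le> (\<Prod>j\<in>UNIV - {i}. 1 + (y $ j)\<^sup>2)" by (rule prod_ge_1) auto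
  ultimately show "\<bar>y $ i\<bar> \<le> (\<Prod>j\<in>UNIV. 1 + (y $ j)\<^sup>2)"
    using mult_mono[OF abs_le_1_sq[of "y $ i"], of 1] by simp
qed

lemma integrable_ker_moment: "integrable lborel (\<lambda>z. \<bar>ker i z\<bar> * moment z)"
proof (cases i)
  case None
  have "integrable lborel (\<lambda>z::real \<times> (real^'a). \<bar>fst z * gk z\<bar> * moment z)"
  proof (rule integrable_gk_bound)
    show "\<bar>fst z\<bar> \<le> (1 + (fst z)\<^sup>2) * (\<Prod>j\<in>UNIV. 1 + (snd z $ j)\<^sup>2)" for z :: "real \<times> (real^'a)"
      using mult_mono[OF abs_le_1_sq[of "fst z"] le_prod_1_sq[of "snd z"]] by simp
  qed (intro borel_measurable_continuous_onI continuous_intros)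
  then show ?thesis by (simp add: None ker_def[abs_def])
next
  case (Some j)
  have "integrable lborel (\<lambda>z::real \<times> (real^'a). \<bar>snd z $ j * gk z\<bar> * moment z)"
  proof (rule integrable_gk_bound)
    show "\<bar>snd z $ j\<bar> \<le> (1 + (fst z)\<^sup>2) * (\<Prod>j\<in>UNIV. 1 + (snd z $ j)\<^sup>2)" for z :: "real \<times> (real^'a)"
      using mult_mono[of 1 "1 + (fst z)\<^sup>2", OF _ abs_le_prod_1_sq[of "snd z" j]] by simp
  qed (intro borel_measurable_continuous_onI continuous_intros)
  then show ?thesis by (simp add: Some ker_def[abs_def])
qed

lemma integrable_gk: "integrable lborel (gk :: real \<times> (real^'n) \<Rightarrow> real)"
proof -
  have "integrable lborel (\<lambda>z::real \<times> (real^'n). \<bar>1 * gk z\<bar> * moment z)"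
  proof (rule integrable_gk_bound)
    show "\<bar>1\<bar> \<le> (1 + (fst z)\<^sup>2) * (\<Prod>j\<in>UNIV. 1 + (snd z $ j)\<^sup>2)" for z :: "real \<times> (real^'n)"
      using mult_mono[of 1 "1 + (fst z)\<^sup>2", OF _ le_prod_1_sq[of "snd z"]] by simp
  qed auto
  then show ?thesis
  proof (rule Bochner_Integration.integrable_bound)
    have "gk z * 1 \<le> gk z * moment z" for z :: "real \<times> (real^'n)"
      by (intro mult_left_mono moment_ge_1 gk_nonneg)
    then show "AE z::real \<times> (real^'n) in lborel. norm (gk z) \<le> norm (\<bar>1 * gk z\<bar> * moment z)"
      using moment_ge_1 by (intro AE_I2) (auto simp: abs_mult gk_nonneg intro: order_trans[OF _ mult_left_mono[OF abs_ge_self gk_nonneg]])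
  qed simp
qed

text \<open>Summing over all kernels gives one operator bound that serves every index.\<close>

definition KM :: "'n::finite itself \<Rightarrow> real" where
  "KM _ = (\<Sum>i\<in>UNIV. \<integral>z. \<bar>ker (i::'n option) z\<bar> * moment z \<partial>lborel)"

lemma moment_nonneg: "0 \<le> moment z" using moment_ge_1[of z] by simp

lemma KM_ge: "(\<integral>z. \<bar>ker (i::'n::finite option) z\<bar> * moment z \<partial>lborel) \<le> KM TYPE('n)"
  unfolding KM_def by (rule member_le_sum) (auto simp: moment_nonneg)

lemma KM_nonneg: "0 \<le> KM TYPE('n::finite)"
  unfolding KM_def by (intro sum_nonneg integral_nonneg) (auto simp: moment_nonneg)

text \<open>Abstracts the two weights in use, 1 and \<open>rho\<close>. The last clause is exactly
  what keeps \<open>|g| \<le> K W\<close> under averaging; both signs of \<sigma> are required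
  because the transposed kernels are used as well.\<close>

definition weight_fn :: "(real^'n \<Rightarrow> real) \<Rightarrow> bool" where
  "weight_fn W \<longleftrightarrow> continuous_on UNIV W \<and> (\<forall>x. 0 < W x \<and> W x \<le> 1) \<and>
     (\<forall>x y \<sigma>. \<bar>\<sigma>\<bar> = 1 \<longrightarrow> W (x + \<sigma> *\<^sub>R (fst y *\<^sub>R snd y)) \<le> moment y * W x)"

lemma weight_one: "weight_fn (\<lambda>_. 1)"
  by (auto simp: weight_fn_def moment_ge_1)

text \<open>Peetre's inequality in each coordinate. The sign of \<sigma> disappears because the
  shift enters squared.\<close>

lemma weight_rho: "weight_fn rho"
  unfolding weight_fn_def
proof (intro conjI allI impI)
  fix x :: "real^'n" and y :: "real \<times> (real^'n)" and \<sigma> :: real assume \<sigma>: "\<bar>\<sigma>\<bar> = 1"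
  have "rho (x + \<sigma> *\<^sub>R (fst y *\<^sub>R snd y)) \<le> (\<Prod>j\<in>UNIV. 2 * (1 + (fst y * snd y $ j)\<^sup>2) * q (x $ j))"
    unfolding rho_def
  proof (intro prod_mono conjI)
    fix j
    have *: "q (a + b) \<le> 2 * (1 + b\<^sup>2) * q a" for a b :: real
    proof -
      have p: "0 < 1 + (a + b)\<^sup>2" "0 < 1 + a\<^sup>2" by (simp_all add: add_pos_nonneg)
      have "1 + a\<^sup>2 \<le> 2 * (1 + b\<^sup>2) * (1 + (a + b)\<^sup>2)"
      proof -
        \<comment> \<open>The two sides differ by
          \<open>1 + (a + 2 b)^2 + 2 (b (a + b))^2\<close>.\<close>
        have "0 \<le> (a + 2 * b)\<^sup>2" "0 \<le> (b * (a + b))\<^sup>2" by auto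
        then show ?thesis by (simp add: power2_eq_square algebra_simps)
      qed
      then show ?thesis using p by (simp add: q_def divide_simps mult_ac)
    qed
    have "(\<sigma> * (fst y * snd y $ j))\<^sup>2 = (fst y * snd y $ j)\<^sup>2"
      using \<sigma> by (simp add: power_mult_distrib power2_eq_1_iff abs_if split: if_splits)
    then show "q ((x + \<sigma> *\<^sub>R (fst y *\<^sub>R snd y)) $ j) \<le> 2 * (1 + (fst y * snd y $ j)\<^sup>2) * q (x $ j)"
      using *[of "x $ j" "\<sigma> * (fst y * snd y $ j)"] by (simp add: mult.assoc)
  qed (simp add: q_pos less_imp_le)
  also have "\<dots> = moment y * rho x" by (simp add: moment_def rho_def prod.distrib)
  finally show "rho (x + \<sigma> *\<^sub>R (fst y *\<^sub>R snd y)) \<le> moment y * rho x" .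
qed (auto simp: rho_pos rho_le intro!: continuous_intros)

lemma weight_simps: assumes "weight_fn W" shows "0 < W x" "0 \<le> W x" "W x \<le> 1"
  using assms by (auto simp: weight_fn_def less_imp_le)

text \<open>Only the space variable is shifted, so time is a mere parameter and every estimate may
  be made at a single time. Passing from \<open>\<sigma> = 1\<close> to \<open>\<sigma> = -1\<close>
  transposes the operator.\<close>

definition Aop :: "real \<Rightarrow> (real \<times> (real^'n) \<Rightarrow> real) \<Rightarrow> (real \<times> (real^'n) \<Rightarrow> real) \<Rightarrow> real \<times> (real^'n) \<Rightarrow> real" where
  "Aop \<sigma> k g z = (\<integral>y. k y * g (z + \<sigma> *\<^sub>R (0, fst y *\<^sub>R snd y)) \<partial>lborel)"

lemma shift_measurable:
  fixes g :: "real \<times> (real^'n) \<Rightarrow> real"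
  assumes "continuous_on UNIV g"
  shows "(\<lambda>y. g (z + \<sigma> *\<^sub>R (0, fst y *\<^sub>R snd y))) \<in> borel_measurable borel"
  by (intro borel_measurable_continuous_onI continuous_on_compose2[OF assms] continuous_intros) auto

text \<open>Translating \<open>W\<close> costs \<open>moment y\<close>, which the kernel integrates
  to at most \<open>KM\<close>. Hence the weight survives with an explicit constant.\<close>

lemma Aop_weighted:
  fixes g :: "real \<times> (real^'n) \<Rightarrow> real"
  assumes W: "weight_fn W" and \<sigma>: "\<bar>\<sigma>\<bar> = 1" and g: "continuous_on UNIV g" and le: "\<And>x. \<bar>g (t, x)\<bar> \<le> K * W x"
  shows "integrable lborel (\<lambda>y. ker i y * g ((t, x) + \<sigma> *\<^sub>R (0, fst y *\<^sub>R snd y)))"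
    and "\<bar>Aop \<sigma> (ker i) g (t, x)\<bar> \<le> K * KM TYPE('n) * W x"
proof -
  have K: "0 \<le> K" using le[of 0] weight_simps(1)[OF W, of 0]
    by (meson abs_ge_zero order_trans zero_le_mult_iff not_less order_less_imp_le)
  have *: "\<bar>ker i y * g ((t, x) + \<sigma> *\<^sub>R (0, fst y *\<^sub>R snd y))\<bar> \<le> K * W x * (\<bar>ker i y\<bar> * moment y)" for y
  proof -
    have "\<bar>g (t, x + \<sigma> *\<^sub>R (fst y *\<^sub>R snd y))\<bar> \<le> K * (moment y * W x)"
      using le W \<sigma> K by (smt (verit) mult_left_mono weight_fn_def)
    then have "\<bar>ker i y\<bar> * \<bar>g (t, x + \<sigma> *\<^sub>R (fst y *\<^sub>R snd y))\<bar> \<le> \<bar>ker i y\<bar> * (K * (moment y * W x))"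
      by (rule mult_left_mono) simp
    then show ?thesis by (simp add: abs_mult mult_ac)
  qed
  have int: "integrable lborel (\<lambda>y. K * W x * (\<bar>ker i y\<bar> * moment y))"
    by (intro integrable_mult_right integrable_ker_moment)
  show 1: "integrable lborel (\<lambda>y. ker i y * g ((t, x) + \<sigma> *\<^sub>R (0, fst y *\<^sub>R snd y)))"
  proof (rule Bochner_Integration.integrable_bound[OF int])
    show "(\<lambda>y. ker i y * g ((t, x) + \<sigma> *\<^sub>R (0, fst y *\<^sub>R snd y))) \<in> borel_measurable lborel"
      using borel_measurable_times[OF ker_measurable shift_measurable[OF g, of "(t, x)" \<sigma>], of i] by simp
  qed (use * in \<open>auto intro!: AE_I2 order_trans[OF _ abs_ge_self]\<close>)
  have "\<bar>Aop \<sigma> (ker i) g (t, x)\<bar> \<le> (\<integral>y. K * W x * (\<bar>ker i y\<bar> * moment y) \<partial>lborel)"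
    unfolding Aop_def by (rule order_trans[OF integral_abs_bound integral_mono]) (use * int integrable_abs[OF 1] in auto)
  also have "\<dots> = K * W x * (\<integral>y. \<bar>ker i y\<bar> * moment y \<partial>lborel)" by simp
  also have "\<dots> \<le> K * W x * KM TYPE('n)"
    using K weight_simps[OF W] by (intro mult_left_mono KM_ge) auto
  finally show "\<bar>Aop \<sigma> (ker i) g (t, x)\<bar> \<le> K * KM TYPE('n) * W x" by (simp add: mult_ac)
qed

lemma Aop_integrable:
  assumes "\<bar>\<sigma>\<bar> = 1" "C0 (\<lambda>_. 1) g"
  shows "integrable lborel (\<lambda>y. ker i y * g (z + \<sigma> *\<^sub>R (0, fst y *\<^sub>R snd y)))"
proof -
  obtain C where "\<And>t x. \<bar>t\<bar> \<le> \<bar>fst z\<bar> \<Longrightarrow> \<bar>g (t, x)\<bar> \<le> C * 1" using C0_bound[OF assms(2)] by metis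
  then show ?thesis
    using Aop_weighted(1)[OF weight_one assms(1) C0_continuous[OF assms(2)], of "fst z" C i "snd z"] by simp
qed

lemma Aop_add:
  "\<bar>\<sigma>\<bar> = 1 \<Longrightarrow> C0 (\<lambda>_. 1) g \<Longrightarrow> C0 (\<lambda>_. 1) h \<Longrightarrow> Aop \<sigma> (ker i) (\<lambda>z. g z + h z) z = Aop \<sigma> (ker i) g z + Aop \<sigma> (ker i) h z"
  using Aop_integrable[of \<sigma> g i z] Aop_integrable[of \<sigma> h i z] by (simp add: Aop_def distrib_left)

lemma Aop_diff:
  "\<bar>\<sigma>\<bar> = 1 \<Longrightarrow> C0 (\<lambda>_. 1) g \<Longrightarrow> C0 (\<lambda>_. 1) h \<Longrightarrow> Aop \<sigma> (ker i) (\<lambda>z. g z - h z) z = Aop \<sigma> (ker i) g z - Aop \<sigma> (ker i) h z"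
  using Aop_integrable[of \<sigma> g i z] Aop_integrable[of \<sigma> h i z] by (simp add: Aop_def right_diff_distrib)

lemma Aop_sum:
  "finite J \<Longrightarrow> \<bar>\<sigma>\<bar> = 1 \<Longrightarrow> (\<And>j. j \<in> J \<Longrightarrow> C0 (\<lambda>_. 1) (g j)) \<Longrightarrow>
    Aop \<sigma> (ker i) (\<lambda>z. \<Sum>j\<in>J. g j z) z = (\<Sum>j\<in>J. Aop \<sigma> (ker i) (g j) z)"
proof (induction J rule: finite_induct)
  case empty
  then show ?case by (simp add: Aop_def)
next
  case (insert x F)
  then show ?case by (simp add: Aop_add C0_sum)
qed

lemma C0_Aop:
  fixes g :: "real \<times> (real^'n) \<Rightarrow> real"
  assumes W: "weight_fn W" and \<sigma>: "\<bar>\<sigma>\<bar> = 1" and g: "C0 W g"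
  shows "C0 W (Aop \<sigma> (ker i) g)"
  unfolding C0_def
proof (intro conjI allI)
  note cont = C0_continuous[OF g]
  have g1: "C0 (\<lambda>_. 1) g" using C0_weight[OF g] weight_simps[OF W] by blast
  show "continuous_on UNIV (Aop \<sigma> (ker i) g)"
    unfolding Aop_def[abs_def]
  proof (rule continuous_param_integral)
    show "(\<lambda>y. ker i y * g (z + \<sigma> *\<^sub>R (0, fst y *\<^sub>R snd y))) \<in> borel_measurable lborel" for z
      using Aop_integrable[OF \<sigma> g1] by simp
    show "continuous_on UNIV (\<lambda>z. ker i y * g (z + \<sigma> *\<^sub>R (0, fst y *\<^sub>R snd y)))" for y
      by (intro continuous_intros continuous_on_compose2[OF cont]) auto
    fix z :: "real \<times> (real^'n)"
    obtain C where C: "C \<ge> 0" "\<And>t x. \<bar>t\<bar> \<le> \<bar>fst z\<bar> + 1 \<Longrightarrow> \<bar>g (t, x)\<bar> \<le> C * 1" using C0_bound[OF g1] by metis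
    have int: "integrable lborel (\<lambda>y. C * (\<bar>ker i y\<bar> * moment y))"
      by (intro integrable_mult_right integrable_ker_moment)
    have "\<bar>ker i y * g (w + \<sigma> *\<^sub>R (0, fst y *\<^sub>R snd y))\<bar> \<le> C * (\<bar>ker i y\<bar> * moment y)" if "w \<in> ball z 1" for w y
    proof -
      have "\<bar>fst w\<bar> \<le> \<bar>fst z\<bar> + 1"
      proof -
        have "dist (fst z) (fst w) < 1" using that dist_fst_le[of z w] by simp
        then show ?thesis by (simp add: dist_real_def abs_if split: if_splits)
      qed
      then have "\<bar>g (w + \<sigma> *\<^sub>R (0, fst y *\<^sub>R snd y))\<bar> \<le> C"
        using C(2)[of "fst w" "snd w + \<sigma> *\<^sub>R fst y *\<^sub>R snd y"] by (cases w) simp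
      then have "\<bar>ker i y\<bar> * \<bar>g (w + \<sigma> *\<^sub>R (0, fst y *\<^sub>R snd y))\<bar> \<le> (\<bar>ker i y\<bar> * moment y) * C"
        by (intro mult_mono) (use moment_ge_1[of y] mult_left_mono[of 1 "moment y" "\<bar>ker i y\<bar>"] in auto)
      then show ?thesis by (simp add: abs_mult mult_ac)
    qed
    then show "\<exists>U W. open U \<and> z \<in> U \<and> integrable lborel W \<and>
        (\<forall>w\<in>U. \<forall>y. \<bar>ker i y * g (w + \<sigma> *\<^sub>R (0, fst y *\<^sub>R snd y))\<bar> \<le> W y)"
      using int by (intro exI[of _ "ball z 1"] exI[of _ "\<lambda>y. C * (\<bar>ker i y\<bar> * moment y)"]) auto
  qed
  fix \<tau>
  obtain C where C: "C \<ge> 0" "\<And>t x. \<bar>t\<bar> \<le> \<tau> \<Longrightarrow> \<bar>g (t, x)\<bar> \<le> C * W x" using C0_bound[OF g] by metis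
  have "\<bar>Aop \<sigma> (ker i) g (t, x)\<bar> \<le> (C * KM TYPE('n)) * W x" if "\<bar>t\<bar> \<le> \<tau>" for t x
    using Aop_weighted(2)[OF W \<sigma> cont] C(2)[OF that] by blast
  then show "\<exists>C\<ge>0. \<forall>t x. \<bar>t\<bar> \<le> \<tau> \<longrightarrow> \<bar>Aop \<sigma> (ker i) g (t, x)\<bar> \<le> C * W x"
    using C(1) KM_nonneg[where 'n='n] by (intro exI[of _ "C * KM TYPE('n)"]) auto
qed

text \<open>Averaging commutes with translations, so the derivative falls on \<open>g\<close>; no
  regularity is gained or claimed.\<close>

lemma has_pdiff_Aop:
  fixes g :: "real \<times> (real^'n) \<Rightarrow> real"
  assumes \<sigma>: "\<bar>\<sigma>\<bar> = 1" and g: "C0 (\<lambda>_. 1) g" and g': "C0 (\<lambda>_. 1) g'" and has_pdiff: "has_pdiff e g g'"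
  shows "has_pdiff e (Aop \<sigma> (ker i) g) (Aop \<sigma> (ker i) g')"
  unfolding has_pdiff_def
proof
  fix z :: "real \<times> (real^'n)"
  obtain C where C: "C \<ge> 0" "\<And>t x. \<bar>t\<bar> \<le> \<bar>fst z\<bar> + \<bar>fst e\<bar> \<Longrightarrow> \<bar>g' (t, x)\<bar> \<le> C * 1" using C0_bound[OF g'] by metis
  have "((\<lambda>s. \<integral>y. ker i y * g ((z + s *\<^sub>R e) + \<sigma> *\<^sub>R (0, fst y *\<^sub>R snd y)) \<partial>lborel) has_real_derivative
     (\<integral>y. ker i y * g' ((z + 0 *\<^sub>R e) + \<sigma> *\<^sub>R (0, fst y *\<^sub>R snd y)) \<partial>lborel)) (at 0)"
  proof (rule DERIV_param_integral[where g'="\<lambda>s y. ker i y * g' ((z + s *\<^sub>R e) + \<sigma> *\<^sub>R (0, fst y *\<^sub>R snd y))"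
        and W="\<lambda>y. C * (\<bar>ker i y\<bar> * moment y)"])
    show "integrable lborel (\<lambda>y. ker i y * g (z + s *\<^sub>R e + \<sigma> *\<^sub>R (0, fst y *\<^sub>R snd y)))" for s
      by (rule Aop_integrable[OF \<sigma> g])
    show "integrable lborel (\<lambda>y. C * (\<bar>ker i y\<bar> * moment y))"
      by (intro integrable_mult_right integrable_ker_moment)
    fix s :: real and y :: "real \<times> (real^'n)"
    show "((\<lambda>s. ker i y * g (z + s *\<^sub>R e + \<sigma> *\<^sub>R (0, fst y *\<^sub>R snd y))) has_real_derivative
        ker i y * g' (z + s *\<^sub>R e + \<sigma> *\<^sub>R (0, fst y *\<^sub>R snd y))) (at s)"
      using DERIV_cmult[OF has_pdiff_at[OF has_pdiff, of "z + \<sigma> *\<^sub>R (0, fst y *\<^sub>R snd y)" s], of "ker i y"]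
      by (simp add: add_ac)
    assume s: "\<bar>s\<bar> < 1"
    have "\<bar>s\<bar> * \<bar>fst e\<bar> \<le> 1 * \<bar>fst e\<bar>" using s by (intro mult_right_mono) auto
    then have "\<bar>fst (z + s *\<^sub>R e)\<bar> \<le> \<bar>fst z\<bar> + \<bar>fst e\<bar>" 
      using abs_triangle_ineq[of "fst z" "s * fst e"] by (simp add: abs_mult)
    then have "\<bar>g' (z + s *\<^sub>R e + \<sigma> *\<^sub>R (0, fst y *\<^sub>R snd y))\<bar> \<le> C"
      using C(2)[of "fst (z + s *\<^sub>R e)" "snd (z + s *\<^sub>R e) + \<sigma> *\<^sub>R fst y *\<^sub>R snd y"] by (cases "z + s *\<^sub>R e") simp
    then have "\<bar>ker i y\<bar> * \<bar>g' (z + s *\<^sub>R e + \<sigma> *\<^sub>R (0, fst y *\<^sub>R snd y))\<bar> \<le> (\<bar>ker i y\<bar> * moment y) * C"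
      by (intro mult_mono) (use moment_ge_1[of y] mult_left_mono[of 1 "moment y" "\<bar>ker i y\<bar>"] in auto)
    then show "\<bar>ker i y * g' (z + s *\<^sub>R e + \<sigma> *\<^sub>R (0, fst y *\<^sub>R snd y))\<bar> \<le> C * (\<bar>ker i y\<bar> * moment y)"
      by (simp add: abs_mult mult_ac)
  qed
  then show "((\<lambda>s. Aop \<sigma> (ker i) g (z + s *\<^sub>R e)) has_real_derivative Aop \<sigma> (ker i) g' z) (at 0)"
    by (simp add: Aop_def)
qed

lemma CB_Aop: "weight_fn W \<Longrightarrow> \<bar>\<sigma>\<bar> = 1 \<Longrightarrow> CB W k g \<Longrightarrow> CB W k (Aop \<sigma> (ker i) g)"
proof (induction k arbitrary: g)
  case (Suc k)
  have g1: "CB W k h \<Longrightarrow> C0 (\<lambda>_. 1) h" for h k using C0_weight[OF CB_C0] weight_simps[OF Suc.prems(1)] by blast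
  have "\<exists>g'. has_pdiff e (Aop \<sigma> (ker i) g) g' \<and> CB W k g'" if e: "e \<in> Basis" for e
  proof -
    obtain g' where "has_pdiff e g g'" "CB W k g'" using Suc.prems e by auto
    then show ?thesis
      by (intro exI[of _ "Aop \<sigma> (ker i) g'"] conjI has_pdiff_Aop Suc.IH Suc.prems g1[OF Suc.prems(3)] g1[of k g'])
  qed
  then show ?case using Suc.prems by (auto intro: C0_Aop)
qed (auto intro: C0_Aop)

section \<open>Resolvent identity\<close>

lemma lborel_shift:
  fixes h :: "'a::euclidean_space \<Rightarrow> real"
  assumes [measurable]: "h \<in> borel_measurable borel"
  shows lborel_integral_shift: "(\<integral>z. h (z + c) \<partial>lborel) = (\<integral>z. h z \<partial>lborel)"
    and lborel_integrable_shift: "integrable lborel (\<lambda>z. h (z + c)) \<longleftrightarrow> integrable lborel h"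
proof -
  have "(\<integral>z. h z \<partial>lborel) = (\<integral>z. h z \<partial>distr lborel borel ((+) c))" by (simp add: lborel_distr_plus)
  also have "\<dots> = (\<integral>z. h (c + z) \<partial>lborel)" by (rule integral_distr) auto
  finally show "(\<integral>z. h (z + c) \<partial>lborel) = (\<integral>z. h z \<partial>lborel)" by (simp add: add.commute)
  have "integrable lborel h \<longleftrightarrow> integrable (distr lborel borel ((+) c)) h" by (simp add: lborel_distr_plus)
  also have "\<dots> \<longleftrightarrow> integrable lborel (\<lambda>z. h (c + z))" by (rule integrable_distr_eq) auto
  finally show "integrable lborel (\<lambda>z. h (z + c)) \<longleftrightarrow> integrable lborel h" by (simp add: add.commute)
qed

text \<open>Translation invariance gives \<open>0 = \<integral> h(z + e) - h(z) dz = \<integral>\<^sub>0\<^sup>1 \<integral> h'(z + s e) dz ds = \<integral> h'\<close>.\<close>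

lemma integral_has_pdiff_eq_0:
  fixes h h' :: "'a::euclidean_space \<Rightarrow> real"
  assumes h: "integrable lborel h" and h': "integrable lborel h'" and has_pdiff: "has_pdiff e h h'"
    and cont: "\<And>z. continuous_on UNIV (\<lambda>s. h' (z + s *\<^sub>R e))"
  shows "(\<integral>z. h' z \<partial>lborel) = 0"
proof -
  have [measurable]: "h \<in> borel_measurable borel" "h' \<in> borel_measurable borel"
    using h h' by auto
  define F where "F = (\<lambda>(s, z). indicator {0..1::real} s * h' (z + s *\<^sub>R e))"
  have "integrable (lborel \<Otimes>\<^sub>M lborel) F"
  proof (rule lborel_pair.Fubini_integrable)
    show "F \<in> borel_measurable (lborel \<Otimes>\<^sub>M lborel)"
      unfolding F_def by measurable
    have "(\<integral>z. norm (F (s, z)) \<partial>lborel) = indicator {0..1} s * (\<integral>z. \<bar>h' z\<bar> \<partial>lborel)" for s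
      using lborel_integral_shift[of "\<lambda>z. \<bar>h' z\<bar>" "s *\<^sub>R e"] by (simp add: F_def abs_mult)
    then show "integrable lborel (\<lambda>s. \<integral>z. norm (F (s, z)) \<partial>lborel)"
      by (simp add: integrable_mult_left integrable_real_indicator)
    show "AE s in lborel. integrable lborel (\<lambda>z. F (s, z))"
      using h' by (auto simp: F_def lborel_integrable_shift)
  qed
  then have F: "integrable (lborel \<Otimes>\<^sub>M lborel) (\<lambda>(s, z). F (s, z))" by simp
  have "(\<integral>z. (\<integral>s. F (s, z) \<partial>lborel) \<partial>lborel) = (\<integral>s. (\<integral>z. F (s, z) \<partial>lborel) \<partial>lborel)"
    using lborel_pair.Fubini_integral[OF F] by simp
  also have "\<dots> = (\<integral>s. indicator {0..1::real} s * (\<integral>z. h' z \<partial>lborel) \<partial>lborel)"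
    by (simp add: F_def lborel_integral_shift)
  also have "\<dots> = (\<integral>z. h' z \<partial>lborel)" by simp
  finally have "(\<integral>z. h' z \<partial>lborel) = (\<integral>z. (\<integral>s. F (s, z) \<partial>lborel) \<partial>lborel)" by simp
  also have "\<dots> = (\<integral>z. h (z + e) - h z \<partial>lborel)"
  proof (rule Bochner_Integration.integral_cong[OF refl])
    fix z
    have "(\<integral>s. h' (z + s *\<^sub>R e) * indicator {0..1} s \<partial>lborel) = h (z + 1 *\<^sub>R e) - h (z + 0 *\<^sub>R e)"
      by (rule integral_FTC_Icc_real)
         (use has_pdiff_at[OF has_pdiff] cont in \<open>auto simp: continuous_on_eq_continuous_at\<close>)
    then show "(\<integral>s. F (s, z) \<partial>lborel) = h (z + e) - h z" by (simp add: F_def mult.commute)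
  qed
  also have "\<dots> = 0"
    using h by (simp add: lborel_integral_shift lborel_integrable_shift)
  finally show ?thesis .
qed

text \<open>The classical criterion: existence of one partial derivative at the point and joint
  continuity of the other give total differentiability there. The diagonal
  \<open>r \<mapsto> (r, r)\<close> is then inserted.\<close>

lemma DERIV_partials:
  fixes f :: "real \<Rightarrow> real \<Rightarrow> real"
  assumes "((\<lambda>a. f a r) has_real_derivative fa) (at r)"
    and fb: "\<And>a b. ((\<lambda>b. f a b) has_real_derivative fb a b) (at b)"
    and cont: "continuous_on UNIV (\<lambda>p. fb (fst p) (snd p))"
  shows "((\<lambda>r. f r r) has_real_derivative fa + fb r r) (at r)"
proof -
  have "((\<lambda>(x, y). f x y) has_derivative (\<lambda>(tx, ty). fa * tx + blinfun_apply (fb r r *\<^sub>R id_blinfun) ty)) (at (r, r) within UNIV \<times> UNIV)"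
  proof (rule has_derivative_partialsI[where f=f and fy="\<lambda>a b. fb a b *\<^sub>R id_blinfun"])
    show "((\<lambda>a. f a r) has_derivative (\<lambda>tx. fa * tx)) (at r within UNIV)"
      using assms(1) by (simp add: has_field_derivative_def)
    show "((\<lambda>b. f a b) has_derivative blinfun_apply (fb a b *\<^sub>R id_blinfun)) (at b within UNIV)" for a b
      using fb[of a b] by (simp add: has_field_derivative_def scaleR_blinfun.rep_eq)
    have "continuous_on UNIV (\<lambda>p. fb (fst p) (snd p) *\<^sub>R (id_blinfun :: real \<Rightarrow>\<^sub>L real))"
      by (intro continuous_intros cont)
    then show "continuous (at (r, r) within UNIV \<times> UNIV) (\<lambda>(x, y). fb x y *\<^sub>R (id_blinfun :: real \<Rightarrow>\<^sub>L real))"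
      unfolding split_beta by (simp add: continuous_on_eq_continuous_at)
  qed auto
  then have *: "((\<lambda>(x, y). f x y) has_derivative (\<lambda>(tx, ty). fa * tx + fb r r * ty)) (at (r, r))"
    by (simp add: scaleR_blinfun.rep_eq)
  have "((\<lambda>r. (r, r)) has_derivative (\<lambda>t. (t, t))) (at r)"
    by (auto intro!: derivative_eq_intros)
  from has_derivative_compose[OF this] * have "((\<lambda>r. f r r) has_derivative (\<lambda>t. fa * t + fb r r * t)) (at r)"
    by fastforce
  moreover have "(\<lambda>t. fa * t + fb r r * t) = (*) (fa + fb r r)" by (auto simp: algebra_simps)
  ultimately show ?thesis by (simp add: has_field_derivative_def)
qed

text \<open>Induction on the set of directions: the induction hypothesis moves along
  \<open>S\<close> with coordinate \<open>k\<close> frozen, \<open>has_pdiff\<close> moves along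
  \<open>e k\<close>, and \<open>DERIV_partials\<close> merges the two motions.\<close>

lemma continuous_partials_DERIV:
  fixes \<phi> :: "'a::euclidean_space \<Rightarrow> real"
  assumes "finite S" and "\<And>j. j \<in> S \<Longrightarrow> has_pdiff (e j) \<phi> (\<phi>' j)" and "\<And>j. j \<in> S \<Longrightarrow> continuous_on UNIV (\<phi>' j)"
  shows "((\<lambda>r. \<phi> (z + (\<Sum>j\<in>S. (r * v j) *\<^sub>R e j))) has_real_derivative
      (\<Sum>j\<in>S. v j * \<phi>' j (z + (\<Sum>j\<in>S. (r * v j) *\<^sub>R e j)))) (at r)"
  using assms
proof (induction S arbitrary: z r rule: finite_induct)
  case (insert k S)
  define P where "P a = (\<Sum>j\<in>S. (a * v j) *\<^sub>R e j)" for a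
  define f where "f a b = \<phi> (z + (b * v k) *\<^sub>R e k + P a)" for a b
  have "((\<lambda>r. f r r) has_real_derivative
     (\<Sum>j\<in>S. v j * \<phi>' j (z + (r * v k) *\<^sub>R e k + P r)) + v k * \<phi>' k (z + (r * v k) *\<^sub>R e k + P r)) (at r)"
  proof (rule DERIV_partials[where f=f and fb="\<lambda>a b. v k * \<phi>' k (z + (b * v k) *\<^sub>R e k + P a)"])
    show "((\<lambda>a. f a r) has_real_derivative (\<Sum>j\<in>S. v j * \<phi>' j (z + (r * v k) *\<^sub>R e k + P r))) (at r)"
      unfolding f_def P_def by (rule insert.IH) (use insert.prems in auto)
    show "((\<lambda>b. f a b) has_real_derivative v k * \<phi>' k (z + (b * v k) *\<^sub>R e k + P a)) (at b)" for a b
    proof -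
      have 1: "((\<lambda>b. b * v k) has_real_derivative v k) (at b)" by (auto intro!: derivative_eq_intros)
      have 2: "((\<lambda>s. \<phi> (z + P a + s *\<^sub>R e k)) has_real_derivative \<phi>' k (z + P a + (b * v k) *\<^sub>R e k)) (at (b * v k))"
        by (rule has_pdiff_at) (use insert.prems in auto)
      show ?thesis using DERIV_chain2[OF 2 1] by (simp add: f_def add_ac mult.commute)
    qed
    have c: "continuous_on UNIV (\<phi>' k)" using insert.prems by auto
    have "continuous_on UNIV (\<lambda>p::real \<times> real. z + (snd p * v k) *\<^sub>R e k + P (fst p))"
      unfolding P_def by (intro continuous_intros)
    from continuous_on_compose2[OF c this]
    show "continuous_on UNIV (\<lambda>p. v k * \<phi>' k (z + (snd p * v k) *\<^sub>R e k + P (fst p)))"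
      by (intro continuous_on_mult_left) simp
  qed
  then show ?case using insert.hyps by (simp add: f_def P_def add_ac)
qed simp

lemma ex_Basis: "ex j \<in> Basis" and et_Basis: "et \<in> Basis"
  by (auto simp: ex_def et_def Basis_prod_def axis_in_Basis_iff)

lemma Basis_cases:
  assumes "(e :: real \<times> (real^'n)) \<in> Basis"
  obtains "e = et" | j where "e = ex j"
  using assms by (auto simp: ex_def et_def Basis_prod_def Basis_vec_def)

lemma ray_DERIV:
  fixes \<phi> :: "real \<times> (real^'n) \<Rightarrow> real"
  assumes "\<And>j. has_pdiff (ex j) \<phi> (\<phi>' j)" and "\<And>j. continuous_on UNIV (\<phi>' j)"
  shows "((\<lambda>r. \<phi> (z + (0, r *\<^sub>R v))) has_real_derivative (\<Sum>j\<in>UNIV. v $ j * \<phi>' j (z + (0, r *\<^sub>R v)))) (at r)"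
proof -
  have *: "(\<Sum>j\<in>UNIV. (r * v $ j) *\<^sub>R ex j) = (0, r *\<^sub>R v)" for r
  proof (rule prod_eqI)
    show "snd (\<Sum>j\<in>UNIV. (r * v $ j) *\<^sub>R ex j) = snd (0, r *\<^sub>R v)"
      by (simp add: snd_sum ex_def vec_eq_iff axis_def if_distrib cong: if_cong)
  qed (simp add: fst_sum ex_def)
  show ?thesis
    using continuous_partials_DERIV[of UNIV ex \<phi> \<phi>' z "\<lambda>j. v $ j" r] assms by (simp add: *)
qed

lemma DERIV_gauss: "((\<lambda>s. gauss (v + s *\<^sub>R axis j 1)) has_real_derivative - (v $ j) * gauss v) (at 0)"
proof -
  have "(norm (v + s *\<^sub>R axis j 1))\<^sup>2 = (norm v)\<^sup>2 + 2 * s * v $ j + s\<^sup>2" for s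
    unfolding power2_norm_eq_inner by (simp add: inner_add_left inner_add_right inner_axis inner_axis' power2_eq_square algebra_simps)
  then show ?thesis
    unfolding gauss_def by (auto intro!: derivative_eq_intros)
qed

text \<open>Gaussian integration by parts in the variable \<open>y\<^sub>j\<close>.\<close>

lemma Aop_Some_eq:
  fixes g :: "real \<times> (real^'n) \<Rightarrow> real"
  assumes g: "C0 (\<lambda>_. 1) g" and g': "C0 (\<lambda>_. 1) g'" and has_pdiff: "has_pdiff (ex j) g g'"
  shows "Aop 1 (ker (Some j)) g z = Aop 1 (ker None) g' z"
proof -
  \<comment> \<open>\<open>h'\<close> is the derivative of \<open>h\<close> in \<open>y_j\<close>:
    the inner function \<open>z + r y\<close> produces the factor \<open>r\<close> and thus
    \<open>ker None\<close>, the Gaussian produces \<open>- y_j\<close> and thus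
    \<open>ker (Some j)\<close>. Its integral vanishes by translation invariance.\<close>
  define h where "h y = gk y * g (z + 1 *\<^sub>R (0, fst y *\<^sub>R snd y))" for y
  define h' where "h' y = ker None y * g' (z + 1 *\<^sub>R (0, fst y *\<^sub>R snd y)) - ker (Some j) y * g (z + 1 *\<^sub>R (0, fst y *\<^sub>R snd y))" for y
  have i1: "integrable lborel (\<lambda>y. ker None y * g' (z + 1 *\<^sub>R (0, fst y *\<^sub>R snd y)))"
    by (rule Aop_integrable[OF _ g']) simp
  have i2: "integrable lborel (\<lambda>y. ker (Some j) y * g (z + 1 *\<^sub>R (0, fst y *\<^sub>R snd y)))"
    by (rule Aop_integrable[OF _ g]) simp
  have "(\<integral>y. h' y \<partial>lborel) = 0"
  proof (rule integral_has_pdiff_eq_0[where h=h and e="ex j"])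
    obtain C where C: "C \<ge> 0" "\<And>t x. \<bar>t\<bar> \<le> \<bar>fst z\<bar> \<Longrightarrow> \<bar>g (t, x)\<bar> \<le> C * 1" using C0_bound[OF g] by metis
    show "integrable lborel h"
    proof (rule Bochner_Integration.integrable_bound[OF integrable_mult_right[OF integrable_gk, of C]])
      show "h \<in> borel_measurable lborel"
        unfolding h_def using borel_measurable_times[OF gk_measurable shift_measurable[OF C0_continuous[OF g], of z 1]] by simp
      have "gk y * \<bar>g (z + 1 *\<^sub>R (0, fst y *\<^sub>R snd y))\<bar> \<le> C * gk y" for y
        using mult_right_mono[OF C(2)[of "fst z" "snd z + fst y *\<^sub>R snd y"] gk_nonneg[of y]] by (cases z) (simp add: mult.commute)
      then show "AE y in lborel. norm (h y) \<le> norm (C * gk y)"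
        using C(1) by (auto simp: h_def abs_mult gk_nonneg)
    qed
    show "integrable lborel h'" unfolding h'_def by (intro Bochner_Integration.integrable_diff i1 i2)
    show "has_pdiff (ex j) h h'"
      unfolding has_pdiff_def
    proof
      fix y :: "real \<times> (real^'n)"
      obtain r v where y: "y = (r, v)" by fastforce
      have G: "((\<lambda>s. g (z + 1 *\<^sub>R (0, r *\<^sub>R (v + s *\<^sub>R axis j 1)))) has_real_derivative g' (z + 1 *\<^sub>R (0, r *\<^sub>R v)) * r) (at 0)"
      proof -
        have "((\<lambda>s. s * r) has_real_derivative r) (at 0)" by (auto intro!: derivative_eq_intros)
        from DERIV_chain2[OF has_pdiff_at[OF has_pdiff, of "z + (0, r *\<^sub>R v)" "0 * r"] this]
        show ?thesis by (simp add: ex_def algebra_simps)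
      qed
      show "((\<lambda>s. h (y + s *\<^sub>R ex j)) has_real_derivative h' y) (at 0)"
      proof (cases "0 \<le> r")
        case True
        have "((\<lambda>s. (exp (- r\<^sup>2 / 2) * gauss (v + s *\<^sub>R axis j 1) / cG TYPE('n)) * g (z + 1 *\<^sub>R (0, r *\<^sub>R (v + s *\<^sub>R axis j 1)))) has_real_derivative
          (exp (- r\<^sup>2 / 2) * gauss (v + 0 *\<^sub>R axis j 1) / cG TYPE('n)) * (g' (z + 1 *\<^sub>R (0, r *\<^sub>R v)) * r) +
          (exp (- r\<^sup>2 / 2) * (- (v $ j) * gauss v) / cG TYPE('n)) * g (z + 1 *\<^sub>R (0, r *\<^sub>R (v + 0 *\<^sub>R axis j 1)))) (at 0)"
          by (intro DERIV_mult' G DERIV_cdivide DERIV_cmult DERIV_gauss)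
        with True show ?thesis
          by (simp add: y h_def h'_def ker_def gk_def ex_def algebra_simps)
      next
        case False
        then show ?thesis by (simp add: y h_def h'_def ker_def gk_def ex_def)
      qed
    qed
    show "continuous_on UNIV (\<lambda>s. h' (y + s *\<^sub>R ex j))" for y
    proof (cases "0 \<le> fst y")
      case True
      have [simp]: "cG TYPE('n) \<noteq> 0" using cG_pos[where 'n='n] by simp
      have "(\<lambda>s. h' (y + s *\<^sub>R ex j)) = (\<lambda>s. (exp (- (fst y)\<^sup>2 / 2) * gauss (snd y + s *\<^sub>R axis j 1) / cG TYPE('n)) *
        (fst y * g' (z + (0, fst y *\<^sub>R (snd y + s *\<^sub>R axis j 1))) - (snd y + s *\<^sub>R axis j 1) $ j * g (z + (0, fst y *\<^sub>R (snd y + s *\<^sub>R axis j 1)))))"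
        using True by (simp add: fun_eq_iff h'_def ker_def gk_def ex_def right_diff_distrib mult_ac)
      moreover have "continuous_on UNIV \<dots>"
        by (intro continuous_intros continuous_on_compose2[OF C0_continuous[OF g]] continuous_on_compose2[OF C0_continuous[OF g']]) auto
      ultimately show ?thesis by (simp only:)
    next
      case False
      then show ?thesis by (simp add: h'_def ker_def gk_def ex_def)
    qed
  qed
  then show ?thesis
    unfolding h'_def Aop_def using i1 i2 by simp
qed

text \<open>The sum of \<open>y_j \<phi>'_j (z + r y)\<close> is the radial derivative of
  \<open>\<phi> (z + r y)\<close>. Hence the combined integrand is, up to
  \<open>gauss y / cG\<close>, the r-derivative of \<open>exp (- r^2 / 2) \<phi> (z + r y)\<close>.
  Integrating r from 0 to infinity leaves \<open>- \<phi> z\<close>, and the normalised Gaussian has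
  mass 1.\<close>

lemma Aop_radial:
  fixes \<phi> :: "real \<times> (real^'n) \<Rightarrow> real"
  assumes \<phi>: "C0 (\<lambda>_. 1) \<phi>" and \<phi>': "\<And>j. C0 (\<lambda>_. 1) (\<phi>' j)" and has_pdiff: "\<And>j. has_pdiff (ex j) \<phi> (\<phi>' j)"
  shows "(\<Sum>j\<in>UNIV. Aop 1 (ker (Some j)) (\<phi>' j) z) = Aop 1 (ker None) \<phi> z - \<phi> z"
proof -
  define S where "S y = (0::real, fst y *\<^sub>R snd y)" for y :: "real \<times> (real^'n)"
  define F where "F y = (\<Sum>j\<in>UNIV. ker (Some j) y * \<phi>' j (z + S y)) - ker None y * \<phi> (z + S y)" for y
  let ?c = "cG TYPE('n)"
  have c: "?c > 0" by (rule cG_pos)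
  have i1: "integrable lborel (\<lambda>y. ker (Some j) y * \<phi>' j (z + S y))" for j
    using Aop_integrable[OF _ \<phi>', of 1 "Some j" j z] by (simp add: S_def)
  have i2: "integrable lborel (\<lambda>y. ker None y * \<phi> (z + S y))"
    using Aop_integrable[OF _ \<phi>, of 1 None z] by (simp add: S_def)
  have iF: "integrable (lborel \<Otimes>\<^sub>M lborel) (\<lambda>(r, v). F (r, v))"
    unfolding F_def lborel_prod split_beta prod.collapse by (intro Bochner_Integration.integrable_diff Bochner_Integration.integrable_sum i1 i2)
  have "(\<Sum>j\<in>UNIV. Aop 1 (ker (Some j)) (\<phi>' j) z) - Aop 1 (ker None) \<phi> z = (\<integral>y. F y \<partial>lborel)"
    unfolding F_def using i1 i2 by (simp add: Aop_def S_def[symmetric])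
  also have "\<dots> = (\<integral>v. (\<integral>r. F (r, v) \<partial>lborel) \<partial>lborel)"
    using lborel_pair.integral_snd[OF iF] by (simp add: lborel_prod)
  also have "\<dots> = (\<integral>v. - \<phi> z / ?c * gauss (v::real^'n) \<partial>lborel)"
  proof (rule integral_cong_AE)
    show "AE v in lborel. (\<integral>r. F (r, v) \<partial>lborel) = - \<phi> z / ?c * gauss v"
      using lborel_pair.AE_integrable_snd[OF iF]
    proof eventually_elim
      case (elim v)
      define G where "G r = gauss v / ?c * (exp (- r\<^sup>2 / 2) * \<phi> (z + (0, r *\<^sub>R v)))" for r :: real
      define G' where "G' r = gauss v / ?c * (exp (- r\<^sup>2 / 2) * (\<Sum>j\<in>UNIV. v $ j * \<phi>' j (z + (0, r *\<^sub>R v))) - r * exp (- r\<^sup>2 / 2) * \<phi> (z + (0, r *\<^sub>R v)))" for r :: real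
      have FG: "F (r, v) = G' r * indicator {0..} r" for r
        by (auto simp: F_def G'_def ker_def gk_def S_def indicator_def sum_distrib_left algebra_simps diff_divide_distrib sum_divide_distrib)
      have dG: "(G has_real_derivative G' r) (at r)" for r
      proof -
        have *: "((\<lambda>r. \<phi> (z + (0, r *\<^sub>R v))) has_real_derivative (\<Sum>j\<in>UNIV. v $ j * \<phi>' j (z + (0, r *\<^sub>R v)))) (at r)"
          by (rule ray_DERIV[OF has_pdiff]) (use \<phi>' in \<open>auto simp: C0_def\<close>)
        have "((\<lambda>r. exp (- r\<^sup>2 / 2)) has_real_derivative - r * exp (- r\<^sup>2 / 2)) (at r)"
          by (auto intro!: derivative_eq_intros)
        from DERIV_cmult[OF DERIV_mult'[OF this *], of "gauss v / ?c"]
        show ?thesis unfolding G_def[abs_def] G'_def by (simp add: algebra_simps)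
      qed
      have contG': "isCont G' r" for r
      proof -
        have ray: "continuous_on UNIV (\<lambda>r. z + (0, r *\<^sub>R v))" by (intro continuous_intros)
        have "continuous_on UNIV (\<lambda>r. \<phi> (z + (0, r *\<^sub>R v)))"
          and "continuous_on UNIV (\<lambda>r. \<phi>' j (z + (0, r *\<^sub>R v)))" for j
          by (rule continuous_on_compose2[OF C0_continuous[OF \<phi>] ray] continuous_on_compose2[OF C0_continuous[OF \<phi>'] ray]; simp)+
        then have "continuous_on UNIV G'"
          unfolding G'_def by (intro continuous_intros) auto
        then show ?thesis by (simp add: continuous_on_eq_continuous_at)
      qed
      have int: "(\<integral>r. G' r * indicator {0..real n} r \<partial>lborel) = G (real n) - G 0" for n
        by (rule integral_FTC_Icc_real) (use dG contG' in auto)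
      \<comment> \<open>The half-line is exhausted by \<open>[0, n]\<close>. The dominating function
        \<open>|F (r, v)|\<close> is integrable in \<open>r\<close> for almost every
        \<open>v\<close> by Fubini.\<close>
      have "(\<lambda>n. \<integral>r. G' r * indicator {0..real n} r \<partial>lborel) \<longlonglongrightarrow> (\<integral>r. F (r, v) \<partial>lborel)"
      proof (rule integral_dominated_convergence[where w="\<lambda>r. \<bar>F (r, v)\<bar>"])
        have [measurable]: "G' \<in> borel_measurable borel"
          using contG' by (intro borel_measurable_continuous_onI) (auto simp: continuous_on_eq_continuous_at)
        show "(\<lambda>r. F (r, v)) \<in> borel_measurable lborel" "integrable lborel (\<lambda>r. \<bar>F (r, v)\<bar>)" using elim by auto
        show "(\<lambda>r. G' r * indicator {0..real n} r) \<in> borel_measurable lborel" for n by measurable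
        show "AE r in lborel. (\<lambda>n. G' r * indicator {0..real n} r) \<longlonglongrightarrow> F (r, v)"
        proof (rule AE_I2)
          fix r :: real
          obtain N where "r \<le> real N" using real_arch_simple by blast
          then have "eventually (\<lambda>n. G' r * indicator {0..real n} r = F (r, v)) sequentially"
            by (intro eventually_sequentiallyI[of N]) (auto simp: FG indicator_def)
          then show "(\<lambda>n. G' r * indicator {0..real n} r) \<longlonglongrightarrow> F (r, v)" by (rule tendsto_eventually)
        qed
        show "AE r in lborel. norm (G' r * indicator {0..real n} r) \<le> \<bar>F (r, v)\<bar>" for n
          by (auto simp: FG indicator_def)
      qed
      moreover have "(\<lambda>n. G (real n) - G 0) \<longlonglongrightarrow> 0 - G 0"
      proof (intro tendsto_intros)
        obtain C where C: "C \<ge> 0" "\<And>t x. \<bar>t\<bar> \<le> \<bar>fst z\<bar> \<Longrightarrow> \<bar>\<phi> (t, x)\<bar> \<le> C * 1" using C0_bound[OF \<phi>] by metis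
        have b: "\<bar>\<phi> (z + (0, r *\<^sub>R v))\<bar> \<le> C" for r using C(2)[of "fst z" "snd z + r *\<^sub>R v"] by (cases z) simp
        have e: "(\<lambda>n. exp (- (real n)\<^sup>2 / 2)) \<longlonglongrightarrow> 0"
        proof (rule Lim_null_comparison)
          show "(\<lambda>n. exp (- 1 / 2 :: real) ^ n) \<longlonglongrightarrow> 0" by (rule LIMSEQ_realpow_zero) auto
          \<comment> \<open>Since \<open>n \<le> n^2\<close>, the Gaussian factor is bounded by a
            geometric sequence.\<close>
          have "real n * 1 \<le> real n * real n" for n by (cases "n = 0") auto
          then show "eventually (\<lambda>n. norm (exp (- (real n)\<^sup>2 / 2)) \<le> exp (- 1 / 2 :: real) ^ n) sequentially"
            by (intro always_eventually allI) (simp add: exp_of_nat_mult[symmetric] power2_eq_square)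
        qed
        have lim: "(\<lambda>n. gauss v / ?c * C * exp (- (real n)\<^sup>2 / 2)) \<longlonglongrightarrow> 0"
          using tendsto_mult_left[OF e, of "gauss v / ?c * C"] by simp
        show "(\<lambda>n. G (real n)) \<longlonglongrightarrow> 0"
        proof (rule Lim_null_comparison[OF _ lim], intro always_eventually allI)
          fix n
          have "\<bar>G (real n)\<bar> = gauss v / ?c * (exp (- (real n)\<^sup>2 / 2) * \<bar>\<phi> (z + (0, real n *\<^sub>R v))\<bar>)"
            using c by (simp add: G_def abs_mult gauss_pos less_imp_le)
          also have "\<dots> \<le> gauss v / ?c * (exp (- (real n)\<^sup>2 / 2) * C)"
            using c b by (intro mult_left_mono) (auto simp: gauss_pos less_imp_le)
          finally show "norm (G (real n)) \<le> gauss v / ?c * C * exp (- (real n)\<^sup>2 / 2)" by (simp add: mult_ac)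
        qed
      qed
      ultimately have "(\<integral>r. F (r, v) \<partial>lborel) = - G 0"
        using LIMSEQ_unique unfolding int by fastforce
      then show ?case by (simp add: G_def zero_prod_def[symmetric])
    qed
    show "(\<lambda>v. \<integral>r. F (r, v) \<partial>lborel) \<in> borel_measurable lborel"
      using lborel_pair.integrable_snd[OF iF] by simp
  qed simp
  also have "\<dots> = - \<phi> z"
    using c by (simp add: cG_def)
  finally show ?thesis by simp
qed

text \<open>One derivative of each second derivative is moved onto the kernel, and the radial
  identity then gives \<open>B \<Delta> \<phi> = B \<phi> - \<phi>\<close>. This identifies the
  Gaussian average as a left inverse of \<open>1 - \<Delta>\<close>.\<close>

theorem Aop_resolvent:
  fixes \<phi> :: "real \<times> (real^'n) \<Rightarrow> real"
  assumes \<phi>: "C0 (\<lambda>_. 1) \<phi>" and \<phi>': "\<And>j. C0 (\<lambda>_. 1) (\<phi>' j)" "\<And>j. has_pdiff (ex j) \<phi> (\<phi>' j)"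
    and \<phi>'': "\<And>j. C0 (\<lambda>_. 1) (\<phi>'' j)" "\<And>j. has_pdiff (ex j) (\<phi>' j) (\<phi>'' j)"
  shows "Aop 1 (ker None) (\<lambda>z. \<phi> z - (\<Sum>j\<in>UNIV. \<phi>'' j z)) z = \<phi> z"
proof -
  have "Aop 1 (ker None) (\<lambda>z. \<phi> z - (\<Sum>j\<in>UNIV. \<phi>'' j z)) z = Aop 1 (ker None) \<phi> z - (\<Sum>j\<in>UNIV. Aop 1 (ker None) (\<phi>'' j) z)"
    using \<phi> \<phi>'' by (simp add: Aop_diff Aop_sum C0_sum)
  also have "(\<Sum>j\<in>UNIV. Aop 1 (ker None) (\<phi>'' j) z) = (\<Sum>j\<in>UNIV. Aop 1 (ker (Some j)) (\<phi>' j) z)"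
    using Aop_Some_eq[OF \<phi>'(1) \<phi>''(1) \<phi>''(2)] by simp
  also have "\<dots> = Aop 1 (ker None) \<phi> z - \<phi> z"
    by (rule Aop_radial[OF \<phi> \<phi>'])
  finally show ?thesis by simp
qed

section \<open>Picard iteration\<close>

text \<open>The index \<open>None\<close> carries the unknown itself and \<open>Some j\<close> the flux component \<open>f\<^sub>j\<close>. The shift by
  \<open>-1\<close> turns the kernels into the transposed ones; this accounts for the sign of the divergence.\<close>

definition rhs :: "('n option \<Rightarrow> real \<times> (real^'n) \<Rightarrow> real \<Rightarrow> real) \<Rightarrow> (real \<times> (real^'n) \<Rightarrow> real) \<Rightarrow> real \<times> (real^'n) \<Rightarrow> real" where
  "rhs N w z = - w z + (\<Sum>i\<in>UNIV. Aop (-1) (ker i) (\<lambda>z. N i z (w z)) z)"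

definition solves :: "('n option \<Rightarrow> real \<times> (real^'n) \<Rightarrow> real \<Rightarrow> real) \<Rightarrow> (real^'n \<Rightarrow> real) \<Rightarrow> (real \<times> (real^'n) \<Rightarrow> real) \<Rightarrow> bool" where
  "solves N w0 w \<longleftrightarrow> (\<forall>z. w z = w0 (snd z) + Jop (rhs N w) z)"

fun picard :: "('n option \<Rightarrow> real \<times> (real^'n) \<Rightarrow> real \<Rightarrow> real) \<Rightarrow> (real^'n \<Rightarrow> real) \<Rightarrow> nat \<Rightarrow> real \<times> (real^'n) \<Rightarrow> real" where
  "picard N w0 0 z = w0 (snd z)"
| "picard N w0 (Suc n) z = w0 (snd z) + Jop (rhs N (picard N w0 n)) z"

text \<open>The Lipschitz constant is uniform in space and in the unknown and varies only with the
  time window, which makes solutions global. Decay of \<open>N i z 0\<close> together with the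
  Lipschitz bound keeps \<open>N i z (w z)\<close> in the weighted class.\<close>

definition admissible :: "(real^'n \<Rightarrow> real) \<Rightarrow> ('n option \<Rightarrow> real \<times> (real^'n) \<Rightarrow> real \<Rightarrow> real) \<Rightarrow> bool" where
  "admissible W N \<longleftrightarrow> (\<forall>i. continuous_on UNIV (\<lambda>p. N i (fst p) (snd p)) \<and> C0 W (\<lambda>z. N i z 0)) \<and>
     (\<forall>\<tau>. \<exists>L\<ge>0. \<forall>i t x v v'. \<bar>t\<bar> \<le> \<tau> \<longrightarrow> \<bar>N i (t, x) v - N i (t, x) v'\<bar> \<le> L * \<bar>v - v'\<bar>)"

lemma admissible_Lipschitz:
  assumes "admissible W N"
  obtains L where "L \<ge> 0" "\<And>i t x v v'. \<bar>t\<bar> \<le> \<tau> \<Longrightarrow> \<bar>N i (t, x) v - N i (t, x) v'\<bar> \<le> L * \<bar>v - v'\<bar>"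
  using assms unfolding admissible_def by metis

lemma admissible_comp_continuous:
  assumes "admissible W N" "continuous_on UNIV w"
  shows "continuous_on UNIV (\<lambda>z. N i z (w z))"
proof -
  have "continuous_on UNIV (\<lambda>p. N i (fst p) (snd p))" using assms(1) by (simp add: admissible_def)
  from continuous_on_compose2[OF this continuous_on_Pair[OF continuous_on_id assms(2)]]
  show ?thesis by simp
qed

lemma admissible_comp:
  assumes "admissible W N" "C0 W w"
  shows "C0 W (\<lambda>z. N i z (w z))"
  unfolding C0_def
proof (intro conjI allI)
  show "continuous_on UNIV (\<lambda>z. N i z (w z))" using admissible_comp_continuous assms by (auto simp: C0_def)
  fix \<tau>
  obtain L where L: "L \<ge> 0" "\<And>i t x v v'. \<bar>t\<bar> \<le> \<tau> \<Longrightarrow> \<bar>N i (t, x) v - N i (t, x) v'\<bar> \<le> L * \<bar>v - v'\<bar>"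
    using admissible_Lipschitz[OF assms(1)] by metis
  have "C0 W (\<lambda>z. N i z 0)" using assms by (simp add: admissible_def)
  then obtain C where C: "C \<ge> 0" "\<And>t x. \<bar>t\<bar> \<le> \<tau> \<Longrightarrow> \<bar>N i (t, x) 0\<bar> \<le> C * W x"
    using C0_bound by metis
  obtain D where D: "D \<ge> 0" "\<And>t x. \<bar>t\<bar> \<le> \<tau> \<Longrightarrow> \<bar>w (t, x)\<bar> \<le> D * W x"
    using C0_bound[OF assms(2)] by metis
  have "\<bar>N i (t, x) (w (t, x))\<bar> \<le> (C + L * D) * W x" if t: "\<bar>t\<bar> \<le> \<tau>" for t x
  proof -
    have "\<bar>N i (t, x) (w (t, x)) - N i (t, x) 0\<bar> \<le> L * \<bar>w (t, x)\<bar>" using L(2)[OF t, of i x "w (t,x)" 0] by simp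
    also have "\<dots> \<le> L * (D * W x)" using L(1) D(2)[OF t] by (intro mult_left_mono)
    finally show ?thesis using C(2)[OF t, of x] by (simp add: algebra_simps)
  qed
  then show "\<exists>C\<ge>0. \<forall>t x. \<bar>t\<bar> \<le> \<tau> \<longrightarrow> \<bar>N i (t, x) (w (t, x))\<bar> \<le> C * W x"
    using L C D by (intro exI[of _ "C + L * D"]) auto
qed

lemma C0_rhs:
  assumes "weight_fn W" "admissible W N" "C0 W w"
  shows "C0 W (rhs N w)"
proof -
  have "C0 W (Aop (-1) (ker i) (\<lambda>z. N i z (w z)))" for i
    by (rule C0_Aop[OF assms(1) _ admissible_comp[OF assms(2,3)]]) simp
  then have "C0 W (\<lambda>z. \<Sum>i\<in>UNIV. Aop (-1) (ker i) (\<lambda>z. N i z (w z)) z)"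
    by (intro C0_sum[OF weight_simps(2)[OF assms(1)]]) simp_all
  from C0_add[OF C0_minus[OF assms(3)] this] show ?thesis unfolding rhs_def[abs_def] .
qed

text \<open>The averages act in space only, so a bound at the single time \<open>t\<close> suffices.
  This form, pointwise in time, is the one that \<open>Jop_bound\<close> integrates.\<close>

lemma rhs_Lipschitz:
  fixes N :: "'n::finite option \<Rightarrow> real \<times> (real^'n) \<Rightarrow> real \<Rightarrow> real"
  assumes W: "weight_fn W" and N: "admissible W N"
  obtains C where "C \<ge> 1" "\<And>t x w w' D. \<lbrakk>\<bar>t\<bar> \<le> \<tau>; C0 W w; C0 W w'; \<And>x. \<bar>w (t, x) - w' (t, x)\<bar> \<le> D * W x\<rbrakk>
    \<Longrightarrow> \<bar>rhs N w (t, x) - rhs N w' (t, x)\<bar> \<le> C * D * W x"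
proof -
  obtain L where L: "L \<ge> 0" "\<And>i t x v v'. \<bar>t\<bar> \<le> \<tau> \<Longrightarrow> \<bar>N i (t, x) v - N i (t, x) v'\<bar> \<le> L * \<bar>v - v'\<bar>"
    using admissible_Lipschitz[OF N] by metis
  \<comment> \<open>The 1 accounts for the term \<open>- w\<close>; each kernel adds the Lipschitz
    constant times its operator bound.\<close>
  define C where "C = 1 + (\<Sum>i\<in>(UNIV::'n option set). L * KM TYPE('n))"
  have "C \<ge> 1" using L(1) KM_nonneg[where 'n='n] by (auto simp: C_def)
  moreover have "\<bar>rhs N w (t, x) - rhs N w' (t, x)\<bar> \<le> C * D * W x"
    if t: "\<bar>t\<bar> \<le> \<tau>" and w: "C0 W w" "C0 W w'" and d: "\<And>x. \<bar>w (t, x) - w' (t, x)\<bar> \<le> D * W x" for t x w w' D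
  proof -
    note c1 = C0_weight[OF admissible_comp[OF N w(1)] weight_simps(3)[OF W]] and c2 = C0_weight[OF admissible_comp[OF N w(2)] weight_simps(3)[OF W]]
    have A: "\<bar>Aop (-1) (ker i) (\<lambda>z. N i z (w z)) (t, x) - Aop (-1) (ker i) (\<lambda>z. N i z (w' z)) (t, x)\<bar> \<le> L * D * KM TYPE('n) * W x" for i
    proof -
      have "Aop (-1) (ker i) (\<lambda>z. N i z (w z)) (t, x) - Aop (-1) (ker i) (\<lambda>z. N i z (w' z)) (t, x) =
        Aop (-1) (ker i) (\<lambda>z. N i z (w z) - N i z (w' z)) (t, x)"
        by (rule Aop_diff[symmetric]) (use c1 c2 in auto)
      also have "\<bar>\<dots>\<bar> \<le> L * D * KM TYPE('n) * W x"
      proof (rule Aop_weighted(2)[OF W])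
        show "continuous_on UNIV (\<lambda>z. N i z (w z) - N i z (w' z))"
          using c1[of i] c2[of i] by (auto simp: C0_def intro!: continuous_intros)
        show "\<bar>N i (t, x) (w (t, x)) - N i (t, x) (w' (t, x))\<bar> \<le> L * D * W x" for x
          using order_trans[OF L(2)[OF t] mult_left_mono[OF d[of x] L(1)], of i x] by (simp add: mult.assoc)
      qed simp
      finally show ?thesis .
    qed
    have "\<bar>rhs N w (t, x) - rhs N w' (t, x)\<bar> =
      \<bar>(w' (t, x) - w (t, x)) + (\<Sum>i\<in>UNIV. Aop (-1) (ker i) (\<lambda>z. N i z (w z)) (t, x) - Aop (-1) (ker i) (\<lambda>z. N i z (w' z)) (t, x))\<bar>"
      by (simp add: rhs_def sum_subtractf)
    also have "\<dots> \<le> D * W x + (\<Sum>i\<in>(UNIV::'n option set). L * D * KM TYPE('n) * W x)"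
      by (intro order_trans[OF abs_triangle_ineq] add_mono order_trans[OF sum_abs] sum_mono A)
         (use d[of x] in \<open>simp add: abs_minus_commute\<close>)
    also have "\<dots> = C * D * W x" by (simp add: C_def algebra_simps)
    finally show ?thesis .
  qed
  ultimately show ?thesis using that by blast
qed

text \<open>The induction step of every Picard estimate. With \<open>n = 0\<close> it also expresses
  continuity of the integral operator, which is how the limit equation is obtained.\<close>

lemma Jop_rhs_diff_bound:
  fixes N :: "'n::finite option \<Rightarrow> real \<times> (real^'n) \<Rightarrow> real \<Rightarrow> real"
  assumes W: "weight_fn W" and N: "admissible W N"
  obtains C where "C \<ge> 1" "\<And>t x w w' D n. \<lbrakk>\<bar>t\<bar> \<le> \<tau>; C0 W w; C0 W w';
      \<And>s x. \<bar>s\<bar> \<le> \<tau> \<Longrightarrow> \<bar>w (s, x) - w' (s, x)\<bar> \<le> D * (C * \<bar>s\<bar>) ^ n / fact n * W x\<rbrakk>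
    \<Longrightarrow> \<bar>Jop (rhs N w) (t, x) - Jop (rhs N w') (t, x)\<bar> \<le> D * (C * \<bar>t\<bar>) ^ Suc n / fact (Suc n) * W x"
proof -
  obtain C where C: "C \<ge> 1" "\<And>t x w w' D. \<lbrakk>\<bar>t\<bar> \<le> \<tau>; C0 W w; C0 W w'; \<And>x. \<bar>w (t, x) - w' (t, x)\<bar> \<le> D * W x\<rbrakk>
    \<Longrightarrow> \<bar>rhs N w (t, x) - rhs N w' (t, x)\<bar> \<le> C * D * W x"
    by (rule rhs_Lipschitz[OF W N]) blast
  show ?thesis
  proof (rule that[OF C(1)])
    fix t x w w' D n
    assume t: "\<bar>t\<bar> \<le> \<tau>" and w: "C0 W w" "C0 W w'"
      and d: "\<And>s x. \<bar>s\<bar> \<le> \<tau> \<Longrightarrow> \<bar>w (s, x) - w' (s, x)\<bar> \<le> D * (C * \<bar>s\<bar>) ^ n / fact n * W x"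
    note c = C0_continuous[OF C0_rhs[OF W N w(1)]] C0_continuous[OF C0_rhs[OF W N w(2)]]
    have "\<bar>Jop (\<lambda>z. rhs N w z - rhs N w' z) (t, x)\<bar> \<le> (D * C ^ Suc n / fact n * W x) * \<bar>t\<bar> ^ Suc n / Suc n"
    proof (rule Jop_bound)
      show "continuous_on UNIV (\<lambda>z. rhs N w z - rhs N w' z)" using c by (intro continuous_intros)
      fix s assume "\<bar>s\<bar> \<le> \<bar>t\<bar>"
      then have s: "\<bar>s\<bar> \<le> \<tau>" using t by simp
      show "\<bar>rhs N w (s, x) - rhs N w' (s, x)\<bar> \<le> D * C ^ Suc n / fact n * W x * \<bar>s\<bar> ^ n"
        using C(2)[OF s w d[OF s]] by (simp add: power_mult_distrib mult_ac)
    qed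
    also have "\<dots> = D * (C * \<bar>t\<bar>) ^ Suc n / fact (Suc n) * W x"
      by (simp add: power_mult_distrib mult_ac)
    finally show "\<bar>Jop (rhs N w) (t, x) - Jop (rhs N w') (t, x)\<bar> \<le> D * (C * \<bar>t\<bar>) ^ Suc n / fact (Suc n) * W x"
      using Jop_diff[OF c] by simp
  qed
qed

lemma C0_initial:
  assumes "continuous_on UNIV w0" "\<And>x. \<bar>w0 x\<bar> \<le> C * W x" "0 \<le> C"
  shows "C0 W (\<lambda>z. w0 (snd z))"
  unfolding C0_def using assms by (auto intro!: continuous_on_compose2[of UNIV w0] continuous_intros)

lemma C0_picard:
  assumes "weight_fn W" "admissible W N" "C0 W (\<lambda>z. w0 (snd z))"
  shows "C0 W (picard N w0 n)"
proof (induction n)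
  case 0
  have "picard N w0 0 = (\<lambda>z. w0 (snd z))" by auto
  then show ?case using assms(3) by simp
next
  case (Suc n)
  have "picard N w0 (Suc n) = (\<lambda>z. w0 (snd z) + Jop (rhs N (picard N w0 n)) z)" by auto
  then show ?case using C0_add[OF assms(3) C0_Jop[OF C0_rhs[OF assms(1,2) Suc]]] by simp
qed

text \<open>Convergence towards a solution given in advance, for use where the solution comes from
  elsewhere and only its iterates can be differentiated.\<close>

lemma picard_convergence:
  assumes W: "weight_fn W" and N: "admissible W N" and w0: "C0 W (\<lambda>z. w0 (snd z))" and w: "C0 W w" "solves N w0 w"
  obtains C D where "C \<ge> 1" "D \<ge> 0"
    "\<And>n t x. \<bar>t\<bar> \<le> \<tau> \<Longrightarrow> \<bar>picard N w0 n (t, x) - w (t, x)\<bar> \<le> D * (C * \<bar>t\<bar>) ^ n / fact n * W x"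
proof -
  obtain C where C: "C \<ge> 1" "\<And>t x w w' D n. \<lbrakk>\<bar>t\<bar> \<le> \<tau>; C0 W w; C0 W w';
      \<And>s x. \<bar>s\<bar> \<le> \<tau> \<Longrightarrow> \<bar>w (s, x) - w' (s, x)\<bar> \<le> D * (C * \<bar>s\<bar>) ^ n / fact n * W x\<rbrakk>
    \<Longrightarrow> \<bar>Jop (rhs N w) (t, x) - Jop (rhs N w') (t, x)\<bar> \<le> D * (C * \<bar>t\<bar>) ^ Suc n / fact (Suc n) * W x"
    by (rule Jop_rhs_diff_bound[OF W N]) blast
  note cp = C0_picard[OF W N w0]
  obtain D where D: "D \<ge> 0" "\<And>t x. \<bar>t\<bar> \<le> \<tau> \<Longrightarrow> \<bar>picard N w0 0 (t, x) - w (t, x)\<bar> \<le> D * W x"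
    using C0_bound[OF C0_diff[OF cp[of 0] w(1)]] by metis
  have "\<bar>picard N w0 n (t, x) - w (t, x)\<bar> \<le> D * (C * \<bar>t\<bar>) ^ n / fact n * W x" if "\<bar>t\<bar> \<le> \<tau>" for n t x
    using that
  proof (induction n arbitrary: t x)
    case 0
    then show ?case using D by simp
  next
    case (Suc n)
    have "picard N w0 (Suc n) (t, x) - w (t, x) = Jop (rhs N (picard N w0 n)) (t, x) - Jop (rhs N w) (t, x)"
      using w(2) by (simp add: solves_def)
    then show ?case using C(2)[OF Suc.prems cp w(1) Suc.IH, of x] by (simp only:)
  qed
  then show ?thesis using that C(1) D(1) by blast
qed

text \<open>Consecutive iterates differ by at most \<open>D (C |t|)^n / n! W\<close>, the terms of
  an exponential series. The series converges on every time window, so no smallness of the window is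
  required.\<close>

theorem solution_exists:
  fixes N :: "'n::finite option \<Rightarrow> real \<times> (real^'n) \<Rightarrow> real \<Rightarrow> real"
  assumes W: "weight_fn W" and N: "admissible W N" and w0: "C0 W (\<lambda>z. w0 (snd z))"
  obtains w where "C0 W w" "solves N w0 w"
proof -
  let ?p = "picard N w0"
  note cp = C0_picard[OF W N w0]
  define w where "w z = lim (\<lambda>n. ?p n z)" for z
  \<comment> \<open>The rate \<open>r\<close> depends on the time window but \<open>w\<close> does
    not: it is a pointwise limit, so the windows need not be glued.\<close>
  have main: "\<exists>r. r \<longlonglongrightarrow> 0 \<and> (\<forall>n. 0 \<le> r n) \<and> (\<forall>n t x. \<bar>t\<bar> \<le> \<tau> \<longrightarrow> \<bar>?p n (t, x) - w (t, x)\<bar> \<le> r n * W x)" for \<tau>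
  proof -
    obtain C where C: "C \<ge> 1" "\<And>t x w w' D n. \<lbrakk>\<bar>t\<bar> \<le> \<tau>; C0 W w; C0 W w';
        \<And>s x. \<bar>s\<bar> \<le> \<tau> \<Longrightarrow> \<bar>w (s, x) - w' (s, x)\<bar> \<le> D * (C * \<bar>s\<bar>) ^ n / fact n * W x\<rbrakk>
      \<Longrightarrow> \<bar>Jop (rhs N w) (t, x) - Jop (rhs N w') (t, x)\<bar> \<le> D * (C * \<bar>t\<bar>) ^ Suc n / fact (Suc n) * W x"
      by (rule Jop_rhs_diff_bound[OF W N]) blast
    obtain D where D: "D \<ge> 0" "\<And>t x. \<bar>t\<bar> \<le> \<tau> \<Longrightarrow> \<bar>?p 1 (t, x) - ?p 0 (t, x)\<bar> \<le> D * W x"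
      using C0_bound[OF C0_diff[OF cp[of 1] cp[of 0]]] by metis
    have step: "\<bar>?p (Suc n) (t, x) - ?p n (t, x)\<bar> \<le> D * (C * \<bar>t\<bar>) ^ n / fact n * W x" if "\<bar>t\<bar> \<le> \<tau>" for n t x
      using that
    proof (induction n arbitrary: t x)
      case 0
      then show ?case using D by simp
    next
      case (Suc n)
      have "?p (Suc (Suc n)) (t, x) - ?p (Suc n) (t, x) = Jop (rhs N (?p (Suc n))) (t, x) - Jop (rhs N (?p n)) (t, x)"
        by (simp only: picard.simps)
      then show ?case using C(2)[OF Suc.prems cp cp Suc.IH, of x] by (simp only:)
    qed
    \<comment> \<open>The majorant at the edge of the window. The absolute value covers a negative
      \<tau>, for which the claims are vacuous.\<close>
    define a where "a n = D * ((C * \<bar>\<tau>\<bar>) ^ n / fact n)" for n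
    have a0: "a n \<ge> 0" for n using C(1) D(1) by (simp add: a_def)
    have "summable (\<lambda>n. (C * \<bar>\<tau>\<bar>) ^ n / fact n)" using summable_exp[of "C * \<bar>\<tau>\<bar>"] by (simp add: divide_inverse mult.commute)
    then have sa: "summable a" unfolding a_def[abs_def] by (rule summable_mult)
    have step': "\<bar>?p (Suc n) (t, x) - ?p n (t, x)\<bar> \<le> a n * W x" if t: "\<bar>t\<bar> \<le> \<tau>" for n t x
    proof -
      have "D * (C * \<bar>t\<bar>) ^ n / fact n * W x \<le> D * (C * \<bar>\<tau>\<bar>) ^ n / fact n * W x"
        using C(1) D(1) t weight_simps(2)[OF W] by (intro mult_right_mono divide_right_mono mult_left_mono power_mono) auto
      then show ?thesis using step[OF t, of n x] by (simp add: a_def)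
    qed
    have conv: "(\<lambda>n. ?p n (t, x)) \<longlonglongrightarrow> w (t, x) \<and> \<bar>?p n (t, x) - w (t, x)\<bar> \<le> (\<Sum>k. a (k + n)) * W x" if t: "\<bar>t\<bar> \<le> \<tau>" for n t x
    proof -
      let ?d = "\<lambda>n. ?p (Suc n) (t, x) - ?p n (t, x)"
      have sd: "summable (\<lambda>n. \<bar>?d n\<bar>)"
        by (rule summable_comparison_test'[OF summable_mult2[OF sa, of "W x"]]) (use step'[OF t] in auto)
      then have sd': "summable ?d" by (rule summable_rabs_cancel)
      have "(\<lambda>n. \<Sum>k<n. ?d k) \<longlonglongrightarrow> suminf ?d" using sd' by (rule summable_LIMSEQ)
      then have "(\<lambda>n. ?p n (t, x) - ?p 0 (t, x)) \<longlonglongrightarrow> suminf ?d" by (simp only: sum_lessThan_telescope[of "\<lambda>k. ?p k (t, x)"])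
      then have L: "(\<lambda>n. ?p n (t, x)) \<longlonglongrightarrow> suminf ?d + ?p 0 (t, x)"
        using tendsto_add[OF _ tendsto_const, of "\<lambda>n. ?p n (t, x) - ?p 0 (t, x)" "suminf ?d" sequentially "?p 0 (t, x)"] by simp
      then have wl: "w (t, x) = suminf ?d + ?p 0 (t, x)" by (simp add: w_def limI)
      have "w (t, x) - ?p n (t, x) = (\<Sum>k. ?d (k + n))"
        using suminf_split_initial_segment[OF sd', of n] unfolding wl sum_lessThan_telescope[of "\<lambda>k. ?p k (t, x)"] by linarith
      also have "\<bar>\<dots>\<bar> \<le> (\<Sum>k. \<bar>?d (k + n)\<bar>)"
        by (rule summable_rabs) (use sd summable_iff_shift[of "\<lambda>n. \<bar>?d n\<bar>" n] in simp)
      also have "\<dots> \<le> (\<Sum>k. a (k + n) * W x)"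
        by (intro suminf_le step'[OF t] summable_mult2)
           (use sd sa summable_iff_shift[of "\<lambda>n. \<bar>?d n\<bar>" n] summable_iff_shift[of a n] in simp_all)
      also have "\<dots> = (\<Sum>k. a (k + n)) * W x"
        using sa summable_iff_shift[of a n] by (simp add: suminf_mult2)
      finally show ?thesis using L wl by (simp add: abs_minus_commute)
    qed
    have "(\<lambda>n. \<Sum>k. a (k + n)) \<longlonglongrightarrow> 0" using suminf_exist_split2[OF sa] by simp
    moreover have "(\<Sum>k. a (k + n)) \<ge> 0" for n
      using a0 sa summable_iff_shift[of a n] by (intro suminf_nonneg) auto
    ultimately show ?thesis using conv by blast
  qed
  have w: "C0 W w"
    unfolding C0_def
  proof (intro conjI allI)
    have "\<exists>S. open S \<and> z \<in> S \<and> continuous_on S w" for z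
    proof -
      \<comment> \<open>An open time strip around the point, on which the iterates converge
        uniformly; continuity is a local property.\<close>
      define S where "S z0 = {z::real \<times> (real^'n). \<bar>fst z\<bar> < \<bar>fst z0\<bar> + 1}" for z0 :: "real \<times> (real^'n)"
      have "open (S z)" unfolding S_def by (intro open_Collect_less continuous_intros)
      moreover obtain r where r: "r \<longlonglongrightarrow> 0" "\<And>n. 0 \<le> r n" "\<And>n t x. \<bar>t\<bar> \<le> \<bar>fst z\<bar> + 1 \<Longrightarrow> \<bar>?p n (t, x) - w (t, x)\<bar> \<le> r n * W x"
        using main by meson
      have "continuous_on (S z) w"
      proof (rule uniform_limit_theorem[where f="?p" and F=sequentially])
        show "\<forall>\<^sub>F n in sequentially. continuous_on (S z) (?p n)"
          by (intro always_eventually allI continuous_on_subset[OF C0_continuous[OF cp]]) simp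
        show "uniform_limit (S z) ?p w sequentially"
        proof (rule uniform_limitI)
          fix e :: real assume "0 < e"
          then have "\<forall>\<^sub>F n in sequentially. r n < e" using order_tendstoD(2)[OF r(1)] by blast
          then show "\<forall>\<^sub>F n in sequentially. \<forall>y\<in>S z. dist (?p n y) (w y) < e"
          proof eventually_elim
            case (elim n)
            show ?case
            proof
              fix y assume y: "y \<in> S z"
              have "\<bar>?p n y - w y\<bar> \<le> r n * W (snd y)" using r(3)[of "fst y" n "snd y"] y by (auto simp: S_def)
              also have "\<dots> \<le> r n * 1" using r(2) weight_simps(3)[OF W] by (intro mult_left_mono)
              finally show "dist (?p n y) (w y) < e" using elim by (simp add: dist_real_def)
            qed
          qed
        qed
      qed auto
      ultimately show ?thesis by (intro exI[of _ "S z"]) (auto simp: S_def)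
    qed
    then show "continuous_on UNIV w"
      by (metis UNIV_I continuous_at_imp_continuous_on continuous_on_eq_continuous_at)
    fix \<tau>
    obtain r where r: "r \<longlonglongrightarrow> 0" "\<And>n. 0 \<le> r n" "\<And>n t x. \<bar>t\<bar> \<le> \<tau> \<Longrightarrow> \<bar>?p n (t, x) - w (t, x)\<bar> \<le> r n * W x"
      using main by meson
    obtain D where D: "D \<ge> 0" "\<And>t x. \<bar>t\<bar> \<le> \<tau> \<Longrightarrow> \<bar>?p 0 (t, x)\<bar> \<le> D * W x"
      using C0_bound[OF cp[of 0]] by metis
    have "\<bar>w (t, x)\<bar> \<le> (D + r 0) * W x" if t: "\<bar>t\<bar> \<le> \<tau>" for t x
      using D(2)[OF t, of x] r(3)[OF t, of 0 x] by (simp add: algebra_simps)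
    then show "\<exists>C\<ge>0. \<forall>t x. \<bar>t\<bar> \<le> \<tau> \<longrightarrow> \<bar>w (t, x)\<bar> \<le> C * W x"
      using D(1) r(2)[of 0] by (intro exI[of _ "D + r 0"]) auto
  qed
  moreover have "solves N w0 w"
    unfolding solves_def
  proof
    fix z :: "real \<times> (real^'n)"
    obtain t x where z: "z = (t, x)" by fastforce
    obtain C where C: "C \<ge> 1" "\<And>s x w w' D n. \<lbrakk>\<bar>s\<bar> \<le> \<bar>t\<bar>; C0 W w; C0 W w';
        \<And>s x. \<bar>s\<bar> \<le> \<bar>t\<bar> \<Longrightarrow> \<bar>w (s, x) - w' (s, x)\<bar> \<le> D * (C * \<bar>s\<bar>) ^ n / fact n * W x\<rbrakk>
      \<Longrightarrow> \<bar>Jop (rhs N w) (s, x) - Jop (rhs N w') (s, x)\<bar> \<le> D * (C * \<bar>s\<bar>) ^ Suc n / fact (Suc n) * W x"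
      by (rule Jop_rhs_diff_bound[OF W N]) blast
    obtain r where r: "r \<longlonglongrightarrow> 0" "\<And>n. 0 \<le> r n" "\<And>n s x. \<bar>s\<bar> \<le> \<bar>t\<bar> \<Longrightarrow> \<bar>?p n (s, x) - w (s, x)\<bar> \<le> r n * W x"
      using main by meson
    have "\<bar>Jop (rhs N (?p n)) z - Jop (rhs N w) z\<bar> \<le> r n * (C * \<bar>t\<bar> * W x)" for n
      using C(2)[OF order_refl cp w, of n "r n" 0 x] r(3) by (simp add: z mult_ac)
    then have "(\<lambda>n. Jop (rhs N (?p n)) z - Jop (rhs N w) z) \<longlonglongrightarrow> 0"
      by (intro Lim_null_comparison[OF _ tendsto_mult_left_zero[OF r(1), of "C * \<bar>t\<bar> * W x"]] always_eventually allI) simp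
    then have "(\<lambda>n. Jop (rhs N (?p n)) z) \<longlonglongrightarrow> Jop (rhs N w) z" by (simp add: LIM_zero_iff)
    from tendsto_add[OF tendsto_const this, of "w0 (snd z)"]
    have "(\<lambda>n. ?p (Suc n) z) \<longlonglongrightarrow> w0 (snd z) + Jop (rhs N w) z" by simp
    moreover have "(\<lambda>n. ?p n z) \<longlonglongrightarrow> w z"
    proof -
      have "(\<lambda>n. ?p n z - w z) \<longlonglongrightarrow> 0"
        by (rule Lim_null_comparison[OF _ tendsto_mult_left_zero[OF r(1), of "W x"]])
           (use r(3)[OF order_refl] in \<open>auto simp: z\<close>)
      then show ?thesis by (simp add: LIM_zero_iff)
    qed
    then have "(\<lambda>n. ?p (Suc n) z) \<longlonglongrightarrow> w z" by (rule LIMSEQ_Suc)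
    ultimately show "w z = w0 (snd z) + Jop (rhs N w) z" using LIMSEQ_unique by blast
  qed
  ultimately show ?thesis using that by blast
qed

section \<open>Regularity of solutions\<close>

lemma admissible_linear:
  fixes a b :: "'n::finite option \<Rightarrow> real \<times> (real^'n) \<Rightarrow> real"
  assumes "\<And>i. C0 (\<lambda>_. 1) (a i)" "\<And>i. C0 (\<lambda>_. 1) (b i)"
  shows "admissible (\<lambda>_. 1) (\<lambda>i z y. b i z + a i z * y)"
  unfolding admissible_def
proof (intro conjI allI)
  fix i
  have "continuous_on UNIV (\<lambda>p::(real \<times> (real^'n)) \<times> real. a i (fst p))" "continuous_on UNIV (\<lambda>p::(real \<times> (real^'n)) \<times> real. b i (fst p))"
    using assms[of i] by (auto simp: C0_def intro!: continuous_on_compose2[of UNIV "a i"] continuous_on_compose2[of UNIV "b i"] continuous_intros)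
  then show "continuous_on UNIV (\<lambda>p. b i (fst p) + a i (fst p) * snd p)" by (intro continuous_intros)
  show "C0 (\<lambda>_. 1) (\<lambda>z. b i z + a i z * 0)" using assms by simp
next
  fix \<tau>
  have "\<exists>C\<ge>0. \<forall>t x. \<bar>t\<bar> \<le> \<tau> \<longrightarrow> \<bar>a i (t, x)\<bar> \<le> C" for i
    using C0_bound[OF assms(1), of \<tau> i] by (metis mult.right_neutral)
  then obtain C where C: "\<And>i. C i \<ge> 0" "\<And>i t x. \<bar>t\<bar> \<le> \<tau> \<Longrightarrow> \<bar>a i (t, x)\<bar> \<le> C i" by metis
  have "\<bar>b i (t, x) + a i (t, x) * v - (b i (t, x) + a i (t, x) * v')\<bar> \<le> (\<Sum>i\<in>UNIV. C i) * \<bar>v - v'\<bar>" if "\<bar>t\<bar> \<le> \<tau>" for i t x v v'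
  proof -
    have "\<bar>b i (t, x) + a i (t, x) * v - (b i (t, x) + a i (t, x) * v')\<bar> = \<bar>a i (t, x)\<bar> * \<bar>v - v'\<bar>"
      by (simp add: abs_mult[symmetric] algebra_simps)
    also have "\<dots> \<le> (\<Sum>i\<in>UNIV. C i) * \<bar>v - v'\<bar>"
      using order_trans[OF C(2)[OF that] member_le_sum[of i UNIV C]] C(1) by (intro mult_right_mono) auto
    finally show ?thesis .
  qed
  then show "\<exists>L\<ge>0. \<forall>i t x v v'. \<bar>t\<bar> \<le> \<tau> \<longrightarrow>
      \<bar>b i (t, x) + a i (t, x) * v - (b i (t, x) + a i (t, x) * v')\<bar> \<le> L * \<bar>v - v'\<bar>"
    using C(1) by (intro exI[of _ "\<Sum>i\<in>UNIV. C i"]) (auto intro: sum_nonneg)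
qed

lemma has_pdiff_rhs:
  assumes N: "admissible (\<lambda>_. 1) N" and M: "admissible (\<lambda>_. 1) M" and g: "C0 (\<lambda>_. 1) g" "C0 (\<lambda>_. 1) g'" "has_pdiff e g g'"
    and has_pdiff: "\<And>i. has_pdiff e (\<lambda>z. N i z (g z)) (\<lambda>z. M i z (g' z))"
  shows "has_pdiff e (rhs N g) (rhs M g')"
proof -
  have "has_pdiff e (Aop (-1) (ker i) (\<lambda>z. N i z (g z))) (Aop (-1) (ker i) (\<lambda>z. M i z (g' z)))" for i
    by (rule has_pdiff_Aop[OF _ admissible_comp[OF N g(1)] admissible_comp[OF M g(2)] has_pdiff]) simp
  then have "has_pdiff e (\<lambda>z. \<Sum>i\<in>UNIV. Aop (-1) (ker i) (\<lambda>z. N i z (g z)) z) (\<lambda>z. \<Sum>i\<in>UNIV. Aop (-1) (ker i) (\<lambda>z. M i z (g' z)) z)"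
    by (rule has_pdiff_sum[OF finite])
  from has_pdiff_add[OF has_pdiff_cmult[OF g(3), of "-1"] this] show ?thesis
    unfolding rhs_def[abs_def] by simp
qed

text \<open>The derivatives of the Picard iterates converge to the solution \<open>v\<close> of the linearised equation,
  so the limit is differentiable without any smoothing of the equation being used.\<close>

lemma spatial_derivative:
  fixes N Nx Nv :: "'n::finite option \<Rightarrow> real \<times> (real^'n) \<Rightarrow> real \<Rightarrow> real"
  assumes N: "admissible (\<lambda>_. 1) N" "admissible (\<lambda>_. 1) Nx" "admissible (\<lambda>_. 1) Nv"
    and bd: "\<And>\<tau>. \<exists>L\<ge>0. \<forall>i t x y. \<bar>t\<bar> \<le> \<tau> \<longrightarrow> \<bar>Nv i (t, x) y\<bar> \<le> L"
    and chain: "\<And>i g g'. continuous_on UNIV g \<Longrightarrow> has_pdiff (ex j) g g' \<Longrightarrow> has_pdiff (ex j) (\<lambda>z. N i z (g z)) (\<lambda>z. Nx i z (g z) + Nv i z (g z) * g' z)"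
    and w0: "C0 (\<lambda>_. 1) (\<lambda>z::real \<times> (real^'n). w0 (snd z))" "C0 (\<lambda>_. 1) (\<lambda>z::real \<times> (real^'n). w0' (snd z))"
      "has_pdiff (ex j) (\<lambda>z. w0 (snd z)) (\<lambda>z. w0' (snd z))"
    and w: "C0 (\<lambda>_. 1) w" "solves N w0 w"
  obtains v where "C0 (\<lambda>_. 1) v" "solves (\<lambda>i z y. Nx i z (w z) + Nv i z (w z) * y) w0' v" "has_pdiff (ex j) w v"
proof -
  let ?p = "picard N w0"
  note cp = C0_picard[OF weight_one N(1) w0(1)]
  \<comment> \<open>The linearisation of the nonlinearity along \<open>g\<close>, affine in the
    derivative \<open>y\<close>.\<close>
  define M where "M g i z y = Nx i z (g z) + Nv i z (g z) * y" for g i z y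
  have M: "admissible (\<lambda>_. 1) (M g)" if "C0 (\<lambda>_. 1) g" for g
    unfolding M_def[abs_def] by (rule admissible_linear[OF admissible_comp[OF N(3) that] admissible_comp[OF N(2) that]])
  obtain v where v: "C0 (\<lambda>_. 1) v" "solves (M w) w0' v"
    using solution_exists[OF weight_one M[OF w(1)] w0(2)] by blast
  \<comment> \<open>The Picard recursion differentiated term by term: the coefficients are taken
    along the iterate \<open>?p n\<close>, not along the limit \<open>w\<close>. This makes
    \<open>vn n\<close> the exact derivative of \<open>?p n\<close>.\<close>
  define vn where "vn = rec_nat (\<lambda>z. w0' (snd z)) (\<lambda>n g z. w0' (snd z) + Jop (rhs (M (?p n)) g) z)"
  have vn_0: "vn 0 = (\<lambda>z. w0' (snd z))" and vn_Suc: "vn (Suc n) = (\<lambda>z. w0' (snd z) + Jop (rhs (M (?p n)) (vn n)) z)" for n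
    by (simp_all add: vn_def)
  have cvn: "C0 (\<lambda>_. 1) (vn n)" for n
  proof (induction n)
    case 0
    show ?case using w0(2) by (simp add: vn_0)
  next
    case (Suc n)
    show ?case unfolding vn_Suc by (rule C0_add[OF w0(2) C0_Jop[OF C0_rhs[OF weight_one M[OF cp] Suc]]])
  qed
  have pdn: "has_pdiff (ex j) (?p n) (vn n)" for n
  proof (induction n)
    case 0
    have "?p 0 = (\<lambda>z. w0 (snd z))" by auto
    then show ?case using w0(3) by (simp add: vn_0)
  next
    case (Suc n)
    have "has_pdiff (ex j) (rhs N (?p n)) (rhs (M (?p n)) (vn n))"
      by (rule has_pdiff_rhs[OF N(1) M[OF cp] cp cvn Suc]) (use chain[OF C0_continuous[OF cp] Suc] in \<open>simp add: M_def\<close>)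
    then have "has_pdiff (ex j) (Jop (rhs N (?p n))) (Jop (rhs (M (?p n)) (vn n)))"
      unfolding ex_def by (rule has_pdiff_Jop_space[OF C0_rhs[OF weight_one N(1) cp] C0_rhs[OF weight_one M[OF cp] cvn]])
    moreover have "?p (Suc n) = (\<lambda>z. w0 (snd z) + Jop (rhs N (?p n)) z)" by auto
    ultimately show ?case unfolding vn_Suc using has_pdiff_add[OF w0(3)] by simp
  qed
  have conv: "\<exists>r. r \<longlonglongrightarrow> 0 \<and> (\<forall>n t x. \<bar>t\<bar> \<le> \<tau> \<longrightarrow> \<bar>?p n (t, x) - w (t, x)\<bar> \<le> r n \<and> \<bar>vn n (t, x) - v (t, x)\<bar> \<le> r n)" for \<tau>
  proof -
    obtain C E where C: "C \<ge> 1" and E: "E \<ge> 0"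
      and pw: "\<And>n t x. \<bar>t\<bar> \<le> \<tau> \<Longrightarrow> \<bar>?p n (t, x) - w (t, x)\<bar> \<le> E * (C * \<bar>t\<bar>) ^ n / fact n * 1"
      using picard_convergence[OF weight_one N(1) w0(1) w] by metis
    obtain L1 where L1: "L1 \<ge> 0" "\<And>i t x v v'. \<bar>t\<bar> \<le> \<tau> \<Longrightarrow> \<bar>Nx i (t, x) v - Nx i (t, x) v'\<bar> \<le> L1 * \<bar>v - v'\<bar>"
      using admissible_Lipschitz[OF N(2)] by metis
    obtain L2 where L2: "L2 \<ge> 0" "\<And>i t x v v'. \<bar>t\<bar> \<le> \<tau> \<Longrightarrow> \<bar>Nv i (t, x) v - Nv i (t, x) v'\<bar> \<le> L2 * \<bar>v - v'\<bar>"
      using admissible_Lipschitz[OF N(3)] by metis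
    obtain L3 where L3: "L3 \<ge> 0" "\<And>i t x y. \<bar>t\<bar> \<le> \<tau> \<Longrightarrow> \<bar>Nv i (t, x) y\<bar> \<le> L3" using bd by metis
    obtain V where V: "V \<ge> 0" "\<And>t x. \<bar>t\<bar> \<le> \<tau> \<Longrightarrow> \<bar>v (t, x)\<bar> \<le> V * 1" using C0_bound[OF v(1)] by metis
    obtain A0 where A0: "A0 \<ge> 0" "\<And>t x. \<bar>t\<bar> \<le> \<tau> \<Longrightarrow> \<bar>vn 0 (t, x) - v (t, x)\<bar> \<le> A0 * 1"
      using C0_bound[OF C0_diff[OF cvn v(1)]] by metis
    \<comment> \<open>Again 1 for the term \<open>- w\<close>. Per kernel, \<open>L1\<close> and
      \<open>L2 * V\<close> measure the error of the coefficients, the second multiplied by the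
      limit derivative \<open>v\<close>, and \<open>L3\<close> the error of \<open>vn n\<close>
      itself.\<close>
    define K where "K = 1 + real CARD('n option) * ((L1 + L2 * V + L3) * KM TYPE('n))"
    define A where "A = max A0 E"
    \<comment> \<open>A common rate for both errors. The bound for \<open>?p n - w\<close> requires
      \<open>C \<le> B\<close>, the induction step for \<open>vn n - v\<close> requires
      \<open>K \<le> B\<close>.\<close>
    define B where "B = max (2 * K) C"
    have K: "K \<ge> 1" using L1(1) L2(1) L3(1) V(1) KM_nonneg[where 'n='n] by (simp add: K_def)
    have A: "A \<ge> 0" "A0 \<le> A" "E \<le> A" using A0 E by (auto simp: A_def)
    have B: "B \<ge> 0" "C \<le> B" "2 * K \<le> B" using C by (auto simp: B_def)
    have pw': "\<bar>?p n (t, x) - w (t, x)\<bar> \<le> A * (B * \<bar>t\<bar>) ^ n / fact n" if "\<bar>t\<bar> \<le> \<tau>" for n t x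
    proof -
      have "E * (C * \<bar>t\<bar>) ^ n / fact n \<le> A * (B * \<bar>t\<bar>) ^ n / fact n"
        using A B C E by (intro divide_right_mono mult_mono power_mono mult_right_mono) auto
      then show ?thesis using pw[OF that, of n x] by simp
    qed
    have vw: "\<bar>vn n (t, x) - v (t, x)\<bar> \<le> A * (B * \<bar>t\<bar>) ^ n / fact n" if "\<bar>t\<bar> \<le> \<tau>" for n t x
      using that
    proof (induction n arbitrary: t x)
      case 0
      then show ?case using A0(2)[OF 0, of x] A(2) by simp
    next
      case (Suc n)
      define D where "D s = A * (B * \<bar>s\<bar>) ^ n / fact n" for s
      have D0: "D s \<ge> 0" for s using A B by (simp add: D_def)
      have cont: "continuous_on UNIV (rhs (M (?p n)) (vn n))" "continuous_on UNIV (rhs (M w) v)"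
        using C0_rhs[OF weight_one M[OF cp] cvn] C0_rhs[OF weight_one M[OF w(1)] v(1)] by (auto simp: C0_def)
      have r: "\<bar>rhs (M (?p n)) (vn n) (s, x) - rhs (M w) v (s, x)\<bar> \<le> K * D s" if s: "\<bar>s\<bar> \<le> \<tau>" for s x
      proof -
        let ?L = "(L1 + L2 * V + L3) * D s"
        have le: "\<bar>M (?p n) i (s, x) (vn n (s, x)) - M w i (s, x) (v (s, x))\<bar> \<le> ?L" for i x
        proof -
          let ?z = "(s, x)"
          have p: "\<bar>?p n ?z - w ?z\<bar> \<le> D s" using pw'[OF s] by (simp add: D_def)
          \<comment> \<open>Each summand contains exactly one small difference. The split puts the
            unbounded index n in the factor \<open>Nv\<close> of the last term, whose bound
            \<open>L3\<close> is uniform, and the fixed bounded \<open>v\<close> in the middle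
            one.\<close>
          have "M (?p n) i ?z (vn n ?z) - M w i ?z (v ?z) = (Nx i ?z (?p n ?z) - Nx i ?z (w ?z)) +
            (Nv i ?z (?p n ?z) - Nv i ?z (w ?z)) * v ?z + Nv i ?z (?p n ?z) * (vn n ?z - v ?z)"
            by (simp add: M_def algebra_simps)
          also have "\<bar>\<dots>\<bar> \<le> L1 * D s + (L2 * D s) * V + L3 * D s"
          proof (intro order_trans[OF abs_triangle_ineq] add_mono)
            show "\<bar>Nx i ?z (?p n ?z) - Nx i ?z (w ?z)\<bar> \<le> L1 * D s"
              by (rule order_trans[OF L1(2)[OF s] mult_left_mono[OF p L1(1)]])
            show "\<bar>(Nv i ?z (?p n ?z) - Nv i ?z (w ?z)) * v ?z\<bar> \<le> (L2 * D s) * V"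
              unfolding abs_mult
              by (rule mult_mono[OF order_trans[OF L2(2)[OF s] mult_left_mono[OF p L2(1)]]]) (use V(2)[OF s, of x] L2(1) D0 in auto)
            show "\<bar>Nv i ?z (?p n ?z) * (vn n ?z - v ?z)\<bar> \<le> L3 * D s"
              unfolding abs_mult
              by (rule mult_mono[OF L3(2)[OF s]]) (use Suc.IH[OF s, of x] L3(1) in \<open>auto simp: D_def\<close>)
          qed
          finally show ?thesis by (simp add: algebra_simps)
        qed
        have Ai: "\<bar>Aop (-1) (ker i) (\<lambda>z. M (?p n) i z (vn n z)) (s, x) - Aop (-1) (ker i) (\<lambda>z. M w i z (v z)) (s, x)\<bar> \<le> ?L * KM TYPE('n)" for i
        proof -
          note c = admissible_comp[OF M[OF cp[of n]] cvn[of n], of i] admissible_comp[OF M[OF w(1)] v(1), of i]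
          have "\<bar>Aop (-1) (ker i) (\<lambda>z. M (?p n) i z (vn n z) - M w i z (v z)) (s, x)\<bar> \<le> ?L * KM TYPE('n) * 1"
            by (rule Aop_weighted(2)[OF weight_one _ C0_continuous[OF C0_diff[OF c]]]) (use le in auto)
          then show ?thesis using Aop_diff[OF _ c, of "-1" i "(s, x)"] by simp
        qed
        have "\<bar>rhs (M (?p n)) (vn n) (s, x) - rhs (M w) v (s, x)\<bar> =
          \<bar>(v (s, x) - vn n (s, x)) + (\<Sum>i\<in>UNIV. Aop (-1) (ker i) (\<lambda>z. M (?p n) i z (vn n z)) (s, x) - Aop (-1) (ker i) (\<lambda>z. M w i z (v z)) (s, x))\<bar>"
          by (simp add: rhs_def sum_subtractf)
        also have "\<dots> \<le> D s + (\<Sum>i\<in>(UNIV::'n option set). ?L * KM TYPE('n))"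
          by (intro order_trans[OF abs_triangle_ineq] add_mono order_trans[OF sum_abs] sum_mono Ai)
             (use Suc.IH[OF s, of x] in \<open>simp add: D_def abs_minus_commute\<close>)
        also have "\<dots> = K * D s" by (simp add: K_def algebra_simps)
        finally show ?thesis .
      qed
      have "\<bar>Jop (\<lambda>z. rhs (M (?p n)) (vn n) z - rhs (M w) v z) (t, x)\<bar> \<le> (K * A * B ^ n / fact n) * \<bar>t\<bar> ^ Suc n / Suc n"
      proof (rule Jop_bound)
        show "continuous_on UNIV (\<lambda>z. rhs (M (?p n)) (vn n) z - rhs (M w) v z)" using cont by (intro continuous_intros)
        fix s assume "\<bar>s\<bar> \<le> \<bar>t\<bar>"
        then show "\<bar>rhs (M (?p n)) (vn n) (s, x) - rhs (M w) v (s, x)\<bar> \<le> (K * A * B ^ n / fact n) * \<bar>s\<bar> ^ n"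
          using r[of s x] Suc.prems by (simp add: D_def power_mult_distrib mult_ac)
      qed
      also have "\<dots> \<le> (B * A * B ^ n / fact n) * \<bar>t\<bar> ^ Suc n / Suc n"
        using A B K by (intro divide_right_mono mult_right_mono) auto
      also have "\<dots> = A * (B * \<bar>t\<bar>) ^ Suc n / fact (Suc n)" by (simp add: power_mult_distrib mult_ac)
      finally have "\<bar>Jop (rhs (M (?p n)) (vn n)) (t, x) - Jop (rhs (M w) v) (t, x)\<bar> \<le> A * (B * \<bar>t\<bar>) ^ Suc n / fact (Suc n)"
        using Jop_diff[OF cont] by simp
      moreover have "vn (Suc n) (t, x) - v (t, x) = Jop (rhs (M (?p n)) (vn n)) (t, x) - Jop (rhs (M w) v) (t, x)"
        using v(2) by (simp add: vn_Suc solves_def)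
      ultimately show ?case by (simp only:)
    qed
    have "(\<lambda>n. (B * \<bar>\<tau>\<bar>) ^ n / fact n) \<longlonglongrightarrow> 0"
      using summable_LIMSEQ_zero[OF summable_exp[of "B * \<bar>\<tau>\<bar>"]] by (simp add: divide_inverse mult.commute)
    then have lim: "(\<lambda>n. A * ((B * \<bar>\<tau>\<bar>) ^ n / fact n)) \<longlonglongrightarrow> 0" using tendsto_mult_left[of _ 0] by fastforce
    have mono: "A * (B * \<bar>t\<bar>) ^ n / fact n \<le> A * ((B * \<bar>\<tau>\<bar>) ^ n / fact n)" if "\<bar>t\<bar> \<le> \<tau>" for n t
    proof -
      have "A * (B * \<bar>t\<bar>) ^ n / fact n \<le> A * (B * \<bar>\<tau>\<bar>) ^ n / fact n"
        using that A B by (intro divide_right_mono mult_left_mono power_mono) auto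
      then show ?thesis by simp
    qed
    show ?thesis
      by (intro exI[of _ "\<lambda>n. A * ((B * \<bar>\<tau>\<bar>) ^ n / fact n)"] conjI lim allI impI)
         (blast intro: order_trans[OF pw' mono] order_trans[OF vw mono])+
  qed
  have "has_pdiff (ex j) w v"
    unfolding has_pdiff_def
  proof
    fix z :: "real \<times> (real^'n)"
    obtain r where r: "r \<longlonglongrightarrow> 0" "\<And>n t x. \<bar>t\<bar> \<le> \<bar>fst z\<bar> \<Longrightarrow> \<bar>?p n (t, x) - w (t, x)\<bar> \<le> r n \<and> \<bar>vn n (t, x) - v (t, x)\<bar> \<le> r n"
      using conv[of "\<bar>fst z\<bar>"] by metis
    have rz: "\<bar>?p n (z + s *\<^sub>R ex j) - w (z + s *\<^sub>R ex j)\<bar> \<le> r n" "\<bar>vn n (z + s *\<^sub>R ex j) - v (z + s *\<^sub>R ex j)\<bar> \<le> r n" for n s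
      using r(2)[of "fst z" n "snd z + s *\<^sub>R axis j 1"] by (cases z; simp add: ex_def)+
    have lim: "(\<lambda>n. ?p n (z + s *\<^sub>R ex j)) \<longlonglongrightarrow> w (z + s *\<^sub>R ex j)" for s
    proof -
      have "(\<lambda>n. ?p n (z + s *\<^sub>R ex j) - w (z + s *\<^sub>R ex j)) \<longlonglongrightarrow> 0"
        by (rule Lim_null_comparison[OF _ r(1)]) (use rz in auto)
      then show ?thesis by (simp add: LIM_zero_iff)
    qed
    \<comment> \<open>Moving along \<open>ex j\<close> keeps the time fixed, so the rate
      \<open>r n\<close> is uniform in \<open>s\<close> and the limit may be differentiated.\<close>
    have "\<exists>g. \<forall>s\<in>UNIV. (\<lambda>n. ?p n (z + s *\<^sub>R ex j)) \<longlonglongrightarrow> g s \<and> (g has_derivative (\<lambda>h. v (z + s *\<^sub>R ex j) * h)) (at s within UNIV)"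
    proof (rule has_derivative_sequence)
      show "((\<lambda>s. ?p n (z + s *\<^sub>R ex j)) has_derivative (\<lambda>h. vn n (z + s *\<^sub>R ex j) * h)) (at s within UNIV)" for n s
        using has_pdiff_at[OF pdn[of n], of z s] by (simp add: has_field_derivative_def)
      fix e :: real assume "e > 0"
      then have "\<forall>\<^sub>F n in sequentially. r n < e" using order_tendstoD(2)[OF r(1)] by blast
      then show "\<forall>\<^sub>F n in sequentially. \<forall>s\<in>UNIV. \<forall>h. norm (vn n (z + s *\<^sub>R ex j) * h - v (z + s *\<^sub>R ex j) * h) \<le> e * norm h"
      proof eventually_elim
        case (elim n)
        have "\<bar>vn n (z + s *\<^sub>R ex j) - v (z + s *\<^sub>R ex j)\<bar> * \<bar>h\<bar> \<le> e * \<bar>h\<bar>" for s h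
          using rz(2)[of n s] elim by (intro mult_right_mono) auto
        then show ?case by (simp add: left_diff_distrib[symmetric] abs_mult)
      qed
    qed (use lim in auto)
    then obtain g where g: "\<And>s. (\<lambda>n. ?p n (z + s *\<^sub>R ex j)) \<longlonglongrightarrow> g s"
      "\<And>s. (g has_derivative (\<lambda>h. v (z + s *\<^sub>R ex j) * h)) (at s)" by auto
    have "g = (\<lambda>s. w (z + s *\<^sub>R ex j))" using LIMSEQ_unique[OF g(1) lim] by auto
    then show "((\<lambda>s. w (z + s *\<^sub>R ex j)) has_real_derivative v z) (at 0)"
      using g(2)[of 0] by (simp add: has_field_derivative_def)
  qed
  then show ?thesis using that[OF v(1)] v(2) by (simp add: M_def[abs_def])
qed

lemma solves_time_derivative:
  fixes w :: "real \<times> (real^'n::finite) \<Rightarrow> real"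
  assumes "solves N w0 w" "continuous_on UNIV (rhs N w)"
  shows "has_pdiff et w (rhs N w)"
proof -
  have "has_pdiff et (\<lambda>z::real \<times> (real^'n). w0 (snd z)) (\<lambda>_. 0)" by (simp add: has_pdiff_def et_def)
  from has_pdiff_add[OF this Jop_time_derivative[OF assms(2), folded et_def]]
  have "has_pdiff et (\<lambda>z. w0 (snd z) + Jop (rhs N w) z) (rhs N w)" by simp
  moreover have "w = (\<lambda>z. w0 (snd z) + Jop (rhs N w) z)" using assms(1) by (auto simp: solves_def)
  ultimately show ?thesis by simp
qed

lemma CB_rhs:
  assumes "\<And>i. CB (\<lambda>_. 1) k (\<lambda>z. N i z (w z))" "CB (\<lambda>_. 1) k w"
  shows "CB (\<lambda>_. 1) k (rhs N w)"
proof -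
  have "CB (\<lambda>_. 1) k (Aop (-1) (ker i) (\<lambda>z. N i z (w z)))" for i
    by (rule CB_Aop[OF weight_one _ assms(1)]) simp
  then have "CB (\<lambda>_. 1) k (\<lambda>z. \<Sum>i\<in>UNIV. Aop (-1) (ker i) (\<lambda>z. N i z (w z)) z)"
    by (intro CB_sum) simp_all
  from CB_add[OF CB_minus[OF assms(2)] this] show ?thesis unfolding rhs_def[abs_def] .
qed

text \<open>The derivative is rewritten as a function of \<open>x\<close> alone, since
  \<open>solves\<close> expects initial data in that form.\<close>

lemma initial_derivative:
  fixes w0 :: "real^'n \<Rightarrow> real"
  assumes "\<And>k. CB (\<lambda>_. 1) k (\<lambda>z. w0 (snd z))"
  obtains w0' where "has_pdiff (ex j) (\<lambda>z. w0 (snd z)) (\<lambda>z. w0' (snd z))" "\<And>k. CB (\<lambda>_. 1) k (\<lambda>z. w0' (snd z))"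
proof -
  let ?G = "pdiff (ex j) (\<lambda>z::real \<times> (real^'n). w0 (snd z))"
  have "?G = (\<lambda>z. ?G (0, snd z))" by (auto simp: pdiff_def fun_eq_iff)
  moreover have "has_pdiff (ex j) (\<lambda>z. w0 (snd z)) ?G" "CB (\<lambda>_. 1) k ?G" for k
    using CB_pdiff[OF assms ex_Basis] by auto
  ultimately show ?thesis using that[of "\<lambda>x. ?G (0, x)"] by simp
qed

text \<open>Induction on the order. The spatial derivative of \<open>w\<close> solves a linear
  equation with the same \<open>a\<close> and the new inhomogeneity \<open>b' + a' w\<close>; the
  induction hypothesis is applied first to \<open>w\<close>, to place that inhomogeneity in order
  \<open>k\<close>, and then to the derivative. For the time direction the equation itself is the
  derivative.\<close>

lemma linear_CB:
  fixes a b :: "'n::finite option \<Rightarrow> real \<times> (real^'n) \<Rightarrow> real"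
  assumes "\<And>i. CB (\<lambda>_. 1) k (a i)" "\<And>i. CB (\<lambda>_. 1) k (b i)" "\<And>k. CB (\<lambda>_. 1) k (\<lambda>z. w0 (snd z))"
    and "C0 (\<lambda>_. 1) w" "solves (\<lambda>i z y. b i z + a i z * y) w0 w"
  shows "CB (\<lambda>_. 1) k w"
  using assms
proof (induction k arbitrary: b w0 w)
  case (Suc k)
  let ?N = "\<lambda>i z y. b i z + a i z * y"
  have a: "CB (\<lambda>_. 1) k (a i)" and b: "CB (\<lambda>_. 1) k (b i)" for i using Suc.prems(1,2) CB_Suc_imp by blast+
  note a0 = CB_C0[OF a] and b0 = CB_C0[OF b]
  have w: "CB (\<lambda>_. 1) k w" by (rule Suc.IH[OF a b Suc.prems(3,4,5)])
  have N: "admissible (\<lambda>_. 1) ?N" by (rule admissible_linear[OF a0 b0])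
  have rhs: "CB (\<lambda>_. 1) k (rhs ?N w)" by (intro CB_rhs CB_add CB_mult a b w)
  have "\<exists>g'. has_pdiff e w g' \<and> CB (\<lambda>_. 1) k g'" if "e \<in> Basis" for e
    using that
  proof (cases rule: Basis_cases)
    case 1
    then show ?thesis
      using solves_time_derivative[OF Suc.prems(5) C0_continuous[OF CB_C0[OF rhs]]] rhs by blast
  next
    case (2 j)
    define a' where "a' i = pdiff (ex j) (a i)" for i
    define b' where "b' i = pdiff (ex j) (b i)" for i
    have a': "has_pdiff (ex j) (a i) (a' i)" "CB (\<lambda>_. 1) k (a' i)" and b': "has_pdiff (ex j) (b i) (b' i)" "CB (\<lambda>_. 1) k (b' i)" for i
      using CB_pdiff[OF Suc.prems(1) ex_Basis] CB_pdiff[OF Suc.prems(2) ex_Basis] by (auto simp: a'_def b'_def)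
    obtain w0' where w0': "has_pdiff (ex j) (\<lambda>z. w0 (snd z)) (\<lambda>z. w0' (snd z))" "\<And>k. CB (\<lambda>_. 1) k (\<lambda>z. w0' (snd z))"
      using initial_derivative[OF Suc.prems(3)] by metis
    obtain v where v: "C0 (\<lambda>_. 1) v" "solves (\<lambda>i z y. (b' i z + a' i z * w z) + a i z * y) w0' v" "has_pdiff (ex j) w v"
    proof (rule spatial_derivative[where N="?N" and Nx="\<lambda>i z y. b' i z + a' i z * y" and Nv="\<lambda>i z y. a i z"
          and j=j and ?w0.0=w0 and w0'=w0' and w=w])
      show "admissible (\<lambda>_. 1) (\<lambda>i z y. b' i z + a' i z * y)" by (rule admissible_linear[OF CB_C0[OF a'(2)] CB_C0[OF b'(2)]])
      have "admissible (\<lambda>_. 1) (\<lambda>(i::'n option) z y. a i z + (\<lambda>_ _. 0) i z * y)"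
        by (rule admissible_linear[OF _ a0]) (rule C0_const)
      then show av: "admissible (\<lambda>_. 1) (\<lambda>i z y. a i z)" by simp
      show "\<exists>L\<ge>0. \<forall>i t x (y::real). \<bar>t\<bar> \<le> \<tau> \<longrightarrow> \<bar>a i (t, x)\<bar> \<le> L" for \<tau>
      proof -
        have "\<exists>C\<ge>0. \<forall>t x. \<bar>t\<bar> \<le> \<tau> \<longrightarrow> \<bar>a i (t, x)\<bar> \<le> C" for i
          using C0_bound[OF a0, of \<tau> i] by (metis mult.right_neutral)
        then obtain C where C: "\<And>i. C i \<ge> 0" "\<And>i t x. \<bar>t\<bar> \<le> \<tau> \<Longrightarrow> \<bar>a i (t, x)\<bar> \<le> C i" by metis
        have "\<bar>t\<bar> \<le> \<tau> \<Longrightarrow> \<bar>a i (t, x)\<bar> \<le> (\<Sum>i\<in>UNIV. C i)" for i t x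
          using C(2)[of t i x] member_le_sum[of i UNIV C] C(1) by (auto intro: order_trans)
        then show ?thesis using C(1) by (intro exI[of _ "\<Sum>i\<in>UNIV. C i"]) (auto intro: sum_nonneg)
      qed
      show "has_pdiff (ex j) (\<lambda>z. b i z + a i z * g z) (\<lambda>z. b' i z + a' i z * g z + a i z * g' z)" if "has_pdiff (ex j) g g'" for i g g'
        using has_pdiff_add[OF b'(1)[of i] has_pdiff_mult[OF a'(1)[of i] that]] by (simp add: algebra_simps)
    qed (use N CB_C0[OF Suc.prems(3)] CB_C0[OF w0'(2)] w0'(1) Suc.prems(4,5) in auto)
    have "CB (\<lambda>_. 1) k v"
      by (rule Suc.IH[OF a _ w0'(2) v(1,2)]) (intro CB_add CB_mult a' b' w)
    then show ?thesis using v(3) 2 by blast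
  qed
  then show ?case using Suc.prems(4) by simp
qed simp

section \<open>Compactly supported smooth functions and their compositions\<close>

definition smooth_cs :: "('a::euclidean_space \<Rightarrow> real) \<Rightarrow> bool" where
  "smooth_cs G \<longleftrightarrow> Cinf_on UNIV G \<and> compact_support G"

text \<open>Off the closed support \<open>G\<close> vanishes on a neighbourhood, so the derivative
  there is that of the zero function.\<close>

lemma pdiff_support: "closure {z. pdiff e G z \<noteq> 0} \<subseteq> closure {z. G z \<noteq> 0}"
proof -
  let ?S = "closure {z. G z \<noteq> 0}"
  have "pdiff e G z = 0" if "z \<notin> ?S" for z
  proof -
    have "open ((\<lambda>s. z + s *\<^sub>R e) -` (- ?S))"
      by (intro open_vimage continuous_intros) auto
    moreover have "0 \<in> (\<lambda>s. z + s *\<^sub>R e) -` (- ?S)" using that by simp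
    ultimately have "\<forall>\<^sub>F s in nhds 0. s \<in> (\<lambda>s. z + s *\<^sub>R e) -` (- ?S)" by (rule eventually_nhds_in_open)
    then have "\<forall>\<^sub>F s in nhds 0. G (z + s *\<^sub>R e) = 0"
    proof eventually_elim
      case (elim s)
      then have "z + s *\<^sub>R e \<notin> {z. G z \<noteq> 0}" using closure_subset[of "{z. G z \<noteq> 0}"] by auto
      then show ?case by simp
    qed
    then have "pdiff e G z = deriv (\<lambda>s. 0) 0"
      unfolding pdiff_def by (rule deriv_cong_ev) simp
    then show ?thesis by simp
  qed
  then have "{z. pdiff e G z \<noteq> 0} \<subseteq> ?S" by blast
  then show ?thesis by (simp add: closure_minimal)
qed

lemma smooth_cs_pdiff:
  assumes "smooth_cs G" "e \<in> Basis"
  shows "smooth_cs (pdiff e G)" "has_pdiff e G (pdiff e G)"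
proof -
  show "has_pdiff e G (pdiff e G)" using assms Cinf_on_pdiff unfolding smooth_cs_def by blast
  have "compact (closure {z. G z \<noteq> 0})" using assms by (simp add: smooth_cs_def compact_support_def)
  then have "compact_support (pdiff e G)"
    unfolding compact_support_def by (metis pdiff_support closed_closure compact_Int_closed inf.absorb2)
  then show "smooth_cs (pdiff e G)" using assms Cinf_on_pdiff unfolding smooth_cs_def by blast
qed

lemma smooth_cs_continuous: "smooth_cs G \<Longrightarrow> continuous_on UNIV G"
  by (simp add: smooth_cs_def Cinf_on_continuous)

text \<open>The quotient \<open>G / W\<close> is continuous on the compact support, hence
  bounded.\<close>

lemma compact_support_bound:
  fixes G :: "'a::euclidean_space \<Rightarrow> real"
  assumes G: "continuous_on UNIV G" "compact_support G" and W: "continuous_on UNIV W" "\<And>z. 0 < W z"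
  obtains C where "C \<ge> 0" "\<And>z. \<bar>G z\<bar> \<le> C * W z"
proof -
  let ?S = "closure {z. G z \<noteq> 0}"
  have "continuous_on ?S (\<lambda>z. G z / W z)"
    by (intro continuous_on_divide continuous_on_subset[OF G(1)] continuous_on_subset[OF W(1)]) (use W(2) in \<open>auto simp: less_imp_neq[symmetric]\<close>)
  then have "bounded ((\<lambda>z. G z / W z) ` ?S)"
    using G(2) by (intro compact_imp_bounded compact_continuous_image) (auto simp: compact_support_def)
  then obtain C where C: "\<And>z. z \<in> ?S \<Longrightarrow> \<bar>G z / W z\<bar> \<le> C" unfolding bounded_iff by auto
  have "\<bar>G z\<bar> \<le> max C 0 * W z" for z
  proof (cases "G z = 0")
    case False
    then have "z \<in> ?S" using closure_subset by fastforce
    then have "\<bar>G z\<bar> / W z \<le> C" using C[of z] W(2)[of z] by (simp add: abs_divide)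
    then have "\<bar>G z\<bar> \<le> C * W z" using W(2)[of z] by (simp add: pos_divide_le_eq)
    also have "\<dots> \<le> max C 0 * W z" using W(2)[of z] by (intro mult_right_mono) auto
    finally show ?thesis .
  qed (use W(2)[of z] in \<open>auto intro!: mult_nonneg_nonneg\<close>)
  then show ?thesis using that[of "max C 0"] by simp
qed

lemma smooth_cs_weight_bound:
  assumes "smooth_cs G" "continuous_on UNIV W" "\<And>z. 0 < W z"
  shows "\<exists>C\<ge>0. \<forall>z. \<bar>G z\<bar> \<le> C * W z"
proof -
  have "compact_support G" using assms(1) by (simp add: smooth_cs_def)
  from compact_support_bound[OF smooth_cs_continuous[OF assms(1)] this assms(2,3)] show ?thesis by metis
qed

lemma smooth_cs_bounded:
  assumes "smooth_cs G" obtains C where "C \<ge> 0" "\<And>z. \<bar>G z\<bar> \<le> C"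
proof -
  obtain C where "C \<ge> 0" "\<And>z. \<bar>G z\<bar> \<le> C * 1"
    by (rule compact_support_bound[of G "\<lambda>_. 1"]) (use assms smooth_cs_continuous in \<open>auto simp: smooth_cs_def\<close>)
  then show ?thesis using that by simp
qed

lemma smooth_cs_CB:
  fixes W :: "real^'n \<Rightarrow> real"
  assumes "smooth_cs G" "continuous_on UNIV W" "\<And>x. 0 < W x"
  shows "CB W k G"
proof -
  have c: "C0 W G" if "smooth_cs G" for G
    unfolding C0_def
  proof (intro conjI allI)
    show "continuous_on UNIV G" using smooth_cs_continuous[OF that] .
    have "continuous_on UNIV (\<lambda>z::real \<times> (real^'n). W (snd z))"
      by (intro continuous_on_compose2[OF assms(2)] continuous_intros) auto
    from smooth_cs_weight_bound[OF that this assms(3)] obtain C where "C \<ge> 0" "\<And>z. \<bar>G z\<bar> \<le> C * W (snd z)" by auto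
    then show "\<exists>C\<ge>0. \<forall>t x. \<bar>t\<bar> \<le> \<tau> \<longrightarrow> \<bar>G (t, x)\<bar> \<le> C * W x" for \<tau> by (metis snd_conv)
  qed
  show ?thesis using assms(1)
  proof (induction k arbitrary: G)
    case (Suc k)
    have "\<exists>g'. has_pdiff e G g' \<and> CB W k g'" if "e \<in> Basis" for e
      using smooth_cs_pdiff[OF Suc.prems that] Suc.IH by blast
    then show ?case using c[OF Suc.prems] by simp
  qed (use c in simp)
qed

lemma smooth_cs_snd_CB:
  fixes G :: "real^'n \<Rightarrow> real"
  assumes "smooth_cs G" "continuous_on UNIV W" "\<And>x. 0 < W x"
  shows "CB W k (\<lambda>z. G (snd z))"
  using assms(1)
proof (induction k arbitrary: G)
  have c: "C0 W (\<lambda>z. G (snd z))" if G: "smooth_cs G" for G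
  proof -
    obtain C where "C \<ge> 0" "\<And>x. \<bar>G x\<bar> \<le> C * W x"
      using smooth_cs_weight_bound[OF G assms(2,3)] by auto
    then show ?thesis using C0_initial[OF smooth_cs_continuous[OF G]] by blast
  qed
  {
    case 0
    then show ?case using c by simp
  next
    case (Suc k)
    have "\<exists>g'. has_pdiff e (\<lambda>z. G (snd z)) g' \<and> CB W k g'" if "e \<in> Basis" for e :: "real \<times> (real^'n)"
      using that
    proof (cases rule: Basis_cases)
      case 1
      have "has_pdiff et (\<lambda>z::real \<times> (real^'n). G (snd z)) (\<lambda>_. 0)" by (simp add: has_pdiff_def et_def)
      then show ?thesis using CB_zero[of W k] assms(3) 1 less_imp_le by metis
    next
      case (2 j)
      have e: "axis j 1 \<in> (Basis :: (real^'n) set)" by (simp add: axis_in_Basis_iff)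
      have "has_pdiff (ex j) (\<lambda>z. G (snd z)) (\<lambda>z. pdiff (axis j 1) G (snd z))"
        using smooth_cs_pdiff(2)[OF Suc.prems e] by (simp add: has_pdiff_def ex_def)
      then show ?thesis using Suc.IH[OF smooth_cs_pdiff(1)[OF Suc.prems e]] 2 by blast
    qed
    then show ?case using c[OF Suc.prems] by simp
  }
qed

lemma Basis_vec_real: "(axis j 1, 0) \<in> (Basis :: ((real^'n) \<times> real) set)" "(0, 1) \<in> (Basis :: ((real^'n) \<times> real) set)"
  by (auto simp: Basis_prod_def axis_in_Basis_iff)

lemma chain_space:
  fixes G :: "(real^'n) \<times> real \<Rightarrow> real"
  assumes "smooth_cs G" and u: "continuous_on UNIV u" "has_pdiff (ex j) u u'"
  shows "has_pdiff (ex j) (\<lambda>z. G (snd z, u z)) (\<lambda>z. pdiff (axis j 1, 0) G (snd z, u z) + pdiff (0, 1) G (snd z, u z) * u' z)"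
  unfolding has_pdiff_def
proof
  fix z :: "real \<times> (real^'n)"
  note G = smooth_cs_pdiff[OF assms(1) Basis_vec_real(1), of j] smooth_cs_pdiff[OF assms(1) Basis_vec_real(2)]
  have ul: "continuous_on UNIV (\<lambda>a. u (z + a *\<^sub>R ex j))"
    by (intro continuous_on_compose2[OF u(1)] continuous_intros) auto
  have "((\<lambda>r. G (snd z + r *\<^sub>R axis j 1, u (z + r *\<^sub>R ex j))) has_real_derivative
      pdiff (0, 1) G (snd z, u z) * u' z + pdiff (axis j 1, 0) G (snd z + 0 *\<^sub>R axis j 1, u (z + 0 *\<^sub>R ex j))) (at 0)"
  \<comment> \<open>Here \<open>a\<close> moves the point at which \<open>u\<close> is evaluated and
    \<open>b\<close> the explicit space argument. Only the derivative in \<open>b\<close> must be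
    jointly continuous, so \<open>u'\<close> may be any pointwise derivative.\<close>
  proof (rule DERIV_partials[where f="\<lambda>a b. G (snd z + b *\<^sub>R axis j 1, u (z + a *\<^sub>R ex j))"
        and fb="\<lambda>a b. pdiff (axis j 1, 0) G (snd z + b *\<^sub>R axis j 1, u (z + a *\<^sub>R ex j))"])
    have "((\<lambda>s. G ((snd z, 0) + s *\<^sub>R (0, 1))) has_real_derivative pdiff (0, 1) G ((snd z, 0) + u z *\<^sub>R (0, 1))) (at (u (z + 0 *\<^sub>R ex j)))"
      using has_pdiff_at[OF G(4), of "(snd z, 0)" "u z"] by simp
    from DERIV_chain2[OF this u(2)[unfolded has_pdiff_def, rule_format, of z]]
    show "((\<lambda>a. G (snd z + 0 *\<^sub>R axis j 1, u (z + a *\<^sub>R ex j))) has_real_derivative pdiff (0, 1) G (snd z, u z) * u' z) (at 0)"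
      by simp
    show "((\<lambda>b. G (snd z + b *\<^sub>R axis j 1, u (z + a *\<^sub>R ex j))) has_real_derivative
        pdiff (axis j 1, 0) G (snd z + b *\<^sub>R axis j 1, u (z + a *\<^sub>R ex j))) (at b)" for a b
      using has_pdiff_at[OF G(2), of "(snd z, u (z + a *\<^sub>R ex j))" b] by simp
    have "continuous_on UNIV (\<lambda>p::real \<times> real. (snd z + snd p *\<^sub>R axis j 1, u (z + fst p *\<^sub>R ex j)))"
      by (intro continuous_intros continuous_on_compose2[OF ul]) auto
    from continuous_on_compose2[OF smooth_cs_continuous[OF G(1)] this]
    show "continuous_on UNIV (\<lambda>p::real \<times> real. pdiff (axis j 1, 0) G (snd z + snd p *\<^sub>R axis j 1, u (z + fst p *\<^sub>R ex j)))"
      by simp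
  qed
  then show "((\<lambda>s. G (snd (z + s *\<^sub>R ex j), u (z + s *\<^sub>R ex j))) has_real_derivative
      pdiff (axis j 1, 0) G (snd z, u z) + pdiff (0, 1) G (snd z, u z) * u' z) (at 0)"
    by (simp add: ex_def add.commute zero_prod_def[symmetric])
qed

lemma chain_time:
  fixes G :: "(real^'n) \<times> real \<Rightarrow> real"
  assumes "smooth_cs G" and u: "has_pdiff et u u'"
  shows "has_pdiff et (\<lambda>z. G (snd z, u z)) (\<lambda>z. pdiff (0, 1) G (snd z, u z) * u' z)"
  unfolding has_pdiff_def
proof
  fix z :: "real \<times> (real^'n)"
  have "((\<lambda>s. G ((snd z, 0) + s *\<^sub>R (0, 1))) has_real_derivative pdiff (0, 1) G ((snd z, 0) + u z *\<^sub>R (0, 1))) (at (u (z + 0 *\<^sub>R et)))"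
    using has_pdiff_at[OF smooth_cs_pdiff(2)[OF assms(1) Basis_vec_real(2)], of "(snd z, 0)" "u z"] by simp
  from DERIV_chain2[OF this u[unfolded has_pdiff_def, rule_format, of z]]
  show "((\<lambda>s. G (snd (z + s *\<^sub>R et), u (z + s *\<^sub>R et))) has_real_derivative pdiff (0, 1) G (snd z, u z) * u' z) (at 0)"
    by (simp add: et_def)
qed

text \<open>The partial derivatives of \<open>G\<close> are again compactly supported and smooth, so
  the chain rule reproduces compositions of the same kind with lower order. Hence the induction is
  general in \<open>G\<close>.\<close>

lemma CB_comp:
  fixes G :: "(real^'n) \<times> real \<Rightarrow> real"
  assumes "smooth_cs G" "CB (\<lambda>_. 1) k u"
  shows "CB (\<lambda>_. 1) k (\<lambda>z. G (snd z, u z))"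
  using assms
proof (induction k arbitrary: G)
  have c: "C0 (\<lambda>_. 1) (\<lambda>z. G (snd z, u z))" if "smooth_cs G" "C0 (\<lambda>_. 1) u" for G
  proof -
    obtain C where "C \<ge> 0" "\<And>z. \<bar>G z\<bar> \<le> C" using smooth_cs_bounded[OF \<open>smooth_cs G\<close>] by metis
    moreover have "continuous_on UNIV (\<lambda>z. G (snd z, u z))"
      using that by (intro continuous_on_compose2[OF smooth_cs_continuous[OF that(1)]] continuous_intros) (auto simp: C0_def)
    ultimately show ?thesis unfolding C0_def by auto
  qed
  {
    case 0
    then show ?case using c by simp
  next
    case (Suc k)
    have u: "CB (\<lambda>_. 1) k u" using Suc.prems(2) by (rule CB_Suc_imp)
    note G = smooth_cs_pdiff(1)[OF Suc.prems(1) Basis_vec_real(1)] smooth_cs_pdiff(1)[OF Suc.prems(1) Basis_vec_real(2)]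
    have "\<exists>g'. has_pdiff e (\<lambda>z. G (snd z, u z)) g' \<and> CB (\<lambda>_. 1) k g'" if e: "e \<in> Basis" for e
      using that
    proof (cases rule: Basis_cases)
      case 1
      obtain u' where u': "has_pdiff et u u'" "CB (\<lambda>_. 1) k u'" using Suc.prems(2) et_Basis by fastforce
      show ?thesis unfolding 1
        by (intro exI conjI, rule chain_time[OF Suc.prems(1) u'(1)]) (intro CB_mult Suc.IH G u u')
    next
      case (2 j)
      obtain u' where u': "has_pdiff (ex j) u u'" "CB (\<lambda>_. 1) k u'" using Suc.prems(2) ex_Basis by fastforce
      show ?thesis unfolding 2
        by (intro exI conjI, rule chain_space[OF Suc.prems(1) C0_continuous[OF CB_C0[OF u]] u'(1)])
           (intro CB_add CB_mult Suc.IH G u u')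
    qed
    then show ?case using c[OF Suc.prems(1) CB_C0[OF u]] by simp
  }
qed

definition flux :: "('n \<Rightarrow> (real^'n) \<times> real \<Rightarrow> real) \<Rightarrow> 'n option \<Rightarrow> real \<times> (real^'n) \<Rightarrow> real \<Rightarrow> real" where
  "flux F i z y = (case i of None \<Rightarrow> y | Some l \<Rightarrow> F l (snd z, y))"

lemma smooth_cs_Lipschitz:
  fixes G :: "(real^'n) \<times> real \<Rightarrow> real"
  assumes "smooth_cs G"
  obtains C where "C \<ge> 0" "\<And>x y y'. \<bar>G (x, y) - G (x, y')\<bar> \<le> C * \<bar>y - y'\<bar>"
proof -
  note G = smooth_cs_pdiff[OF assms Basis_vec_real(2)]
  obtain C where C: "C \<ge> 0" "\<And>z. \<bar>pdiff (0, 1) G z\<bar> \<le> C" using smooth_cs_bounded[OF G(1)] by metis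
  have "\<bar>G (x, y) - G (x, y')\<bar> \<le> C * \<bar>y - y'\<bar>" for x y y'
    using field_differentiable_bound[of UNIV "\<lambda>s. G (x, s)" "\<lambda>s. pdiff (0, 1) G (x, s)" C y y']
      has_pdiff_at[OF G(2), of "(x, 0)"] C(2) by simp
  then show ?thesis using that C(1) by blast
qed

text \<open>Compact support gives the decay of \<open>G l (x, 0)\<close>, and the bounded derivative
  in the last variable gives the Lipschitz constant. The function \<open>h\<close> is the identity
  for the flux and the constants 0 and 1 for its derivatives.\<close>

lemma admissible_opt:
  fixes G :: "'n::finite \<Rightarrow> (real^'n) \<times> real \<Rightarrow> real"
  assumes G: "\<And>l. smooth_cs (G l)" and W: "weight_fn W" and h: "continuous_on UNIV h" "\<And>y y'. \<bar>h y - h y'\<bar> \<le> \<bar>y - y'\<bar>" "C0 W (\<lambda>z. h 0)"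
  shows "admissible W (\<lambda>i z y. case i of None \<Rightarrow> h y | Some l \<Rightarrow> G l (snd z, y))"
  unfolding admissible_def
proof (intro conjI allI)
  fix i :: "'n option"
  show "continuous_on UNIV (\<lambda>p::(real \<times> (real^'n)) \<times> real. case i of None \<Rightarrow> h (snd p) | Some l \<Rightarrow> G l (snd (fst p), snd p))"
  proof (cases i)
    case None
    have "continuous_on UNIV (\<lambda>p::(real \<times> (real^'n)) \<times> real. h (snd p))"
      by (rule continuous_on_compose2[OF h(1)]) (auto intro: continuous_intros)
    then show ?thesis using None by simp
  next
    case (Some l)
    have "continuous_on UNIV (\<lambda>p::(real \<times> (real^'n)) \<times> real. G l (snd (fst p), snd p))"
      by (rule continuous_on_compose2[OF smooth_cs_continuous[OF G]], intro continuous_intros) simp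
    then show ?thesis using Some by simp
  qed
  show "C0 W (\<lambda>z. case i of None \<Rightarrow> h 0 | Some l \<Rightarrow> G l (snd z, 0))"
  proof (cases i)
    case (Some l)
    have cW: "continuous_on UNIV W" using W by (simp add: weight_fn_def)
    have "continuous_on UNIV (\<lambda>z::(real^'n) \<times> real. W (fst z))"
      by (rule continuous_on_compose2[OF cW], intro continuous_intros) simp
    from smooth_cs_weight_bound[OF G this weight_simps(1)[OF W], of l] obtain C where C: "C \<ge> 0" "\<And>z. \<bar>G l z\<bar> \<le> C * W (fst z)" by auto
    have "continuous_on UNIV (\<lambda>x. G l (x, 0))"
      by (intro continuous_on_compose2[OF smooth_cs_continuous[OF G]] continuous_intros) auto
    then have "C0 W (\<lambda>z. G l (snd z, 0))"
      by (rule C0_initial[where C=C]) (use C(2)[of "(_, 0)"] C(1) in auto)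
    then show ?thesis using Some by simp
  qed (use h in simp)
next
  fix \<tau> :: real
  have "\<exists>C\<ge>0. \<forall>x y y'. \<bar>G l (x, y) - G l (x, y')\<bar> \<le> C * \<bar>y - y'\<bar>" for l
    using smooth_cs_Lipschitz[OF G] by metis
  then obtain C where C: "\<And>l. C l \<ge> 0" "\<And>l x y y'. \<bar>G l (x, y) - G l (x, y')\<bar> \<le> C l * \<bar>y - y'\<bar>" by metis
  let ?L = "1 + (\<Sum>l\<in>UNIV. C l)"
  have L: "?L \<ge> 1" "C l \<le> ?L" for l
    using C(1) by (auto intro!: sum_nonneg order_trans[OF member_le_sum[of l UNIV C]])
  have "\<bar>(case i of None \<Rightarrow> h v | Some l \<Rightarrow> G l (x, v)) - (case i of None \<Rightarrow> h v' | Some l \<Rightarrow> G l (x, v'))\<bar> \<le> ?L * \<bar>v - v'\<bar>" for i x v v'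
  proof (cases i)
    case None
    have "\<bar>h v - h v'\<bar> \<le> 1 * \<bar>v - v'\<bar>" using h(2) by simp
    also have "\<dots> \<le> ?L * \<bar>v - v'\<bar>" using L by (intro mult_right_mono) auto
    finally show ?thesis using None by simp
  next
    case (Some l)
    have "\<bar>G l (x, v) - G l (x, v')\<bar> \<le> ?L * \<bar>v - v'\<bar>"
      by (rule order_trans[OF C(2) mult_right_mono[OF L(2)]]) simp
    then show ?thesis using Some by simp
  qed
  then show "\<exists>L\<ge>0. \<forall>i t x v v'. \<bar>t\<bar> \<le> \<tau> \<longrightarrow> \<bar>(case i of None \<Rightarrow> h v | Some l \<Rightarrow> G l (snd (t, x), v)) -
      (case i of None \<Rightarrow> h v' | Some l \<Rightarrow> G l (snd (t, x), v'))\<bar> \<le> L * \<bar>v - v'\<bar>"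
    using L(1) by (intro exI[of _ ?L]) auto
qed

lemma admissible_flux: "(\<And>l. smooth_cs (F l)) \<Longrightarrow> weight_fn W \<Longrightarrow> admissible W (flux F)"
  unfolding flux_def[abs_def] by (rule admissible_opt) (auto intro!: C0_zero dest: weight_simps(2))

text \<open>A bootstrap. If \<open>u\<close> has order \<open>k\<close>, the coefficients of the
  linearised equation have order \<open>k\<close>. By \<open>linear_CB\<close> so has its solution,
  which is the spatial derivative of \<open>u\<close>; the time derivative is the right-hand side.
  Hence \<open>u\<close> has order \<open>k + 1\<close>.\<close>

theorem solution_smooth:
  fixes F :: "'n::finite \<Rightarrow> (real^'n) \<times> real \<Rightarrow> real"
  assumes F: "\<And>l. smooth_cs (F l)" and u0: "\<And>k. CB (\<lambda>_. 1) k (\<lambda>z. u0 (snd z))"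
    and u: "C0 (\<lambda>_. 1) u" "solves (flux F) u0 u"
  shows "CB (\<lambda>_. 1) k u"
proof (induction k)
  case (Suc k)
  have fl: "CB (\<lambda>_. 1) k (\<lambda>z. flux F i z (u z))" for i
    by (cases i) (auto simp: flux_def Suc CB_comp[OF F Suc])
  note rhs = CB_rhs[of k "flux F" u, OF fl Suc]
  have "\<exists>g'. has_pdiff e u g' \<and> CB (\<lambda>_. 1) k g'" if "e \<in> Basis" for e
    using that
  proof (cases rule: Basis_cases)
    case 1
    then show ?thesis using solves_time_derivative[OF u(2) C0_continuous[OF CB_C0[OF rhs]]] rhs by blast
  next
    case (2 j)
    let ?Gx = "\<lambda>l. pdiff (axis j 1, 0) (F l)" and ?Gv = "\<lambda>l. pdiff (0, 1) (F l)"
    have Gx: "smooth_cs (?Gx l)" and Gv: "smooth_cs (?Gv l)" for l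
      using smooth_cs_pdiff(1)[OF F Basis_vec_real(1)] smooth_cs_pdiff(1)[OF F Basis_vec_real(2)] by auto
    define Nx where "Nx i z y = (case i of None \<Rightarrow> (\<lambda>_. 0) y | Some l \<Rightarrow> ?Gx l (snd z, y))" for i and z :: "real \<times> (real^'n)" and y :: real
    define Nv where "Nv i z y = (case i of None \<Rightarrow> (\<lambda>_. 1) y | Some l \<Rightarrow> ?Gv l (snd z, y))" for i and z :: "real \<times> (real^'n)" and y :: real
    obtain w0' where w0': "has_pdiff (ex j) (\<lambda>z. u0 (snd z)) (\<lambda>z. w0' (snd z))" "\<And>k. CB (\<lambda>_. 1) k (\<lambda>z. w0' (snd z))"
      using initial_derivative[OF u0] by metis
    obtain v where v: "C0 (\<lambda>_. 1) v" "solves (\<lambda>i z y. Nx i z (u z) + Nv i z (u z) * y) w0' v" "has_pdiff (ex j) u v"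
    proof (rule spatial_derivative[where N="flux F" and Nx=Nx and Nv=Nv and j=j and ?w0.0=u0 and w0'=w0' and w=u])
      show "admissible (\<lambda>_. 1) (flux F)" by (rule admissible_flux[OF F weight_one])
      show "admissible (\<lambda>_. 1) Nx" unfolding Nx_def[abs_def] by (rule admissible_opt[OF Gx weight_one]) (auto intro: C0_const)
      show "admissible (\<lambda>_. 1) Nv" unfolding Nv_def[abs_def] by (rule admissible_opt[OF Gv weight_one]) (auto intro: C0_const)
      have "\<exists>C\<ge>0. \<forall>z. \<bar>?Gv l z\<bar> \<le> C" for l using smooth_cs_bounded[OF Gv] by metis
      then obtain C where C: "\<And>l. C l \<ge> 0" "\<And>l z. \<bar>?Gv l z\<bar> \<le> C l" by metis
      have "\<bar>Nv i z y\<bar> \<le> 1 + (\<Sum>l\<in>UNIV. C l)" for i z y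
        unfolding Nv_def using C(1) by (cases i) (auto intro!: sum_nonneg order_trans[OF C(2)] order_trans[OF member_le_sum[of _ UNIV C]])
      then show "\<exists>L\<ge>0. \<forall>i t x y. \<bar>t\<bar> \<le> \<tau> \<longrightarrow> \<bar>Nv i (t, x) y\<bar> \<le> L" for \<tau>
        using sum_nonneg[of UNIV C] C(1) by (intro exI[of _ "1 + (\<Sum>l\<in>UNIV. C l)"]) simp
      show "has_pdiff (ex j) (\<lambda>z. flux F i z (g z)) (\<lambda>z. Nx i z (g z) + Nv i z (g z) * g' z)"
        if "continuous_on UNIV g" "has_pdiff (ex j) g g'" for i g g'
        using that chain_space[OF F that] by (cases i) (auto simp: flux_def Nx_def Nv_def)
    qed (use u CB_C0[OF u0] CB_C0[OF w0'(2)] w0'(1) in auto)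
    have "CB (\<lambda>_. 1) k (\<lambda>z. Nx i z (u z))" "CB (\<lambda>_. 1) k (\<lambda>z. Nv i z (u z))" for i
      unfolding Nx_def Nv_def by (cases i; simp add: CB_const CB_comp[OF Gx Suc] CB_comp[OF Gv Suc])+
    then have "CB (\<lambda>_. 1) k v"
      by (intro linear_CB[OF _ _ w0'(2) v(1,2)])
    then show ?thesis using v(3) 2 by blast
  qed
  then show ?case using u(1) by simp
qed (use u in simp)

section \<open>Classical solutions are weak solutions\<close>

lemma integrable_pair_mult:
  fixes a :: "'a::euclidean_space \<Rightarrow> real" and b :: "'b::euclidean_space \<Rightarrow> real"
  assumes a: "integrable lborel a" and b: "integrable lborel b"
  shows "integrable (lborel \<Otimes>\<^sub>M lborel) (\<lambda>p. a (fst p) * b (snd p))"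
proof (rule lborel_pair.Fubini_integrable)
  have [measurable]: "a \<in> borel_measurable lborel" "b \<in> borel_measurable lborel" using a b by auto
  show "(\<lambda>p. a (fst p) * b (snd p)) \<in> borel_measurable (lborel \<Otimes>\<^sub>M lborel)" by measurable
  show "integrable lborel (\<lambda>x. \<integral>y. norm (a (fst (x, y)) * b (snd (x, y))) \<partial>lborel)"
    using a by (simp add: abs_mult)
  show "AE x in lborel. integrable lborel (\<lambda>y. a (fst (x, y)) * b (snd (x, y)))"
    using b by simp
qed

lemma Omega_measurable [measurable]: "(Omega T :: (real \<times> (real^'n)) set) \<in> sets borel"
  unfolding Omega_def by (intro borel_open open_Times) auto

lemma C0_integrable_Omega:
  fixes g :: "real \<times> (real^'n::finite) \<Rightarrow> real"
  assumes "C0 rho g"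
  shows "integrable lborel (\<lambda>z. indicator (Omega T) z * g z)"
proof -
  obtain C where C: "C \<ge> 0" "\<And>t x. \<bar>t\<bar> \<le> \<bar>T\<bar> \<Longrightarrow> \<bar>g (t, x)\<bar> \<le> C * rho x" using C0_bound[OF assms] by metis
  have [measurable]: "g \<in> borel_measurable borel"
    using C0_continuous[OF assms] by (rule borel_measurable_continuous_onI)
  show ?thesis
  proof (rule Bochner_Integration.integrable_bound[OF integrable_mult_right[OF integrable_q_rho, of "C * (1 + T\<^sup>2)"]])
    show "(\<lambda>z. indicator (Omega T) z * g z) \<in> borel_measurable lborel" by measurable
    show "AE z in lborel. norm (indicator (Omega T) z * g z) \<le> norm (C * (1 + T\<^sup>2) * (q (fst z) * rho (snd z)))"
    proof (rule AE_I2)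
      fix z :: "real \<times> (real^'n)"
      have nn: "0 \<le> C * (1 + T\<^sup>2) * (q (fst z) * rho (snd z))"
        using C(1) by (intro mult_nonneg_nonneg) (auto simp: q_pos rho_pos less_imp_le)
      have "\<bar>g z\<bar> \<le> C * (1 + T\<^sup>2) * (q (fst z) * rho (snd z))" if "z \<in> Omega T"
      proof -
        have t: "0 < fst z" "fst z < T" using that by (auto simp: Omega_def)
        then have "(fst z)\<^sup>2 \<le> T\<^sup>2" by (intro power_mono) auto
        \<comment> \<open>On the bounded time interval \<open>q\<close> is at least
          \<open>1 / (1 + T^2)\<close>, so this factor exchanges a bound in time for the integrable
          profile.\<close>
        then have "1 \<le> (1 + T\<^sup>2) * q (fst z)" by (simp add: q_def divide_simps add_pos_nonneg)
        then have "C * rho (snd z) * 1 \<le> C * rho (snd z) * ((1 + T\<^sup>2) * q (fst z))"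
          using C(1) rho_pos[of "snd z"] by (intro mult_left_mono) auto
        then show ?thesis using C(2)[of "fst z" "snd z"] t by (simp add: mult_ac)
      qed
      then show "norm (indicator (Omega T) z * g z) \<le> norm (C * (1 + T\<^sup>2) * (q (fst z) * rho (snd z)))"
        using nn by (auto simp: indicator_def)
    qed
  qed
qed

lemma C0_slice_integrable:
  fixes g :: "real \<times> (real^'n::finite) \<Rightarrow> real"
  assumes "C0 rho g"
  shows "integrable lborel (\<lambda>x. g (t, x))"
proof -
  obtain C where C: "C \<ge> 0" "\<And>s x. \<bar>s\<bar> \<le> \<bar>t\<bar> \<Longrightarrow> \<bar>g (s, x)\<bar> \<le> C * rho x" using C0_bound[OF assms] by metis
  have "continuous_on UNIV (\<lambda>x. g (t, x))"
    by (rule continuous_on_compose2[OF C0_continuous[OF assms]], intro continuous_intros) simp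
  then have [measurable]: "(\<lambda>x. g (t, x)) \<in> borel_measurable borel" by (rule borel_measurable_continuous_onI)
  show ?thesis
    by (rule Bochner_Integration.integrable_bound[OF integrable_mult_right[OF integrable_rho, of C]])
       (use C in \<open>auto intro!: AE_I2 order_trans[OF _ abs_ge_self]\<close>)
qed

text \<open>Fubini and the substitution \<open>x \<mapsto> x + r y\<close>, which reverses the sign
  of the shift. The factor \<psi> carries the decay that makes both double integrals absolutely
  convergent.\<close>

lemma Aop_dual:
  fixes g \<psi> :: "real \<times> (real^'n::finite) \<Rightarrow> real"
  assumes g: "C0 (\<lambda>_. 1) g" and \<psi>: "C0 rho \<psi>"
  shows "(\<integral>x. Aop (-1) (ker i) g (t, x) * \<psi> (t, x) \<partial>lborel) = (\<integral>x. g (t, x) * Aop 1 (ker i) \<psi> (t, x) \<partial>lborel)"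
proof -
  define c where "c y = fst y *\<^sub>R snd y" for y :: "real \<times> (real^'n)"
  obtain C where C: "C \<ge> 0" "\<And>s x. \<bar>s\<bar> \<le> \<bar>t\<bar> \<Longrightarrow> \<bar>g (s, x)\<bar> \<le> C * 1" using C0_bound[OF g] by metis
  obtain D where D: "D \<ge> 0" "\<And>s x. \<bar>s\<bar> \<le> \<bar>t\<bar> \<Longrightarrow> \<bar>\<psi> (s, x)\<bar> \<le> D * rho x" using C0_bound[OF \<psi>] by metis
  have gt: "continuous_on UNIV (\<lambda>x. g (t, x))" and \<psi>t: "continuous_on UNIV (\<lambda>x. \<psi> (t, x))"
    by (rule continuous_on_compose2[OF C0_continuous[OF g]] continuous_on_compose2[OF C0_continuous[OF \<psi>]], intro continuous_intros, simp)+
  have cm: "continuous_on UNIV (\<lambda>p::(real \<times> (real^'n)) \<times> (real^'n). snd p - c (fst p))"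
    "continuous_on UNIV (\<lambda>p::(real \<times> (real^'n)) \<times> (real^'n). snd p + c (fst p))"
    unfolding c_def by (intro continuous_intros)+
  define H1 where "H1 p = ker i (fst p) * (g (t, snd p - c (fst p)) * \<psi> (t, snd p))" for p
  define H2 where "H2 p = ker i (fst p) * (g (t, snd p) * \<psi> (t, snd p + c (fst p)))" for p
  have km: "(\<lambda>p::(real \<times> (real^'n)) \<times> (real^'n). ker i (fst p)) \<in> borel_measurable borel"
  proof -
    have "fst \<in> borel_measurable (borel :: ((real \<times> (real^'n)) \<times> (real^'n)) measure)"
      by (intro borel_measurable_continuous_onI continuous_intros)
    from measurable_compose[OF this ker_measurable] show ?thesis .
  qed
  have bound: "integrable (lborel \<Otimes>\<^sub>M lborel) H" if "continuous_on UNIV h" "H = (\<lambda>p. ker i (fst p) * h p)"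
      "\<And>p. \<bar>h p\<bar> \<le> C * D * (moment (fst p) * rho (snd p))" for H and h :: "(real \<times> (real^'n)) \<times> (real^'n) \<Rightarrow> real"
  proof (rule Bochner_Integration.integrable_bound[OF integrable_mult_right[OF integrable_pair_mult[OF integrable_ker_moment integrable_rho], of "C * D" i]])
    have "H \<in> borel_measurable borel"
      unfolding that(2) by (rule borel_measurable_times[OF km borel_measurable_continuous_onI[OF that(1)]])
    then show "H \<in> borel_measurable (lborel \<Otimes>\<^sub>M lborel)" by (simp add: lborel_prod)
    show "AE p in lborel \<Otimes>\<^sub>M lborel. norm (H p) \<le> norm (C * D * (\<bar>ker i (fst p)\<bar> * moment (fst p) * rho (snd p)))"
    proof (rule AE_I2)
      fix p :: "(real \<times> (real^'n)) \<times> (real^'n)"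
      have "\<bar>ker i (fst p)\<bar> * \<bar>h p\<bar> \<le> \<bar>ker i (fst p)\<bar> * (C * D * (moment (fst p) * rho (snd p)))"
        by (intro mult_left_mono that(3)) simp
      then show "norm (H p) \<le> norm (C * D * (\<bar>ker i (fst p)\<bar> * moment (fst p) * rho (snd p)))"
        unfolding that(2) real_norm_def by (intro order_trans[OF _ abs_ge_self]) (simp add: abs_mult mult_ac)
    qed
  qed
  have i1: "integrable (lborel \<Otimes>\<^sub>M lborel) H1"
  proof (rule bound)
    show "continuous_on UNIV (\<lambda>p. g (t, snd p - c (fst p)) * \<psi> (t, snd p))"
      by (intro continuous_on_mult continuous_on_compose2[OF gt] continuous_on_compose2[OF \<psi>t] cm continuous_intros) auto
    show "\<bar>g (t, snd p - c (fst p)) * \<psi> (t, snd p)\<bar> \<le> C * D * (moment (fst p) * rho (snd p))" for p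
    proof -
      have "\<bar>g (t, snd p - c (fst p))\<bar> * \<bar>\<psi> (t, snd p)\<bar> \<le> C * (D * rho (snd p))"
        using C D by (intro mult_mono) auto
      also have "\<dots> = C * D * (1 * rho (snd p))" by simp
      also have "\<dots> \<le> C * D * (moment (fst p) * rho (snd p))"
        using C(1) D(1) rho_pos[of "snd p"] moment_ge_1[of "fst p"] by (intro mult_left_mono mult_right_mono) auto
      finally show ?thesis by (simp add: abs_mult)
    qed
  qed (auto simp: H1_def)
  have i2: "integrable (lborel \<Otimes>\<^sub>M lborel) H2"
  proof (rule bound)
    show "continuous_on UNIV (\<lambda>p. g (t, snd p) * \<psi> (t, snd p + c (fst p)))"
      by (intro continuous_on_mult continuous_on_compose2[OF gt] continuous_on_compose2[OF \<psi>t] cm continuous_intros) auto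
    show "\<bar>g (t, snd p) * \<psi> (t, snd p + c (fst p))\<bar> \<le> C * D * (moment (fst p) * rho (snd p))" for p
    proof -
      have "\<bar>g (t, snd p)\<bar> * \<bar>\<psi> (t, snd p + c (fst p))\<bar> \<le> C * (D * rho (snd p + c (fst p)))"
        using C D by (intro mult_mono) auto
      also have "\<dots> \<le> C * (D * (moment (fst p) * rho (snd p)))"
      proof (intro mult_left_mono C(1) D(1))
        show "rho (snd p + c (fst p)) \<le> moment (fst p) * rho (snd p)"
          using weight_rho unfolding weight_fn_def by (metis abs_one c_def scaleR_one)
      qed
      finally show ?thesis by (simp add: abs_mult mult_ac)
    qed
  qed (auto simp: H2_def)
  have "(\<integral>x. Aop (-1) (ker i) g (t, x) * \<psi> (t, x) \<partial>lborel) = (\<integral>x. (\<integral>y. H1 (y, x) \<partial>lborel) \<partial>lborel)"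
    by (simp add: Aop_def H1_def c_def mult.assoc[symmetric])
  also have "\<dots> = (\<integral>y. (\<integral>x. H1 (y, x) \<partial>lborel) \<partial>lborel)"
    using lborel_pair.Fubini_integral[of "\<lambda>y x. H1 (y, x)"] i1 by simp
  also have "(\<lambda>y. \<integral>x. H1 (y, x) \<partial>lborel) = (\<lambda>y. \<integral>x. H2 (y, x) \<partial>lborel)"
  proof
    fix y
    have "(\<lambda>x. H1 (y, x)) \<in> borel_measurable borel"
      unfolding H1_def fst_conv snd_conv
      by (intro borel_measurable_times borel_measurable_const borel_measurable_continuous_onI
          continuous_on_compose2[OF gt] \<psi>t continuous_intros) auto
    from lborel_integral_shift[OF this, of "c y"]
    show "(\<integral>x. H1 (y, x) \<partial>lborel) = (\<integral>x. H2 (y, x) \<partial>lborel)" by (auto simp: H1_def H2_def)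
  qed
  also have "(\<integral>y. (\<integral>x. H2 (y, x) \<partial>lborel) \<partial>lborel) = (\<integral>x. (\<integral>y. H2 (y, x) \<partial>lborel) \<partial>lborel)"
    using lborel_pair.Fubini_integral[of "\<lambda>y x. H2 (y, x)"] i2 by simp
  also have "\<dots> = (\<integral>x. g (t, x) * Aop 1 (ker i) \<psi> (t, x) \<partial>lborel)"
  proof (rule Bochner_Integration.integral_cong[OF refl])
    fix x
    have "(\<lambda>y. H2 (y, x)) = (\<lambda>y. g (t, x) * (ker i y * \<psi> (t, x + c y)))" by (auto simp: H2_def)
    then show "(\<integral>y. H2 (y, x) \<partial>lborel) = g (t, x) * Aop 1 (ker i) \<psi> (t, x)" by (simp add: Aop_def c_def)
  qed
  finally show ?thesis .
qed

lemma smooth_cs_C0: "smooth_cs G \<Longrightarrow> C0 rho G" "smooth_cs G \<Longrightarrow> C0 (\<lambda>_. 1) G"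
  using smooth_cs_CB[of G rho 0] smooth_cs_CB[of G "\<lambda>_. 1" 0] continuous_rho[OF continuous_on_id] by (auto simp: rho_pos)

lemma lap_eq: "lap \<phi> = (\<lambda>z. \<Sum>j\<in>UNIV. pdiff (ex j) (pdiff (ex j) \<phi>) z)"
  by (simp add: lap_def fun_eq_iff)

lemma test_fun_sm: "test_fun T \<phi> \<Longrightarrow> smooth_cs \<phi>"
  by (simp add: test_fun_def smooth_cs_def)

text \<open>Pairing the integrated equation with \<open>\<psi> = \<phi> - \<Delta>\<phi>\<close> and
  transposing the kernels returns \<phi> and its gradient, which are the terms of the weak
  formulation.\<close>

lemma test_potential:
  fixes \<phi> :: "real \<times> (real^'n::finite) \<Rightarrow> real"
  assumes \<phi>: "smooth_cs \<phi>"
  defines "\<psi> \<equiv> \<lambda>z. \<phi> z - lap \<phi> z"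
  shows "Aop 1 (ker None) \<psi> = \<phi>" "Aop 1 (ker (Some j)) \<psi> = pdiff (ex j) \<phi>"
proof -
  have \<phi>1: "smooth_cs (pdiff (ex j) \<phi>)" "has_pdiff (ex j) \<phi> (pdiff (ex j) \<phi>)" for j
    using smooth_cs_pdiff[OF \<phi> ex_Basis] by auto
  have \<phi>2: "smooth_cs (pdiff (ex j) (pdiff (ex j) \<phi>))" "has_pdiff (ex j) (pdiff (ex j) \<phi>) (pdiff (ex j) (pdiff (ex j) \<phi>))" for j
    using smooth_cs_pdiff[OF \<phi>1(1) ex_Basis] by auto
  show A: "Aop 1 (ker None) \<psi> = \<phi>"
    unfolding \<psi>_def lap_eq
    by (rule ext, rule Aop_resolvent[where \<phi>'="\<lambda>j. pdiff (ex j) \<phi>"])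
       (intro smooth_cs_C0(2) \<phi> \<phi>1 \<phi>2)+
  have "CB (\<lambda>_. 1) (Suc 0) (\<lambda>z. lap \<phi> z)"
    unfolding lap_eq by (intro CB_sum smooth_cs_CB \<phi>2) auto
  then have \<psi>: "CB (\<lambda>_. 1) (Suc 0) \<psi>"
    unfolding \<psi>_def using CB_add[OF smooth_cs_CB[OF \<phi>, of "\<lambda>_. 1" "Suc 0"] CB_minus] by simp
  have p: "has_pdiff (ex j) \<psi> (pdiff (ex j) \<psi>)" "C0 (\<lambda>_. 1) (pdiff (ex j) \<psi>)" using CB_pdiff[OF \<psi> ex_Basis, of j] by auto
  have "Aop 1 (ker (Some j)) \<psi> = Aop 1 (ker None) (pdiff (ex j) \<psi>)"
    using Aop_Some_eq[OF CB_C0[OF \<psi>] p(2,1)] by auto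
  also have "\<dots> = pdiff (ex j) (Aop 1 (ker None) \<psi>)"
    by (rule has_pdiff_pdiff[OF has_pdiff_Aop[OF _ CB_C0[OF \<psi>] p(2,1)], symmetric]) simp
  finally show "Aop 1 (ker (Some j)) \<psi> = pdiff (ex j) \<phi>" by (simp add: A)
qed

lemma lebesgue_eq_lborel:
  fixes h :: "'a::euclidean_space \<Rightarrow> real"
  assumes "h \<in> borel_measurable borel" "S \<in> sets borel"
  shows "(LINT z:S|lebesgue. h z) = (\<integral>z. indicator S z * h z \<partial>lborel)"
  using assms unfolding set_lebesgue_integral_def by (subst integral_completion) auto

lemma L2_onI:
  fixes g :: "'a::euclidean_space \<Rightarrow> real"
  assumes [measurable]: "g \<in> borel_measurable borel" "S \<in> sets borel"
    and int: "integrable lborel (\<lambda>z. indicator S z * (g z)\<^sup>2)"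
  shows "L2_on S g"
proof -
  have "(\<lambda>z. indicator S z *\<^sub>R g z) \<in> borel_measurable lborel" by measurable
  then have "(\<lambda>z. indicator S z *\<^sub>R g z) \<in> borel_measurable lebesgue" by (rule measurable_completion)
  moreover have "integrable lebesgue (\<lambda>z. indicator S z *\<^sub>R (g z)\<^sup>2)"
    using int by (subst integrable_completion) auto
  ultimately show ?thesis by (simp add: L2_on_def set_borel_measurable_def set_integrable_def)
qed

text \<open>The integrand is the time derivative of \<open>u \<psi>\<close>; the boundary term at
  \<open>T\<close> vanishes and the one at 0 carries the initial datum.\<close>

lemma time_by_parts:
  fixes u :: "real \<times> (real^'n::finite) \<Rightarrow> real"
  assumes T: "T > 0" and u: "has_pdiff et u u'" "continuous_on UNIV u'" and \<psi>: "has_pdiff et \<psi> \<psi>'" "continuous_on UNIV \<psi>'"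
    and c: "continuous_on UNIV u" "continuous_on UNIV \<psi>" and 0: "\<psi> (T, x) = 0"
  shows "(\<integral>t. indicator (Omega T) (t, x) * (u (t, x) * \<psi>' (t, x) + u' (t, x) * \<psi> (t, x)) \<partial>lborel) = - u (0, x) * \<psi> (0, x)"
proof -
  let ?h = "\<lambda>t. u (t, x) * \<psi>' (t, x) + u' (t, x) * \<psi> (t, x)"
  have slice: "continuous_on UNIV (\<lambda>t. g (t, x))" if "continuous_on UNIV g" for g :: "real \<times> (real^'n) \<Rightarrow> real"
    by (rule continuous_on_compose2[OF that], intro continuous_intros) simp
  have "(\<integral>t. indicator (Omega T) (t, x) * ?h t \<partial>lborel) = (\<integral>t. ?h t * indicator {0..T} t \<partial>lborel)"
    \<comment> \<open>\<open>Omega T\<close> uses the open interval, the fundamental theorem the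
      closed one; they differ by the two end points.\<close>
    by (rule integral_discrete_difference[of "{0, T}"]) (auto simp: Omega_def indicator_def)
  also have "\<dots> = u (T, x) * \<psi> (T, x) - u (0, x) * \<psi> (0, x)"
  proof (rule integral_FTC_Icc_real)
    fix t
    have "((\<lambda>s. u ((0, x) + s *\<^sub>R et)) has_real_derivative u' ((0, x) + t *\<^sub>R et)) (at t)"
      "((\<lambda>s. \<psi> ((0, x) + s *\<^sub>R et)) has_real_derivative \<psi>' ((0, x) + t *\<^sub>R et)) (at t)"
      using has_pdiff_at[OF u(1)] has_pdiff_at[OF \<psi>(1)] by blast+
    then have "((\<lambda>s. u (s, x)) has_real_derivative u' (t, x)) (at t)" "((\<lambda>s. \<psi> (s, x)) has_real_derivative \<psi>' (t, x)) (at t)"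
      by (simp_all add: et_def)
    then show "((\<lambda>t. u (t, x) * \<psi> (t, x)) has_real_derivative ?h t) (at t)" by (rule DERIV_mult')
    have "continuous_on UNIV ?h" by (intro continuous_intros slice u \<psi> c)
    then show "isCont ?h t" by (simp add: continuous_on_eq_continuous_at)
  qed (use T in simp)
  finally show ?thesis using 0 by simp
qed

text \<open>With \<open>\<psi> = \<phi> - \<Delta>\<phi>\<close> the weak integrand is
  \<open>u \<psi>_t + R\<close>. By duality \<open>R\<close> has the same space integral as
  \<open>u_t \<psi>\<close>, so the total is the integral of \<open>(u \<psi>)_t\<close> and reduces
  to the initial term.\<close>

theorem classical_weak_sol:
  fixes f :: "real^'n::finite \<Rightarrow> real \<Rightarrow> real^'n"
  assumes T: "T > 0" and f: "\<And>l. smooth_cs (\<lambda>p. f (fst p) (snd p) $ l)" and u0: "smooth_cs u0"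
    and u: "C0 rho u" "solves (flux (\<lambda>l p. f (fst p) (snd p) $ l)) u0 u"
  shows "weak_sol T f u0 u"
proof -
  define N where "N = flux (\<lambda>l p. f (fst p) (snd p) $ l)"
  have N: "admissible rho N" unfolding N_def by (rule admissible_flux[OF f weight_rho])
  have Nsim: "N None z y = y" "N (Some l) z y = f (snd z) y $ l" for l z y by (auto simp: N_def flux_def)
  have to1: "C0 rho g \<Longrightarrow> C0 (\<lambda>_. 1) g" for g :: "real \<times> (real^'n) \<Rightarrow> real"
    using C0_weight rho_le by blast
  have cN: "C0 rho (\<lambda>z. N i z (u z))" for i by (rule admissible_comp[OF N u(1)])
  have cF: "C0 rho (\<lambda>z. f (snd z) (u z) $ l)" for l using cN[of "Some l"] by (simp add: Nsim)
  define u' where "u' = rhs N u"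
  have u': "C0 rho u'" unfolding u'_def by (rule C0_rhs[OF weight_rho N u(1)])
  have pu: "has_pdiff et u u'" unfolding u'_def N_def
    by (rule solves_time_derivative[OF u(2)]) (use C0_continuous[OF u'] in \<open>simp add: u'_def N_def\<close>)
  have u00: "u (0, x) = u0 x" for x using u(2) by (simp add: solves_def Jop_def)
  have L2: "L2_on (Omega T) g" if "C0 rho g" for g :: "real \<times> (real^'n) \<Rightarrow> real"
  proof (rule L2_onI)
    show "g \<in> borel_measurable borel" using C0_continuous[OF that] by (rule borel_measurable_continuous_onI)
    show "integrable lborel (\<lambda>z. indicator (Omega T) z * (g z)\<^sup>2)"
      using C0_integrable_Omega[OF C0_mult[OF to1[OF that] that], of T] by (simp add: power2_eq_square)
  qed simp
  have cu0: "C0 rho (\<lambda>z::real \<times> (real^'n). u0 (snd z))"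
    using smooth_cs_snd_CB[OF u0, of rho 0] by (simp add: rho_pos continuous_intros)
  have L20: "L2_on UNIV u0"
  proof (rule L2_onI)
    show "u0 \<in> borel_measurable borel" using smooth_cs_continuous[OF u0] by (rule borel_measurable_continuous_onI)
    show "integrable lborel (\<lambda>z. indicator UNIV z * (u0 z)\<^sup>2)"
      using C0_slice_integrable[OF C0_mult[OF to1[OF cu0] cu0], of 0] by (simp add: power2_eq_square)
  qed simp
  have main: "(LINT z:Omega T|lebesgue. u z * pdiff et \<phi> z + (\<Sum>j\<in>UNIV. f (snd z) (u z) $ j * pdiff (ex j) \<phi> z)
      + u z * lap \<phi> z - u z * pdiff et (lap \<phi>) z)
      + (LINT x|lebesgue. u0 x * (\<phi> (0, x) - lap \<phi> (0, x))) = 0" if \<phi>: "test_fun T \<phi>" for \<phi>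
  proof -
    note smooth_cs = test_fun_sm[OF \<phi>]
    define \<psi> where "\<psi> = (\<lambda>z. \<phi> z - lap \<phi> z)"
    have \<phi>1: "smooth_cs (pdiff (ex j) \<phi>)" for j using smooth_cs_pdiff[OF smooth_cs ex_Basis] by auto
    have \<phi>2: "smooth_cs (pdiff (ex j) (pdiff (ex j) \<phi>))" for j using smooth_cs_pdiff[OF \<phi>1 ex_Basis] by auto
    have \<phi>t: "smooth_cs (pdiff et \<phi>)" "has_pdiff et \<phi> (pdiff et \<phi>)" using smooth_cs_pdiff[OF smooth_cs et_Basis] by auto
    have rc: "continuous_on UNIV rho" by (intro continuous_intros)
    have lapCB: "CB rho (Suc 0) (lap \<phi>)"
      unfolding lap_eq by (intro CB_sum smooth_cs_CB \<phi>2 rc rho_pos) (auto simp: rho_pos less_imp_le)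
    note lapC = CB_C0[OF lapCB]
    have lapt: "has_pdiff et (lap \<phi>) (pdiff et (lap \<phi>))" "C0 rho (pdiff et (lap \<phi>))"
      using CB_pdiff[OF lapCB et_Basis] by auto
    define \<psi>t where "\<psi>t = (\<lambda>z. pdiff et \<phi> z - pdiff et (lap \<phi>) z)"
    have c\<psi>: "C0 rho \<psi>" "C0 rho \<psi>t" unfolding \<psi>_def \<psi>t_def by (intro C0_diff smooth_cs_C0 smooth_cs lapC \<phi>t lapt)+
    have p\<psi>: "has_pdiff et \<psi> \<psi>t"
      using has_pdiff_add[OF \<phi>t(2) has_pdiff_cmult[OF lapt(1), of "-1"]] by (simp add: \<psi>_def \<psi>t_def)
    have supp: "closure {z. \<phi> z \<noteq> 0} \<subseteq> {..<T} \<times> UNIV" using \<phi> by (simp add: test_fun_def)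
    have "pdiff (ex j) (pdiff (ex j) \<phi>) (T, x) = 0" for j x
    proof (rule ccontr)
      assume "pdiff (ex j) (pdiff (ex j) \<phi>) (T, x) \<noteq> 0"
      then have "(T, x) \<in> closure {z. pdiff (ex j) (pdiff (ex j) \<phi>) z \<noteq> 0}" by (intro subsetD[OF closure_subset]) simp
      then show False using pdiff_support[of "ex j" "pdiff (ex j) \<phi>"] pdiff_support[of "ex j" \<phi>] supp by auto
    qed
    moreover have "\<phi> (T, x) = 0" for x
    proof (rule ccontr)
      assume "\<phi> (T, x) \<noteq> 0"
      then have "(T, x) \<in> closure {z. \<phi> z \<noteq> 0}" by (intro subsetD[OF closure_subset]) simp
      then show False using supp by auto
    qed
    ultimately have \<psi>T: "\<psi> (T, x) = 0" for x by (simp add: \<psi>_def lap_eq)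
    define G where "G z = u z * \<psi>t z + u' z * \<psi> z" for z
    define R where "R z = (\<Sum>j\<in>UNIV. f (snd z) (u z) $ j * pdiff (ex j) \<phi> z) + u z * lap \<phi> z" for z
    have cut: "C0 rho (\<lambda>z. u z * \<psi>t z)" "C0 rho (\<lambda>z. u' z * \<psi> z)" by (intro C0_mult to1 u(1) u' c\<psi>)+
    have cR: "C0 rho R" unfolding R_def
      by (intro C0_add C0_sum C0_mult to1 cF smooth_cs_C0 \<phi>1 u(1) lapC) (auto simp: rho_pos less_imp_le)
    let ?I = "\<lambda>g. \<integral>z. indicator (Omega T) z * g z \<partial>lborel"
    have I_time: "?I g = (\<integral>t. (\<integral>x. indicator (Omega T) (t, x) * g (t, x) \<partial>lborel) \<partial>lborel)"
      and I_space: "?I g = (\<integral>x. (\<integral>t. indicator (Omega T) (t, x) * g (t, x) \<partial>lborel) \<partial>lborel)" if "C0 rho g" for g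
    proof -
      have i: "integrable (lborel \<Otimes>\<^sub>M lborel) (\<lambda>(t, x). indicator (Omega T) (t, x) * g (t, x))"
        using C0_integrable_Omega[OF that, of T] by (simp add: lborel_prod case_prod_unfold)
      show "?I g = (\<integral>t. (\<integral>x. indicator (Omega T) (t, x) * g (t, x) \<partial>lborel) \<partial>lborel)"
        using lborel_pair.integral_fst[OF i] by (simp add: lborel_prod case_prod_unfold)
      show "?I g = (\<integral>x. (\<integral>t. indicator (Omega T) (t, x) * g (t, x) \<partial>lborel) \<partial>lborel)"
        using lborel_pair.integral_snd[OF i] by (simp add: lborel_prod case_prod_unfold)
    qed
    have IG: "?I G = - (\<integral>x. u0 x * \<psi> (0, x) \<partial>lborel)"
    proof -
      have "?I G = (\<integral>x. (\<integral>t. indicator (Omega T) (t, x) * G (t, x) \<partial>lborel) \<partial>lborel)"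
        unfolding G_def by (rule I_space[OF C0_add[OF cut]])
      also have "\<dots> = (\<integral>x. - (u0 x * \<psi> (0, x)) \<partial>lborel)"
        using time_by_parts[OF T pu C0_continuous[OF u'] p\<psi> C0_continuous[OF c\<psi>(2)] C0_continuous[OF u(1)] C0_continuous[OF c\<psi>(1)] \<psi>T]
        by (simp add: G_def u00)
      finally show ?thesis by simp
    qed
    have IR: "?I (\<lambda>z. u' z * \<psi> z) = ?I R"
    proof -
      have eq: "(\<integral>x. u' (t, x) * \<psi> (t, x) \<partial>lborel) = (\<integral>x. R (t, x) \<partial>lborel)" for t
      proof -
        have iA: "integrable lborel (\<lambda>x. Aop (-1) (ker i) (\<lambda>z. N i z (u z)) (t, x) * \<psi> (t, x))" for i
          by (rule C0_slice_integrable, rule C0_mult[OF C0_Aop[OF weight_one _ to1[OF cN]] c\<psi>(1)]) simp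
        have iu: "integrable lborel (\<lambda>x. u (t, x) * \<psi> (t, x))"
          by (rule C0_slice_integrable[OF C0_mult[OF to1[OF u(1)] c\<psi>(1)]])
        have iD: "integrable lborel (\<lambda>x. N i (t, x) (u (t, x)) * Aop 1 (ker i) \<psi> (t, x))" for i
          by (rule C0_slice_integrable, rule C0_mult[OF to1[OF cN] C0_Aop[OF weight_rho _ c\<psi>(1)]]) simp
        have "(\<integral>x. u' (t, x) * \<psi> (t, x) \<partial>lborel) =
          (\<integral>x. - (u (t, x) * \<psi> (t, x)) + (\<Sum>i\<in>UNIV. Aop (-1) (ker i) (\<lambda>z. N i z (u z)) (t, x) * \<psi> (t, x)) \<partial>lborel)"
          by (simp add: u'_def rhs_def left_diff_distrib sum_distrib_right)
        also have "\<dots> = - (\<integral>x. u (t, x) * \<psi> (t, x) \<partial>lborel) + (\<Sum>i\<in>UNIV. \<integral>x. Aop (-1) (ker i) (\<lambda>z. N i z (u z)) (t, x) * \<psi> (t, x) \<partial>lborel)"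
          using iu iA by simp
        also have "\<dots> = - (\<integral>x. u (t, x) * \<psi> (t, x) \<partial>lborel) + (\<Sum>i\<in>UNIV. \<integral>x. N i (t, x) (u (t, x)) * Aop 1 (ker i) \<psi> (t, x) \<partial>lborel)"
          using Aop_dual[OF to1[OF cN] c\<psi>(1)] by simp
        also have "\<dots> = (\<integral>x. - (u (t, x) * \<psi> (t, x)) + (\<Sum>i\<in>UNIV. N i (t, x) (u (t, x)) * Aop 1 (ker i) \<psi> (t, x)) \<partial>lborel)"
          using iu iD by simp
        also have "\<dots> = (\<integral>x. R (t, x) \<partial>lborel)"
        proof -
          \<comment> \<open>The terms without flux give
            \<open>- u (\<phi> - \<Delta>\<phi>) + u \<phi> = u \<Delta>\<phi>\<close>.\<close>
          have "- (u z * \<psi> z) + (\<Sum>i\<in>UNIV. N i z (u z) * Aop 1 (ker i) \<psi> z) = R z" for z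
            using test_potential[OF smooth_cs] by (simp add: UNIV_option_conv sum.reindex Nsim R_def \<psi>_def[symmetric])
              (simp add: \<psi>_def algebra_simps)
          then show ?thesis by simp
        qed
        finally show ?thesis .
      qed
      have *: "(\<integral>x. indicator (Omega T) (t, x) * g x \<partial>lborel) = indicator {0<..<T} t * (\<integral>x. g x \<partial>lborel)"
        for t and g :: "real^'n \<Rightarrow> real"
        by (auto simp: Omega_def indicator_def)
      show ?thesis unfolding I_time[OF cut(2)] I_time[OF cR] * eq ..
    qed
    have eq: "(\<lambda>z. u z * pdiff et \<phi> z + (\<Sum>j\<in>UNIV. f (snd z) (u z) $ j * pdiff (ex j) \<phi> z)
      + u z * lap \<phi> z - u z * pdiff et (lap \<phi>) z) = (\<lambda>z. u z * \<psi>t z + R z)"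
      by (simp add: \<psi>t_def R_def algebra_simps)
    have majorant_measurable: "(\<lambda>z. u z * \<psi>t z + R z) \<in> borel_measurable borel"
      using C0_continuous[OF C0_add[OF cut(1) cR]] by (rule borel_measurable_continuous_onI)
    have "(LINT z:Omega T|lebesgue. u z * \<psi>t z + R z) = ?I (\<lambda>z. u z * \<psi>t z + R z)"
      by (rule lebesgue_eq_lborel[OF majorant_measurable]) simp
    also have "\<dots> = ?I (\<lambda>z. u z * \<psi>t z) + ?I R"
      using C0_integrable_Omega[OF cut(1)] C0_integrable_Omega[OF cR] by (simp add: distrib_left)
    also have "\<dots> = ?I G"
      unfolding IR[symmetric] G_def using C0_integrable_Omega[OF cut(1)] C0_integrable_Omega[OF cut(2)] by (simp add: distrib_left)
    finally have 1: "(LINT z:Omega T|lebesgue. u z * \<psi>t z + R z) = - (\<integral>x. u0 x * \<psi> (0, x) \<partial>lborel)" using IG by simp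
    have "continuous_on UNIV (\<lambda>x. \<psi> (0, x))"
      by (rule continuous_on_compose2[OF C0_continuous[OF c\<psi>(1)]], intro continuous_intros) simp
    then have "(\<lambda>x. u0 x * \<psi> (0, x)) \<in> borel_measurable lborel"
      using smooth_cs_continuous[OF u0] by (auto intro!: borel_measurable_continuous_onI continuous_intros)
    then have 2: "(LINT x|lebesgue. u0 x * \<psi> (0, x)) = (\<integral>x. u0 x * \<psi> (0, x) \<partial>lborel)"
      by (rule integral_completion)
    have 3: "(LINT x|lebesgue. u0 x * (\<phi> (0, x) - lap \<phi> (0, x))) = (LINT x|lebesgue. u0 x * \<psi> (0, x))"
      by (simp add: \<psi>_def)
    show ?thesis unfolding eq 1 3 2 by simp
  qed
  show ?thesis
    unfolding weak_sol_def weak_sol_lin_def using L2[OF u(1)] L2[OF cF] L20 main by blast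
qed

section \<open>Smooth bumps\<close>

text \<open>The powers of \<open>1 / x\<close> make the family closed under differentiation, up to
  linear combinations.\<close>

definition flat_exp :: "nat \<Rightarrow> real \<Rightarrow> real" where
  "flat_exp n x = (if 0 < x then (1 / x) ^ n * exp (- 1 / x) else 0)"

lemma flat_exp_nonneg: "0 \<le> flat_exp n x" by (simp add: flat_exp_def)

text \<open>The exponential dominates the power:
  \<open>exp (1 / x) \<ge> (1 + 1 / (n x)) ^ n \<ge> (1 / (n x)) ^ n\<close>.\<close>

lemma flat_exp_bound: obtains B where "B \<ge> 0" "\<And>x. flat_exp n x \<le> B"
proof (cases "n = 0")
  case True
  have "flat_exp n x \<le> 1" for x using True by (simp add: flat_exp_def)
  then show ?thesis using that[of 1] by simp
next
  case False
  have "flat_exp n x \<le> real n ^ n" for x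
  proof (cases "0 < x")
    case True
    have "(1 / x / n) ^ n \<le> (1 + 1 / x / n) ^ n" using True by (intro power_mono) auto
    also have "\<dots> \<le> exp (1 / x)" using False True by (intro exp_ge_one_plus_x_over_n_power_n) (auto intro: order_trans[of _ 0])
    finally have "(1 / x) ^ n / real n ^ n \<le> exp (1 / x)" by (simp only: power_divide[of "1 / x" "real n" n])
    then have "(1 / x) ^ n \<le> exp (1 / x) * real n ^ n" using False by (simp only: pos_divide_le_eq zero_less_power of_nat_0_less_iff neq0_conv)
    then have "(1 / x) ^ n * exp (- 1 / x) \<le> exp (1 / x) * real n ^ n * exp (- 1 / x)" by (rule mult_right_mono) simp
    also have "\<dots> = real n ^ n" by (simp add: exp_minus)
    finally show ?thesis using True by (simp add: flat_exp_def)
  qed (simp add: flat_exp_def)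
  then show ?thesis using that[of "real n ^ n"] by simp
qed

text \<open>At 0 the identity \<open>flat_exp n h = h^2 flat_exp (n + 2) h\<close> for positive
  \<open>h\<close>, with the second factor bounded, makes the difference quotient of size
  \<open>|h|\<close>.\<close>

lemma flat_exp_DERIV: "(flat_exp n has_real_derivative flat_exp (n + 2) x - real n * flat_exp (n + 1) x) (at x)"
proof -
  consider "x > 0" | "x < 0" | "x = 0" by linarith
  then show ?thesis
  proof cases
    case 1
    have pw: "real n * (1 / x) ^ (n - Suc 0) * (1 / x * (1 / x)) = real n * (1 / x) ^ (n + 1)"
      by (cases n) (auto simp: field_simps)
    have "((\<lambda>x. (1 / x) ^ n * exp (- 1 / x)) has_real_derivative
        (1 / x) ^ n * (exp (- 1 / x) * (1 / x * (1 / x))) + (real n * (1 / x) ^ (n - Suc 0) * (- (1 / x * (1 / x)))) * exp (- 1 / x)) (at x)"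
    proof (rule DERIV_mult')
      have d: "((\<lambda>x. 1 / x) has_real_derivative - (1 / x * (1 / x))) (at x)"
        using 1 by (auto intro!: derivative_eq_intros)
      show "((\<lambda>x. (1 / x) ^ n) has_real_derivative real n * (1 / x) ^ (n - Suc 0) * (- (1 / x * (1 / x)))) (at x)"
        using DERIV_power[OF d, of n] by (simp add: mult_ac)
      show "((\<lambda>x. exp (- 1 / x)) has_real_derivative exp (- 1 / x) * (1 / x * (1 / x))) (at x)"
        using DERIV_fun_exp[OF DERIV_minus[OF d]] by simp
    qed
    also have "(1 / x) ^ n * (exp (- 1 / x) * (1 / x * (1 / x))) + (real n * (1 / x) ^ (n - Suc 0) * (- (1 / x * (1 / x)))) * exp (- 1 / x)
        = flat_exp (n + 2) x - real n * flat_exp (n + 1) x"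
    proof -
      have "(real n * (1 / x) ^ (n - Suc 0) * (- (1 / x * (1 / x)))) * exp (- 1 / x) = - (real n * (1 / x) ^ (n + 1)) * exp (- 1 / x)"
        using pw by simp
      then show ?thesis using 1 by (simp add: flat_exp_def power_add power2_eq_square mult_ac)
    qed
    finally show ?thesis
      by (rule has_field_derivative_transform_within_open[of _ _ _ "{0<..}"]) (use 1 in \<open>auto simp: flat_exp_def\<close>)
  next
    case 2
    have "((\<lambda>x. 0) has_real_derivative 0) (at x)" by simp
    then have "(flat_exp n has_real_derivative 0) (at x)"
      by (rule has_field_derivative_transform_within_open[of _ _ _ "{..<0}"]) (use 2 in \<open>auto simp: flat_exp_def\<close>)
    then show ?thesis using 2 by (simp add: flat_exp_def)
  next
    case 3
    obtain B where B: "B \<ge> 0" "\<And>x. flat_exp (n + 2) x \<le> B" using flat_exp_bound by blast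
    have le: "\<bar>flat_exp n h\<bar> \<le> B * (\<bar>h\<bar> * \<bar>h\<bar>)" for h
    proof (cases "0 < h")
      case True
      have "flat_exp n h = flat_exp (n + 2) h * (h * h)" using True by (simp add: flat_exp_def power_add power2_eq_square divide_simps)
      also have "\<dots> \<le> B * (h * h)" using B by (intro mult_right_mono) auto
      finally show ?thesis using flat_exp_nonneg[of n h] True by simp
    qed (use B in \<open>simp add: flat_exp_def\<close>)
    have "((\<lambda>h. (flat_exp n (0 + h) - flat_exp n 0) / h) \<longlongrightarrow> 0) (at 0)"
    proof (rule Lim_null_comparison)
      show "((\<lambda>h. B * \<bar>h\<bar>) \<longlongrightarrow> 0) (at 0)" by (auto intro!: tendsto_eq_intros)
      have "\<bar>flat_exp n h\<bar> / \<bar>h\<bar> \<le> B * \<bar>h\<bar>" if "h \<noteq> 0" for h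
        using le[of h] that by (simp add: divide_simps mult.assoc)
      then show "\<forall>\<^sub>F h in at 0. norm ((flat_exp n (0 + h) - flat_exp n 0) / h) \<le> B * \<bar>h\<bar>"
        by (auto simp: eventually_at_filter flat_exp_def[of n 0] abs_divide)
    qed
    then show ?thesis using 3 by (simp add: DERIV_def flat_exp_def[of _ 0])
  qed
qed

text \<open>The affine argument covers bumps in time and in each space coordinate at once.\<close>

lemma CB_flat_exp: "CB (\<lambda>_. 1) k (\<lambda>z::real \<times> (real^'n::finite). flat_exp n (\<alpha> + z \<bullet> c))"
proof (induction k arbitrary: n)
  have c: "C0 (\<lambda>_. 1) (\<lambda>z::real \<times> (real^'n). flat_exp n (\<alpha> + z \<bullet> c))" for n
  proof -
    obtain B where "B \<ge> 0" "\<And>x. flat_exp n x \<le> B" using flat_exp_bound by blast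
    moreover have "continuous_on UNIV (flat_exp n)"
      using DERIV_isCont[OF flat_exp_DERIV] by (simp add: continuous_on_eq_continuous_at)
    then have "continuous_on UNIV (\<lambda>z::real \<times> (real^'n). flat_exp n (\<alpha> + z \<bullet> c))"
      by (rule continuous_on_compose2) (auto intro!: continuous_intros)
    ultimately show ?thesis unfolding C0_def using flat_exp_nonneg by auto
  qed
  {
    case 0
    then show ?case using c by simp
  next
    case (Suc k)
    have "\<exists>g'. has_pdiff e (\<lambda>z::real \<times> (real^'n). flat_exp n (\<alpha> + z \<bullet> c)) g' \<and> CB (\<lambda>_. 1) k g'" for e
    proof (intro exI conjI)
      show "has_pdiff e (\<lambda>z. flat_exp n (\<alpha> + z \<bullet> c)) (\<lambda>z. (e \<bullet> c) * (flat_exp (n + 2) (\<alpha> + z \<bullet> c) + (- real n) * flat_exp (n + 1) (\<alpha> + z \<bullet> c)))"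
        unfolding has_pdiff_def
      proof
        fix z
        have 1: "((\<lambda>s. \<alpha> + (z + s *\<^sub>R e) \<bullet> c) has_real_derivative e \<bullet> c) (at 0)"
          by (auto intro!: derivative_eq_intros simp: inner_add_left)
        show "((\<lambda>s. flat_exp n (\<alpha> + (z + s *\<^sub>R e) \<bullet> c)) has_real_derivative
          (e \<bullet> c) * (flat_exp (n + 2) (\<alpha> + z \<bullet> c) + (- real n) * flat_exp (n + 1) (\<alpha> + z \<bullet> c))) (at 0)"
          using DERIV_chain2[OF flat_exp_DERIV 1] by (simp add: mult.commute)
      qed
      show "CB (\<lambda>_. 1) k (\<lambda>z. (e \<bullet> c) * (flat_exp (n + 2) (\<alpha> + z \<bullet> c) + (- real n) * flat_exp (n + 1) (\<alpha> + z \<bullet> c)))"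
        by (intro CB_cmult CB_add Suc)
    qed
    then show ?case using c by simp
  }
qed

text \<open>For positive \<open>m\<close> the set where the bump is positive is always the open
  interval; raising \<open>m\<close> only steepens the flanks, so that the indicator is approached
  from below.\<close>

definition bump :: "real \<Rightarrow> real \<Rightarrow> real \<Rightarrow> real \<Rightarrow> real" where
  "bump m a b s = flat_exp 0 (m * (s - a)) * flat_exp 0 (m * (b - s))"

lemma bump_nonneg: "0 \<le> bump m a b s" by (simp add: bump_def flat_exp_nonneg)

lemma bump_le_1: "bump m a b s \<le> 1"
  unfolding bump_def by (intro mult_le_one) (auto simp: flat_exp_def)

lemma bump_pos_iff: "m > 0 \<Longrightarrow> bump m a b s > 0 \<longleftrightarrow> a < s \<and> s < b"
  by (auto simp: bump_def flat_exp_def zero_less_mult_iff)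

lemma bump_zero: "m > 0 \<Longrightarrow> \<not> (a < s \<and> s < b) \<Longrightarrow> bump m a b s = 0"
  using bump_pos_iff[of m a b s] bump_nonneg[of m a b s] by linarith

lemma bump_lim: "(\<lambda>n. bump (real (Suc n)) a b s) \<longlonglongrightarrow> (if a < s \<and> s < b then 1 else 0)"
proof (cases "a < s \<and> s < b")
  case True
  have "(\<lambda>n. flat_exp 0 (real (Suc n) * d)) \<longlonglongrightarrow> 1" if "d > 0" for d
  proof -
    have "(\<lambda>n. exp (- (1 / d) * (1 / real (Suc n)))) \<longlonglongrightarrow> exp (- (1 / d) * 0)"
      by (intro tendsto_intros LIMSEQ_inverse_real_of_nat[unfolded inverse_eq_divide])
    moreover have "flat_exp 0 (real (Suc n) * d) = exp (- (1 / d) * (1 / real (Suc n)))" for n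
      using that by (simp add: flat_exp_def zero_less_mult_iff mult.commute)
    ultimately show ?thesis by simp
  qed
  from tendsto_mult[OF this[of "s - a"] this[of "b - s"]] True show ?thesis by (simp add: bump_def)
next
  case False
  then have "bump (real (Suc n)) a b s = 0" for n by (intro bump_zero) auto
  then show ?thesis using False by auto
qed

lemma CB_bump: "CB (\<lambda>_. 1) k (\<lambda>z::real \<times> (real^'n::finite). bump m a b (z \<bullet> e))"
proof -
  have eq: "(\<lambda>z::real \<times> (real^'n). bump m a b (z \<bullet> e)) = (\<lambda>z. flat_exp 0 (- (m * a) + z \<bullet> (m *\<^sub>R e)) * flat_exp 0 (m * b + z \<bullet> (- m *\<^sub>R e)))"
    by (simp add: bump_def algebra_simps)
  show ?thesis unfolding eq by (intro CB_mult CB_flat_exp)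
qed

lemma inner_et: "z \<bullet> et = fst z" and inner_ex: "z \<bullet> ex j = snd z $ j"
  by (auto simp: et_def ex_def inner_prod_def inner_axis)

lemma CB_prod:
  "finite I \<Longrightarrow> (\<And>i. i \<in> I \<Longrightarrow> CB (\<lambda>_. 1) k (g i)) \<Longrightarrow> CB (\<lambda>_. 1) k (\<lambda>z. \<Prod>i\<in>I. g i z)"
  by (induction I rule: finite_induct) (auto intro: CB_const CB_mult)

section \<open>Smooth approximations of indicators of boxes\<close>

definition tbox :: "real \<Rightarrow> real \<Rightarrow> real \<Rightarrow> real \<times> (real^'n::finite) \<Rightarrow> real" where
  "tbox m a b z = bump m a b (fst z)"

definition xbox :: "real \<Rightarrow> real^'n \<Rightarrow> real^'n \<Rightarrow> real \<times> (real^'n::finite) \<Rightarrow> real" where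
  "xbox m a b z = (\<Prod>j\<in>UNIV. bump m (a $ j) (b $ j) (snd z $ j))"

lemma CB_tbox: "CB (\<lambda>_. 1) k (tbox m a b :: real \<times> (real^'n::finite) \<Rightarrow> real)"
  using CB_bump[of k m a b et] by (simp add: tbox_def[abs_def] inner_et)

lemma CB_xbox: "CB (\<lambda>_. 1) k (xbox m a b)"
  unfolding xbox_def[abs_def] using CB_bump[where e="ex _"] by (intro CB_prod) (simp_all add: inner_ex)

lemma xbox_nonneg: "0 \<le> xbox m a b z" and xbox_le_1: "xbox m a b z \<le> 1"
  unfolding xbox_def by (auto intro: prod_nonneg prod_le_1 simp: bump_nonneg bump_le_1)

lemma xbox_zero: "m > 0 \<Longrightarrow> snd z \<notin> box a b \<Longrightarrow> xbox m a b z = 0"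
  by (auto simp: xbox_def mem_box_cart intro: bump_zero)

lemma xbox_lim: "(\<lambda>n. xbox (real (Suc n)) a b z) \<longlonglongrightarrow> indicator (box a b) (snd z)"
proof -
  have "(\<lambda>n. xbox (real (Suc n)) a b z) \<longlonglongrightarrow> (\<Prod>j\<in>UNIV. if a $ j < snd z $ j \<and> snd z $ j < b $ j then 1 else 0)"
    unfolding xbox_def by (intro tendsto_prod bump_lim)
  also have "(\<Prod>j\<in>UNIV. if a $ j < snd z $ j \<and> snd z $ j < b $ j then 1 else 0) = (indicator (box a b) (snd z) :: real)"
    by (cases "snd z \<in> box a b") (auto simp: mem_box_cart)
  finally show ?thesis .
qed

lemma continuous_tbox: "continuous_on UNIV (tbox m a b :: real \<times> (real^'n::finite) \<Rightarrow> real)"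
  by (rule C0_continuous[OF CB_C0[OF CB_tbox]])

lemma continuous_xbox: "continuous_on UNIV (xbox m a b)"
  by (rule C0_continuous[OF CB_C0[OF CB_xbox]])

text \<open>On the compact \<open>K\<close> the weight has a positive minimum, so a plain bound is a
  weighted one. Derivatives vanish off \<open>K\<close> as well, which carries the
  induction.\<close>

lemma CB_support_weight:
  assumes "\<And>k. CB (\<lambda>_. 1) k g" and W: "continuous_on UNIV W" "\<And>x::real^'n. 0 < W x"
    and K: "compact K" "\<And>z. snd z \<notin> K \<Longrightarrow> g z = 0"
  shows "CB W k g"
proof -
  have "CB W k g" if "\<And>k. CB (\<lambda>_. 1) k g" "\<And>z. snd z \<notin> K \<Longrightarrow> g z = 0" for k g
    using that
  proof (induction k arbitrary: g)
    have c: "C0 W g" if g: "\<And>k. CB (\<lambda>_. 1) k g" "\<And>z. snd z \<notin> K \<Longrightarrow> g z = 0" for g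
      unfolding C0_def
    proof (intro conjI allI)
      have g0: "C0 (\<lambda>_. 1) g" using g(1)[of 0] by simp
      show "continuous_on UNIV g" using C0_continuous[OF g0] .
      fix \<tau>
      obtain C where C: "C \<ge> 0" "\<And>t x. \<bar>t\<bar> \<le> \<tau> \<Longrightarrow> \<bar>g (t, x)\<bar> \<le> C * 1" using C0_bound[OF g0] by metis
      show "\<exists>C\<ge>0. \<forall>t x. \<bar>t\<bar> \<le> \<tau> \<longrightarrow> \<bar>g (t, x)\<bar> \<le> C * W x"
      proof (cases "K = {}")
        case True
        then show ?thesis using g(2) by (intro exI[of _ 0]) auto
      next
        case False
        obtain y where y: "y \<in> K" "\<And>x. x \<in> K \<Longrightarrow> W y \<le> W x"
          using continuous_attains_inf[OF K(1) False continuous_on_subset[OF W(1)]] by auto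
        have "\<bar>g (t, x)\<bar> \<le> (C / W y) * W x" if "\<bar>t\<bar> \<le> \<tau>" for t x
        proof (cases "x \<in> K")
          case True
          have "C * 1 \<le> C * (W x / W y)" using y(2)[OF True] W(2)[of y] C(1) by (intro mult_left_mono) auto
          then show ?thesis using C(2)[OF that, of x] by simp
        next
          case False
          then show ?thesis using g(2)[of "(t, x)"] C(1) W(2)[of x] W(2)[of y] by simp
        qed
        then show ?thesis using C(1) W(2)[of y] by (intro exI[of _ "C / W y"]) (auto simp: less_imp_le)
      qed
    qed
    {
      case 0
      then show ?case using c by simp
    next
      case (Suc k)
      have "\<exists>g'. has_pdiff e g g' \<and> CB W k g'" if e: "e \<in> Basis" for e
      proof -
        have p: "has_pdiff e g (pdiff e g)" "CB (\<lambda>_. 1) l (pdiff e g)" for l using CB_pdiff[OF Suc.prems(1) e] by auto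
        have "closed (snd -` K :: (real \<times> (real^'n)) set)"
          by (intro closed_vimage compact_imp_closed K continuous_intros)
        moreover have "{z. g z \<noteq> 0} \<subseteq> snd -` K" using Suc.prems(2) by auto
        ultimately have "closure {z. g z \<noteq> 0} \<subseteq> snd -` K" by (simp add: closure_minimal)
        then have "pdiff e g z = 0" if "snd z \<notin> K" for z
          using pdiff_support[of e g] closure_subset[of "{z. pdiff e g z \<noteq> 0}"] that by auto
        then have "CB W k (pdiff e g)" using Suc.IH p(2) by blast
        then show ?thesis using p(1) by blast
      qed
      then show ?case using c Suc.prems by simp
    }
  qed
  then show ?thesis using assms by blast
qed

lemma CB_xbox_rho: "m > 0 \<Longrightarrow> CB rho k (xbox m a b)"
  by (rule CB_support_weight[OF CB_xbox, where K="cbox a b"])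
     (auto simp: rho_pos intro!: xbox_zero continuous_intros dest: subsetD[OF box_subset_cbox])

text \<open>Each spatial derivative of a dilated function gains a factor \<epsilon>. This is what
  removes the derivatives of the cutoff in the limit.\<close>

lemma has_pdiff_scale:
  assumes "has_pdiff (ex j) X X'"
  shows "has_pdiff (ex j) (\<lambda>z. X (fst z, \<epsilon> *\<^sub>R snd z)) (\<lambda>z. \<epsilon> * X' (fst z, \<epsilon> *\<^sub>R snd z))"
  unfolding has_pdiff_def
proof
  fix z :: "real \<times> (real^'a)"
  have "((\<lambda>s. s * \<epsilon>) has_real_derivative \<epsilon>) (at 0)" by (auto intro!: derivative_eq_intros)
  from DERIV_chain2[OF has_pdiff_at[OF assms, of "(fst z, \<epsilon> *\<^sub>R snd z)" "0 * \<epsilon>"] this]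
  show "((\<lambda>s. X (fst (z + s *\<^sub>R ex j), \<epsilon> *\<^sub>R snd (z + s *\<^sub>R ex j))) has_real_derivative \<epsilon> * X' (fst z, \<epsilon> *\<^sub>R snd z)) (at 0)"
    by (simp add: ex_def algebra_simps)
qed

lemma CB_scale:
  "CB (\<lambda>_. 1) k X \<Longrightarrow> CB (\<lambda>_. 1) k (\<lambda>z. X (fst z, \<epsilon> *\<^sub>R snd z))"
proof (induction k arbitrary: X)
  have c: "C0 (\<lambda>_. 1) (\<lambda>z. X (fst z, \<epsilon> *\<^sub>R snd z))" if "C0 (\<lambda>_. 1) X" for X :: "real \<times> (real^'a) \<Rightarrow> real"
  proof -
    have "continuous_on UNIV (\<lambda>z. X (fst z, \<epsilon> *\<^sub>R snd z))"
      by (rule continuous_on_compose2[OF C0_continuous[OF that]], intro continuous_intros) simp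
    moreover have "\<exists>C\<ge>0. \<forall>t x. \<bar>t\<bar> \<le> \<tau> \<longrightarrow> \<bar>X (t, \<epsilon> *\<^sub>R x)\<bar> \<le> C * 1" for \<tau>
      using C0_bound[OF that, of \<tau>] by metis
    ultimately show ?thesis unfolding C0_def by simp
  qed
  {
    case 0
    then show ?case using c by simp
  next
    case (Suc k)
    have "\<exists>g'. has_pdiff e (\<lambda>z. X (fst z, \<epsilon> *\<^sub>R snd z)) g' \<and> CB (\<lambda>_. 1) k g'" if e: "e \<in> Basis" for e
      using e
    proof (cases rule: Basis_cases)
      case 1
      obtain X' where X': "has_pdiff et X X'" "CB (\<lambda>_. 1) k X'" using Suc.prems et_Basis by fastforce
      have "has_pdiff et (\<lambda>z. X (fst z, \<epsilon> *\<^sub>R snd z)) (\<lambda>z. X' (fst z, \<epsilon> *\<^sub>R snd z))"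
        using X'(1) by (simp add: has_pdiff_def et_def)
      then show ?thesis using Suc.IH[OF X'(2)] 1 by blast
    next
      case (2 j)
      obtain X' where X': "has_pdiff (ex j) X X'" "CB (\<lambda>_. 1) k X'" using Suc.prems ex_Basis by fastforce
      show ?thesis unfolding 2 using has_pdiff_scale[OF X'(1)] CB_cmult[OF Suc.IH[OF X'(2)]] by blast
    qed
    then show ?case using c Suc.prems by simp
  }
qed

section \<open>Test functions built from potentials\<close>

lemma CB_Jop_time:
  fixes g :: "real \<times> (real^'n::finite) \<Rightarrow> real"
  assumes "\<And>k. CB (\<lambda>_. 1) k g" "\<And>t x y. g (t, x) = g (t, y)"
  shows "CB (\<lambda>_. 1) k (Jop g)"
proof -
  have g0: "C0 (\<lambda>_. 1) g" using assms(1)[of 0] by simp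
  have J: "C0 (\<lambda>_. 1) (Jop g)" by (rule C0_Jop[OF g0])
  have "\<exists>g'. has_pdiff e (Jop g) g' \<and> CB (\<lambda>_. 1) k g'" if "e \<in> Basis" for e k
    using that
  proof (cases rule: Basis_cases)
    case 1
    then show ?thesis using Jop_time_derivative[OF C0_continuous[OF g0]] assms(1) by (auto simp: et_def)
  next
    case (2 j)
    have "Jop g (z + s *\<^sub>R ex j) = Jop g z" for z s
      using assms(2)[of _ "snd z + s *\<^sub>R axis j 1" "snd z"] by (simp add: Jop_def ex_def)
    then have "has_pdiff e (Jop g) (\<lambda>_. 0)" by (simp add: 2 has_pdiff_def)
    then show ?thesis using CB_zero[of "\<lambda>_. 1" k] by auto
  qed
  then show ?thesis using J by (cases k) auto
qed

lemma Jop_DERIV: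
  assumes "continuous_on UNIV g"
  shows "((\<lambda>t. Jop g (t, x)) has_real_derivative g (t, x)) (at t)"
  using has_pdiff_at[OF Jop_time_derivative[OF assms], of "(0, x)" t] by simp

lemma DERIV_zero_const_on:
  fixes f :: "real \<Rightarrow> real"
  assumes "convex S" "\<And>t. t \<in> S \<Longrightarrow> (f has_real_derivative 0) (at t)" "s \<in> S" "t \<in> S"
  shows "f s = f t"
  using has_field_derivative_zero_constant[of S f] assms has_field_derivative_at_within by metis

text \<open>A time profile equal to \<open>\<integral>\<^sub>t\<^sup>T\<close> of the bump for \<open>t \<ge> 0\<close>, made compactly supported by a correction at negative times.\<close>

lemma time_profile:
  fixes T t0 t1 m :: real
  assumes t: "0 < t0" "t0 < t1" "t1 < T" and m: "m > 0"
  obtains A B :: "real \<times> (real^'n::finite) \<Rightarrow> real" where "\<And>k. CB (\<lambda>_. 1) k A" "C0 (\<lambda>_. 1) B" "has_pdiff et A B" "\<And>j. has_pdiff (ex j) A (\<lambda>_. 0)"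
    "\<And>z. fst z \<ge> 0 \<Longrightarrow> B z = - tbox m t0 t1 z" "\<And>z. fst z \<le> -2 \<or> t1 \<le> fst z \<Longrightarrow> A z = 0"
    "\<And>s x. 0 \<le> s \<Longrightarrow> s \<le> T \<Longrightarrow> 0 \<le> A (s, x) \<and>
        ennreal (A (s, x)) = (\<integral>\<^sup>+r. ennreal (bump m t0 t1 r) * indicator {s..T} r \<partial>lborel)"
proof -
  define g1 :: "real \<times> (real^'n) \<Rightarrow> real" where "g1 = tbox m t0 t1"
  define g0 :: "real \<times> (real^'n) \<Rightarrow> real" where "g0 = tbox 1 (-2) (-1)"
  define F1 where "F1 s = Jop g1 (s, 0)" for s
  define F0 where "F0 s = Jop g0 (s, 0)" for s
  have J1: "Jop g1 z = F1 (fst z)" and J0: "Jop g0 z = F0 (fst z)" for z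
    by (auto simp: F1_def F0_def Jop_def g1_def g0_def tbox_def)
  have c: "continuous_on UNIV g1" "continuous_on UNIV g0" by (auto simp: g1_def g0_def continuous_tbox)
  have D1: "(F1 has_real_derivative bump m t0 t1 s) (at s)" and D0: "(F0 has_real_derivative bump 1 (-2) (-1) s) (at s)" for s
    using Jop_DERIV[OF c(1), of 0 s] Jop_DERIV[OF c(2), of 0 s] by (auto simp: F1_def[abs_def] F0_def[abs_def] g1_def g0_def tbox_def)
  have F1_neg: "F1 s = 0" if "s \<le> 0" for s
  proof -
    have "\<theta> * s \<le> 0" if "\<theta> \<in> {0..1}" for \<theta> using that \<open>s \<le> 0\<close> by (auto simp: mult_nonneg_nonpos)
    then have "bump m t0 t1 (\<theta> * s) * indicator {0..1} \<theta> = 0" for \<theta>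
      using t(1) bump_zero[OF m, of t0 "\<theta> * s" t1] by (cases "\<theta> \<in> {0..1}") force+
    then show ?thesis unfolding F1_def Jop_def g1_def tbox_def fst_conv by (simp only: ) simp
  qed
  have F0_pos: "F0 s = 0" if "s \<ge> 0" for s
  proof -
    have "0 \<le> \<theta> * s" if "\<theta> \<in> {0..1}" for \<theta> using that \<open>s \<ge> 0\<close> by auto
    then have "bump 1 (-2) (-1) (\<theta> * s) * indicator {0..1} \<theta> = 0" for \<theta>
      using bump_zero[of 1 "-2" "\<theta> * s" "-1"] by (cases "\<theta> \<in> {0..1}") force+
    then show ?thesis unfolding F0_def Jop_def g0_def tbox_def fst_conv by (simp only: ) simp
  qed
  have F1_const: "F1 s = F1 t1" if "t1 \<le> s" for s
  proof (rule DERIV_zero_const_on[of "{t1..}" F1])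
    show "(F1 has_real_derivative 0) (at r)" if "r \<in> {t1..}" for r
      using D1[of r] bump_zero[OF m, of t0 r t1] that by simp
  qed (use that in auto)
  have F0_const: "F0 s = F0 (-2)" if "s \<le> -2" for s
  proof (rule DERIV_zero_const_on[of "{..-2}" F0])
    show "(F0 has_real_derivative 0) (at r)" if "r \<in> {..-2}" for r
      using D0[of r] bump_zero[of 1 "-2" r "-1"] that by simp
  qed (use that in auto)
  have "F0 (-2) < F0 (-1)"
  proof (rule DERIV_pos_imp_increasing_open[of "-2" "-1" F0])
    show "\<exists>y. (F0 has_real_derivative y) (at x) \<and> 0 < y" if "-2 < x" "x < -1" for x
      using D0[of x] bump_pos_iff[of 1 "-2" "-1" x] that by auto
    show "continuous_on {-2..-1} F0" using D0 DERIV_isCont by (blast intro: continuous_at_imp_continuous_on)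
  qed simp
  also have "F0 (-1) \<le> F0 0"
    using DERIV_nonneg_imp_nondecreasing[of "-1" 0 F0] D0 bump_nonneg by fastforce
  finally have neg: "F0 (-2) < 0" using F0_pos[of 0] by simp
  \<comment> \<open>Test functions live on all real times, but \<open>F1 t1 - F1\<close> equals
    \<open>F1 t1\<close> for every negative time. The second bump lies in \<open>(-2, -1)\<close>,
    and its primitive \<open>F0\<close> is 0 for nonnegative times and a negative constant before
    -2. This multiple of it cancels \<open>F1 t1\<close> there.\<close>
  define cc where "cc = - F1 t1 / F0 (-2)"
  define A where "A z = F1 t1 + (-1) * Jop g1 z + cc * Jop g0 z" for z
  define B where "B z = 0 + (-1) * g1 z + cc * g0 z" for z
  have CBJ: "CB (\<lambda>_. 1) k (Jop g1)" "CB (\<lambda>_. 1) k (Jop g0)" for k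
    by (rule CB_Jop_time; simp add: g1_def g0_def CB_tbox; simp add: tbox_def)+
  show ?thesis
  proof (rule that)
    show "CB (\<lambda>_. 1) k A" for k unfolding A_def[abs_def] by (intro CB_add CB_cmult CB_const CBJ)
    show "C0 (\<lambda>_. 1) B" unfolding B_def[abs_def] g1_def g0_def by (intro C0_add C0_cmult C0_const CB_C0[OF CB_tbox])
    show "has_pdiff et A B" unfolding A_def[abs_def] B_def[abs_def] et_def
      by (intro has_pdiff_add has_pdiff_cmult has_pdiff_const Jop_time_derivative c)
    show "has_pdiff (ex j) A (\<lambda>_. 0)" for j by (simp add: has_pdiff_def A_def J1 J0 ex_def)
    show "B z = - tbox m t0 t1 z" if "fst z \<ge> 0" for z
      using that by (simp add: B_def g1_def g0_def tbox_def bump_zero)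
    show "A z = 0" if "fst z \<le> -2 \<or> t1 \<le> fst z" for z
      using that
    proof
      assume "fst z \<le> -2"
      then show ?thesis using neg F1_neg[of "fst z"] F0_const[of "fst z"] by (simp add: A_def J1 J0 cc_def)
    next
      assume "t1 \<le> fst z"
      then show ?thesis using t F1_const[of "fst z"] F0_pos[of "fst z"] by (simp add: A_def J1 J0)
    qed
    fix s x assume s: "0 \<le> s" "s \<le> T"
    have A: "A (s, x) = F1 T - F1 s" using s t F1_const[of T] F0_pos[of s] by (simp add: A_def J1 J0)
    have "(\<integral>\<^sup>+r. ennreal (bump m t0 t1 r) * indicator {s..T} r \<partial>lborel) = ennreal (F1 T - F1 s)"
    proof (rule nn_integral_FTC_Icc)
      have "continuous_on UNIV (\<lambda>r. g1 (r, 0))"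
        by (rule continuous_on_compose2[OF c(1)], intro continuous_intros) simp
      then show "bump m t0 t1 \<in> borel_measurable borel"
        by (simp add: g1_def tbox_def borel_measurable_continuous_onI)
    qed (use D1 bump_nonneg s in auto)
    moreover have "F1 s \<le> F1 T"
      using DERIV_nonneg_imp_nondecreasing[of s T F1] D1 bump_nonneg s(2) by blast
    ultimately show "0 \<le> A (s, x) \<and> ennreal (A (s, x)) = (\<integral>\<^sup>+r. ennreal (bump m t0 t1 r) * indicator {s..T} r \<partial>lborel)"
      using A by simp
  qed
qed

section \<open>Products of a time profile and a time-independent potential\<close>

definition time_indep :: "(real \<times> (real^'n::finite) \<Rightarrow> real) \<Rightarrow> bool" where
  "time_indep g \<longleftrightarrow> (\<forall>t t' x. g (t, x) = g (t', x))"

lemma time_indep_pd: "time_indep g \<Longrightarrow> has_pdiff et g (\<lambda>_. 0)"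
proof -
  assume "time_indep g"
  then have "g (z + s *\<^sub>R et) = g z" for z s
    unfolding time_indep_def et_def by (metis add.right_neutral add_Pair prod.collapse scaleR_Pair scaleR_zero_right)
  then show ?thesis by (simp add: has_pdiff_def)
qed

lemma time_indepD: "time_indep g \<Longrightarrow> g (t, x) = g (t', x)"
  unfolding time_indep_def by blast

lemma time_indep_pdiff: "time_indep g \<Longrightarrow> time_indep (pdiff (ex j) g)"
  unfolding time_indep_def[of "pdiff _ _"] pdiff_def
  by (intro allI arg_cong[where f="\<lambda>h. deriv h 0"] ext) (simp add: ex_def, erule time_indepD)

lemma time_indep_Aop: "time_indep g \<Longrightarrow> time_indep (Aop \<sigma> k g)"
  unfolding time_indep_def[of "Aop _ _ _"] Aop_def
  by (intro allI Bochner_Integration.integral_cong refl) (simp, metis time_indepD)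

lemma time_indep_scale: "time_indep g \<Longrightarrow> time_indep (\<lambda>z. g (fst z, \<epsilon> *\<^sub>R snd z))"
  unfolding time_indep_def by auto

lemma time_indep_add: "time_indep f \<Longrightarrow> time_indep g \<Longrightarrow> time_indep (\<lambda>z. f z + g z)"
  and time_indep_mult: "time_indep f \<Longrightarrow> time_indep g \<Longrightarrow> time_indep (\<lambda>z. f z * g z)"
  unfolding time_indep_def by metis+

lemma time_indep_sum: "finite I \<Longrightarrow> (\<And>i. i \<in> I \<Longrightarrow> time_indep (g i)) \<Longrightarrow> time_indep (\<lambda>z. \<Sum>i\<in>I. g i z)"
  by (induction I rule: finite_induct) (auto simp: time_indep_add, auto simp: time_indep_def)

lemma tensor_pdiff:
  fixes A P :: "real \<times> (real^'n::finite) \<Rightarrow> real"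
  assumes A: "has_pdiff et A B" "\<And>j. has_pdiff (ex j) A (\<lambda>_. 0)"
    and P: "time_indep P" "\<And>j. has_pdiff (ex j) P (P1 j)" "\<And>j. has_pdiff (ex j) (P1 j) (P2 j)" "\<And>j. time_indep (P2 j)"
  defines "\<phi> \<equiv> \<lambda>z. A z * P z"
  shows "pdiff et \<phi> z = B z * P z" "pdiff (ex j) \<phi> z = A z * P1 j z"
    "lap \<phi> z = A z * (\<Sum>j\<in>UNIV. P2 j z)" "pdiff et (lap \<phi>) z = B z * (\<Sum>j\<in>UNIV. P2 j z)"
proof -
  show "pdiff et \<phi> z = B z * P z"
    using has_pdiff_pdiff[OF has_pdiff_mult[OF A(1) time_indep_pd[OF P(1)]]] by (simp add: \<phi>_def)
  have 1: "pdiff (ex j) \<phi> = (\<lambda>z. A z * P1 j z)" for j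
    using has_pdiff_pdiff[OF has_pdiff_mult[OF A(2) P(2)]] by (simp add: \<phi>_def)
  then show "pdiff (ex j) \<phi> z = A z * P1 j z" by simp
  have 2: "pdiff (ex j) (pdiff (ex j) \<phi>) = (\<lambda>z. A z * P2 j z)" for j
    using has_pdiff_pdiff[OF has_pdiff_mult[OF A(2) P(3)]] by (simp add: 1)
  have 3: "lap \<phi> = (\<lambda>z. A z * (\<Sum>j\<in>UNIV. P2 j z))"
    by (simp add: lap_eq 2 sum_distrib_left)
  then show "lap \<phi> z = A z * (\<Sum>j\<in>UNIV. P2 j z)" by simp
  have "time_indep (\<lambda>z. \<Sum>j\<in>UNIV. P2 j z)" using P(4) by (intro time_indep_sum) auto
  from has_pdiff_pdiff[OF has_pdiff_mult[OF A(1) time_indep_pd[OF this]]]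
  show "pdiff et (lap \<phi>) z = B z * (\<Sum>j\<in>UNIV. P2 j z)" by (simp add: 3)
qed

text \<open>The value 1 at the origin is enough: as \<epsilon> tends to 0 the dilated cutoff tends
  to it pointwise, so no plateau is built.\<close>

lemma cutoff_exists:
  obtains X :: "real \<times> (real^'n::finite) \<Rightarrow> real" where "\<And>k. CB (\<lambda>_. 1) k X" "time_indep X" "\<And>t. X (t, 0) = 1"
    "\<And>z. snd z \<notin> cbox (vec (-1)) (vec 1) \<Longrightarrow> X z = 0"
proof -
  define b where "b = (xbox 1 (vec (-1)) (vec 1) :: real \<times> (real^'n) \<Rightarrow> real)"
  have "b (0, 0) > 0" unfolding b_def xbox_def by (intro prod_pos) (simp add: bump_pos_iff)
  moreover have "time_indep b" by (simp add: time_indep_def b_def xbox_def)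
  then have "b (0, 0) = b (t, 0)" for t unfolding time_indep_def by blast
  moreover have "time_indep (\<lambda>z. (1 / b (0, 0)) * b z)" using \<open>time_indep b\<close> unfolding time_indep_def by metis
  moreover have "CB (\<lambda>_. 1) k (\<lambda>z. (1 / b (0, 0)) * b z)" for k unfolding b_def by (intro CB_cmult CB_xbox)
  moreover have "b z = 0" if "snd z \<notin> cbox (vec (-1)) (vec 1)" for z
    unfolding b_def by (rule xbox_zero) (use that box_subset_cbox[of "vec (-1) :: real^'n" "vec 1"] in auto)
  ultimately show ?thesis by (intro that[of "\<lambda>z. (1 / b (0, 0)) * b z"]) auto
qed

text \<open>\<open>w\<close> stands for the difference of two weak solutions and \<open>G\<close>
  for the difference of their fluxes. Only the Lipschitz bound of the flux is retained, the initial
  datum has cancelled, and both functions are Borel representatives that vanish outside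
  \<open>Omega T\<close>.\<close>

locale weak_diff =
  fixes T L :: real and w :: "real \<times> (real^'n::finite) \<Rightarrow> real" and G :: "'n \<Rightarrow> real \<times> (real^'n) \<Rightarrow> real"
  assumes T: "0 < T" and L: "0 \<le> L"
    and w_meas [measurable]: "w \<in> borel_measurable borel" and w_out: "\<And>z. z \<notin> Omega T \<Longrightarrow> w z = 0"
    and w_L2: "integrable lborel (\<lambda>z. (w z)\<^sup>2)"
    and G_meas [measurable]: "\<And>j. G j \<in> borel_measurable borel" and G_le: "\<And>j z. \<bar>G j z\<bar> \<le> L * \<bar>w z\<bar>"
    and weak: "\<And>\<phi>. test_fun T \<phi> \<Longrightarrow>
      (\<integral>z. w z * (pdiff et \<phi> z + lap \<phi> z - pdiff et (lap \<phi>) z) + (\<Sum>j\<in>UNIV. G j z * pdiff (ex j) \<phi> z) \<partial>lborel) = 0"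
begin

text \<open>Young's inequality gives \<open>|w| rho \<le> w^2 + rho^2\<close>; moreover
  \<open>rho \<le> 1\<close> and \<open>rho\<close> has finite integral over \<open>Omega T\<close>.
  This places L2 inside the weighted L1 space of the uniqueness argument.\<close>

lemma w_rho: "integrable lborel (\<lambda>z. \<bar>w z\<bar> * rho (snd z))"
proof -
  have r: "C0 rho (\<lambda>z::real \<times> (real^'n). rho (snd z))"
    by (rule C0_initial[of rho 1]) (auto simp: rho_pos less_imp_le intro!: continuous_intros)
  have i: "integrable lborel (\<lambda>z. (w z)\<^sup>2 + indicator (Omega T) z * rho (snd z))"
    by (intro Bochner_Integration.integrable_add w_L2 C0_integrable_Omega r)
  have rm: "(\<lambda>z::real \<times> (real^'n). rho (snd z)) \<in> borel_measurable borel"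
    by (rule borel_measurable_continuous_onI[OF C0_continuous[OF r]])
  show ?thesis
  proof (rule Bochner_Integration.integrable_bound[OF i])
    show "(\<lambda>z. \<bar>w z\<bar> * rho (snd z)) \<in> borel_measurable lborel" using rm by measurable
    show "AE z in lborel. norm (\<bar>w z\<bar> * rho (snd z)) \<le> norm ((w z)\<^sup>2 + indicator (Omega T) z * rho (snd z))"
    proof (rule AE_I2)
      fix z :: "real \<times> (real^'n)"
      have rp: "0 \<le> rho (snd z)" "rho (snd z) \<le> 1" using rho_pos[of "snd z"] rho_le by (auto simp: less_imp_le)
      have "0 \<le> (\<bar>w z\<bar> - rho (snd z))\<^sup>2" by simp
      then have "2 * (\<bar>w z\<bar> * rho (snd z)) \<le> (w z)\<^sup>2 + rho (snd z) * rho (snd z)"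
        by (simp add: power2_eq_square algebra_simps)
      also have "rho (snd z) * rho (snd z) \<le> 1 * rho (snd z)" using rp by (intro mult_right_mono) auto
      finally have "\<bar>w z\<bar> * rho (snd z) \<le> (w z)\<^sup>2 + rho (snd z)"
        using rp mult_nonneg_nonneg[of "\<bar>w z\<bar>" "rho (snd z)"] by linarith
      then show "norm (\<bar>w z\<bar> * rho (snd z)) \<le> norm ((w z)\<^sup>2 + indicator (Omega T) z * rho (snd z))"
        using rp w_out[of z] by (cases "z \<in> Omega T") auto
    qed
  qed
qed

lemma dominated_integrable:
  assumes "h \<in> borel_measurable borel" "\<And>z. \<bar>h z\<bar> \<le> C * (\<bar>w z\<bar> * rho (snd z))"
  shows "integrable lborel h"
  by (rule Bochner_Integration.integrable_bound[OF integrable_mult_right[OF w_rho, of C]])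
     (use assms in \<open>auto intro!: AE_I2 order_trans[OF _ abs_ge_self]\<close>)

lemma C0_bound_Omega:
  assumes "C0 W g"
  obtains C where "C \<ge> 0" "\<And>z. z \<in> Omega T \<Longrightarrow> \<bar>g z\<bar> \<le> C * W (snd z)"
proof -
  obtain C where C: "C \<ge> 0" "\<And>t x. \<bar>t\<bar> \<le> T \<Longrightarrow> \<bar>g (t, x)\<bar> \<le> C * W x" using C0_bound[OF assms] by metis
  have "\<bar>g z\<bar> \<le> C * W (snd z)" if "z \<in> Omega T" for z
    using C(2)[of "fst z" "snd z"] that by (auto simp: Omega_def)
  then show ?thesis using that C(1) by blast
qed

lemma C0_bounds_Omega:
  assumes "\<And>j::'n. C0 W (g j)" and W: "\<And>x. 0 \<le> W x"
  obtains C where "C \<ge> 0" "\<And>j z. z \<in> Omega T \<Longrightarrow> \<bar>g j z\<bar> \<le> C * W (snd z)"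
proof -
  have "\<exists>C\<ge>0. \<forall>z. z \<in> Omega T \<longrightarrow> \<bar>g j z\<bar> \<le> C * W (snd z)" for j
    using C0_bound_Omega[OF assms(1)] by metis
  then obtain C where C: "\<And>j. C j \<ge> 0" "\<And>j z. z \<in> Omega T \<Longrightarrow> \<bar>g j z\<bar> \<le> C j * W (snd z)" by metis
  have "\<bar>g j z\<bar> \<le> (\<Sum>j\<in>UNIV. C j) * W (snd z)" if "z \<in> Omega T" for j z
    by (rule order_trans[OF C(2)[OF that]]) (intro mult_right_mono W member_le_sum; use C(1) in simp)
  then show ?thesis using that[of "\<Sum>j\<in>UNIV. C j"] C(1) by (simp add: sum_nonneg)
qed

text \<open>Since \<open>(1 - \<Delta>) B g = g\<close>, the two terms with time derivatives
  collapse to the time bump times \<open>g\<close>, while \<open>\<Delta> B g = B g - g\<close>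
  turns the Laplacian term into a bounded one. \<open>B g\<close> decays like \<open>rho\<close> but
  has no compact support, so it is cut off at scale \<open>1 / e n\<close> before the weak equation
  is applied.\<close>

lemma tensor_identity:
  fixes a b :: "real^'n"
  assumes A: "\<And>k. CB (\<lambda>_. 1) k A" "C0 (\<lambda>_. 1) B" "has_pdiff et A B" "\<And>j. has_pdiff (ex j) A (\<lambda>_. 0)"
      "\<And>z. fst z \<ge> 0 \<Longrightarrow> B z = - tbox m t0 t1 z" "\<And>z. fst z \<le> -2 \<or> t1 \<le> fst z \<Longrightarrow> A z = 0"
    and t: "t1 < T" and m: "m > 0"
  defines "g \<equiv> xbox m a b"
  shows "(\<integral>z. w z * (tbox m t0 t1 z * g z) \<partial>lborel) =
    (\<integral>z. A z * (w z * (Aop 1 (ker None) g z - g z) + (\<Sum>j\<in>UNIV. G j z * Aop 1 (ker (Some j)) g z)) \<partial>lborel)"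
proof -
  have g: "CB rho k g" for k unfolding g_def by (rule CB_xbox_rho[OF m])
  have to1: "CB rho k h \<Longrightarrow> CB (\<lambda>_. 1) k h" for k and h :: "real \<times> (real^'n) \<Rightarrow> real" using CB_weight rho_le by blast
  define g1 where "g1 j = pdiff (ex j) g" for j
  define g2 where "g2 j = pdiff (ex j) (g1 j)" for j
  have g1: "CB rho k (g1 j)" "has_pdiff (ex j) g (g1 j)" for j k using CB_pdiff[OF g ex_Basis] by (auto simp: g1_def)
  have g2: "CB rho k (g2 j)" "has_pdiff (ex j) (g1 j) (g2 j)" for j k using CB_pdiff[OF g1(1) ex_Basis] by (auto simp: g2_def)
  note C1 = CB_C0[OF to1[OF g]] CB_C0[OF to1[OF g1(1)]] CB_C0[OF to1[OF g2(1)]]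
  define P where "P = Aop 1 (ker None) g"
  define P1 where "P1 j = Aop 1 (ker (Some j)) g" for j
  define P2 where "P2 j = Aop 1 (ker None) (g2 j)" for j
  have P1_eq: "P1 j = Aop 1 (ker None) (g1 j)" for j
    unfolding P1_def using Aop_Some_eq[OF C1(1,2) g1(2)] by auto
  have tg: "time_indep g" by (simp add: g_def time_indep_def xbox_def)
  have tP: "time_indep P" "time_indep (P1 j)" "time_indep (P2 j)" for j
    unfolding P_def P1_def P2_def g2_def g1_def by (intro time_indep_Aop time_indep_pdiff tg)+
  have pP: "has_pdiff (ex j) P (P1 j)" "has_pdiff (ex j) (P1 j) (P2 j)" for j
    unfolding P_def P1_eq P2_def by (rule has_pdiff_Aop[OF _ C1(1) C1(2) g1(2)] has_pdiff_Aop[OF _ C1(2) C1(3) g2(2)], simp)+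
  have cP: "CB rho k P" "CB rho k (P1 j)" "CB rho k (P2 j)" for k j
    unfolding P_def P1_eq P2_def by (rule CB_Aop[OF weight_rho]; simp add: g g1 g2)+
  have P2_sum: "(\<Sum>j\<in>UNIV. P2 j z) = P z - g z" for z
  proof -
    have "Aop 1 (ker None) (\<lambda>z. g z - (\<Sum>j\<in>UNIV. g2 j z)) z = g z"
      by (rule Aop_resolvent[OF C1(1) C1(2) g1(2) C1(3) g2(2)])
    moreover have "C0 (\<lambda>_. 1) (\<lambda>z. \<Sum>j\<in>UNIV. g2 j z)" by (intro C0_sum C1) auto
    then have "Aop 1 (ker None) (\<lambda>z. g z - (\<Sum>j\<in>UNIV. g2 j z)) z = P z - (\<Sum>j\<in>UNIV. P2 j z)"
      using C1(3) by (simp add: Aop_diff[OF _ C1(1)] Aop_sum P_def P2_def)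
    ultimately show ?thesis by simp
  qed
  obtain X where X: "\<And>k. CB (\<lambda>_. 1) k X" "time_indep X" "\<And>t. X (t, 0) = 1" "\<And>z. snd z \<notin> cbox (vec (-1)) (vec 1 :: real^'n) \<Longrightarrow> X z = 0"
    using cutoff_exists by blast
  define X1 where "X1 j = pdiff (ex j) X" for j
  define X2 where "X2 j = pdiff (ex j) (X1 j)" for j
  have X1: "CB (\<lambda>_. 1) k (X1 j)" "has_pdiff (ex j) X (X1 j)" "time_indep (X1 j)" for j k
    using CB_pdiff[OF X(1) ex_Basis] time_indep_pdiff[OF X(2)] by (auto simp: X1_def)
  have X2: "CB (\<lambda>_. 1) k (X2 j)" "has_pdiff (ex j) (X1 j) (X2 j)" "time_indep (X2 j)" for j k
    using CB_pdiff[OF X1(1) ex_Basis] time_indep_pdiff[OF X1(3)] by (auto simp: X2_def)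
  define e where "e n = 1 / real (Suc n)" for n
  have e: "0 < e n" "e n \<le> 1" for n by (auto simp: e_def)
  have e0: "e \<longlonglongrightarrow> 0" unfolding e_def[abs_def] by (rule LIMSEQ_inverse_real_of_nat[unfolded inverse_eq_divide])
  define S where "S n z = (fst z, e n *\<^sub>R snd z)" for n and z :: "real \<times> (real^'n)"
  define Q where "Q n z = X (S n z) * P z" for n z
  define Q1 where "Q1 n j z = X (S n z) * P1 j z + (e n * X1 j (S n z)) * P z" for n j z
  \<comment> \<open>Grouped exactly as two applications of the product rule produce it. Every term
    with a derivative of the cutoff carries a factor \<open>e n\<close>.\<close>
  define Q2 where "Q2 n j z = (X (S n z) * P2 j z + (e n * X1 j (S n z)) * P1 j z) +
      ((e n * X1 j (S n z)) * P1 j z + (e n * (e n * X2 j (S n z))) * P z)" for n j z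
  have tS: "time_indep (\<lambda>z. h (S n z))" if "time_indep h" for h n unfolding S_def using time_indep_scale[OF that] .
  have pQ1: "has_pdiff (ex j) (Q n) (Q1 n j)" for n j
    unfolding Q_def[abs_def] Q1_def[abs_def] S_def by (rule has_pdiff_mult[OF has_pdiff_scale[OF X1(2)] pP(1)])
  have pQ2: "has_pdiff (ex j) (Q1 n j) (Q2 n j)" for n j
    unfolding Q1_def[abs_def] Q2_def[abs_def] S_def
    by (intro has_pdiff_add has_pdiff_mult has_pdiff_cmult has_pdiff_scale X1(2) X2(2) pP)
  have tQ: "time_indep (Q n)" "time_indep (Q2 n j)" for n j
  proof -
    have tc: "time_indep (\<lambda>z. c * h z)" if "time_indep h" for c and h :: "real \<times> (real^'n) \<Rightarrow> real"
      using that by (simp add: time_indep_def)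
    note x = tS[OF X(2), of n] tc[OF tS[OF X1(3)[of j], of n], of "e n"] tc[OF tc[OF tS[OF X2(3)[of j], of n], of "e n"], of "e n"]
    show "time_indep (Q n)" unfolding Q_def[abs_def] by (rule time_indep_mult[OF x(1) tP(1)])
    show "time_indep (Q2 n j)" unfolding Q2_def[abs_def]
      by (rule time_indep_add[OF time_indep_add[OF time_indep_mult[OF x(1) tP(3)] time_indep_mult[OF x(2) tP(2)]]
            time_indep_add[OF time_indep_mult[OF x(2) tP(2)] time_indep_mult[OF x(3) tP(1)]]])
  qed
  define \<phi> where "\<phi> n z = A z * Q n z" for n z
  note has_pdiff\<phi> = tensor_pdiff[OF A(3,4) tQ(1) pQ1 pQ2 tQ(2), folded \<phi>_def]
  have test: "test_fun T (\<phi> n)" for n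
    unfolding test_fun_def
  proof (intro conjI)
    have "CB (\<lambda>_. 1) k (\<phi> n)" for k
      unfolding \<phi>_def[abs_def] Q_def S_def by (intro CB_mult A(1) CB_scale X(1) to1[OF cP(1)])
    then show "Cinf_on UNIV (\<phi> n)" by (rule CB_Cinf)
    let ?R = "1 / e n"
    have R: "?R * e n = 1" using e(1)[of n] by simp
    have "{z. \<phi> n z \<noteq> 0} \<subseteq> {-2..t1} \<times> cbox (vec (- ?R)) (vec ?R)"
    proof
      fix z assume "z \<in> {z. \<phi> n z \<noteq> 0}"
      then have nz: "A z \<noteq> 0" "X (S n z) \<noteq> 0" by (auto simp: \<phi>_def Q_def)
      have "fst z \<in> {-2..t1}" using nz(1) A(6)[of z] by force
      moreover have "e n *\<^sub>R snd z \<in> cbox (vec (-1)) (vec 1)" using nz(2) X(4)[of "S n z"] by (auto simp: S_def)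
      then have "snd z \<in> cbox (vec (- ?R)) (vec ?R)"
        using e(1)[of n] by (simp add: mem_box_cart field_simps)
      ultimately show "z \<in> {-2..t1} \<times> cbox (vec (- ?R)) (vec ?R)" by (cases z) auto
    qed
    moreover have K: "compact ({-2..t1} \<times> cbox (vec (- ?R)) (vec ?R :: real^'n))" by (intro compact_Times) auto
    ultimately have sub: "closure {z. \<phi> n z \<noteq> 0} \<subseteq> {-2..t1} \<times> cbox (vec (- ?R)) (vec ?R)"
      by (intro closure_minimal compact_imp_closed)
    then show "compact_support (\<phi> n)"
      unfolding compact_support_def by (metis K closed_closure compact_Int_closed inf.absorb2)
    show "closure {z. \<phi> n z \<noteq> 0} \<subseteq> {..<T} \<times> UNIV" using sub t by auto
  qed
  define I where "I n z = w z * (B z * Q n z + A z * (\<Sum>j\<in>UNIV. Q2 n j z) - B z * (\<Sum>j\<in>UNIV. Q2 n j z)) +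
      (\<Sum>j\<in>UNIV. G j z * (A z * Q1 n j z))" for n z
  have int0: "(\<integral>z. I n z \<partial>lborel) = 0" for n
    using weak[OF test] by (simp add: has_pdiff\<phi> I_def)
  define J where "J z = w z * (B z * P z + A z * (\<Sum>j\<in>UNIV. P2 j z) - B z * (\<Sum>j\<in>UNIV. P2 j z)) +
      (\<Sum>j\<in>UNIV. G j z * (A z * P1 j z))" for z
  have Slim: "(\<lambda>n. h (S n z)) \<longlonglongrightarrow> h (fst z, 0)" if "continuous_on UNIV h" for h :: "real \<times> (real^'n) \<Rightarrow> real" and z
  proof -
    have "(\<lambda>n. S n z) \<longlonglongrightarrow> (fst z, 0 *\<^sub>R snd z)" unfolding S_def by (intro tendsto_intros e0)
    moreover have "isCont h (fst z, 0)" using that by (simp add: continuous_on_eq_continuous_at)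
    ultimately show ?thesis using isCont_tendsto_compose by fastforce
  qed
  note cX = C0_continuous[OF CB_C0[OF X(1)]] C0_continuous[OF CB_C0[OF X1(1)]] C0_continuous[OF CB_C0[OF X2(1)]]
  have Qlim: "(\<lambda>n. Q n z) \<longlonglongrightarrow> P z" "(\<lambda>n. Q1 n j z) \<longlonglongrightarrow> P1 j z" "(\<lambda>n. Q2 n j z) \<longlonglongrightarrow> P2 j z" for z j
  proof -
    have x: "(\<lambda>n. X (S n z)) \<longlonglongrightarrow> 1" using Slim[OF cX(1), of z] X(3) by simp
    have x1: "(\<lambda>n. e n * X1 j (S n z)) \<longlonglongrightarrow> 0" using tendsto_mult[OF e0 Slim[OF cX(2), of j z]] by simp
    have x2: "(\<lambda>n. e n * (e n * X2 j (S n z))) \<longlonglongrightarrow> 0"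
      using tendsto_mult[OF e0 tendsto_mult[OF e0 Slim[OF cX(3), of j z]]] by simp
    show "(\<lambda>n. Q n z) \<longlonglongrightarrow> P z" unfolding Q_def using tendsto_mult_right[OF x, of "P z"] by simp
    show "(\<lambda>n. Q1 n j z) \<longlonglongrightarrow> P1 j z"
      unfolding Q1_def using tendsto_add[OF tendsto_mult_right[OF x, of "P1 j z"] tendsto_mult_right[OF x1, of "P z"]] by simp
    show "(\<lambda>n. Q2 n j z) \<longlonglongrightarrow> P2 j z"
      unfolding Q2_def using tendsto_add[OF tendsto_add[OF tendsto_mult_right[OF x, of "P2 j z"] tendsto_mult_right[OF x1, of "P1 j z"]]
          tendsto_add[OF tendsto_mult_right[OF x1, of "P1 j z"] tendsto_mult_right[OF x2, of "P z"]]] by simp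
  qed
  obtain K1 where K1: "K1 \<ge> 0" "\<And>z. z \<in> Omega T \<Longrightarrow> \<bar>A z\<bar> \<le> K1 * 1" using C0_bound_Omega[OF CB_C0[OF A(1)]] by metis
  obtain K2 where K2: "K2 \<ge> 0" "\<And>z. z \<in> Omega T \<Longrightarrow> \<bar>B z\<bar> \<le> K2 * 1" using C0_bound_Omega[OF A(2)] by metis
  obtain x0 where x0: "x0 \<ge> 0" "\<And>z. z \<in> Omega T \<Longrightarrow> \<bar>X z\<bar> \<le> x0 * 1" using C0_bound_Omega[OF CB_C0[OF X(1)]] by metis
  obtain x1 where x1: "x1 \<ge> 0" "\<And>j z. z \<in> Omega T \<Longrightarrow> \<bar>X1 j z\<bar> \<le> x1 * 1"
    using C0_bounds_Omega[of "\<lambda>_. 1" X1, OF CB_C0[OF X1(1)]] by (metis zero_le_one)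
  obtain x2 where x2: "x2 \<ge> 0" "\<And>j z. z \<in> Omega T \<Longrightarrow> \<bar>X2 j z\<bar> \<le> x2 * 1"
    using C0_bounds_Omega[of "\<lambda>_. 1" X2, OF CB_C0[OF X2(1)]] by (metis zero_le_one)
  note rn = less_imp_le[OF rho_pos]
  obtain p0 where p0: "p0 \<ge> 0" "\<And>z. z \<in> Omega T \<Longrightarrow> \<bar>P z\<bar> \<le> p0 * rho (snd z)" using C0_bound_Omega[OF CB_C0[OF cP(1)]] by metis
  obtain p1 where p1: "p1 \<ge> 0" "\<And>j z. z \<in> Omega T \<Longrightarrow> \<bar>P1 j z\<bar> \<le> p1 * rho (snd z)"
    using C0_bounds_Omega[of rho P1, OF CB_C0[OF cP(2)] rn] by metis
  obtain p2 where p2: "p2 \<ge> 0" "\<And>j z. z \<in> Omega T \<Longrightarrow> \<bar>P2 j z\<bar> \<le> p2 * rho (snd z)"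
    using C0_bounds_Omega[of rho P2, OF CB_C0[OF cP(3)] rn] by metis
  define x where "x = x0 + x1 + x2"
  define p where "p = p0 + p1 + p2"
  \<comment> \<open>The longest of the three expressions, \<open>Q2\<close>, has four products, each
    bounded by \<open>x * p * rho\<close>.\<close>
  define M where "M = 4 * (x * p)"
  have xp: "x \<ge> 0" "p \<ge> 0" "M \<ge> 0" "x0 \<le> x" "x1 \<le> x" "x2 \<le> x" "p0 \<le> p" "p1 \<le> p" "p2 \<le> p" using x0 x1 x2 p0 p1 p2 by (auto simp: x_def p_def M_def)
  define K where "K = K1 + K2"
  have K: "K \<ge> 0" "K1 \<le> K" "K2 \<le> K" using K1 K2 by (auto simp: K_def)
  have Qb: "\<bar>Q n z\<bar> \<le> M * rho (snd z)" "\<bar>Q1 n j z\<bar> \<le> M * rho (snd z)" "\<bar>Q2 n j z\<bar> \<le> M * rho (snd z)" if z: "z \<in> Omega T" for n j z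
  proof -
    have Sz: "S n z \<in> Omega T" using z by (auto simp: S_def Omega_def)
    let ?r = "rho (snd z)"
    have r: "?r \<ge> 0" by (rule rn)
    have bp: "\<bar>P z\<bar> \<le> p * ?r" "\<bar>P1 j z\<bar> \<le> p * ?r" "\<bar>P2 j z\<bar> \<le> p * ?r"
      using p0(2)[OF z] p1(2)[OF z, of j] p2(2)[OF z, of j] mult_right_mono[OF xp(7) r] mult_right_mono[OF xp(8) r] mult_right_mono[OF xp(9) r] by linarith+
    have bX: "\<bar>X (S n z)\<bar> \<le> x" "\<bar>X1 j (S n z)\<bar> \<le> x" "\<bar>X2 j (S n z)\<bar> \<le> x"
      using x0(2)[OF Sz] x1(2)[OF Sz, of j] x2(2)[OF Sz, of j] xp by linarith+
    have bX': "\<bar>e n * y\<bar> \<le> x" if "\<bar>y\<bar> \<le> x" for y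
    proof -
      have "\<bar>e n\<bar> * \<bar>y\<bar> \<le> 1 * x" using e[of n] that by (intro mult_mono) auto
      then show ?thesis by (simp add: abs_mult)
    qed
    have mm: "\<bar>y * y'\<bar> \<le> x * (p * ?r)" if "\<bar>y\<bar> \<le> x" "\<bar>y'\<bar> \<le> p * ?r" for y y'
      unfolding abs_mult using that xp by (intro mult_mono) auto
    have nn: "0 \<le> x * (p * ?r)" using xp r by simp
    have M: "M * ?r = x * (p * ?r) + x * (p * ?r) + (x * (p * ?r) + x * (p * ?r))" by (simp add: M_def)
    show "\<bar>Q n z\<bar> \<le> M * ?r" unfolding Q_def M using mm[OF bX(1) bp(1)] nn by linarith
    show "\<bar>Q1 n j z\<bar> \<le> M * ?r" unfolding Q1_def M
      using mm[OF bX(1) bp(2)] mm[OF bX'[OF bX(2)] bp(1)] nn by linarith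
    show "\<bar>Q2 n j z\<bar> \<le> M * ?r" unfolding Q2_def M
      using mm[OF bX(1) bp(3)] mm[OF bX'[OF bX(2)] bp(2)] mm[OF bX'[OF bX'[OF bX(3)]] bp(1)] by linarith
  qed
  let ?N = "real CARD('n)"
  \<comment> \<open>One unit for \<open>B y\<close>, twice the dimension for the two sums of second
    derivatives, and \<open>L\<close> times the dimension for the flux terms.\<close>
  define KK where "KK = K * M * (1 + 2 * ?N + ?N * L)"
  have bound: "\<bar>w z * (B z * y + A z * (\<Sum>j\<in>UNIV. y2 j) - B z * (\<Sum>j\<in>UNIV. y2 j)) + (\<Sum>j\<in>UNIV. G j z * (A z * y1 j))\<bar> \<le> KK * (\<bar>w z\<bar> * rho (snd z))"
    if "z \<in> Omega T \<Longrightarrow> \<bar>y\<bar> \<le> M * rho (snd z)" "\<And>j. z \<in> Omega T \<Longrightarrow> \<bar>y1 j\<bar> \<le> M * rho (snd z)" "\<And>j. z \<in> Omega T \<Longrightarrow> \<bar>y2 j\<bar> \<le> M * rho (snd z)"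
    for z y and y1 y2 :: "'n \<Rightarrow> real"
  proof (cases "z \<in> Omega T")
    case True
    let ?m = "M * rho (snd z)"
    have m0: "?m \<ge> 0" by (rule mult_nonneg_nonneg[OF xp(3) rn])
    have AB: "\<bar>A z\<bar> \<le> K" "\<bar>B z\<bar> \<le> K" using K1(2)[OF True] K2(2)[OF True] K by auto
    have s: "\<bar>\<Sum>j\<in>UNIV. y2 j\<bar> \<le> ?N * ?m"
      using order_trans[OF sum_abs sum_bounded_above[of UNIV "\<lambda>j. \<bar>y2 j\<bar>" ?m]] that(3)[OF True] by simp
    have b1: "\<bar>B z * y\<bar> \<le> K * ?m" unfolding abs_mult by (intro mult_mono AB that True) (use K in auto)
    have b2: "\<bar>A z * (\<Sum>j\<in>UNIV. y2 j)\<bar> \<le> K * (?N * ?m)" unfolding abs_mult by (intro mult_mono AB s) (use K in auto)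
    have b3: "\<bar>B z * (\<Sum>j\<in>UNIV. y2 j)\<bar> \<le> K * (?N * ?m)" unfolding abs_mult by (intro mult_mono AB s) (use K in auto)
    have "\<bar>B z * y + A z * (\<Sum>j\<in>UNIV. y2 j) - B z * (\<Sum>j\<in>UNIV. y2 j)\<bar> \<le> K * ?m + 2 * (K * (?N * ?m))"
      using b1 b2 b3 by linarith
    then have 1: "\<bar>w z * (B z * y + A z * (\<Sum>j\<in>UNIV. y2 j) - B z * (\<Sum>j\<in>UNIV. y2 j))\<bar> \<le> \<bar>w z\<bar> * (K * ?m + 2 * (K * (?N * ?m)))"
      unfolding abs_mult by (intro mult_left_mono) auto
    have "\<bar>G j z * (A z * y1 j)\<bar> \<le> (L * \<bar>w z\<bar>) * (K * ?m)" for j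
      unfolding abs_mult by (intro mult_mono G_le AB that True) (use K L m0 in auto)
    then have 2: "\<bar>\<Sum>j\<in>UNIV. G j z * (A z * y1 j)\<bar> \<le> ?N * ((L * \<bar>w z\<bar>) * (K * ?m))"
      using order_trans[OF sum_abs sum_bounded_above[of UNIV "\<lambda>j. \<bar>G j z * (A z * y1 j)\<bar>" "(L * \<bar>w z\<bar>) * (K * ?m)"]] by simp
    have "KK * (\<bar>w z\<bar> * rho (snd z)) = \<bar>w z\<bar> * (K * ?m + 2 * (K * (?N * ?m))) + ?N * ((L * \<bar>w z\<bar>) * (K * ?m))"
      by (simp add: KK_def algebra_simps)
    then show ?thesis using 1 2 by linarith
  next
    case False
    then have "w z = 0" by (rule w_out)
    moreover have "G j z = 0" for j using G_le[of j z] \<open>w z = 0\<close> by simp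
    ultimately show ?thesis by simp
  qed
  have [measurable]: "A \<in> borel_measurable borel" "B \<in> borel_measurable borel" "P \<in> borel_measurable borel"
    "\<And>j. P1 j \<in> borel_measurable borel" "\<And>j. P2 j \<in> borel_measurable borel" "g \<in> borel_measurable borel"
    using C0_continuous[OF CB_C0[OF A(1)]] C0_continuous[OF A(2)] C0_continuous[OF CB_C0[OF cP(1)]]
      C0_continuous[OF CB_C0[OF cP(2)]] C0_continuous[OF CB_C0[OF cP(3)]] C0_continuous[OF CB_C0[OF g]]
    by (auto intro: borel_measurable_continuous_onI)
  have [measurable]: "(\<lambda>z. h (S n z)) \<in> borel_measurable borel" if "continuous_on UNIV h" for h :: "real \<times> (real^'n) \<Rightarrow> real" and n
    unfolding S_def by (rule borel_measurable_continuous_onI, rule continuous_on_compose2[OF that], intro continuous_intros) simp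
  have [measurable]: "Q n \<in> borel_measurable borel" "Q1 n j \<in> borel_measurable borel" "Q2 n j \<in> borel_measurable borel" for n j
    unfolding Q_def[abs_def] Q1_def[abs_def] Q2_def[abs_def] using cX by measurable
  have [measurable]: "I n \<in> borel_measurable borel" "J \<in> borel_measurable borel" for n
    unfolding I_def[abs_def] J_def[abs_def] by measurable
  \<comment> \<open>The limits inherit the bounds of the truncations, so \<open>bound\<close> covers
    \<open>J\<close> as well.\<close>
  have Pb: "\<bar>P z\<bar> \<le> M * rho (snd z)" "\<bar>P1 j z\<bar> \<le> M * rho (snd z)" "\<bar>P2 j z\<bar> \<le> M * rho (snd z)" if "z \<in> Omega T" for j z
    by (rule LIMSEQ_le_const2[OF tendsto_rabs[OF Qlim(1)]] LIMSEQ_le_const2[OF tendsto_rabs[OF Qlim(2)]] LIMSEQ_le_const2[OF tendsto_rabs[OF Qlim(3)]];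
        use Qb[OF that] in blast)+
  have lim: "(\<lambda>n. \<integral>z. I n z \<partial>lborel) \<longlonglongrightarrow> (\<integral>z. J z \<partial>lborel)"
  proof (rule integral_dominated_convergence[where w="\<lambda>z. KK * (\<bar>w z\<bar> * rho (snd z))"])
    show "integrable lborel (\<lambda>z. KK * (\<bar>w z\<bar> * rho (snd z)))" by (intro integrable_mult_right w_rho)
    show "AE z in lborel. (\<lambda>n. I n z) \<longlonglongrightarrow> J z"
      unfolding I_def J_def by (intro AE_I2 tendsto_intros Qlim)
    show "AE z in lborel. norm (I n z) \<le> KK * (\<bar>w z\<bar> * rho (snd z))" for n
      unfolding I_def real_norm_def by (intro AE_I2 bound Qb)
  qed simp_all
  have J0: "(\<integral>z. J z \<partial>lborel) = 0" using LIMSEQ_unique[OF lim] by (simp add: int0)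
  define R where "R z = A z * (w z * (P z - g z) + (\<Sum>j\<in>UNIV. G j z * P1 j z))" for z
  \<comment> \<open>On \<open>Omega T\<close> the time terms are
    \<open>B P - B (P - g) = B g\<close>, and there \<open>B\<close> is minus the bump. Elsewhere
    \<open>w\<close> and \<open>G\<close> vanish.\<close>
  have JR: "J z = R z - w z * (tbox m t0 t1 z * g z)" for z
  proof (cases "z \<in> Omega T")
    case True
    then have "B z = - tbox m t0 t1 z" by (intro A(5)) (auto simp: Omega_def)
    then show ?thesis by (simp add: J_def R_def P2_sum sum_distrib_left algebra_simps)
  next
    case False
    then have "w z = 0" by (rule w_out)
    moreover have "G j z = 0" for j using G_le[of j z] \<open>w z = 0\<close> by simp
    ultimately show ?thesis by (simp add: J_def R_def)
  qed
  have Jint: "integrable lborel J"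
    by (rule dominated_integrable[where C=KK]) (auto simp: J_def intro!: bound Pb)
  obtain D where D: "D \<ge> 0" "\<And>z. z \<in> Omega T \<Longrightarrow> \<bar>g z\<bar> \<le> D * rho (snd z)"
    using C0_bound_Omega[OF CB_C0[OF g]] by metis
  have Wint: "integrable lborel (\<lambda>z. w z * (tbox m t0 t1 z * g z))"
  proof (rule dominated_integrable[where C=D])
    have [measurable]: "tbox m t0 t1 \<in> borel_measurable (borel :: (real \<times> (real^'n)) measure)"
      by (rule borel_measurable_continuous_onI[OF continuous_tbox])
    show "(\<lambda>z. w z * (tbox m t0 t1 z * g z)) \<in> borel_measurable borel" by measurable
    show "\<bar>w z * (tbox m t0 t1 z * g z)\<bar> \<le> D * (\<bar>w z\<bar> * rho (snd z))" for z
    proof (cases "z \<in> Omega T")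
      case True
      have "\<bar>w z\<bar> * (\<bar>tbox m t0 t1 z\<bar> * \<bar>g z\<bar>) \<le> \<bar>w z\<bar> * (1 * (D * rho (snd z)))"
        by (intro mult_left_mono mult_mono D(2)[OF True]) (auto simp: tbox_def bump_le_1 bump_nonneg)
      then show ?thesis by (simp add: abs_mult mult_ac)
    qed (simp add: w_out)
  qed
  have "R z = J z + w z * (tbox m t0 t1 z * g z)" for z by (simp add: JR)
  then have "(\<integral>z. R z \<partial>lborel) = (\<integral>z. J z + w z * (tbox m t0 t1 z * g z) \<partial>lborel)" by simp
  also have "\<dots> = (\<integral>z. w z * (tbox m t0 t1 z * g z) \<partial>lborel)" using Wint Jint J0 by simp
  finally show ?thesis by (simp add: R_def P_def P1_def)
qed

end

section \<open>Uniqueness\<close>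

lemma nn_integral_lborel_shift:
  fixes f :: "'a::euclidean_space \<Rightarrow> ennreal"
  assumes [measurable]: "f \<in> borel_measurable borel"
  shows "(\<integral>\<^sup>+z. f (z + c) \<partial>lborel) = (\<integral>\<^sup>+z. f z \<partial>lborel)"
proof -
  have "(\<integral>\<^sup>+z. f z \<partial>lborel) = (\<integral>\<^sup>+z. f z \<partial>distr lborel borel ((+) c))" by (simp add: lborel_distr_plus)
  also have "\<dots> = (\<integral>\<^sup>+z. f (c + z) \<partial>lborel)" by (rule nn_integral_distr) auto
  finally show ?thesis by (simp add: add.commute)
qed

lemma borel_measurable_fst_snd [measurable]:
  "(fst :: 'a::second_countable_topology \<times> 'b::second_countable_topology \<Rightarrow> 'a) \<in> borel_measurable borel"
  "(snd :: 'a::second_countable_topology \<times> 'b::second_countable_topology \<Rightarrow> 'b) \<in> borel_measurable borel"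
  by (auto intro!: borel_measurable_continuous_onI continuous_intros)

lemma nn_integral_lborel_pair:
  fixes f :: "'a::euclidean_space \<times> 'b::euclidean_space \<Rightarrow> ennreal"
  assumes "f \<in> borel_measurable borel"
  shows "(\<integral>\<^sup>+z. f z \<partial>lborel) = (\<integral>\<^sup>+x. (\<integral>\<^sup>+y. f (x, y) \<partial>lborel) \<partial>lborel)"
proof -
  have "f \<in> borel_measurable (lborel \<Otimes>\<^sub>M lborel)" using assms by (simp add: lborel_prod)
  from lborel.nn_integral_fst[OF this] show ?thesis by (simp add: lborel_prod)
qed

text \<open>Tonelli on the set of pairs of times with \<open>t \<le> r\<close>: a tail integral of
  \<alpha> becomes a running integral of \<open>V\<close>, with space as a spectator.\<close>

lemma nn_integral_time_swap:
  fixes \<alpha> :: "real \<Rightarrow> ennreal" and \<beta> :: "real^'n::finite \<Rightarrow> ennreal" and V :: "real \<times> (real^'n) \<Rightarrow> ennreal"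
  assumes [measurable]: "\<alpha> \<in> borel_measurable borel" "\<beta> \<in> borel_measurable borel" "V \<in> borel_measurable borel"
  shows "(\<integral>\<^sup>+z. (\<integral>\<^sup>+r. \<alpha> r * (if fst z \<le> r then 1 else 0) \<partial>lborel) * (\<beta> (snd z) * V z) \<partial>lborel) =
    (\<integral>\<^sup>+z. \<alpha> (fst z) * \<beta> (snd z) * (\<integral>\<^sup>+t. V (t, snd z) * (if t \<le> fst z then 1 else 0) \<partial>lborel) \<partial>lborel)"
proof -
  define F where "F t x r = \<alpha> r * (if t \<le> r then 1 else 0) * (\<beta> x * V (t, x))" for t r :: real and x :: "real^'n"
  have "(\<integral>\<^sup>+z. (\<integral>\<^sup>+r. \<alpha> r * (if fst z \<le> r then 1 else 0) \<partial>lborel) * (\<beta> (snd z) * V z) \<partial>lborel) =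
    (\<integral>\<^sup>+t. (\<integral>\<^sup>+x. (\<integral>\<^sup>+r. \<alpha> r * (if t \<le> r then 1 else 0) \<partial>lborel) * (\<beta> x * V (t, x)) \<partial>lborel) \<partial>lborel)"
    by (subst nn_integral_lborel_pair) simp_all
  also have "\<dots> = (\<integral>\<^sup>+t. (\<integral>\<^sup>+x. (\<integral>\<^sup>+r. F t x r \<partial>lborel) \<partial>lborel) \<partial>lborel)"
    unfolding F_def by (simp add: nn_integral_multc)
  also have "\<dots> = (\<integral>\<^sup>+t. (\<integral>\<^sup>+r. (\<integral>\<^sup>+x. F t x r \<partial>lborel) \<partial>lborel) \<partial>lborel)"
    unfolding F_def by (intro nn_integral_cong lborel_pair.Fubini') measurable
  also have "\<dots> = (\<integral>\<^sup>+r. (\<integral>\<^sup>+t. (\<integral>\<^sup>+x. F t x r \<partial>lborel) \<partial>lborel) \<partial>lborel)"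
    unfolding F_def by (intro lborel_pair.Fubini') measurable
  also have "\<dots> = (\<integral>\<^sup>+r. (\<integral>\<^sup>+x. (\<integral>\<^sup>+t. F t x r \<partial>lborel) \<partial>lborel) \<partial>lborel)"
    unfolding F_def by (intro nn_integral_cong lborel_pair.Fubini') measurable
  also have "\<dots> = (\<integral>\<^sup>+r. (\<integral>\<^sup>+x. \<alpha> r * \<beta> x * (\<integral>\<^sup>+t. V (t, x) * (if t \<le> r then 1 else 0) \<partial>lborel) \<partial>lborel) \<partial>lborel)"
  proof (intro nn_integral_cong)
    fix r :: real and x :: "real^'n"
    have "(\<integral>\<^sup>+t. F t x r \<partial>lborel) = (\<integral>\<^sup>+t. \<alpha> r * \<beta> x * (V (t, x) * (if t \<le> r then 1 else 0)) \<partial>lborel)"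
      unfolding F_def by (intro nn_integral_cong) (simp add: mult_ac)
    then show "(\<integral>\<^sup>+t. F t x r \<partial>lborel) = \<alpha> r * \<beta> x * (\<integral>\<^sup>+t. V (t, x) * (if t \<le> r then 1 else 0) \<partial>lborel)"
      by (simp add: nn_integral_cmult)
  qed
  also have "\<dots> = (\<integral>\<^sup>+z. \<alpha> (fst z) * \<beta> (snd z) * (\<integral>\<^sup>+t. V (t, snd z) * (if t \<le> fst z then 1 else 0) \<partial>lborel) \<partial>lborel)"
    by (subst nn_integral_lborel_pair) simp_all
  finally show ?thesis .
qed

text \<open>Lebesgue differentiation along cubes with corner \<open>z\<close>: were
  \<open>h z\<close> negative, the averages over small cubes inside \<open>S\<close> would be
  negative too.\<close>

lemma AE_nonneg_of_boxes:
  fixes h :: "'a::euclidean_space \<Rightarrow> real"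
  assumes S: "open S" and int: "\<And>a b. set_integrable lborel (cbox a b) h"
    and nn: "\<And>a b. cbox a b \<subseteq> S \<Longrightarrow> 0 \<le> integral (cbox a b) h"
  shows "AE z in lebesgue. z \<in> S \<longrightarrow> 0 \<le> h z"
proof -
  have "h integrable_on cbox a b" for a b using set_borel_integral_eq_integral(1)[OF int] .
  from integrable_ccontinuous_explicit[OF this] obtain N where N: "negligible N"
    "\<And>x e. x \<notin> N \<Longrightarrow> 0 < e \<Longrightarrow> \<exists>d>0. \<forall>r. 0 < r \<and> r < d \<longrightarrow>
        norm (integral (cbox x (x + r *\<^sub>R One)) h /\<^sub>R r ^ DIM('a) - h x) < e"
    by blast
  have "0 \<le> h z" if z: "z \<notin> N" "z \<in> S" for z
  proof (rule ccontr)
    assume "\<not> 0 \<le> h z"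
    then have "0 < - h z" by simp
    \<comment> \<open>With tolerance \<open>- h z\<close>, every such average is strictly below
      0.\<close>
    then obtain d where d: "d > 0" "\<And>r. 0 < r \<Longrightarrow> r < d \<Longrightarrow> norm (integral (cbox z (z + r *\<^sub>R One)) h /\<^sub>R r ^ DIM('a) - h z) < - h z"
      using N(2)[OF z(1), of "- h z"] by auto
    obtain \<delta> where \<delta>: "\<delta> > 0" "ball z \<delta> \<subseteq> S" using S z(2) open_contains_ball by blast
    \<comment> \<open>The cube has l1 radius \<open>r\<close> times the dimension; this choice keeps
      it inside the ball of radius \<delta>.\<close>
    define r where "r = min (d / 2) (\<delta> / (2 * real DIM('a)))"
    have r: "0 < r" "r < d" "r * real DIM('a) < \<delta>"
    proof -
      have D: "0 < real DIM('a)" by simp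
      show "0 < r" "r < d" using d(1) \<delta>(1) by (auto simp: r_def min_less_iff_disj)
      have "r * real DIM('a) \<le> \<delta> / (2 * real DIM('a)) * real DIM('a)" by (intro mult_right_mono) (auto simp: r_def)
      also have "\<dots> = \<delta> / 2" using D by simp
      finally show "r * real DIM('a) < \<delta>" using \<delta>(1) by simp
    qed
    have "cbox z (z + r *\<^sub>R One) \<subseteq> ball z \<delta>"
    proof
      fix y assume y: "y \<in> cbox z (z + r *\<^sub>R One)"
      have "norm (y - z) \<le> (\<Sum>b\<in>Basis. \<bar>(y - z) \<bullet> b\<bar>)" by (rule norm_le_l1)
      also have "\<dots> \<le> (\<Sum>b\<in>(Basis::'a set). r)"
        using y by (intro sum_mono) (auto simp: mem_box inner_diff_left inner_add_left)
      also have "\<dots> = r * real DIM('a)" by simp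
      finally show "y \<in> ball z \<delta>" using r(3) by (simp add: dist_norm norm_minus_commute)
    qed
    then have "0 \<le> integral (cbox z (z + r *\<^sub>R One)) h" using \<delta>(2) nn by blast
    then have "0 \<le> integral (cbox z (z + r *\<^sub>R One)) h /\<^sub>R r ^ DIM('a)" using r(1) by (simp add: divide_nonneg_pos)
    then show False using d(2)[OF r(1,2)] by (simp add: abs_less_iff)
  qed
  then have "{z. \<not> (z \<in> S \<longrightarrow> 0 \<le> h z)} \<subseteq> N" by blast
  then have "negligible {z. \<not> (z \<in> S \<longrightarrow> 0 \<le> h z)}" using N(1) negligible_subset by blast
  then show ?thesis by (simp add: eventually_ae_filter negligible_iff_null_sets) blast
qed

section \<open>The positive majorant and its contraction property\<close>

context weak_diff
begin

text \<open>All kernels with absolute values; those of the flux carry the Lipschitz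
  constant.\<close>

definition kap :: "real \<times> (real^'n) \<Rightarrow> real" where
  "kap y = \<bar>ker None y\<bar> + L * (\<Sum>j\<in>UNIV. \<bar>ker (Some j) y\<bar>)"

definition cs :: "real \<times> (real^'n) \<Rightarrow> real \<times> (real^'n)" where
  "cs y = (0, fst y *\<^sub>R snd y)"

text \<open>Majorant of the time derivative of \<open>w\<close> in the equation with inverted
  \<open>1 - \<Delta>\<close>. It takes values in \<open>ennreal\<close>, so it needs no
  integrability to be defined.\<close>

definition Vw :: "real \<times> (real^'n) \<Rightarrow> ennreal" where
  "Vw z = ennreal \<bar>w z\<bar> + (\<integral>\<^sup>+y. ennreal (kap y) * ennreal \<bar>w (z - cs y)\<bar> \<partial>lborel)"

text \<open>The running integral starts at time 0 implicitly: \<open>w\<close>, and with it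
  \<open>Vw\<close>, vanishes for times outside \<open>(0, T)\<close>.\<close>

definition Qw :: "real \<times> (real^'n) \<Rightarrow> ennreal" where
  "Qw z = (\<integral>\<^sup>+t. Vw (t, snd z) * (if t \<le> fst z then 1 else 0) \<partial>lborel)"

lemma kap_nonneg: "0 \<le> kap y" using L by (auto simp: kap_def intro!: add_nonneg_nonneg mult_nonneg_nonneg sum_nonneg)

lemma majorant_measurable [measurable]: "kap \<in> borel_measurable borel" "cs \<in> borel_measurable borel" "Vw \<in> borel_measurable borel" "Qw \<in> borel_measurable borel"
proof -
  show k [measurable]: "kap \<in> borel_measurable borel" unfolding kap_def[abs_def] by measurable
  show c [measurable]: "cs \<in> borel_measurable borel"
    unfolding cs_def[abs_def] by (intro borel_measurable_continuous_onI continuous_intros)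
  show v [measurable]: "Vw \<in> borel_measurable borel" unfolding Vw_def[abs_def] by measurable
  show "Qw \<in> borel_measurable borel" unfolding Qw_def[abs_def] by measurable
qed

text \<open>The counterpart of \<open>Aop_dual\<close> for nonnegative functions, by Tonelli and
  translation alone.\<close>

lemma kernel_adjoint:
  assumes [measurable]: "h \<in> borel_measurable borel"
  shows "(\<integral>\<^sup>+z. h z * (\<integral>\<^sup>+y. ennreal (kap y) * ennreal \<bar>w (z - cs y)\<bar> \<partial>lborel) \<partial>lborel) =
    (\<integral>\<^sup>+z. ennreal \<bar>w z\<bar> * (\<integral>\<^sup>+y. ennreal (kap y) * h (z + cs y) \<partial>lborel) \<partial>lborel)"
proof -
  have "(\<integral>\<^sup>+z. h z * (\<integral>\<^sup>+y. ennreal (kap y) * ennreal \<bar>w (z - cs y)\<bar> \<partial>lborel) \<partial>lborel) =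
    (\<integral>\<^sup>+z. (\<integral>\<^sup>+y. h z * (ennreal (kap y) * ennreal \<bar>w (z - cs y)\<bar>) \<partial>lborel) \<partial>lborel)"
    by (simp add: nn_integral_cmult)
  also have "\<dots> = (\<integral>\<^sup>+y. (\<integral>\<^sup>+z. h z * (ennreal (kap y) * ennreal \<bar>w (z - cs y)\<bar>) \<partial>lborel) \<partial>lborel)"
    by (intro lborel_pair.Fubini') measurable
  also have "\<dots> = (\<integral>\<^sup>+y. (\<integral>\<^sup>+z. h (z + cs y) * (ennreal (kap y) * ennreal \<bar>w z\<bar>) \<partial>lborel) \<partial>lborel)"
  proof (rule nn_integral_cong)
    fix y
    show "(\<integral>\<^sup>+z. h z * (ennreal (kap y) * ennreal \<bar>w (z - cs y)\<bar>) \<partial>lborel) = (\<integral>\<^sup>+z. h (z + cs y) * (ennreal (kap y) * ennreal \<bar>w z\<bar>) \<partial>lborel)"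
      using nn_integral_lborel_shift[of "\<lambda>z. h z * (ennreal (kap y) * ennreal \<bar>w (z - cs y)\<bar>)" "cs y"] by simp
  qed
  also have "\<dots> = (\<integral>\<^sup>+z. (\<integral>\<^sup>+y. h (z + cs y) * (ennreal (kap y) * ennreal \<bar>w z\<bar>) \<partial>lborel) \<partial>lborel)"
    by (intro lborel_pair.Fubini') measurable
  also have "\<dots> = (\<integral>\<^sup>+z. ennreal \<bar>w z\<bar> * (\<integral>\<^sup>+y. ennreal (kap y) * h (z + cs y) \<partial>lborel) \<partial>lborel)"
  proof (intro nn_integral_cong)
    fix z
    have "(\<integral>\<^sup>+y. h (z + cs y) * (ennreal (kap y) * ennreal \<bar>w z\<bar>) \<partial>lborel) = (\<integral>\<^sup>+y. ennreal \<bar>w z\<bar> * (ennreal (kap y) * h (z + cs y)) \<partial>lborel)"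
      by (intro nn_integral_cong) (simp add: mult_ac)
    then show "(\<integral>\<^sup>+y. h (z + cs y) * (ennreal (kap y) * ennreal \<bar>w z\<bar>) \<partial>lborel) = ennreal \<bar>w z\<bar> * (\<integral>\<^sup>+y. ennreal (kap y) * h (z + cs y) \<partial>lborel)"
      by (simp add: nn_integral_cmult)
  qed
  finally show ?thesis .
qed

lemma Vw_pairing:
  assumes [measurable]: "h \<in> borel_measurable borel"
  shows "(\<integral>\<^sup>+z. h z * Vw z \<partial>lborel) = (\<integral>\<^sup>+z. ennreal \<bar>w z\<bar> * (h z + (\<integral>\<^sup>+y. ennreal (kap y) * h (z + cs y) \<partial>lborel)) \<partial>lborel)"
proof -
  have "(\<integral>\<^sup>+z. h z * Vw z \<partial>lborel) = (\<integral>\<^sup>+z. h z * ennreal \<bar>w z\<bar> \<partial>lborel) +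
      (\<integral>\<^sup>+z. h z * (\<integral>\<^sup>+y. ennreal (kap y) * ennreal \<bar>w (z - cs y)\<bar> \<partial>lborel) \<partial>lborel)"
    unfolding Vw_def by (subst nn_integral_add[symmetric]) (auto simp: distrib_left)
  also have "\<dots> = (\<integral>\<^sup>+z. ennreal \<bar>w z\<bar> * h z \<partial>lborel) + (\<integral>\<^sup>+z. ennreal \<bar>w z\<bar> * (\<integral>\<^sup>+y. ennreal (kap y) * h (z + cs y) \<partial>lborel) \<partial>lborel)"
    by (simp only: kernel_adjoint[OF assms]) (simp only: mult.commute)
  also have "\<dots> = (\<integral>\<^sup>+z. ennreal \<bar>w z\<bar> * (h z + (\<integral>\<^sup>+y. ennreal (kap y) * h (z + cs y) \<partial>lborel)) \<partial>lborel)"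
    by (subst nn_integral_add[symmetric]) (auto simp: distrib_left)
  finally show ?thesis .
qed

lemma integral_ker_le:
  fixes g :: "real \<times> (real^'n) \<Rightarrow> real"
  assumes g: "C0 (\<lambda>_. 1) g" "\<And>z. 0 \<le> g z"
  shows "\<bar>Aop 1 (ker None) g z\<bar> + L * (\<Sum>j\<in>UNIV. \<bar>Aop 1 (ker (Some j)) g z\<bar>) \<le> (\<integral>y. kap y * g (z + cs y) \<partial>lborel)"
    "integrable lborel (\<lambda>y. kap y * g (z + cs y))"
proof -
  have i: "integrable lborel (\<lambda>y. \<bar>ker i y\<bar> * g (z + cs y))" for i
    using integrable_abs[OF Aop_integrable[OF _ g(1), of 1 i z]] g(2) by (simp add: abs_mult cs_def)
  have eq: "(\<lambda>y. kap y * g (z + cs y)) = (\<lambda>y. \<bar>ker None y\<bar> * g (z + cs y) + L * (\<Sum>j\<in>UNIV. \<bar>ker (Some j) y\<bar> * g (z + cs y)))"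
    by (simp add: kap_def algebra_simps sum_distrib_left)
  show "integrable lborel (\<lambda>y. kap y * g (z + cs y))" unfolding eq using i by simp
  have le: "\<bar>Aop 1 (ker i) g z\<bar> \<le> (\<integral>y. \<bar>ker i y\<bar> * g (z + cs y) \<partial>lborel)" for i
    unfolding Aop_def by (rule order_trans[OF integral_abs_bound]) (simp add: abs_mult g(2) cs_def)
  have "(\<integral>y. kap y * g (z + cs y) \<partial>lborel) = (\<integral>y. \<bar>ker None y\<bar> * g (z + cs y) \<partial>lborel) + L * (\<Sum>j\<in>UNIV. \<integral>y. \<bar>ker (Some j) y\<bar> * g (z + cs y) \<partial>lborel)"
    unfolding eq using i by simp
  then show "\<bar>Aop 1 (ker None) g z\<bar> + L * (\<Sum>j\<in>UNIV. \<bar>Aop 1 (ker (Some j)) g z\<bar>) \<le> (\<integral>y. kap y * g (z + cs y) \<partial>lborel)"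
    by (simp only:) (intro add_mono mult_left_mono sum_mono le L)
qed

text \<open>Absolute values are taken in \<open>tensor_identity\<close>. The adjoint moves the
  kernel from the bump to \<open>|w|\<close>, and the formula of \<open>A\<close> as a tail integral
  lets the time swap turn it into the running integral \<open>Qw\<close>.\<close>

lemma bump_estimate:
  assumes t: "0 < t0" "t0 < t1" "t1 < T" and m: "m > 0"
  shows "ennreal \<bar>\<integral>z. w z * (tbox m t0 t1 z * xbox m a b z) \<partial>lborel\<bar> \<le> (\<integral>\<^sup>+z. ennreal (tbox m t0 t1 z) * ennreal (xbox m a b z) * Qw z \<partial>lborel)"
proof -
  define g where "g = xbox m a b"
  obtain A B :: "real \<times> (real^'n) \<Rightarrow> real" where A: "\<And>k. CB (\<lambda>_. 1) k A" "C0 (\<lambda>_. 1) B" "has_pdiff et A B" "\<And>j. has_pdiff (ex j) A (\<lambda>_. 0)"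
    "\<And>z. fst z \<ge> 0 \<Longrightarrow> B z = - tbox m t0 t1 z" "\<And>z. fst z \<le> -2 \<or> t1 \<le> fst z \<Longrightarrow> A z = 0"
    and A7: "\<And>s x. 0 \<le> s \<Longrightarrow> s \<le> T \<Longrightarrow> 0 \<le> A (s, x) \<and>
        ennreal (A (s, x)) = (\<integral>\<^sup>+r. ennreal (bump m t0 t1 r) * indicator {s..T} r \<partial>lborel)"
    using time_profile[OF t m, where 'n='n] by blast
  have gC: "C0 (\<lambda>_. 1) g" unfolding g_def by (rule CB_C0[OF CB_xbox])
  have g0: "0 \<le> g z" for z by (simp add: g_def xbox_nonneg)
  have [measurable]: "g \<in> borel_measurable borel" by (rule borel_measurable_continuous_onI[OF C0_continuous[OF gC]])
  have bmpm [measurable]: "bump m t0 t1 \<in> borel_measurable borel"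
  proof -
    have "continuous_on UNIV (\<lambda>r. tbox m t0 t1 (r, 0 :: real^'n))"
      by (rule continuous_on_compose2[OF continuous_tbox], intro continuous_intros) simp
    then show ?thesis by (simp add: tbox_def borel_measurable_continuous_onI)
  qed
  define \<alpha> where "\<alpha> r = ennreal (bump m t0 t1 r) * indicator {..T} r" for r
  define I where "I z = (\<integral>\<^sup>+r. \<alpha> r * (if fst z \<le> r then 1 else 0) \<partial>lborel)" for z :: "real \<times> (real^'n)"
  have [measurable]: "\<alpha> \<in> borel_measurable borel" unfolding \<alpha>_def[abs_def] by measurable
  have [measurable]: "I \<in> borel_measurable borel" unfolding I_def[abs_def] by measurable
  have AI: "ennreal (A z) = I z" "0 \<le> A z" if "z \<in> Omega T" for z
  proof -
    have z: "0 \<le> fst z" "fst z \<le> T" using that by (auto simp: Omega_def)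
    have "I z = (\<integral>\<^sup>+r. ennreal (bump m t0 t1 r) * indicator {fst z..T} r \<partial>lborel)"
      unfolding I_def \<alpha>_def by (intro nn_integral_cong) (auto simp: indicator_def)
    then show "ennreal (A z) = I z" "0 \<le> A z" using A7[OF z, of "snd z"] by auto
  qed
  let ?K = "\<lambda>z. \<integral>\<^sup>+y. ennreal (kap y) * ennreal (g (z + cs y)) \<partial>lborel"
  define R where "R z = A z * (w z * (Aop 1 (ker None) g z - g z) + (\<Sum>j\<in>UNIV. G j z * Aop 1 (ker (Some j)) g z))" for z
  have R: "ennreal \<bar>R z\<bar> \<le> ennreal \<bar>w z\<bar> * (I z * ennreal (g z) + I z * ?K z)" for z
  proof (cases "z \<in> Omega T")
    case True
    let ?k = "\<integral>y. kap y * g (z + cs y) \<partial>lborel"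
    have k: "ennreal ?k = ?K z"
      using nn_integral_eq_integral[OF integral_ker_le(2)[OF gC g0]] by (simp add: kap_nonneg g0 ennreal_mult)
    have k0: "0 \<le> ?k" by (intro Bochner_Integration.integral_nonneg) (simp add: kap_nonneg g0)
    have "\<bar>w z * (Aop 1 (ker None) g z - g z) + (\<Sum>j\<in>UNIV. G j z * Aop 1 (ker (Some j)) g z)\<bar> \<le>
      \<bar>w z\<bar> * (\<bar>Aop 1 (ker None) g z\<bar> + g z) + (\<Sum>j\<in>UNIV. (L * \<bar>w z\<bar>) * \<bar>Aop 1 (ker (Some j)) g z\<bar>)"
    proof (intro order_trans[OF abs_triangle_ineq] add_mono order_trans[OF sum_abs] sum_mono)
      show "\<bar>w z * (Aop 1 (ker None) g z - g z)\<bar> \<le> \<bar>w z\<bar> * (\<bar>Aop 1 (ker None) g z\<bar> + g z)"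
        unfolding abs_mult using g0[of z] by (intro mult_left_mono) auto
      show "\<bar>G j z * Aop 1 (ker (Some j)) g z\<bar> \<le> (L * \<bar>w z\<bar>) * \<bar>Aop 1 (ker (Some j)) g z\<bar>" for j
        unfolding abs_mult by (intro mult_right_mono G_le) simp
    qed
    also have "\<dots> = \<bar>w z\<bar> * (g z + (\<bar>Aop 1 (ker None) g z\<bar> + L * (\<Sum>j\<in>UNIV. \<bar>Aop 1 (ker (Some j)) g z\<bar>)))"
      by (simp add: sum_distrib_left algebra_simps)
    also have "\<dots> \<le> \<bar>w z\<bar> * (g z + ?k)"
      by (intro mult_left_mono add_left_mono integral_ker_le(1)[OF gC g0]) simp
    finally have "\<bar>R z\<bar> \<le> A z * (\<bar>w z\<bar> * (g z + ?k))"
      unfolding R_def abs_mult using AI(2)[OF True] by (simp add: mult_left_mono)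
    then have "ennreal \<bar>R z\<bar> \<le> ennreal (A z * (\<bar>w z\<bar> * (g z + ?k)))" by (rule ennreal_leI)
    also have "\<dots> = I z * (ennreal \<bar>w z\<bar> * (ennreal (g z) + ?K z))"
      using AI[OF True] g0[of z] k0 by (simp add: ennreal_mult k[symmetric])
    finally show ?thesis by (simp add: distrib_left mult_ac)
  next
    case False
    then have "w z = 0" by (rule w_out)
    moreover have "G j z = 0" for j using G_le[of j z] \<open>w z = 0\<close> by simp
    ultimately show ?thesis by (simp add: R_def)
  qed
  have "ennreal \<bar>\<integral>z. w z * (tbox m t0 t1 z * g z) \<partial>lborel\<bar> = ennreal (norm (\<integral>z. R z \<partial>lborel))"
    unfolding g_def R_def using tensor_identity[OF A t(3) m, of a b] by simp
  also have "\<dots> \<le> (\<integral>\<^sup>+z. ennreal (norm (R z)) \<partial>lborel)" 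
    \<comment> \<open>If \<open>R\<close> were not integrable its integral would be 0 by convention,
      and the bound would still hold.\<close>
    by (cases "integrable lborel R") (use integral_norm_bound_ennreal[of lborel R] in \<open>simp_all add: not_integrable_integral_eq\<close>)
  also have "\<dots> \<le> (\<integral>\<^sup>+z. ennreal \<bar>w z\<bar> * (I z * ennreal (g z) + I z * ?K z) \<partial>lborel)"
    using R by (intro nn_integral_mono) simp
  also have "\<dots> = (\<integral>\<^sup>+z. (I z * ennreal (g z)) * Vw z \<partial>lborel)"
  proof -
    \<comment> \<open>\<open>I\<close> depends on time only, so it passes through the spatial
      shift.\<close>
    have "I (z + cs y) = I z" for z y by (simp add: I_def cs_def)
    then have "(\<integral>\<^sup>+y. ennreal (kap y) * (I (z + cs y) * ennreal (g (z + cs y))) \<partial>lborel) = I z * ?K z" for z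
      by (simp add: nn_integral_cmult[symmetric] mult_ac)
    then show ?thesis by (subst Vw_pairing) auto
  qed
  also have "\<dots> = (\<integral>\<^sup>+z. I z * (ennreal (g (0, snd z)) * Vw z) \<partial>lborel)"
    by (simp add: g_def xbox_def mult_ac)
  also have "\<dots> = (\<integral>\<^sup>+z. \<alpha> (fst z) * ennreal (g (0, snd z)) * Qw z \<partial>lborel)"
    unfolding I_def Qw_def by (rule nn_integral_time_swap) measurable
  also have "\<dots> \<le> (\<integral>\<^sup>+z. ennreal (tbox m t0 t1 z) * ennreal (xbox m a b z) * Qw z \<partial>lborel)"
    by (intro nn_integral_mono mult_right_mono) (auto simp: \<alpha>_def tbox_def g_def xbox_def indicator_def)
  finally show ?thesis by (simp add: g_def)
qed

lemma box_le_rho: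
  fixes a b :: "real^'n"
  obtains C where "C \<ge> 0" "\<And>x. indicator (cbox a b) x \<le> C * rho x"
proof -
  have "continuous_on (cbox a b) (\<lambda>x. 1 / rho x)"
    by (intro continuous_intros) (simp add: rho_pos less_imp_neq[symmetric])
  then have "bounded ((\<lambda>x. 1 / rho x) ` cbox a b)"
    by (intro compact_imp_bounded compact_continuous_image) auto
  then obtain C where C: "\<And>x. x \<in> cbox a b \<Longrightarrow> \<bar>1 / rho x\<bar> \<le> C" unfolding bounded_iff by auto
  have "indicator (cbox a b) x \<le> max C 0 * rho x" for x
  proof (cases "x \<in> cbox a b")
    case True
    have p: "0 < rho x" by (rule rho_pos)
    have "1 / rho x \<le> max C 0" using C[OF True] p by (simp add: le_max_iff_disj)
    then show ?thesis using True p by (simp add: pos_divide_le_eq)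
  qed (use rho_pos[of x] in \<open>simp add: less_imp_le\<close>)
  then show ?thesis using that[of "max C 0"] by simp
qed

text \<open>The left side converges as the bumps sharpen, dominated by \<open>|w| rho\<close>. On
  the right each bump lies below the indicator, so the bound holds for every member of the
  sequence.\<close>

lemma box_estimate:
  fixes a b :: "real^'n"
  assumes t: "0 < t0" "t0 < t1" "t1 < T"
  defines "S \<equiv> {t0<..<t1} \<times> box a b"
  shows "ennreal \<bar>\<integral>z. w z * indicator S z \<partial>lborel\<bar> \<le> (\<integral>\<^sup>+z. indicator S z * Qw z \<partial>lborel)"
proof -
  have [measurable]: "S \<in> sets borel" unfolding S_def by (intro borel_open open_Times) auto
  have tm [measurable]: "tbox m t0 t1 \<in> borel_measurable (borel :: (real \<times> (real^'n)) measure)" "xbox m a b \<in> borel_measurable borel" for m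
    by (auto intro: borel_measurable_continuous_onI continuous_tbox continuous_xbox)
  obtain C where C: "C \<ge> 0" "\<And>x. indicator (cbox a b) x \<le> C * rho x" using box_le_rho by blast
  let ?h = "\<lambda>n z. tbox (real (Suc n)) t0 t1 z * xbox (real (Suc n)) a b z"
  have h: "0 \<le> ?h n z" "?h n z \<le> indicator S z" for n z
  proof -
    show "0 \<le> ?h n z" by (simp add: tbox_def bump_nonneg xbox_nonneg)
    show "?h n z \<le> indicator S z"
    proof (cases "z \<in> S")
      case True
      then show ?thesis using mult_le_one[OF bump_le_1 xbox_nonneg xbox_le_1] by (simp add: tbox_def)
    next
      case False
      then have "\<not> (t0 < fst z \<and> fst z < t1) \<or> snd z \<notin> box a b" by (cases z) (auto simp: S_def)
      then have "?h n z = 0" using bump_zero[of "real (Suc n)" t0 "fst z" t1] xbox_zero[of "real (Suc n)" z a b] by (auto simp: tbox_def)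
      then show ?thesis by (rule ord_eq_le_trans) simp
    qed
  qed
  have "(\<lambda>n. \<integral>z. w z * ?h n z \<partial>lborel) \<longlonglongrightarrow> (\<integral>z. w z * indicator S z \<partial>lborel)"
  proof (rule integral_dominated_convergence[where w="\<lambda>z. C * (\<bar>w z\<bar> * rho (snd z))"])
    show "integrable lborel (\<lambda>z. C * (\<bar>w z\<bar> * rho (snd z)))" by (intro integrable_mult_right w_rho)
    show "AE z in lborel. (\<lambda>n. w z * ?h n z) \<longlonglongrightarrow> w z * indicator S z"
    proof (intro AE_I2 tendsto_mult tendsto_const)
      fix z :: "real \<times> (real^'n)"
      have "(\<lambda>n. ?h n z) \<longlonglongrightarrow> (if t0 < fst z \<and> fst z < t1 then 1 else 0) * indicator (box a b) (snd z)"
        unfolding tbox_def by (intro tendsto_mult bump_lim xbox_lim)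
      also have "(if t0 < fst z \<and> fst z < t1 then 1 else 0) * indicator (box a b) (snd z) = (indicator S z :: real)"
        by (cases z) (auto simp: S_def indicator_def)
      finally show "(\<lambda>n. ?h n z) \<longlonglongrightarrow> indicator S z" .
    qed
    show "AE z in lborel. norm (w z * ?h n z) \<le> C * (\<bar>w z\<bar> * rho (snd z))" for n
    proof (rule AE_I2)
      fix z :: "real \<times> (real^'n)"
      have "indicator S z \<le> (indicator (cbox a b) (snd z) :: real)"
        using box_subset_cbox[of a b] by (auto simp: S_def indicator_def)
      then have "?h n z \<le> indicator (cbox a b) (snd z)" using h(2)[where n=n and z=z] by linarith
      then have "?h n z \<le> C * rho (snd z)" using C(2)[of "snd z"] by linarith
      then have "\<bar>w z\<bar> * ?h n z \<le> \<bar>w z\<bar> * (C * rho (snd z))" by (rule mult_left_mono) simp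
      then show "norm (w z * ?h n z) \<le> C * (\<bar>w z\<bar> * rho (snd z))"
        by (simp add: abs_mult tbox_def bump_nonneg xbox_nonneg mult_ac)
    qed
  qed simp_all
  then have lim: "(\<lambda>n. ennreal \<bar>\<integral>z. w z * ?h n z \<partial>lborel\<bar>) \<longlonglongrightarrow> ennreal \<bar>\<integral>z. w z * indicator S z \<partial>lborel\<bar>"
    by (intro tendsto_ennrealI tendsto_rabs)
  have "ennreal \<bar>\<integral>z. w z * ?h n z \<partial>lborel\<bar> \<le> (\<integral>\<^sup>+z. indicator S z * Qw z \<partial>lborel)" for n
  proof -
    have "ennreal \<bar>\<integral>z. w z * ?h n z \<partial>lborel\<bar> \<le> (\<integral>\<^sup>+z. ennreal (tbox (real (Suc n)) t0 t1 z) * ennreal (xbox (real (Suc n)) a b z) * Qw z \<partial>lborel)"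
      by (rule bump_estimate[OF t]) simp
    also have "\<dots> \<le> (\<integral>\<^sup>+z. indicator S z * Qw z \<partial>lborel)"
    proof (intro nn_integral_mono mult_right_mono)
      fix z :: "real \<times> (real^'n)"
      have "ennreal (tbox (real (Suc n)) t0 t1 z) * ennreal (xbox (real (Suc n)) a b z) = ennreal (?h n z)"
        by (rule ennreal_mult[symmetric]) (auto simp: tbox_def bump_nonneg xbox_nonneg)
      also have "\<dots> \<le> ennreal (indicator S z)" by (rule ennreal_leI[OF h(2)])
      finally show "ennreal (tbox (real (Suc n)) t0 t1 z) * ennreal (xbox (real (Suc n)) a b z) \<le> indicator S z"
        by (simp add: ennreal_indicator)
    qed simp
    finally show ?thesis .
  qed
  then show ?thesis by (intro LIMSEQ_le_const2[OF lim]) auto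
qed

text \<open>Bounds the cost of passing \<open>kap\<close> through the weight
  \<open>rho\<close>.\<close>

definition Kk :: real where "Kk = (\<integral>y. kap y * moment y \<partial>lborel)"

lemma Kk: "(\<integral>\<^sup>+y. ennreal (kap y) * ennreal (moment y) \<partial>lborel) = ennreal Kk" "0 \<le> Kk"
proof -
  have eq: "(\<lambda>y. kap y * moment y) = (\<lambda>y. \<bar>ker None y\<bar> * moment y + L * (\<Sum>j\<in>UNIV. \<bar>ker (Some j) y\<bar> * moment y))"
    by (simp add: kap_def algebra_simps sum_distrib_left)
  have i: "integrable lborel (\<lambda>y. kap y * moment y)" unfolding eq
    by (intro Bochner_Integration.integrable_add integrable_mult_right Bochner_Integration.integrable_sum integrable_ker_moment)
  show "0 \<le> Kk" unfolding Kk_def by (intro Bochner_Integration.integral_nonneg) (simp add: kap_nonneg moment_nonneg)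
  show "(\<integral>\<^sup>+y. ennreal (kap y) * ennreal (moment y) \<partial>lborel) = ennreal Kk"
    unfolding Kk_def using nn_integral_eq_integral[OF i] by (simp add: kap_nonneg moment_nonneg ennreal_mult)
qed

lemma nn_integral_exp_tail:
  assumes "0 < l"
  shows "(\<integral>\<^sup>+r. ennreal (exp (- l * r)) * indicator {a..} r \<partial>lborel) = ennreal (exp (- l * a) / l)"
proof -
  have "(\<integral>\<^sup>+r. ennreal (exp (- l * r)) * indicator {a..} r \<partial>lborel) = ennreal (0 - (- exp (- l * a) / l))"
  proof (rule nn_integral_FTC_atLeast)
    show "((\<lambda>r. - exp (- l * r) / l) has_real_derivative exp (- l * x)) (at x)" for x
      using assms by (auto intro!: derivative_eq_intros)
    have "((\<lambda>r. exp (- (l * r))) \<longlongrightarrow> 0) at_top"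
      using assms by (intro filterlim_compose[OF exp_at_bot] filterlim_compose[OF filterlim_uminus_at_bot_at_top]
          filterlim_tendsto_pos_mult_at_top[OF tendsto_const] filterlim_ident)
    then show "((\<lambda>r. - exp (- l * r) / l) \<longlongrightarrow> 0) at_top"
      using tendsto_divide[OF tendsto_minus, of _ 0 at_top "\<lambda>_. l" l] assms by simp
  qed auto
  then show ?thesis by simp
qed

text \<open>After the time swap the tail of \<open>exp (- l r)\<close> contributes
  \<open>1 / l\<close>. The adjoint then puts the kernel on the weight, where shifting
  \<open>rho\<close> costs \<open>moment\<close>; thus \<open>|w|\<close> itself contributes 1 and
  the kernel \<open>Kk\<close>.\<close>

lemma Qw_contraction:
  assumes l: "0 < l"
  shows "(\<integral>\<^sup>+z. ennreal (exp (- l * fst z) * rho (snd z)) * indicator (Omega T) z * Qw z \<partial>lborel) \<le>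
    ennreal ((1 + Kk) / l) * (\<integral>\<^sup>+z. ennreal (exp (- l * fst z) * rho (snd z) * \<bar>w z\<bar>) \<partial>lborel)"
proof -
  define \<alpha> where "\<alpha> r = ennreal (exp (- l * r)) * indicator {0<..<T} r" for r
  define \<beta> where "\<beta> x = ennreal (rho x)" for x :: "real^'n"
  define h where "h z = ennreal (exp (- l * fst z) / l * rho (snd z))" for z :: "real \<times> (real^'n)"
  have [measurable]: "\<alpha> \<in> borel_measurable borel" "\<beta> \<in> borel_measurable borel" "h \<in> borel_measurable borel"
    unfolding \<alpha>_def[abs_def] \<beta>_def[abs_def] h_def[abs_def] by measurable
  have "(\<integral>\<^sup>+z. ennreal (exp (- l * fst z) * rho (snd z)) * indicator (Omega T) z * Qw z \<partial>lborel) =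
    (\<integral>\<^sup>+z. \<alpha> (fst z) * \<beta> (snd z) * Qw z \<partial>lborel)"
  proof (rule nn_integral_cong)
    fix z :: "real \<times> (real^'n)"
    show "ennreal (exp (- l * fst z) * rho (snd z)) * indicator (Omega T) z * Qw z = \<alpha> (fst z) * \<beta> (snd z) * Qw z"
      using rho_pos[of "snd z"] by (cases z) (auto simp: \<alpha>_def \<beta>_def Omega_def indicator_def ennreal_mult less_imp_le)
  qed
  also have "\<dots> = (\<integral>\<^sup>+z. (\<integral>\<^sup>+r. \<alpha> r * (if fst z \<le> r then 1 else 0) \<partial>lborel) * (\<beta> (snd z) * Vw z) \<partial>lborel)"
    unfolding Qw_def by (rule nn_integral_time_swap[symmetric]) measurable
  also have "\<dots> \<le> (\<integral>\<^sup>+z. h z * Vw z \<partial>lborel)"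
  proof (rule nn_integral_mono)
    fix z :: "real \<times> (real^'n)"
    have "(\<integral>\<^sup>+r. \<alpha> r * (if fst z \<le> r then 1 else 0) \<partial>lborel) \<le> (\<integral>\<^sup>+r. ennreal (exp (- l * r)) * indicator {fst z..} r \<partial>lborel)"
      by (intro nn_integral_mono) (auto simp: \<alpha>_def indicator_def)
    then have "(\<integral>\<^sup>+r. \<alpha> r * (if fst z \<le> r then 1 else 0) \<partial>lborel) \<le> ennreal (exp (- l * fst z) / l)"
      by (simp only: nn_integral_exp_tail[OF l])
    then have "(\<integral>\<^sup>+r. \<alpha> r * (if fst z \<le> r then 1 else 0) \<partial>lborel) * (\<beta> (snd z) * Vw z) \<le> ennreal (exp (- l * fst z) / l) * (\<beta> (snd z) * Vw z)"
      by (rule mult_right_mono) simp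
    also have "ennreal (exp (- l * fst z) / l) * (\<beta> (snd z) * Vw z) = h z * Vw z"
    proof -
      have "h z = ennreal (exp (- l * fst z) / l) * ennreal (rho (snd z))"
        unfolding h_def by (rule ennreal_mult) (use l rho_pos[of "snd z"] in \<open>auto simp: less_imp_le\<close>)
      then show ?thesis by (simp add: \<beta>_def mult.assoc)
    qed
    finally show "(\<integral>\<^sup>+r. \<alpha> r * (if fst z \<le> r then 1 else 0) \<partial>lborel) * (\<beta> (snd z) * Vw z) \<le> h z * Vw z" .
  qed
  also have "\<dots> = (\<integral>\<^sup>+z. ennreal \<bar>w z\<bar> * (h z + (\<integral>\<^sup>+y. ennreal (kap y) * h (z + cs y) \<partial>lborel)) \<partial>lborel)"
    by (rule Vw_pairing) measurable
  also have "\<dots> \<le> (\<integral>\<^sup>+z. ennreal ((1 + Kk) / l) * ennreal (exp (- l * fst z) * rho (snd z) * \<bar>w z\<bar>) \<partial>lborel)"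
  proof (rule nn_integral_mono)
    fix z :: "real \<times> (real^'n)"
    have "h (z + cs y) \<le> ennreal (moment y) * h z" for y
    proof -
      have "rho (snd z + 1 *\<^sub>R (fst y *\<^sub>R snd y)) \<le> moment y * rho (snd z)"
        using weight_rho unfolding weight_fn_def by (metis abs_one)
      then have "exp (- l * fst z) / l * rho (snd z + fst y *\<^sub>R snd y) \<le> exp (- l * fst z) / l * (moment y * rho (snd z))"
        using l by (intro mult_left_mono) auto
      then have "exp (- l * fst z) / l * rho (snd z + fst y *\<^sub>R snd y) \<le> moment y * (exp (- l * fst z) / l * rho (snd z))"
        by (simp add: mult_ac)
      then have "h (z + cs y) \<le> ennreal (moment y * (exp (- l * fst z) / l * rho (snd z)))"
        unfolding h_def cs_def by (intro ennreal_leI) simp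
      also have "\<dots> = ennreal (moment y) * h z"
        unfolding h_def using l rho_pos[of "snd z"] moment_nonneg[of y] by (intro ennreal_mult) (auto simp: less_imp_le)
      finally show ?thesis .
    qed
    then have "(\<integral>\<^sup>+y. ennreal (kap y) * h (z + cs y) \<partial>lborel) \<le> (\<integral>\<^sup>+y. (ennreal (kap y) * ennreal (moment y)) * h z \<partial>lborel)"
      by (intro nn_integral_mono) (simp add: mult.assoc mult_left_mono)
    also have "\<dots> = ennreal Kk * h z" by (simp add: nn_integral_multc Kk)
    finally have "h z + (\<integral>\<^sup>+y. ennreal (kap y) * h (z + cs y) \<partial>lborel) \<le> h z + ennreal Kk * h z" by (rule add_left_mono)
    also have "\<dots> = ennreal (1 + Kk) * h z" using Kk(2) by (simp add: distrib_right)
    finally have "ennreal \<bar>w z\<bar> * (h z + (\<integral>\<^sup>+y. ennreal (kap y) * h (z + cs y) \<partial>lborel)) \<le> ennreal \<bar>w z\<bar> * (ennreal (1 + Kk) * h z)"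
      by (rule mult_left_mono) simp
    also have "\<dots> = ennreal (\<bar>w z\<bar> * ((1 + Kk) * (exp (- l * fst z) / l * rho (snd z))))"
      unfolding h_def using l rho_pos[of "snd z"] Kk(2) by (subst ennreal_mult[symmetric] | simp add: less_imp_le)+
    also have "\<dots> = ennreal ((1 + Kk) / l * (exp (- l * fst z) * rho (snd z) * \<bar>w z\<bar>))" by (simp add: mult_ac)
    also have "\<dots> = ennreal ((1 + Kk) / l) * ennreal (exp (- l * fst z) * rho (snd z) * \<bar>w z\<bar>)"
      using l rho_pos[of "snd z"] Kk(2) by (intro ennreal_mult) (auto simp: less_imp_le)
    finally show "ennreal \<bar>w z\<bar> * (h z + (\<integral>\<^sup>+y. ennreal (kap y) * h (z + cs y) \<partial>lborel)) \<le>
        ennreal ((1 + Kk) / l) * ennreal (exp (- l * fst z) * rho (snd z) * \<bar>w z\<bar>)" .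
  qed
  also have "\<dots> = ennreal ((1 + Kk) / l) * (\<integral>\<^sup>+z. ennreal (exp (- l * fst z) * rho (snd z) * \<bar>w z\<bar>) \<partial>lborel)"
    by (rule nn_integral_cmult) measurable
  finally show ?thesis .
qed

text \<open>Finiteness is what allows \<open>N \<le> N / 2\<close> to be read as
  \<open>N = 0\<close>.\<close>

lemma weighted_norm_finite:
  assumes l: "0 < l"
  shows "(\<integral>\<^sup>+z. ennreal (exp (- l * fst z) * rho (snd z) * \<bar>w z\<bar>) \<partial>lborel) < \<infinity>"
proof -
  have "(\<integral>\<^sup>+z. ennreal (exp (- l * fst z) * rho (snd z) * \<bar>w z\<bar>) \<partial>lborel) \<le> (\<integral>\<^sup>+z. ennreal (norm (\<bar>w z\<bar> * rho (snd z))) \<partial>lborel)"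
  proof (intro nn_integral_mono ennreal_leI)
    fix z :: "real \<times> (real^'n)"
    show "exp (- l * fst z) * rho (snd z) * \<bar>w z\<bar> \<le> norm (\<bar>w z\<bar> * rho (snd z))"
    proof (cases "z \<in> Omega T")
      case True
      then have "exp (- l * fst z) \<le> 1" using l by (auto simp: Omega_def)
      then have "exp (- l * fst z) * (rho (snd z) * \<bar>w z\<bar>) \<le> 1 * (rho (snd z) * \<bar>w z\<bar>)"
        using rho_pos[of "snd z"] by (intro mult_right_mono) auto
      then show ?thesis using rho_pos[of "snd z"] by (simp add: abs_mult mult_ac)
    qed (simp add: w_out)
  qed
  also have "\<dots> < \<infinity>" using w_rho by (simp only: integrable_iff_bounded)
  finally show ?thesis .
qed

text \<open>A real version of \<open>Qw\<close> for Lebesgue differentiation. Where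
  \<open>Qw\<close> is infinite the value is 0, by the convention of \<open>enn2real\<close>; inside
  \<open>Omega T\<close> this happens only on a null set.\<close>

definition Qr :: "real \<times> (real^'n) \<Rightarrow> real" where
  "Qr z = indicator (Omega T) z * enn2real (Qw z)"

lemma Qr_measurable [measurable]: "Qr \<in> borel_measurable borel"
  unfolding Qr_def[abs_def] by measurable

lemma Qr_facts: "integrable lborel (\<lambda>z. Qr z * rho (snd z))" "AE z in lborel. z \<in> Omega T \<longrightarrow> Qw z = ennreal (Qr z)"
proof -
  \<comment> \<open>Any positive rate gives finiteness; with rate 1 the factor \<open>exp T\<close>
    below undoes the exponential on \<open>Omega T\<close>.\<close>
  have fin: "(\<integral>\<^sup>+z. ennreal (exp (- 1 * fst z) * rho (snd z)) * indicator (Omega T) z * Qw z \<partial>lborel) < \<infinity>"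
    using order_le_less_trans[OF Qw_contraction[of 1] ennreal_mult_less_top[THEN iffD2]] weighted_norm_finite[of 1] by simp
  have "(\<integral>\<^sup>+z. ennreal (Qr z * rho (snd z)) \<partial>lborel) \<le> (\<integral>\<^sup>+z. ennreal (exp T) * (ennreal (exp (- 1 * fst z) * rho (snd z)) * indicator (Omega T) z * Qw z) \<partial>lborel)"
  proof (rule nn_integral_mono)
    fix z :: "real \<times> (real^'n)"
    show "ennreal (Qr z * rho (snd z)) \<le> ennreal (exp T) * (ennreal (exp (- 1 * fst z) * rho (snd z)) * indicator (Omega T) z * Qw z)"
    proof (cases "z \<in> Omega T")
      case True
      have r: "0 \<le> rho (snd z)" using rho_pos less_imp_le by blast
      have "1 \<le> exp T * exp (- 1 * fst z)" using True by (simp add: exp_add[symmetric] Omega_def mem_Times_iff)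
      then have "1 * rho (snd z) \<le> (exp T * exp (- 1 * fst z)) * rho (snd z)" using r by (rule mult_right_mono)
      then have "ennreal (rho (snd z)) \<le> ennreal (exp T * (exp (- 1 * fst z) * rho (snd z)))" by (intro ennreal_leI) (simp add: mult.assoc)
      then have 1: "ennreal (rho (snd z)) \<le> ennreal (exp T) * ennreal (exp (- 1 * fst z) * rho (snd z))" using r by (simp add: ennreal_mult)
      have "ennreal (Qr z * rho (snd z)) = ennreal (enn2real (Qw z)) * ennreal (rho (snd z))"
        using True r by (simp add: Qr_def ennreal_mult)
      also have "\<dots> \<le> Qw z * (ennreal (exp T) * ennreal (exp (- 1 * fst z) * rho (snd z)))"
        by (intro mult_mono 1) (auto simp: ennreal_enn2real_if)
      finally show ?thesis using True by (simp add: mult_ac)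
    qed (simp add: Qr_def)
  qed
  also have "\<dots> = ennreal (exp T) * (\<integral>\<^sup>+z. ennreal (exp (- 1 * fst z) * rho (snd z)) * indicator (Omega T) z * Qw z \<partial>lborel)"
    by (rule nn_integral_cmult) measurable
  also have "\<dots> < \<infinity>" using fin by (simp add: ennreal_mult_less_top)
  finally show "integrable lborel (\<lambda>z. Qr z * rho (snd z))"
    by (intro integrableI_nonneg) (auto simp: Qr_def rho_pos less_imp_le)
  have "AE z in lborel. ennreal (exp (- 1 * fst z) * rho (snd z)) * indicator (Omega T) z * Qw z \<noteq> \<infinity>"
    using fin by (intro nn_integral_noteq_infinite) auto
  then show "AE z in lborel. z \<in> Omega T \<longrightarrow> Qw z = ennreal (Qr z)"
  proof eventually_elim
    case (elim z)
    have "ennreal (exp (- 1 * fst z) * rho (snd z)) \<noteq> 0" using rho_pos[of "snd z"] by (simp add: ennreal_eq_0_iff not_le)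
    then show ?case using elim by (auto simp: Qr_def ennreal_mult_eq_top_iff top.not_eq_extremum)
  qed
qed

lemma box_Pair: "box (t0, a) (t1, b) = {t0<..<t1::real} \<times> box a (b::real^'n)"
  by (auto simp: box_def Basis_prod_def ball_Un)

text \<open>\<open>box_estimate\<close> controls the absolute value of the integral of
  \<open>w\<close> over every box, so both \<open>Qr + w\<close> and \<open>Qr - w\<close> have
  nonnegative integrals over boxes. The sign \<open>s\<close> treats the two cases together.\<close>

lemma w_le_Qr: "AE z in lborel. z \<in> Omega T \<longrightarrow> \<bar>w z\<bar> \<le> Qr z"
proof -
  have *: "AE z in lborel. z \<in> Omega T \<longrightarrow> 0 \<le> Qr z + s * w z" if s: "\<bar>s\<bar> = 1" for s
  proof -
    let ?h = "\<lambda>z. Qr z + s * w z"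
    have int: "set_integrable lborel (cbox p p') ?h" for p p'
    proof -
      obtain a b where ab: "snd ` cbox p p' \<subseteq> cbox a b"
        using bounded_subset_cbox_symmetric bounded_snd[OF bounded_cbox] by metis
      obtain C where C: "C \<ge> 0" "\<And>x. indicator (cbox a b) x \<le> C * rho x" using box_le_rho by blast
      have i: "integrable lborel (\<lambda>z. C * (Qr z * rho (snd z)) + C * (\<bar>w z\<bar> * rho (snd z)))"
        by (intro Bochner_Integration.integrable_add integrable_mult_right w_rho Qr_facts)
      show ?thesis
        unfolding set_integrable_def
      proof (rule Bochner_Integration.integrable_bound[OF i])
        show "(\<lambda>z. indicator (cbox p p') z *\<^sub>R ?h z) \<in> borel_measurable lborel" by measurable
        show "AE z in lborel. norm (indicator (cbox p p') z *\<^sub>R ?h z) \<le> norm (C * (Qr z * rho (snd z)) + C * (\<bar>w z\<bar> * rho (snd z)))"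
        proof (rule AE_I2)
          fix z
          have Q0: "0 \<le> Qr z" by (simp add: Qr_def)
          have "indicator (cbox p p') z \<le> (indicator (cbox a b) (snd z) :: real)" using ab by (auto simp: indicator_def)
          then have c: "indicator (cbox p p') z \<le> C * rho (snd z)" using C(2)[of "snd z"] by linarith
          have "\<bar>?h z\<bar> \<le> Qr z + \<bar>w z\<bar>" using s Q0 abs_triangle_ineq[of "Qr z" "s * w z"] by (simp add: abs_mult)
          then have "indicator (cbox p p') z * \<bar>?h z\<bar> \<le> (C * rho (snd z)) * (Qr z + \<bar>w z\<bar>)"
            using c C(1) rho_pos[of "snd z"] by (intro mult_mono) (auto simp: less_imp_le)
          also have "\<dots> = C * (Qr z * rho (snd z)) + C * (\<bar>w z\<bar> * rho (snd z))" by (simp add: algebra_simps)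
          also have "\<dots> \<le> \<bar>\<dots>\<bar>" by (rule abs_ge_self)
          finally show "norm (indicator (cbox p p') z *\<^sub>R ?h z) \<le> norm (C * (Qr z * rho (snd z)) + C * (\<bar>w z\<bar> * rho (snd z)))"
            by (simp add: abs_mult)
        qed
      qed
    qed
    have "AE z in lebesgue. z \<in> Omega T \<longrightarrow> 0 \<le> ?h z"
    proof (rule AE_nonneg_of_boxes[OF _ int])
      show "open (Omega T :: (real \<times> (real^'n)) set)" unfolding Omega_def by (intro open_Times) auto
      fix p p' :: "real \<times> (real^'n)" assume sub: "cbox p p' \<subseteq> Omega T"
      obtain t0 a t1 b where p: "p = (t0, a)" "p' = (t1, b)" by (cases p, cases p') auto
      show "0 \<le> integral (cbox p p') ?h"
      proof (cases "box p p' = {}")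
        case True
        then show ?thesis using integral_open_interval[of p p' ?h] by simp
      next
        case False
        define S where "S = {t0<..<t1} \<times> box a b"
        have S: "box p p' = S" by (simp add: S_def p box_Pair)
        have [measurable]: "S \<in> sets borel" unfolding S_def by (intro borel_open open_Times) auto
        have "t0 < t1" using False by (auto simp: S S_def)
        \<comment> \<open>The closed box contains its corners, so its inclusion in the open
          \<open>Omega T\<close> yields the strict inequalities that \<open>box_estimate\<close>
          requires.\<close>
        moreover have "p \<in> cbox p p'" "p' \<in> cbox p p'" using False by (auto simp: box_ne_empty mem_box less_imp_le)
        then have "p \<in> Omega T" "p' \<in> Omega T" using sub by blast+
        then have "0 < t0" "t1 < T" by (auto simp: p Omega_def)
        ultimately have est: "ennreal \<bar>\<integral>z. w z * indicator S z \<partial>lborel\<bar> \<le> (\<integral>\<^sup>+z. indicator S z * Qw z \<partial>lborel)"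
          unfolding S_def by (intro box_estimate)
        have SO: "S \<subseteq> Omega T" using sub box_subset_cbox[of p p'] S by auto
        have iS: "integrable lborel (\<lambda>z. indicator S z * Qr z)" "integrable lborel (\<lambda>z. indicator S z * w z)"
        proof -
          obtain C where C: "C \<ge> 0" "\<And>x. indicator (cbox a b) x \<le> C * rho x" using box_le_rho by blast
          have Sr: "indicator S z \<le> C * rho (snd z)" for z
          proof -
            have "indicator S z \<le> (indicator (cbox a b) (snd z) :: real)" using box_subset_cbox[of a b] by (auto simp: S_def indicator_def)
            then show ?thesis using C(2)[of "snd z"] by linarith
          qed
          show "integrable lborel (\<lambda>z. indicator S z * Qr z)"
          proof (rule Bochner_Integration.integrable_bound[OF integrable_mult_right[OF Qr_facts(1), of C]])
            have "indicator S z * Qr z \<le> (C * rho (snd z)) * Qr z" for z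
              by (intro mult_right_mono Sr) (simp add: Qr_def)
            then show "AE z in lborel. norm (indicator S z * Qr z) \<le> norm (C * (Qr z * rho (snd z)))"
              using C(1) by (intro AE_I2) (simp add: abs_mult Qr_def mult_ac abs_of_pos[OF rho_pos])
          qed simp
          have "indicator S z * \<bar>w z\<bar> \<le> (C * rho (snd z)) * \<bar>w z\<bar>" for z by (intro mult_right_mono Sr) simp
          then show "integrable lborel (\<lambda>z. indicator S z * w z)"
            by (intro dominated_integrable[where C=C]) (simp_all add: abs_mult mult_ac)
        qed
        have "(\<integral>\<^sup>+z. indicator S z * Qw z \<partial>lborel) = (\<integral>\<^sup>+z. ennreal (indicator S z * Qr z) \<partial>lborel)"
        proof (rule nn_integral_cong_AE)
          show "AE z in lborel. indicator S z * Qw z = ennreal (indicator S z * Qr z)"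
            using Qr_facts(2) by eventually_elim (use SO in \<open>auto simp: indicator_def\<close>)
        qed
        also have "\<dots> = ennreal (\<integral>z. indicator S z * Qr z \<partial>lborel)"
          by (rule nn_integral_eq_integral[OF iS(1)]) (simp add: Qr_def)
        finally have "ennreal \<bar>\<integral>z. indicator S z * w z \<partial>lborel\<bar> \<le> ennreal (\<integral>z. indicator S z * Qr z \<partial>lborel)"
          using est by (simp only: mult.commute)
        moreover have "0 \<le> (\<integral>z. indicator S z * Qr z \<partial>lborel)"
          by (intro Bochner_Integration.integral_nonneg) (simp add: Qr_def)
        ultimately have "\<bar>\<integral>z. indicator S z * w z \<partial>lborel\<bar> \<le> (\<integral>z. indicator S z * Qr z \<partial>lborel)"
          by (simp only: ennreal_le_iff)
        then have "0 \<le> (\<integral>z. indicator S z * Qr z \<partial>lborel) + s * (\<integral>z. indicator S z * w z \<partial>lborel)"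
          using s by (auto simp: abs_if split: if_splits)
        also have "\<dots> = (\<integral>z. indicator S z * ?h z \<partial>lborel)" using iS by (simp add: distrib_left mult.left_commute)
        also have "\<dots> = integral S ?h"
          using set_borel_integral_eq_integral(2)[of S ?h] iS unfolding set_integrable_def set_lebesgue_integral_def
          by (simp add: distrib_left mult.left_commute)
        finally show ?thesis using integral_open_interval[of p p' ?h] S by simp
      qed
    qed
    then show ?thesis by (simp add: AE_completion_iff)
  qed
  have "AE z in lborel. z \<in> Omega T \<longrightarrow> 0 \<le> Qr z + 1 * w z" by (rule *) simp
  moreover have "AE z in lborel. z \<in> Omega T \<longrightarrow> 0 \<le> Qr z + (-1) * w z" by (rule *) simp
  ultimately show ?thesis by eventually_elim auto
qed

theorem w_zero: "AE z in lborel. w z = 0"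
proof -
  \<comment> \<open>Chosen so that the factor \<open>(1 + Kk) / l\<close> of
    \<open>Qw_contraction\<close> is one half.\<close>
  define l where "l = 2 * (1 + Kk)"
  have l: "0 < l" using Kk(2) by (simp add: l_def)
  let ?W = "\<lambda>z::real \<times> (real^'n). exp (- l * fst z) * rho (snd z)"
  define N where "N = (\<integral>\<^sup>+z. ennreal (?W z * \<bar>w z\<bar>) \<partial>lborel)"
  have Wp: "0 < ?W z" for z by (simp add: rho_pos)
  have fin: "N < \<infinity>" unfolding N_def by (rule weighted_norm_finite[OF l])
  have "N \<le> (\<integral>\<^sup>+z. ennreal (?W z) * indicator (Omega T) z * Qw z \<partial>lborel)"
    unfolding N_def
  proof (rule nn_integral_mono_AE)
    show "AE z in lborel. ennreal (?W z * \<bar>w z\<bar>) \<le> ennreal (?W z) * indicator (Omega T) z * Qw z"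
      using w_le_Qr Qr_facts(2)
    proof eventually_elim
      case (elim z)
      show ?case
      proof (cases "z \<in> Omega T")
        case True
        have "ennreal (?W z * \<bar>w z\<bar>) = ennreal (?W z) * ennreal \<bar>w z\<bar>" using Wp[of z] by (intro ennreal_mult) auto
        also have "\<dots> \<le> ennreal (?W z) * Qw z" using elim True by (intro mult_left_mono) (auto intro: ennreal_leI)
        finally show ?thesis using True by simp
      qed (simp add: w_out)
    qed
  qed
  also have "\<dots> \<le> ennreal ((1 + Kk) / l) * N" unfolding N_def by (rule Qw_contraction[OF l])
  also have "(1 + Kk) / l = 1 / 2" using Kk(2) by (simp add: l_def divide_simps)
  finally have le: "N \<le> ennreal (1 / 2) * N" .
  have "N = 0"
  proof -
    obtain r where r: "N = ennreal r" "0 \<le> r" using fin by (cases N) auto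
    have "ennreal r \<le> ennreal (1 / 2 * r)" using le r by (simp only: ennreal_mult)
    then have "r \<le> 1 / 2 * r" using r(2) by (subst (asm) ennreal_le_iff) auto
    then show ?thesis using r by simp
  qed
  then have "AE z in lborel. ennreal (?W z * \<bar>w z\<bar>) = 0"
    unfolding N_def by (subst (asm) nn_integral_0_iff_AE) auto
  then show ?thesis
  proof eventually_elim
    case (elim z)
    then have "?W z * \<bar>w z\<bar> \<le> 0" by (simp only: ennreal_eq_0_iff)
    then show ?case using Wp[of z] by (simp add: mult_le_0_iff not_le[symmetric])
  qed
qed

end

section \<open>Uniqueness for the nonlinear problem and the final statement\<close>

lemma Cinf_on_subset: "Cinf_on UNIV g \<Longrightarrow> open S \<Longrightarrow> Cinf_on S g"
  unfolding Cinf_on_def by (meson UNIV_I continuous_on_subset subset_UNIV)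

text \<open>An arbitrary weak solution \<open>v\<close> is compared with one that is continuous and
  decays like \<open>rho\<close>, so only \<open>v\<close> raises questions of measurability and
  integrability.\<close>

lemma weak_sol_unique:
  fixes f :: "real^'n::finite \<Rightarrow> real \<Rightarrow> real^'n"
  assumes T: "T > 0" and f: "\<And>l. smooth_cs (\<lambda>p. f (fst p) (snd p) $ l)"
    and u: "C0 rho u" "weak_sol T f u0 u" and v: "weak_sol T f u0 v"
  shows "AE z in lebesgue. z \<in> Omega T \<longrightarrow> v z = u z"
proof -
  define F where "F l = (\<lambda>p. f (fst p) (snd p) $ l)" for l
  have F: "smooth_cs (F l)" and Fe: "f x y $ l = F l (x, y)" for l x y using f by (auto simp: F_def)
  let ?i = "\<lambda>z. indicator (Omega T) z :: real"
  have vm: "(\<lambda>z. ?i z * v z) \<in> borel_measurable lebesgue"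
    using v by (simp add: weak_sol_def weak_sol_lin_def L2_on_def set_borel_measurable_def)
  \<comment> \<open>\<open>v\<close> is only Lebesgue measurable, while the Fubini arguments need
    Borel functions; a Borel representative replaces it.\<close>
  obtain v' where v'm: "v' \<in> borel_measurable lborel" and v': "AE z in lborel. ?i z * v z = v' z"
    using completion_ex_borel_measurable_real[OF vm] by blast
  have [measurable]: "v' \<in> borel_measurable borel" using v'm by simp
  have um [measurable]: "u \<in> borel_measurable borel" by (rule borel_measurable_continuous_onI[OF C0_continuous[OF u(1)]])
  have Fm [measurable]: "F l \<in> borel_measurable borel" for l by (rule borel_measurable_continuous_onI[OF smooth_cs_continuous[OF F]])
  define w where "w z = ?i z * (v' z - u z)" for z
  define G where "G l z = ?i z * (F l (snd z, v' z) - F l (snd z, u z))" for l z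
  have wm [measurable]: "w \<in> borel_measurable borel" unfolding w_def[abs_def] by measurable
  have Gm [measurable]: "G l \<in> borel_measurable borel" for l unfolding G_def[abs_def] by measurable
  have "\<exists>C\<ge>0. \<forall>x y y'. \<bar>F l (x, y) - F l (x, y')\<bar> \<le> C * \<bar>y - y'\<bar>" for l using smooth_cs_Lipschitz[OF F] by metis
  then obtain C where C: "\<And>l. C l \<ge> 0" "\<And>l x y y'. \<bar>F l (x, y) - F l (x, y')\<bar> \<le> C l * \<bar>y - y'\<bar>" by metis
  define L where "L = (\<Sum>l\<in>UNIV. C l)"
  have L: "0 \<le> L" "C l \<le> L" for l using C(1) member_le_sum[of l UNIV C] by (auto simp: L_def sum_nonneg)
  have G_le: "\<bar>G l z\<bar> \<le> L * \<bar>w z\<bar>" for l z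
    using order_trans[OF C(2)[of l "snd z" "v' z" "u z"] mult_right_mono[OF L(2)[of l]]] L(1) by (auto simp: G_def w_def indicator_def)
  have w_out: "w z = 0" if "z \<notin> Omega T" for z using that by (simp add: w_def)
  have to1: "C0 rho g \<Longrightarrow> C0 (\<lambda>_. 1) g" for g :: "real \<times> (real^'n) \<Rightarrow> real" using C0_weight rho_le by blast
  have sq: "integrable lborel (\<lambda>z. ?i z * (g z)\<^sup>2)" if "C0 rho g" for g :: "real \<times> (real^'n) \<Rightarrow> real"
    using C0_integrable_Omega[OF C0_mult[OF to1[OF that] that], of T] by (simp add: power2_eq_square)
  have v'2: "integrable lborel (\<lambda>z. ?i z * (v' z)\<^sup>2)"
  proof -
    have i: "integrable lebesgue (\<lambda>z. ?i z * (v z)\<^sup>2)"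
      using v by (simp add: weak_sol_def weak_sol_lin_def L2_on_def set_integrable_def)
    have "AE z in lebesgue. ?i z * (v z)\<^sup>2 = ?i z * (v' z)\<^sup>2"
      using AE_completion[OF v'] by eventually_elim (auto simp: indicator_def split: if_splits)
    then have "integrable lebesgue (\<lambda>z. ?i z * (v' z)\<^sup>2)"
      using i by (subst integrable_cong_AE[symmetric]) (auto intro!: measurable_completion)
    then show ?thesis by (subst (asm) integrable_completion) auto
  qed
  have w2: "integrable lborel (\<lambda>z. (w z)\<^sup>2)"
  proof (rule Bochner_Integration.integrable_bound[OF integrable_mult_right[OF Bochner_Integration.integrable_add[OF v'2 sq[OF u(1)]], of 2]])
    have "(a - b)\<^sup>2 \<le> 2 * (a\<^sup>2 + b\<^sup>2)" for a b :: real
      using zero_le_power2[of "a + b"] by (simp add: power2_eq_square algebra_simps)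
    then show "AE z in lborel. norm ((w z)\<^sup>2) \<le> norm (2 * (?i z * (v' z)\<^sup>2 + ?i z * (u z)\<^sup>2))"
      by (intro AE_I2) (auto simp: w_def indicator_def)
  qed simp
  \<comment> \<open>Young's inequality: a product with the L2 function \<open>w\<close> is
    integrable once the other factor is square integrable on \<open>Omega T\<close>.\<close>
  have prod: "integrable lborel (\<lambda>z. h z * \<theta> z)" if h [measurable]: "h \<in> borel_measurable borel" "\<And>z. \<bar>h z\<bar> \<le> K * \<bar>w z\<bar>" and K: "0 \<le> K" and \<theta>: "C0 rho \<theta>" for h \<theta> K
  proof (rule Bochner_Integration.integrable_bound[OF integrable_mult_right[OF Bochner_Integration.integrable_add[OF w2 sq[OF \<theta>]], of K]])
    have [measurable]: "\<theta> \<in> borel_measurable borel" by (rule borel_measurable_continuous_onI[OF C0_continuous[OF \<theta>]])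
    show "(\<lambda>z. h z * \<theta> z) \<in> borel_measurable lborel" by measurable
    show "AE z in lborel. norm (h z * \<theta> z) \<le> norm (K * ((w z)\<^sup>2 + ?i z * (\<theta> z)\<^sup>2))"
    proof (rule AE_I2)
      fix z :: "real \<times> (real^'n)"
      have "\<bar>h z\<bar> * \<bar>\<theta> z\<bar> \<le> (K * \<bar>w z\<bar>) * \<bar>\<theta> z\<bar>" by (intro mult_right_mono h) simp
      also have "\<dots> = K * (\<bar>w z\<bar> * \<bar>\<theta> z\<bar>)" by simp
      also have "\<dots> \<le> K * ((w z)\<^sup>2 + ?i z * (\<theta> z)\<^sup>2)"
      proof (rule mult_left_mono[OF _ K], cases "z \<in> Omega T")
        case True
        have "0 \<le> (\<bar>w z\<bar> - \<bar>\<theta> z\<bar>)\<^sup>2" by simp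
        then have "2 * (\<bar>w z\<bar> * \<bar>\<theta> z\<bar>) \<le> (w z)\<^sup>2 + (\<theta> z)\<^sup>2" by (simp add: power2_diff)
        moreover have "0 \<le> \<bar>w z\<bar> * \<bar>\<theta> z\<bar>" by simp
        ultimately show "\<bar>w z\<bar> * \<bar>\<theta> z\<bar> \<le> (w z)\<^sup>2 + ?i z * (\<theta> z)\<^sup>2"
          using True by (simp only: indicator_simps)
      qed (simp add: w_out)
      finally show "norm (h z * \<theta> z) \<le> norm (K * ((w z)\<^sup>2 + ?i z * (\<theta> z)\<^sup>2))"
        using K by (simp add: abs_mult)
    qed
  qed
  interpret weak_diff T L w G
  proof (unfold_locales)
    fix \<phi> :: "real \<times> (real^'n) \<Rightarrow> real" assume \<phi>: "test_fun T \<phi>"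
    note smooth_cs = test_fun_sm[OF \<phi>]
    have \<phi>2: "smooth_cs (pdiff (ex j) (pdiff (ex j) \<phi>))" for j using smooth_cs_pdiff(1)[OF smooth_cs_pdiff(1)[OF smooth_cs ex_Basis] ex_Basis] .
    have lapCB: "CB rho (Suc 0) (lap \<phi>)"
      unfolding lap_eq by (intro CB_sum smooth_cs_CB \<phi>2 rho_pos) (auto simp: rho_pos less_imp_le intro: continuous_intros)
    define \<theta> where "\<theta> = (\<lambda>z. pdiff et \<phi> z + lap \<phi> z - pdiff et (lap \<phi>) z)"
    have \<theta>: "C0 rho \<theta>" unfolding \<theta>_def
      using CB_pdiff[OF lapCB et_Basis] CB_C0[OF lapCB] smooth_cs_C0(1)[OF smooth_cs_pdiff(1)[OF smooth_cs et_Basis]] by (intro C0_diff C0_add) auto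
    have \<phi>1: "C0 rho (pdiff (ex j) \<phi>)" for j by (rule smooth_cs_C0(1)[OF smooth_cs_pdiff(1)[OF smooth_cs ex_Basis]])
    have [measurable]: "\<theta> \<in> borel_measurable borel" "pdiff (ex j) \<phi> \<in> borel_measurable borel" for j
      using C0_continuous[OF \<theta>] C0_continuous[OF \<phi>1] by (auto intro: borel_measurable_continuous_onI)
    have leb: "g \<in> borel_measurable lebesgue" if "g \<in> borel_measurable borel" for g :: "real \<times> (real^'n) \<Rightarrow> real"
      using that by (intro measurable_completion) simp
    \<comment> \<open>The weak integrand as a function of the value \<open>x\<close> of the
      solution. Both solutions share the initial term, so subtracting the two weak equations leaves
      only integrals of \<open>E\<close>.\<close>
    define E where "E x z = x * \<theta> z + (\<Sum>j\<in>UNIV. F j (snd z, x) * pdiff (ex j) \<phi> z)" for x z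
    have Eq: "u z * pdiff et \<phi> z + (\<Sum>j\<in>UNIV. f (snd z) (u z) $ j * pdiff (ex j) \<phi> z) + u z * lap \<phi> z - u z * pdiff et (lap \<phi>) z = E (u z) z" for u z
      by (simp add: E_def Fe \<theta>_def algebra_simps)
    have "(LINT z:Omega T|lebesgue. E (x z) z) + (LINT x|lebesgue. u0 x * (\<phi> (0, x) - lap \<phi> (0, x))) = 0" if "weak_sol T f u0 x" for x
    proof -
      from that have "\<forall>\<phi>. test_fun T \<phi> \<longrightarrow> (LINT z:Omega T|lebesgue. x z * pdiff et \<phi> z
          + (\<Sum>j\<in>UNIV. f (snd z) (x z) $ j * pdiff (ex j) \<phi> z) + x z * lap \<phi> z - x z * pdiff et (lap \<phi>) z)
          + (LINT x|lebesgue. u0 x * (\<phi> (0, x) - lap \<phi> (0, x))) = 0"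
        unfolding weak_sol_def weak_sol_lin_def by blast
      from this[rule_format, OF \<phi>] show ?thesis unfolding Eq .
    qed
    from this[OF v] this[OF u(2)]
    have weakE: "(LINT z:Omega T|lebesgue. E (v z) z) = (LINT z:Omega T|lebesgue. E (u z) z)" by linarith
    have "(LINT z:Omega T|lebesgue. E (v z) z) = (\<integral>z. ?i z * E (v' z) z \<partial>lebesgue)"
      unfolding set_lebesgue_integral_def
    proof (rule integral_cong_AE)
      \<comment> \<open>A weak solution has its flux in L2 by definition, which supplies this
        measurability for \<open>v\<close>.\<close>
      have Fv: "(\<lambda>z. ?i z * F j (snd z, v z)) \<in> borel_measurable lebesgue" for j
        using v by (simp add: weak_sol_def weak_sol_lin_def L2_on_def set_borel_measurable_def Fe)
      have "(\<lambda>z. (?i z * v z) * \<theta> z + (\<Sum>j\<in>UNIV. (?i z * F j (snd z, v z)) * pdiff (ex j) \<phi> z)) \<in> borel_measurable lebesgue"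
        by (rule borel_measurable_add[OF borel_measurable_times[OF vm leb] borel_measurable_sum[OF borel_measurable_times[OF Fv leb]]]) simp_all
      then show "(\<lambda>z. ?i z *\<^sub>R E (v z) z) \<in> borel_measurable lebesgue"
        by (simp add: E_def distrib_left sum_distrib_left mult.assoc)
      show "(\<lambda>z. ?i z * E (v' z) z) \<in> borel_measurable lebesgue"
        unfolding E_def by (intro leb) measurable
      show "AE z in lebesgue. ?i z *\<^sub>R E (v z) z = ?i z * E (v' z) z"
        using AE_completion[OF v'] by eventually_elim (auto simp: indicator_def split: if_splits)
    qed
    also have "\<dots> = (\<integral>z. ?i z * E (v' z) z \<partial>lborel)"
      by (rule integral_completion) (unfold E_def, measurable)
    finally have 1: "(LINT z:Omega T|lebesgue. E (v z) z) = (\<integral>z. ?i z * E (v' z) z \<partial>lborel)" .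
    have 2: "(LINT z:Omega T|lebesgue. E (u z) z) = (\<integral>z. ?i z * E (u z) z \<partial>lborel)"
      by (rule lebesgue_eq_lborel) (unfold E_def, measurable)
    let ?D = "\<lambda>z. w z * \<theta> z + (\<Sum>j\<in>UNIV. G j z * pdiff (ex j) \<phi> z)"
    have D: "integrable lborel ?D"
      by (intro Bochner_Integration.integrable_add Bochner_Integration.integrable_sum
          prod[OF wm _ zero_le_one \<theta>] prod[OF Gm G_le L(1) \<phi>1]) simp
    have cF: "C0 rho (\<lambda>z. F j (snd z, u z))" for j
    proof -
      have "admissible rho (flux F)" by (rule admissible_flux[OF F weight_rho])
      from admissible_comp[OF this u(1), of "Some j"] show ?thesis by (simp add: flux_def)
    qed
    have "C0 rho (\<lambda>z. E (u z) z)"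
      unfolding E_def by (intro C0_add C0_mult C0_sum to1[OF u(1)] to1[OF cF] \<theta> \<phi>1) (auto simp: rho_pos less_imp_le)
    then have Eu: "integrable lborel (\<lambda>z. ?i z * E (u z) z)" by (rule C0_integrable_Omega)
    have "?i z * E (v' z) z = ?i z * E (u z) z + ?D z" for z
    proof -
      have "?D z = ?i z * ((v' z - u z) * \<theta> z + (\<Sum>j\<in>UNIV. (F j (snd z, v' z) - F j (snd z, u z)) * pdiff (ex j) \<phi> z))"
        by (simp add: w_def G_def distrib_left sum_distrib_left mult.assoc)
      also have "(\<Sum>j\<in>UNIV. (F j (snd z, v' z) - F j (snd z, u z)) * pdiff (ex j) \<phi> z) =
        (\<Sum>j\<in>UNIV. F j (snd z, v' z) * pdiff (ex j) \<phi> z) - (\<Sum>j\<in>UNIV. F j (snd z, u z) * pdiff (ex j) \<phi> z)"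
        by (simp add: left_diff_distrib sum_subtractf)
      finally show ?thesis by (simp add: E_def algebra_simps)
    qed
    then have "(\<integral>z. ?i z * E (v' z) z \<partial>lborel) = (\<integral>z. ?i z * E (u z) z \<partial>lborel) + (\<integral>z. ?D z \<partial>lborel)"
      using Eu D by simp
    then have "(\<integral>z. ?D z \<partial>lborel) = 0" using weakE 1 2 by simp
    then show "(\<integral>z. w z * (pdiff et \<phi> z + lap \<phi> z - pdiff et (lap \<phi>) z) + (\<Sum>j\<in>UNIV. G j z * pdiff (ex j) \<phi> z) \<partial>lborel) = 0"
      by (simp add: \<theta>_def)
  qed (use T L(1) wm w_out w2 Gm G_le in auto)
  show ?thesis
    using AE_completion[OF v'] AE_completion[OF w_zero]
    by eventually_elim (auto simp: w_def indicator_def split: if_splits)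
qed

theorem theorem1p1:
  fixes T :: real
    and f :: "real^'n::finite \<Rightarrow> real \<Rightarrow> real^'n"
    and u0 :: "real^'n \<Rightarrow> real"
  assumes "T > 0"
    and "\<forall>j. Cinf_on UNIV (\<lambda>(x, v). f x v $ j)"
    and "compact_support (\<lambda>(x, v). f x v)"
    and "Cinf_on UNIV u0"
    and "compact_support u0"
  shows "\<exists>u. weak_sol T f u0 u
           \<and> (\<forall>v. weak_sol T f u0 v \<longrightarrow> (AE z in lebesgue. z \<in> Omega T \<longrightarrow> v z = u z))
           \<and> Cinf_on (Omega T) u"
proof -
  define F where "F l = (\<lambda>p. f (fst p) (snd p) $ l)" for l
  have sF: "smooth_cs (\<lambda>p. f (fst p) (snd p) $ l)" for l
  proof -
    have "compact_support (\<lambda>p. f (fst p) (snd p) $ l)"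
      \<comment> \<open>A closure is compact exactly when the set is bounded, and a component is
        nonzero only where the vector is.\<close>
      using assms(3) unfolding compact_support_def compact_closure by (rule bounded_subset) auto
    then show ?thesis using assms(2) by (simp add: smooth_cs_def case_prod_unfold)
  qed
  have F: "smooth_cs (F l)" for l using sF by (simp add: F_def)
  have u0: "smooth_cs u0" using assms by (simp add: smooth_cs_def)
  have "C0 rho (\<lambda>z::real \<times> (real^'n). u0 (snd z))"
    using smooth_cs_snd_CB[OF u0 continuous_rho[OF continuous_on_id] rho_pos, of 0] by simp
  from solution_exists[OF weight_rho admissible_flux[OF F weight_rho] this]
  obtain u where u: "C0 rho u" "solves (flux F) u0 u" .
  have weak: "weak_sol T f u0 u"
    by (rule classical_weak_sol[OF assms(1) sF u0 u(1)]) (use u(2) in \<open>simp add: F_def[abs_def]\<close>)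
  \<comment> \<open>The constructed solution is smooth for all real times; \<open>Omega T\<close>
    enters only by restriction.\<close>
  have "CB (\<lambda>_. 1) k u" for k
    by (rule solution_smooth[OF F _ C0_weight[OF u(1) rho_le] u(2)]) (rule smooth_cs_snd_CB[OF u0], auto)
  from Cinf_on_subset[OF CB_Cinf[OF this]] have "Cinf_on (Omega T) u"
    by (simp add: Omega_def open_Times)
  then show ?thesis using weak weak_sol_unique[OF assms(1) sF u(1) weak] by blast
qed

end
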